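(* Let $r>0$, let $v_{2,r}=\pi r^2$ be the area of the disk of radius $r$ in $\mathbb{R}^2$, and consider the hard sphere model on $\mathbb{R}^2$, i.e. the potential $\phi(x,y)=+\infty$ if $\|x-y\|_2<r$ and $\phi(x,y)=0$ otherwise. For all activities $$0\le\lambda<\frac{e}{\sqrt{\frac12+\frac{3\sqrt3}{8\pi}}\;v_{2,r}}$$ there is a unique Gibbs measure on $\mathbb{R}^2$ with potential $\phi$ and activity $\lambda$, and the infinite volume pressure $p(\lambda)=\lim_{n\to\infty}\frac1n\log Z_{\Lambda_n}(\lambda)$ is analytic for $\lambda$ in this range.
   Context: $\mathbb{R}^2$ carries Lebesgue measure, and $\Lambda_n$ is the (axis-parallel, origin-centred) square of area $n$. Convention: $e^{-\infty}=0$. Gibbs measure: put $H_x(X)=\sum_{y\in X}\phi(x,y)$. A Gibbs measure with potential $\phi$ and activity $\lambda\ge0$ is a probability measure $\nu$ on locally finite point sets of $\mathbb{R}^2$ such that, with $\mathbf{X}$ a sample from $\nu$, $$\mathbb{E}_\nu\Big[\sum_{x\in\mathbf{X}}F(x,\mathbf{X})\Big]=\lambda\int_{\mathbb{R}^2}\mathbb{E}_\nu\big[F(x,\mathbf{X}\cup\{x\})e^{-H_x(\mathbf{X})}\big]\,dx$$ for all measurable non-negative test functions $F$. Partition function: $Z_\Lambda(\lambda)=1+\sum_{k\ge1}\frac{\lambda^k}{k!}\int_{\Lambda^k}e^{-\sum_{1\le i<j\le k}\phi(x_i,x_j)}\,dx_1\cdots dx_k$. Analytic on a half-open interval $[0,b)$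 means that $p$ agrees there with a function holomorphic in an open complex neighbourhood of $[0,b)$. *)

theory Defs
  imports "HOL-Analysis.Analysis" "HOL-Probability.Probability"
begin

type_synonym plane = "real ^ 2"

definition loc_finite :: "plane set \<Rightarrow> bool" where
  "loc_finite X \<longleftrightarrow> (\<forall>B. bounded B \<longrightarrow> finite (X \<inter> B))"

text \<open>The sigma-algebra on locally finite point sets is the one generated by the counting maps
  \<open>X \<mapsto> card (X \<inter> B)\<close>, for bounded Borel sets \<open>B\<close>.\<close>

definition config_space :: "plane set measure" where
  "config_space = sigma {X. loc_finite X}
     {{X. loc_finite X \<and> card (X \<inter> B) = k} | B k. bounded B \<and> B \<in> sets borel}"

text \<open>Potentials take values in \<open>[0,\<infinity>]\<close>, and \<open>exp_neg u\<close> is \<open>e\<^sup>-\<^sup>u\<close> with the convention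
  that it vanishes at \<open>u = \<infinity>\<close>.\<close>

type_synonym potential = "plane \<Rightarrow> plane \<Rightarrow> ennreal"

definition exp_neg :: "ennreal \<Rightarrow> real" where
  "exp_neg u = (if u = \<top> then 0 else exp (- enn2real u))"

definition hard_sphere :: "real \<Rightarrow> potential" where
  "hard_sphere r x y = (if norm (x - y) < r then \<top> else 0)"

definition energy :: "potential \<Rightarrow> plane \<Rightarrow> plane set \<Rightarrow> ennreal" where
  "energy \<phi> x X = (\<integral>\<^sup>+ y. \<phi> x y \<partial>count_space X)"

definition gibbs_measure :: "potential \<Rightarrow> real \<Rightarrow> plane set measure \<Rightarrow> bool" where
  "gibbs_measure \<phi> z \<nu> \<longleftrightarrow>
     0 \<le> z \<and> prob_space \<nu> \<and> sets \<nu> = sets config_space \<and>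
     (\<forall>F :: plane \<times> plane set \<Rightarrow> ennreal. F \<in> borel_measurable (borel \<Otimes>\<^sub>M config_space) \<longrightarrow>
        (\<integral>\<^sup>+ X. (\<integral>\<^sup>+ x. F (x, X) \<partial>count_space X) \<partial>\<nu>) =
        ennreal z * (\<integral>\<^sup>+ x. (\<integral>\<^sup>+ X. F (x, X \<union> {x}) * ennreal (exp_neg (energy \<phi> x X)) \<partial>\<nu>) \<partial>lborel))"

definition partition_function :: "potential \<Rightarrow> plane set \<Rightarrow> real \<Rightarrow> real" where
  "partition_function \<phi> \<Lambda> z = 1 + (\<Sum>m. let k = Suc m in
     z ^ k / fact k *
     (LINT x : ({1..k} \<rightarrow>\<^sub>E \<Lambda>) | (\<Pi>\<^sub>M i\<in>{1..k}. lborel).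
        exp_neg (\<Sum>(i, j) \<in> {(i, j). 1 \<le> i \<and> i < j \<and> j \<le> k}. \<phi> (x i) (x j))))"

definition square_of_area :: "nat \<Rightarrow> plane set" where
  "square_of_area n = {x. \<forall>i. \<bar>x $ i\<bar> \<le> sqrt (real n) / 2}"

definition finite_volume_pressure :: "potential \<Rightarrow> real \<Rightarrow> nat \<Rightarrow> real" where
  "finite_volume_pressure \<phi> z n = 1 / real n * ln (partition_function \<phi> (square_of_area n) z)"

text \<open>Only meaningful when the limit exists.\<close>

definition pressure :: "potential \<Rightarrow> real \<Rightarrow> real" where
  "pressure \<phi> z = lim (finite_volume_pressure \<phi> z)"

definition real_analytic_on :: "(real \<Rightarrow> real) \<Rightarrow> real set \<Rightarrow> bool" where
  "real_analytic_on p I \<longleftrightarrow>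
     (\<exists>U f. open U \<and> complex_of_real ` I \<subseteq> U \<and> f holomorphic_on U \<and>
        (\<forall>t\<in>I. f (complex_of_real t) = complex_of_real (p t)))"

end

theory Submission
  imports Defs "HOL-Complex_Analysis.Complex_Analysis"
begin

text \<open>
  The proof works with functionals \<open>q\<close> of the region \<open>S\<close> in which points are allowed, and with a single
  identity, the \<^emph>\<open>removal identity\<close>
  \<open>q(S) - q(S \<setminus> B) = z \<integral>\<^bsub>B \<inter> S\<^esub> q(S \<setminus> ball x r) dx\<close> for all sets \<open>B\<close> of diameter less than \<open>r\<close>.
  Since a hard sphere configuration has at most one point in \<open>B\<close>, the identity says that either
  \<open>B\<close> is empty or it contains exactly one point \<open>x\<close>, which then forbids the disk around \<open>x\<close>.
  It holds for the partition function (\<open>partition_sum_remove\<close>), and for the void probabilities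
  \<open>S \<mapsto> \<nu>(no point outside S)\<close> of a Gibbs measure (\<open>gibbs_removal\<close>).

  Emptying the disk around \<open>x\<close> from its centre outwards, in infinitesimal shells, turns the identity into
  a closed recursion (\<open>vacancy_recursion\<close>) for the vacancy ratio \<open>R(S,x) = q(S \<setminus> ball x r) / q(S)\<close>:
  \<open>R(S,x) = exp (-z \<integral>\<^bsub>ball x r \<inter> S\<^esub> R(S \<setminus> ball x (dist x y), y) dy)\<close>. For \<open>s = sqrt R\<close> the exponent is
  \<open>-(z/2) \<integral> s\<^sup>2\<close>, and the Cauchy--Schwarz inequality together with \<open>t e\<^sup>-\<^sup>t \<le> 1/e\<close> shows that a
  perturbation \<open>u\<close> of \<open>s\<close> is mapped to one whose square is at most \<open>(z/e) \<integral> u\<^sup>2\<close>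
  (\<open>exp_square_contraction\<close>). After two steps the square has been multiplied by at most \<open>(z/e)\<^sup>2\<close> times the
  area of the pairs \<open>(y,w)\<close> with \<open>y\<close> in the disk around \<open>x\<close>, \<open>w\<close> in the disk around \<open>y\<close>, and \<open>w\<close> farther
  from \<open>x\<close> than \<open>y\<close>, because nearer points have already been removed. That area is at most
  \<open>(1/2 + 3 sqrt 3 / (8 \<pi>)) (\<pi> r\<^sup>2)\<^sup>2\<close> (\<open>two_step_volume_bound\<close>), so the estimate gives a
  contraction exactly for the activities of the theorem. A weight that depends on the free area
  around \<open>x\<close> makes one step contract already (\<open>weight_contraction\<close>).

  Consequently every solution with values in \<open>[0, 1]\<close> equals \<open>limit_ratio\<close>, obtained from iterates that are entire in \<open>z\<close>. The
  contraction persists for complex \<open>z\<close> near the real interval, and the value at \<open>x\<close> depends on the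
  part of \<open>S\<close> far from \<open>x\<close> only up to an exponentially small error. Three consequences follow.

  \<^item> \<^emph>\<open>Pressure.\<close> Emptying the square from left to right gives \<open>ln Z(\<Lambda>) = z \<integral>\<^bsub>\<Lambda>\<^esub> R(\<Lambda> \<inter> {points right of x}, x) dx\<close>,
    so the pressure is \<open>z\<close> times the vacancy ratio of a half plane at a boundary point, a locally uniform
    limit of holomorphic functions.

  \<^item> \<^emph>\<open>Uniqueness.\<close> The same sweep expresses the void probabilities of a Gibbs measure by \<open>R\<close>, and
    the void events generate the \<open>\<sigma>\<close>-algebra.

  \<^item> \<^emph>\<open>Existence.\<close> The limits of \<open>Z(ball 0 n \<inter> S) / Z(ball 0 n)\<close> satisfy the removal identity. A point process with these
    void probabilities is built by revealing the cells of a fine grid one after the other, by the theorem of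
    Ionescu-Tulcea (\<open>gibbs_law_void\<close>), and the removal identity is exactly the defining equation of a Gibbs
    measure on a generating system (\<open>campbell_eq\<close>).
\<close>

no_notation Formal_Power_Series.fps_nth (infixl "$" 75)

section \<open>Borel regions of the plane\<close>

abbreviation area :: "plane set \<Rightarrow> real" where "area \<equiv> measure lborel"

lemma area_ball: "0 \<le> \<rho> \<Longrightarrow> area (ball (x::plane) \<rho>) = pi * \<rho>\<^sup>2"
  by (simp add: measure_def emeasure_ball unit_ball_vol_2)

lemma emeasure_ball_plane: "0 \<le> \<rho> \<Longrightarrow> emeasure lborel (ball (x::plane) \<rho>) = ennreal (pi * \<rho>\<^sup>2)"
  by (simp add: emeasure_ball unit_ball_vol_2)

lemma finite_area:
  assumes "bounded (C::plane set)" shows "emeasure lborel C < \<infinity>"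
  using emeasure_bounded_finite[OF assms] .

lemma area_mono:
  assumes "bounded (C::plane set)" "D \<subseteq> C" "C \<in> sets borel" "D \<in> sets borel"
  shows "area D \<le> area C"
proof (rule measure_mono_fmeasurable[OF assms(2)])
  show "D \<in> sets lborel" using assms by simp
  show "C \<in> fmeasurable lborel"
    using assms finite_area[OF assms(1)] by (simp add: fmeasurable_def)
qed

lemma emeasure_area:
  assumes "bounded (C::plane set)" shows "emeasure lborel C = ennreal (area C)"
  using finite_area[OF assms] by (simp add: emeasure_eq_ennreal_measure)

lemma area_Un_disjoint:
  assumes "bounded (C::plane set)" "bounded D" "C \<inter> D = {}" "C \<in> sets borel" "D \<in> sets borel"
  shows "area (C \<union> D) = area C + area D"
  by (rule measure_Union) (use assms finite_area[of C] finite_area[of D] in auto)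

lemma small_subset_ball: "x \<in> K \<Longrightarrow> (\<And>x y. x \<in> K \<Longrightarrow> y \<in> K \<Longrightarrow> dist x y < r) \<Longrightarrow> K \<subseteq> ball x r"
  by auto

lemma bounded_if_small:
  assumes "\<And>x y. x \<in> K \<Longrightarrow> y \<in> K \<Longrightarrow> dist x y < r"
  shows "bounded (K :: plane set)"
proof (cases "K = {}")
  case False
  then obtain a where "a \<in> K" by auto
  hence "K \<subseteq> ball a r" by (rule small_subset_ball) (rule assms)
  thus ?thesis by (rule bounded_subset[OF bounded_ball])
qed simp

text \<open>All regions that occur arise from a fixed one by removing balls, so a function of the region becomes a
  function of a sequence of balls, for which joint measurability makes sense. A ball of radius \<open>0\<close> is
  empty, hence sequences also encode finitely many removals.\<close>

definition minus_balls :: "plane set \<Rightarrow> (nat \<Rightarrow> plane \<times> real) \<Rightarrow> plane set" where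
  "minus_balls T \<omega> = {w \<in> T. \<forall>i. snd (\<omega> i) \<le> dist (fst (\<omega> i)) w}"

abbreviation ball_seqs :: "(nat \<Rightarrow> plane \<times> real) measure" where
  "ball_seqs \<equiv> \<Pi>\<^sub>M i\<in>UNIV. borel \<Otimes>\<^sub>M borel"

lemma minus_balls_cons: "minus_balls T (case_nat (y, \<rho>) \<omega>) = minus_balls T \<omega> - ball y \<rho>"
proof -
  have *: "(\<forall>i. P i) \<longleftrightarrow> P 0 \<and> (\<forall>i. P (Suc i))" for P using not0_implies_Suc by metis
  show ?thesis unfolding minus_balls_def by (subst *) auto
qed

lemma minus_balls_none [simp]: "minus_balls T (\<lambda>_. (0, 0)) = T"
  by (auto simp: minus_balls_def)

lemma minus_balls_borel: "T \<in> sets borel \<Longrightarrow> minus_balls T \<omega> \<in> sets borel"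
proof -
  assume T: "T \<in> sets borel"
  have "minus_balls T \<omega> = T - (\<Union>i. ball (fst (\<omega> i)) (snd (\<omega> i)))"
    unfolding minus_balls_def by (auto simp: not_less) (meson linorder_not_le)
  thus ?thesis using T by simp
qed

lemma minus_balls_member [measurable]:
  assumes [measurable]: "T \<in> sets borel"
  shows "Measurable.pred (ball_seqs \<Otimes>\<^sub>M borel) (\<lambda>(\<omega>, w). w \<in> minus_balls T \<omega>)"
proof -
  have [measurable]: "(\<lambda>x. fst x i) \<in> measurable (ball_seqs \<Otimes>\<^sub>M (borel :: plane measure)) (borel \<Otimes>\<^sub>M borel)" for i
    by (rule measurable_compose[OF measurable_fst measurable_component_singleton]) simp
  have "Measurable.pred (ball_seqs \<Otimes>\<^sub>M borel)
      (\<lambda>x. snd x \<in> T \<and> (\<forall>i. snd (fst x i) \<le> dist (fst (fst x i)) (snd x)))"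
    by measurable
  thus ?thesis by (simp add: minus_balls_def case_prod_beta)
qed

lemma minus_balls_indicator [measurable]:
  assumes [measurable]: "T \<in> sets borel" "f \<in> measurable M ball_seqs" "g \<in> measurable M borel"
  shows "Measurable.pred M (\<lambda>x. g x \<in> minus_balls T (f x))"
proof -
  have "Measurable.pred M (\<lambda>x. (\<lambda>(\<omega>, w). w \<in> minus_balls T \<omega>) (f x, g x))"
    by measurable
  thus ?thesis by simp
qed

lemma measurable_const_seq [measurable]: "(\<lambda>_. c) \<in> measurable M ball_seqs"
  by (auto intro!: measurable_const simp: space_PiM space_pair_measure)

section \<open>The area of two successive steps\<close>

lemma nn_integral_plane_translate:
  fixes f :: "plane \<Rightarrow> ennreal"
  assumes [measurable]: "f \<in> borel_measurable borel"
  shows "(\<integral>\<^sup>+ w. f (a + w) \<partial>lborel) = (\<integral>\<^sup>+ w. f w \<partial>lborel)"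
proof -
  have "(\<integral>\<^sup>+ w. f w \<partial>lborel) = (\<integral>\<^sup>+ w. f w \<partial>distr lborel borel ((+) a))" by (simp add: lborel_distr_plus)
  also have "\<dots> = (\<integral>\<^sup>+ w. f (a + w) \<partial>lborel)" by (subst nn_integral_distr) auto
  finally show ?thesis ..
qed

lemma lborel_scaled_plane:
  assumes "c \<noteq> (0::real)"
  shows "(lborel :: plane measure) = density (distr lborel borel (\<lambda>x. c *\<^sub>R x)) (\<lambda>_. ennreal (c\<^sup>2))"
  using lborel_affine[of c "0::plane"] assms by (simp add: power2_abs)

lemma nn_integral_plane_scale:
  fixes f :: "plane \<Rightarrow> ennreal"
  assumes "c \<noteq> (0::real)" and [measurable]: "f \<in> borel_measurable borel"
  shows "(\<integral>\<^sup>+ w. f w \<partial>lborel) = ennreal (c\<^sup>2) * (\<integral>\<^sup>+ w. f (c *\<^sub>R w) \<partial>lborel)"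
  by (subst lborel_scaled_plane[OF assms(1)])
     (simp add: nn_integral_density nn_integral_distr nn_integral_cmult)

lemma nn_integral_plane_reflect:
  fixes f :: "plane \<Rightarrow> ennreal"
  assumes [measurable]: "f \<in> borel_measurable borel"
  shows "(\<integral>\<^sup>+ w. f (a - w) \<partial>lborel) = (\<integral>\<^sup>+ w. f w \<partial>lborel)"
proof -
  have "(\<integral>\<^sup>+ w. f w \<partial>lborel) = (\<integral>\<^sup>+ w. f (a + w) \<partial>lborel)" by (rule nn_integral_plane_translate[symmetric]) simp
  also have "\<dots> = (\<integral>\<^sup>+ w. f (a + (-1) *\<^sub>R w) \<partial>lborel)"
    by (subst nn_integral_plane_scale[of "-1"]) auto
  finally show ?thesis by simp
qed

lemma coords_measurable: "(\<lambda>(s, t). vector [s, t] :: plane) \<in> borel_measurable (lborel \<Otimes>\<^sub>M lborel)"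
proof -
  have e: "(\<lambda>(s, t). vector [s, t] :: plane) = (\<lambda>p. fst p *\<^sub>R axis 1 1 + snd p *\<^sub>R axis 2 1)"
    by (auto simp: fun_eq_iff vec_eq_iff forall_2 axis_def)
  show ?thesis unfolding e by measurable
qed

text \<open>Lebesgue measure on the plane is the image of a product measure, so areas can be
  computed by Fubini's theorem.\<close>

lemma lborel_plane_eq: "(lborel :: plane measure) = distr (lborel \<Otimes>\<^sub>M lborel) borel (\<lambda>(s, t). vector [s, t])"
proof (rule lborel_eqI)
  note m[measurable] = coords_measurable
  show "sets (distr (lborel \<Otimes>\<^sub>M lborel) borel (\<lambda>(s, t). vector [s, t] :: plane)) = sets borel" by simp
  fix l u :: plane
  assume le: "\<And>b. b \<in> Basis \<Longrightarrow> l \<bullet> b \<le> u \<bullet> b"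
  have le': "l $ i \<le> u $ i" for i using le[of "axis i 1"] by (simp add: axis_in_Basis_iff inner_axis)
  have "emeasure (distr (lborel \<Otimes>\<^sub>M lborel) borel (\<lambda>(s, t). vector [s, t] :: plane)) (box l u)
    = emeasure (lborel \<Otimes>\<^sub>M lborel) ({l $ 1 <..< u $ 1} \<times> {l $ 2 <..< u $ 2})"
    by (subst emeasure_distr) (auto intro!: arg_cong[where f="emeasure _"] simp: mem_box_cart forall_2 space_pair_measure)
  also have "\<dots> = ennreal ((u $ 1 - l $ 1) * (u $ 2 - l $ 2))"
    using le' by (subst lborel.emeasure_pair_measure_Times) (auto simp: ennreal_mult)
  also have "(u $ 1 - l $ 1) * (u $ 2 - l $ 2) = (\<Prod>b\<in>Basis. (u - l) \<bullet> b)"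
  proof -
    have B: "(Basis :: plane set) = {axis 1 1, axis 2 1}" by (auto simp: Basis_vec_def UNIV_2)
    show ?thesis unfolding B by (simp add: inner_axis axis_eq_axis)
  qed
  finally show "emeasure (distr (lborel \<Otimes>\<^sub>M lborel) borel (\<lambda>(s, t). vector [s, t] :: plane)) (box l u) = ennreal (\<Prod>b\<in>Basis. (u - l) \<bullet> b)" .
qed

lemma norm_plane: "norm (x::plane) = sqrt ((x $ 1)\<^sup>2 + (x $ 2)\<^sup>2)"
  by (simp add: norm_vec_def L2_set_def UNIV_2)

text \<open>The area of the intersection of two unit disks at distance \<open>1\<close>: twice the circular segment computed
  in \<open>semicircle_integral\<close>.\<close>

definition unit_lens :: real where "unit_lens = 2 * pi / 3 - sqrt 3 / 2"

lemma semicircle_integral: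
  "((\<lambda>t. 2 * sqrt (1 - t\<^sup>2)) has_integral (pi / 3 - sqrt 3 / 4)) {1/2..1}"
proof -
  \<comment> \<open>An antiderivative of the chord length of the unit disk.\<close>
  define F where "F t = t * sqrt (1 - t\<^sup>2) + arcsin t" for t
  have "((\<lambda>t. 2 * sqrt (1 - t\<^sup>2)) has_integral (F 1 - F (1/2))) {1/2..1}"
  proof (rule fundamental_theorem_of_calculus_interior)
    show "continuous_on {1/2..1} F" unfolding F_def by (intro continuous_intros) auto
    fix t :: real assume t: "t \<in> {1/2<..<1}"
    have p: "0 < 1 - t\<^sup>2" using t by (simp add: abs_square_less_1)
    have d: "(F has_real_derivative (sqrt (1 - t\<^sup>2) + t * (- 2 * t) / (2 * sqrt (1 - t\<^sup>2)) + 1 / sqrt (1 - t\<^sup>2))) (at t)"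
      unfolding F_def using t p
      by (auto intro!: derivative_eq_intros simp: field_simps)
    have e: "sqrt (1 - t\<^sup>2) + t * (- 2 * t) / (2 * sqrt (1 - t\<^sup>2)) + 1 / sqrt (1 - t\<^sup>2) = 2 * sqrt (1 - t\<^sup>2)"
    proof -
      define s where "s = sqrt (1 - t\<^sup>2)"
      have s: "0 < s" "s * s = 1 - t\<^sup>2" using p by (auto simp: s_def)
      have "s + t * (- 2 * t) / (2 * s) + 1 / s = (s * s + (1 - t * t)) / s" using s(1) by (simp add: field_simps)
      also have "\<dots> = 2 * s" using s by (simp add: power2_eq_square field_simps)
      finally show ?thesis unfolding s_def .
    qed
    show "(F has_vector_derivative 2 * sqrt (1 - t\<^sup>2)) (at t)"
      using d unfolding e by (simp add: has_real_derivative_iff_has_vector_derivative)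
  qed simp
  moreover have "F 1 - F (1/2) = pi / 3 - sqrt 3 / 4"
  proof -
    have "arcsin (1/2) = pi / 6" by (rule arcsin_unique) (auto simp: sin_30)
    moreover have "sqrt (1 - (1/2)\<^sup>2) = sqrt 3 / 2"
      by (rule real_sqrt_unique) (auto simp: power2_eq_square)
    ultimately show ?thesis by (simp add: F_def)
  qed
  ultimately show ?thesis by simp
qed

lemma nn_semicircle: "(\<integral>\<^sup>+ t. ennreal (2 * sqrt (1 - t\<^sup>2)) * indicator {1/2..1} t \<partial>lborel) = ennreal (pi / 3 - sqrt 3 / 4)"
proof -
  let ?f = "\<lambda>t::real. if t \<in> {1/2..1} then 2 * sqrt (1 - t\<^sup>2) else 0"
  have "(\<integral>\<^sup>+ t. ennreal (?f t) \<partial>lborel) = ennreal (pi / 3 - sqrt 3 / 4)"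
  proof (rule nn_integral_has_integral_lborel)
    show "(?f has_integral (pi / 3 - sqrt 3 / 4)) UNIV"
      using semicircle_integral by (simp only: has_integral_restrict_UNIV)
    show "0 \<le> ?f t" for t by (auto simp: abs_square_le_1)
  qed measurable
  also have "(\<lambda>t. ennreal (?f t)) = (\<lambda>t. ennreal (2 * sqrt (1 - t\<^sup>2)) * indicator {1/2..1} t)"
    by (auto simp: fun_eq_iff indicator_def)
  finally show ?thesis .
qed

text \<open>The vertical line through the midpoint of the two centres cuts the lens into two congruent circular
  segments. A lower bound suffices, since the lens is subtracted in the end.\<close>

lemma unit_lens_le: "ennreal unit_lens \<le> emeasure lborel {w::plane. norm w < 1 \<and> norm (w - vector [1, 0]) < 1}"
proof -
  let ?L = "{w::plane. norm w < 1 \<and> norm (w - vector [1, 0]) < 1}"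
  define g where "g s = ennreal (2 * sqrt (1 - s\<^sup>2)) * indicator {1/2..1} s" for s :: real
  have [measurable]: "g \<in> borel_measurable borel" unfolding g_def by measurable
  have Lm: "?L \<in> sets borel" by measurable
  have inner: "g s + g (1 - s) \<le> (\<integral>\<^sup>+ t. indicator ?L (vector [s, t] :: plane) \<partial>lborel)" if "s \<noteq> 1/2" for s
  proof -
    have norms: "norm (vector [s, t] :: plane) < 1 \<longleftrightarrow> s\<^sup>2 + t\<^sup>2 < 1" "norm (vector [s, t] - vector [1, 0] :: plane) < 1 \<longleftrightarrow> (1 - s)\<^sup>2 + t\<^sup>2 < 1" for t
      by (auto simp: norm_plane power2_commute[of s 1])
    have *: "g u \<le> (\<integral>\<^sup>+ t. indicator {t. u\<^sup>2 + t\<^sup>2 < 1 \<and> (1 - u)\<^sup>2 + t\<^sup>2 < 1} t \<partial>lborel)" if u: "1/2 \<le> u" for u :: real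
    proof (cases "u \<le> 1")
      case True
      define c where "c = sqrt (1 - u\<^sup>2)"
      have c: "0 \<le> c" "c\<^sup>2 = 1 - u\<^sup>2" using True u by (auto simp: c_def abs_square_le_1)
      have "{-c<..<c} \<subseteq> {t. u\<^sup>2 + t\<^sup>2 < 1 \<and> (1 - u)\<^sup>2 + t\<^sup>2 < 1}"
      proof
        fix t assume "t \<in> {-c<..<c}"
        hence "\<bar>t\<bar> < c" by auto
        hence "t\<^sup>2 < c\<^sup>2" by (metis abs_ge_zero power2_abs power_strict_mono zero_less_numeral)
        moreover have "(1 - u)\<^sup>2 \<le> u\<^sup>2" using u True by (intro power_mono) auto
        ultimately show "t \<in> {t. u\<^sup>2 + t\<^sup>2 < 1 \<and> (1 - u)\<^sup>2 + t\<^sup>2 < 1}" using c by auto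
      qed
      hence "emeasure lborel {-c<..<c} \<le> emeasure lborel {t. u\<^sup>2 + t\<^sup>2 < 1 \<and> (1 - u)\<^sup>2 + t\<^sup>2 < 1}"
        by (intro emeasure_mono) (simp, measurable)
      thus ?thesis using c(1) u True by (simp add: g_def c_def)
    qed (simp add: g_def)
    show ?thesis
    proof (cases "1/2 \<le> s")
      case True
      hence "g (1 - s) = 0" using that by (simp add: g_def)
      thus ?thesis using *[OF True] by (simp add: indicator_def norms)
    next
      case False
      hence "g s = 0" by (simp add: g_def)
      moreover have "{t. (1 - s)\<^sup>2 + t\<^sup>2 < 1 \<and> (1 - (1 - s))\<^sup>2 + t\<^sup>2 < 1} = {t. s\<^sup>2 + t\<^sup>2 < 1 \<and> (1 - s)\<^sup>2 + t\<^sup>2 < 1}" by auto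
      ultimately show ?thesis using *[of "1 - s"] False by (simp add: indicator_def norms conj_commute)
    qed
  qed
  have "emeasure lborel ?L = (\<integral>\<^sup>+ w. indicator ?L w \<partial>lborel)" using Lm by simp
  also have "\<dots> = (\<integral>\<^sup>+ p. indicator ?L (case p of (s, t) \<Rightarrow> vector [s, t]) \<partial>(lborel \<Otimes>\<^sub>M lborel))"
  proof (subst lborel_plane_eq, rule nn_integral_distr)
    show "(\<lambda>(s, t). vector [s, t] :: plane) \<in> measurable (lborel \<Otimes>\<^sub>M lborel) borel" by (rule coords_measurable)
  qed (use Lm in simp)
  also have "\<dots> = (\<integral>\<^sup>+ s. (\<integral>\<^sup>+ t. indicator ?L (case (s, t) of (s, t) \<Rightarrow> vector [s, t]) \<partial>lborel) \<partial>lborel)"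
    by (rule lborel.nn_integral_fst[symmetric]) (rule measurable_compose[OF coords_measurable], use Lm in simp)
  also have "\<dots> = (\<integral>\<^sup>+ s. (\<integral>\<^sup>+ t. indicator ?L (vector [s, t]) \<partial>lborel) \<partial>lborel)" by simp
  also have "\<dots> \<ge> (\<integral>\<^sup>+ s. g s + g (1 - s) \<partial>lborel)"
  proof (rule nn_integral_mono_AE)
    have "AE s in lborel. s \<noteq> (1/2 :: real)" by (rule AE_lborel_singleton)
    thus "AE s in lborel. g s + g (1 - s) \<le> (\<integral>\<^sup>+ t. indicator ?L (vector [s, t] :: plane) \<partial>lborel)"
      by (rule AE_mp) (auto intro!: AE_I2 inner)
  qed
  also have "(\<integral>\<^sup>+ s. g s + g (1 - s) \<partial>lborel) = (\<integral>\<^sup>+ s. g s \<partial>lborel) + (\<integral>\<^sup>+ s. g (1 - s) \<partial>lborel)"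
    by (rule nn_integral_add) auto
  also have "(\<integral>\<^sup>+ s. g (1 - s) \<partial>lborel) = (\<integral>\<^sup>+ s. g s \<partial>lborel)"
    by (subst nn_integral_real_affine[of g "-1" 1]) auto
  also have "(\<integral>\<^sup>+ s. g s \<partial>lborel) = ennreal (pi / 3 - sqrt 3 / 4)" unfolding g_def by (rule nn_semicircle)
  also have "ennreal (pi / 3 - sqrt 3 / 4) + ennreal (pi / 3 - sqrt 3 / 4) = ennreal unit_lens"
  proof -
    have "sqrt 3 \<le> 2" by (rule real_le_lsqrt) auto
    hence "0 \<le> pi / 3 - sqrt 3 / 4" using pi_ge_two by simp
    thus ?thesis by (simp add: ennreal_plus[symmetric] unit_lens_def del: ennreal_plus)
  qed
  finally show ?thesis .
qed

text \<open>A rotation and a scaling carry the lens of the disks of radius \<open>norm y\<close> around \<open>0\<close> and \<open>y\<close> to the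
  lens of unit disks.\<close>

lemma lens_area_le:
  fixes y :: plane
  shows "ennreal ((norm y)\<^sup>2) * ennreal unit_lens \<le> emeasure lborel {w. norm w < norm y \<and> norm (w - y) < norm y}"
proof (cases "y = 0")
  case False
  define s where "s = norm y"
  have s: "0 < s" using False by (simp add: s_def)
  define e :: plane where "e = vector [1, 0]"
  have "norm e = 1" by (simp add: e_def norm_plane)
  moreover have "norm (y /\<^sub>R s) = 1" using s by (simp add: s_def)
  ultimately have "norm e = norm (y /\<^sub>R s)" by simp
  then obtain f where f: "orthogonal_transformation f" "f e = y /\<^sub>R s" using orthogonal_transformation_exists by metis
  define A1 where "A1 = {w. norm w < 1 \<and> norm (w - e) < 1}"
  define A2 where "A2 = {w. norm w < 1 \<and> norm (w - y /\<^sub>R s) < 1}"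
  have m: "A1 \<in> sets borel" "A2 \<in> sets borel" unfolding A1_def A2_def by measurable
  have b: "bounded A1" "bounded A2"
    by (rule bounded_subset[OF bounded_ball[of 0 1]], force simp: A1_def A2_def)+
  have img: "f ` A1 = A2"
  proof
    show "f ` A1 \<subseteq> A2"
      unfolding A1_def A2_def f(2)[symmetric]
      using orthogonal_transformation_norm[OF f(1)] by (auto simp: linear_diff[OF orthogonal_transformation_linear[OF f(1)], symmetric])
    show "A2 \<subseteq> f ` A1"
    proof
      fix w assume w: "w \<in> A2"
      obtain u where u: "w = f u" using orthogonal_transformation_surj[OF f(1)] by (auto simp: surj_def)
      have "norm u = norm w" "norm (u - e) = norm (w - y /\<^sub>R s)"
        unfolding u f(2)[symmetric] linear_diff[OF orthogonal_transformation_linear[OF f(1)], symmetric]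
        using orthogonal_transformation_norm[OF f(1)] by auto
      thus "w \<in> f ` A1" using w u by (auto simp: A1_def A2_def)
    qed
  qed
  have "A1 \<in> lmeasurable" using m(1) b(1) by (intro bounded_set_imp_lmeasurable) auto
  hence "measure lebesgue A2 = measure lebesgue A1" using measure_orthogonal_image[OF f(1)] img by metis
  hence "area A2 = area A1" using m by (simp add: measure_completion)
  hence e12: "emeasure lborel A1 = emeasure lborel A2" using emeasure_area[OF b(1)] emeasure_area[OF b(2)] by simp
  let ?A = "{w. norm w < norm y \<and> norm (w - y) < norm y}"
  have Am: "?A \<in> sets borel" by measurable
  have sc: "s *\<^sub>R w \<in> ?A \<longleftrightarrow> w \<in> A2" for w
  proof -
    have "norm (s *\<^sub>R w) = s * norm w" using s by simp
    moreover have "s *\<^sub>R w - y = s *\<^sub>R (w - y /\<^sub>R s)" using s by (simp add: algebra_simps)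
    hence "norm (s *\<^sub>R w - y) = s * norm (w - y /\<^sub>R s)" using s by simp
    ultimately show ?thesis using s by (simp add: A2_def s_def[symmetric])
  qed
  have "emeasure lborel ?A = (\<integral>\<^sup>+ w. indicator ?A w \<partial>lborel)" using Am by simp
  also have "\<dots> = ennreal (s\<^sup>2) * (\<integral>\<^sup>+ w. indicator ?A (s *\<^sub>R w) \<partial>lborel)"
    by (rule nn_integral_plane_scale) (use s Am in auto)
  also have "(\<integral>\<^sup>+ w. indicator ?A (s *\<^sub>R w) \<partial>lborel) = (\<integral>\<^sup>+ w. indicator A2 w \<partial>lborel)"
    unfolding indicator_def sc ..
  also have "\<dots> = emeasure lborel A1" using m e12 by simp
  finally have "emeasure lborel ?A = ennreal (s\<^sup>2) * emeasure lborel A1" .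
  moreover have "ennreal unit_lens \<le> emeasure lborel A1" unfolding A1_def e_def by (rule unit_lens_le)
  ultimately show ?thesis unfolding s_def by (simp add: mult_left_mono)
qed simp

text \<open>The layer-cake formula: \<open>(norm y)\<^sup>2\<close> is the integral of \<open>2 s\<close> over \<open>0 \<le> s \<le> norm y\<close>, and for fixed \<open>s\<close>
  the points \<open>y\<close> form an annulus.\<close>

lemma second_moment_disk:
  assumes "0 < r"
  shows "(\<integral>\<^sup>+ y. indicator (ball (0::plane) r) y * ennreal ((norm y)\<^sup>2) \<partial>lborel) = ennreal (pi * r ^ 4 / 2)"
proof -
  have sq: "ennreal ((norm y)\<^sup>2) = (\<integral>\<^sup>+ s. ennreal (2 * s) * indicator {0..norm y} s \<partial>lborel)" for y :: plane
    by (subst nn_integral_FTC_Icc[where F="\<lambda>s. s\<^sup>2"]) (auto intro!: derivative_eq_intros)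
  have m: "(\<lambda>(y, s). indicator (ball (0::plane) r) y * (ennreal (2 * s) * indicator {0..norm y} s)) \<in> borel_measurable (lborel \<Otimes>\<^sub>M lborel)"
  proof -
    have "(\<lambda>p. (if norm (fst p :: plane) < r then 1 else 0) * (ennreal (2 * snd p) * (if 0 \<le> snd p \<and> snd p \<le> norm (fst p) then 1 else 0))) \<in> borel_measurable (lborel \<Otimes>\<^sub>M lborel)"
      by measurable
    also have "(\<lambda>p. (if norm (fst p :: plane) < r then 1 else 0) * (ennreal (2 * snd p) * (if 0 \<le> snd p \<and> snd p \<le> norm (fst p) then 1 else 0)))
      = (\<lambda>(y, s). indicator (ball (0::plane) r) y * (ennreal (2 * s) * indicator {0..norm y} s))"
      by (auto simp: fun_eq_iff indicator_def)
    finally show ?thesis .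
  qed
  have "(\<integral>\<^sup>+ y. indicator (ball (0::plane) r) y * ennreal ((norm y)\<^sup>2) \<partial>lborel)
     = (\<integral>\<^sup>+ y. (\<integral>\<^sup>+ s. indicator (ball (0::plane) r) y * (ennreal (2 * s) * indicator {0..norm y} s) \<partial>lborel) \<partial>lborel)"
    unfolding sq by (intro nn_integral_cong nn_integral_cmult[symmetric]) measurable
  also have "\<dots> = (\<integral>\<^sup>+ s. (\<integral>\<^sup>+ y. indicator (ball (0::plane) r) y * (ennreal (2 * s) * indicator {0..norm y} s) \<partial>lborel) \<partial>lborel)"
    by (rule lborel_pair.Fubini'[OF m, symmetric])
  also have "\<dots> = (\<integral>\<^sup>+ s. ennreal (2 * s * (pi * r\<^sup>2 - pi * s\<^sup>2)) * indicator {0..r} s \<partial>lborel)"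
  proof (intro nn_integral_cong)
    fix s :: real
    show "(\<integral>\<^sup>+ y. indicator (ball (0::plane) r) y * (ennreal (2 * s) * indicator {0..norm y} s) \<partial>lborel) = ennreal (2 * s * (pi * r\<^sup>2 - pi * s\<^sup>2)) * indicator {0..r} s"
    proof (cases "0 \<le> s \<and> s \<le> r")
      case True
      have "(\<integral>\<^sup>+ y. indicator (ball (0::plane) r) y * (ennreal (2 * s) * indicator {0..norm y} s) \<partial>lborel) = (\<integral>\<^sup>+ y. ennreal (2 * s) * indicator (ball (0::plane) r - ball 0 s) y \<partial>lborel)"
        using True by (intro nn_integral_cong) (auto simp: indicator_def)
      also have "\<dots> = ennreal (2 * s) * emeasure lborel (ball (0::plane) r - ball 0 s)"
        by (rule nn_integral_cmult_indicator) simp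
      also have "emeasure lborel (ball (0::plane) r - ball 0 s) = emeasure lborel (ball (0::plane) r) - emeasure lborel (ball (0::plane) s)"
        using True finite_area[OF bounded_ball[of "0::plane" s]] by (intro emeasure_Diff) auto
      also have "\<dots> = ennreal (pi * r\<^sup>2 - pi * s\<^sup>2)" using True assms by (simp add: emeasure_ball_plane ennreal_minus)
      also have "ennreal (2 * s) * \<dots> = ennreal (2 * s * (pi * r\<^sup>2 - pi * s\<^sup>2))" using True by (simp add: ennreal_mult')
      finally show ?thesis using True by simp
    next
      case False
      hence 0: "indicator (ball (0::plane) r) y * (ennreal (2 * s) * indicator {0..norm y} s) = 0" for y by (auto simp: indicator_def)
      show ?thesis unfolding 0 using False by simp
    qed
  qed
  also have "\<dots> = ennreal ((pi * r\<^sup>2 * r\<^sup>2 - pi * r ^ 4 / 2) - (pi * r\<^sup>2 * 0\<^sup>2 - pi * 0 ^ 4 / 2))"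
  proof (rule nn_integral_FTC_Icc[where F="\<lambda>s. pi * r\<^sup>2 * s\<^sup>2 - pi * s ^ 4 / 2"])
    show "((\<lambda>s. pi * r\<^sup>2 * s\<^sup>2 - pi * s ^ 4 / 2) has_real_derivative 2 * s * (pi * r\<^sup>2 - pi * s\<^sup>2)) (at s)" for s
      by (auto intro!: derivative_eq_intros simp: algebra_simps power2_eq_square power3_eq_cube)
  next
    fix s assume "s \<in> {0..r}"
    hence "0 \<le> s" "s \<le> r" by auto
    thus "0 \<le> 2 * s * (pi * r\<^sup>2 - pi * s\<^sup>2)"
      by (auto intro!: mult_nonneg_nonneg mult_left_mono power_mono)
  qed (use assms in auto)
  also have "(pi * r\<^sup>2 * r\<^sup>2 - pi * r ^ 4 / 2) - (pi * r\<^sup>2 * 0\<^sup>2 - pi * 0 ^ 4 / 2) = pi * r ^ 4 / 2"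
    by (simp add: power2_eq_square power4_eq_xxxx)
  finally show ?thesis .
qed

lemma circle_null: "{w::plane. norm w = c} \<in> null_sets lborel"
proof (rule null_setsI)
  have "{w::plane. norm w = c} = sphere 0 c" by (auto simp: dist_norm)
  thus "{w::plane. norm w = c} \<in> sets lborel" by simp
  show "emeasure lborel {w::plane. norm w = c} = 0"
  proof (cases "0 \<le> c")
    case True
    have "{w::plane. norm w = c} = cball 0 c - ball 0 c" by auto
    also have "emeasure lborel \<dots> = emeasure lborel (cball (0::plane) c) - emeasure lborel (ball (0::plane) c)"
      using finite_area[OF bounded_ball[of "0::plane" c]] by (intro emeasure_Diff) auto
    also have "\<dots> = 0" using True by (simp add: emeasure_ball emeasure_cball)
    finally show ?thesis .
  next
    case False
    hence "{w::plane. norm w = c} = {}" by (auto dest: order.trans[OF norm_ge_zero])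
    thus ?thesis by simp
  qed
qed

text \<open>The volume of a set of pairs \<open>(y, w)\<close>, thought of as triangles with one vertex at \<open>0\<close>. The
  substitutions below permute the three vertices and preserve this volume.\<close>

definition pairs :: "(plane \<Rightarrow> plane \<Rightarrow> bool) \<Rightarrow> ennreal" where
  "pairs P = (\<integral>\<^sup>+ y. (\<integral>\<^sup>+ w. (if P y w then 1 else 0) \<partial>lborel) \<partial>lborel)"

lemma pairs_reflect_second:
  assumes [measurable]: "Measurable.pred (borel \<Otimes>\<^sub>M borel) (\<lambda>p. P (fst p) (snd p))"
  shows "pairs P = pairs (\<lambda>y w. P y (y - w))"
  unfolding pairs_def
proof (rule nn_integral_cong)
  fix y :: plane
  have "(\<lambda>w. (y, w)) \<in> measurable borel (borel \<Otimes>\<^sub>M borel)" by measurable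
  from measurable_compose[OF this assms] have [measurable]: "Measurable.pred borel (P y)" by simp
  show "(\<integral>\<^sup>+ w. (if P y w then 1 else 0) \<partial>lborel) = (\<integral>\<^sup>+ w. (if P y (y - w) then 1 else 0) \<partial>lborel)"
    by (rule nn_integral_plane_reflect[symmetric]) measurable
qed

lemma pairs_swap:
  assumes "Measurable.pred (borel \<Otimes>\<^sub>M borel) (\<lambda>p. P (fst p) (snd p))"
  shows "pairs P = pairs (\<lambda>w y. P y w)"
proof -
  have [measurable]: "Measurable.pred (lborel \<Otimes>\<^sub>M lborel) (\<lambda>p. P (fst p) (snd p))" using assms by simp
  have "(\<lambda>(y, w). (if P y w then 1 else 0) :: ennreal) \<in> borel_measurable (lborel \<Otimes>\<^sub>M lborel)"
    unfolding case_prod_beta by measurable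
  from lborel_pair.Fubini'[OF this] show ?thesis unfolding pairs_def by simp
qed

lemma pairs_reflect_first:
  assumes m[measurable]: "Measurable.pred (borel \<Otimes>\<^sub>M borel) (\<lambda>p. P (fst p) (snd p))"
  shows "pairs P = pairs (\<lambda>y w. P (w - y) w)"
proof -
  have [measurable]: "Measurable.pred (borel \<Otimes>\<^sub>M borel) (\<lambda>p. P (f p) (g p))"
    if [measurable]: "f \<in> borel_measurable (borel \<Otimes>\<^sub>M borel)" "g \<in> borel_measurable (borel \<Otimes>\<^sub>M borel)" for f g :: "plane \<times> plane \<Rightarrow> plane"
  proof -
    have "(\<lambda>p. (f p, g p)) \<in> measurable (borel \<Otimes>\<^sub>M borel) (borel \<Otimes>\<^sub>M borel)" by measurable
    from measurable_compose[OF this m] show ?thesis by simp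
  qed
  have "pairs P = pairs (\<lambda>w y. P y w)" by (rule pairs_swap[OF m])
  also have "\<dots> = pairs (\<lambda>w y. P (w - y) w)" by (rule pairs_reflect_second) measurable
  also have "\<dots> = pairs (\<lambda>y w. P (w - y) w)" by (rule pairs_swap) measurable
  finally show ?thesis .
qed

lemma pairs_mono: "(\<And>y w. P y w \<Longrightarrow> Q y w) \<Longrightarrow> pairs P \<le> pairs Q"
  unfolding pairs_def by (intro nn_integral_mono) simp

lemma pairs_disjoint:
  assumes m: "Measurable.pred (borel \<Otimes>\<^sub>M borel) (\<lambda>p. P (fst p) (snd p))" "Measurable.pred (borel \<Otimes>\<^sub>M borel) (\<lambda>p. Q (fst p) (snd p))"
    and "\<And>y w. \<not> (P y w \<and> Q y w)"
  shows "pairs (\<lambda>y w. P y w \<or> Q y w) = pairs P + pairs Q"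
proof -
  have s: "(\<lambda>w. (if X y w then 1 else 0) :: ennreal) \<in> borel_measurable lborel"
    if "Measurable.pred (borel \<Otimes>\<^sub>M borel) (\<lambda>p. X (fst p) (snd p))" for X :: "plane \<Rightarrow> plane \<Rightarrow> bool" and y
  proof -
    have "(\<lambda>w. (y, w)) \<in> measurable borel (borel \<Otimes>\<^sub>M borel)" by measurable
    from measurable_compose[OF this that] have [measurable]: "Measurable.pred borel (X y)" by simp
    show ?thesis by measurable
  qed
  have d: "(\<lambda>y. \<integral>\<^sup>+ w. (if X y w then 1 else 0) \<partial>lborel) \<in> borel_measurable lborel"
    if X: "Measurable.pred (borel \<Otimes>\<^sub>M borel) (\<lambda>p. X (fst p) (snd p))" for X :: "plane \<Rightarrow> plane \<Rightarrow> bool"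
  proof -
    have [measurable]: "Measurable.pred (lborel \<Otimes>\<^sub>M lborel) (\<lambda>p. X (fst p) (snd p))" using X by simp
    have "(\<lambda>(y, w). (if X y w then 1 else 0) :: ennreal) \<in> borel_measurable (lborel \<Otimes>\<^sub>M lborel)"
      unfolding case_prod_beta by measurable
    from lborel.borel_measurable_nn_integral[OF this] show ?thesis .
  qed
  have "pairs (\<lambda>y w. P y w \<or> Q y w) = (\<integral>\<^sup>+ y. (\<integral>\<^sup>+ w. (if P y w then 1 else 0) + (if Q y w then 1 else 0) \<partial>lborel) \<partial>lborel)"
    unfolding pairs_def using assms(3) by (intro nn_integral_cong) auto
  also have "\<dots> = (\<integral>\<^sup>+ y. (\<integral>\<^sup>+ w. (if P y w then 1 else 0) \<partial>lborel) + (\<integral>\<^sup>+ w. (if Q y w then 1 else 0) \<partial>lborel) \<partial>lborel)"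
    by (intro nn_integral_cong nn_integral_add s m)
  also have "\<dots> = pairs P + pairs Q" unfolding pairs_def by (intro nn_integral_add d m)
  finally show ?thesis .
qed

lemma norm_le_pred:
  fixes f g :: "'a \<Rightarrow> plane"
  assumes [measurable]: "f \<in> borel_measurable M" "g \<in> borel_measurable M"
  shows "Measurable.pred M (\<lambda>p. norm (f p) \<le> norm (g p))"
proof -
  have "Measurable.pred M (\<lambda>p. 0 \<le> norm (g p) - norm (f p))" by measurable
  thus ?thesis by simp
qed

lemma norm_less_pred:
  fixes f g :: "'a \<Rightarrow> plane"
  assumes [measurable]: "f \<in> borel_measurable M" "g \<in> borel_measurable M"
  shows "Measurable.pred M (\<lambda>p. norm (f p) < norm (g p))"
proof -
  have "Measurable.pred M (\<lambda>p. 0 < norm (g p) - norm (f p))" by measurable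
  thus ?thesis by simp
qed

lemma norm_less_const_pred:
  fixes f :: "'a \<Rightarrow> plane"
  assumes [measurable]: "f \<in> borel_measurable M"
  shows "Measurable.pred M (\<lambda>p. norm (f p) < c)"
  by measurable

lemmas norm_pred_intros = pred_intros_logic(3) norm_le_pred norm_less_pred norm_less_const_pred
  borel_measurable_diff measurable_fst measurable_snd

text \<open>Among all pairs with \<open>norm y < r\<close> and \<open>norm (w - y) < r\<close>, those with \<open>norm w < norm y\<close> have to be discounted. Look at the
  longest side of the triangle \<open>0, y, w\<close>. It is \<open>y\<close> in a set of volume at least
  \<open>\<integral> (norm y)\<^sup>2 unit_lens dy = (\<pi> r\<^sup>4 / 2) unit_lens\<close>. By symmetry, half of these triangles have
  \<open>norm w \<le> norm (w - y)\<close>, and exchanging the names of two vertices maps this half to triangles whose longest side is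
  \<open>w - y\<close>; they are discounted as well. So the discount is at least \<open>3/2\<close> of the first volume.\<close>

lemma second_step_escapes:
  assumes r: "0 < r"
  shows "pairs (\<lambda>y w. norm y < r \<and> norm (w - y) < r \<and> norm y \<le> norm w) \<le> ennreal ((1 / 2 + 3 * sqrt 3 / (8 * pi)) * (pi * r\<^sup>2)\<^sup>2)"
proof -
  let ?out = "\<lambda>y w. norm y < r \<and> norm (w - y) < r \<and> norm y \<le> norm w"
  let ?in = "\<lambda>y w. norm y < r \<and> norm (w - y) < r \<and> norm w < norm y"
  let ?y = "\<lambda>y w. norm w < norm y \<and> norm (w - y) < norm y \<and> norm y < r"
  let ?y1 = "\<lambda>y w. norm w \<le> norm (w - y) \<and> norm (w - y) < norm y \<and> norm y < r"
  let ?d = "\<lambda>y w. norm w < norm y \<and> norm y \<le> norm (w - y) \<and> norm (w - y) < r"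
  have all: "pairs (\<lambda>y w. norm y < r \<and> norm (w - y) < r) = ennreal ((pi * r\<^sup>2)\<^sup>2)"
  proof -
    have "pairs (\<lambda>y w. norm y < r \<and> norm (w - y) < r) = (\<integral>\<^sup>+ y. ennreal (pi * r\<^sup>2) * indicator (ball (0::plane) r) y \<partial>lborel)"
      unfolding pairs_def
    proof (intro nn_integral_cong)
      fix y :: plane
      have "(\<integral>\<^sup>+ w. (if norm y < r \<and> norm (w - y) < r then 1 else 0) \<partial>lborel) = (\<integral>\<^sup>+ w. indicator (ball 0 r) y * indicator (ball y r) w \<partial>lborel)"
        by (intro nn_integral_cong) (auto simp: indicator_def dist_norm norm_minus_commute)
      also have "\<dots> = ennreal (pi * r\<^sup>2) * indicator (ball 0 r) y"
        using r by (subst nn_integral_cmult_indicator) (auto simp: emeasure_ball_plane mult.commute)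
      finally show "(\<integral>\<^sup>+ w. (if norm y < r \<and> norm (w - y) < r then 1 else 0) \<partial>lborel) = ennreal (pi * r\<^sup>2) * indicator (ball 0 r) y" .
    qed
    also have "\<dots> = ennreal (pi * r\<^sup>2) * ennreal (pi * r\<^sup>2)"
      using r by (subst nn_integral_cmult_indicator) (auto simp: emeasure_ball_plane)
    also have "\<dots> = ennreal ((pi * r\<^sup>2)\<^sup>2)" by (simp add: power2_eq_square ennreal_mult'[symmetric])
    finally show ?thesis .
  qed
  have a: "ennreal (pi * r ^ 4 / 2 * unit_lens) \<le> pairs ?y"
  proof -
    have "sqrt 3 \<le> 2" by (rule real_le_lsqrt) auto
    hence u0: "0 \<le> unit_lens" using pi_ge_two by (simp add: unit_lens_def)
    have "ennreal (pi * r ^ 4 / 2 * unit_lens) = (\<integral>\<^sup>+ y. indicator (ball (0::plane) r) y * ennreal ((norm y)\<^sup>2) \<partial>lborel) * ennreal unit_lens"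
      unfolding second_moment_disk[OF r] using u0 r by (intro ennreal_mult) auto
    also have "\<dots> = (\<integral>\<^sup>+ y. indicator (ball (0::plane) r) y * ennreal ((norm y)\<^sup>2) * ennreal unit_lens \<partial>lborel)"
    proof (rule nn_integral_multc[symmetric])
      have "(\<lambda>y::plane. ennreal ((norm y)\<^sup>2)) \<in> borel_measurable lborel" by measurable
      thus "(\<lambda>y. indicator (ball (0::plane) r) y * ennreal ((norm y)\<^sup>2)) \<in> borel_measurable lborel"
        by (intro borel_measurable_times_ennreal borel_measurable_indicator) auto
    qed
    also have "\<dots> \<le> pairs ?y" unfolding pairs_def
    proof (intro nn_integral_mono)
      fix y :: plane
      have "(\<integral>\<^sup>+ w. (if ?y y w then 1 else 0) \<partial>lborel) = (\<integral>\<^sup>+ w. indicator (ball 0 r) y * indicator {w. norm w < norm y \<and> norm (w - y) < norm y} w \<partial>lborel)"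
        by (intro nn_integral_cong) (auto simp: indicator_def)
      also have "\<dots> = indicator (ball 0 r) y * emeasure lborel {w. norm w < norm y \<and> norm (w - y) < norm y}"
        by (rule nn_integral_cmult_indicator) measurable
      also have "indicator (ball 0 r) y * (ennreal ((norm y)\<^sup>2) * ennreal unit_lens) \<le> \<dots>"
        by (intro mult_left_mono lens_area_le) simp
      finally show "indicator (ball 0 r) y * ennreal ((norm y)\<^sup>2) * ennreal unit_lens \<le> (\<integral>\<^sup>+ w. (if ?y y w then 1 else 0) \<partial>lborel)"
        by (simp add: mult.assoc)
    qed
    finally show ?thesis .
  qed
  \<comment> \<open>The reflection of \<open>w\<close> at the midpoint of \<open>0\<close> and \<open>y\<close> exchanges the two shorter sides.\<close>
  have half: "pairs ?y \<le> pairs ?y1 + pairs ?y1"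
  proof -
    let ?y2 = "\<lambda>y w. norm (w - y) < norm w \<and> norm w < norm y \<and> norm y < r"
    have "pairs ?y \<le> pairs (\<lambda>y w. ?y1 y w \<or> ?y2 y w)" by (rule pairs_mono) auto
    also have "\<dots> = pairs ?y1 + pairs ?y2" by (rule pairs_disjoint) (intro norm_pred_intros, intro norm_pred_intros, auto)
    also have "pairs ?y2 = pairs (\<lambda>y w. ?y2 y (y - w))" by (rule pairs_reflect_second) (intro norm_pred_intros)
    also have "\<dots> \<le> pairs ?y1" by (rule pairs_mono) (auto simp: norm_minus_commute)
    finally show ?thesis by (simp add: add_left_mono)
  qed
  \<comment> \<open>The reflection \<open>y \<mapsto> w - y\<close> fixes the side \<open>w\<close> and exchanges the other two. Strict and weak
    inequalities change places, which only matters on circles.\<close>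
  have y1: "pairs ?y1 \<le> pairs ?d"
  proof -
    let ?d' = "\<lambda>y w. norm w \<le> norm y \<and> norm y < norm (w - y) \<and> norm (w - y) < r"
    have "pairs ?d' = pairs (\<lambda>y w. ?d' (w - y) w)" by (rule pairs_reflect_first) (intro norm_pred_intros)
    hence "pairs ?y1 = pairs ?d'" by (simp add: norm_minus_commute)
    also have "\<dots> \<le> pairs ?d" unfolding pairs_def
    proof (rule nn_integral_mono)
      fix y :: plane
      have "AE w in lborel. w \<notin> {w::plane. norm w = norm y}"
        by (rule AE_not_in) (rule circle_null)
      hence "AE w in lborel. (if ?d' y w then 1 else 0) \<le> (if ?d y w then 1 else (0::ennreal))"
        by (rule AE_mp) (auto intro!: AE_I2)
      thus "(\<integral>\<^sup>+ w. (if ?d' y w then 1 else 0) \<partial>lborel) \<le> (\<integral>\<^sup>+ w. (if ?d y w then 1 else 0) \<partial>lborel)"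
        by (rule nn_integral_mono_AE)
    qed
    finally show ?thesis .
  qed
  have split_in: "pairs ?y + pairs ?d \<le> pairs ?in"
  proof -
    have "pairs ?y + pairs ?d = pairs (\<lambda>y w. ?y y w \<or> ?d y w)" by (rule pairs_disjoint[symmetric]) (intro norm_pred_intros, intro norm_pred_intros, auto)
    also have "\<dots> \<le> pairs ?in" by (rule pairs_mono) auto
    finally show ?thesis .
  qed
  have split_all: "pairs ?out + pairs ?in = ennreal ((pi * r\<^sup>2)\<^sup>2)"
  proof -
    have "pairs ?out + pairs ?in = pairs (\<lambda>y w. ?out y w \<or> ?in y w)" by (rule pairs_disjoint[symmetric]) (intro norm_pred_intros, intro norm_pred_intros, auto)
    also have "(\<lambda>y w. ?out y w \<or> ?in y w) = (\<lambda>y w. norm y < r \<and> norm (w - y) < r)" by (auto simp: fun_eq_iff)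
    finally show ?thesis using all by simp
  qed
  have "pairs ?out + pairs ?in < \<top>" unfolding split_all by simp
  hence fin: "pairs ?out < \<top>" "pairs ?in < \<top>" by (simp_all add: ennreal_add_less_top)
  have "pairs ?y \<le> pairs ?in" "pairs ?d \<le> pairs ?in" by (rule pairs_mono, auto)+
  hence fin': "pairs ?y < \<top>" "pairs ?d < \<top>" using order_le_less_trans[OF _ fin(2)] by auto
  have fin'': "pairs ?y1 < \<top>" by (rule order_le_less_trans[OF y1 fin'(2)])
  define O1 where "O1 = enn2real (pairs ?out)"
  define I1 where "I1 = enn2real (pairs ?in)"
  define Y1 where "Y1 = enn2real (pairs ?y)"
  define Y2 where "Y2 = enn2real (pairs ?y1)"
  define D1 where "D1 = enn2real (pairs ?d)"
  have n: "pairs ?out = ennreal O1" "pairs ?in = ennreal I1" "pairs ?y = ennreal Y1" "pairs ?y1 = ennreal Y2" "pairs ?d = ennreal D1"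
    unfolding O1_def I1_def Y1_def Y2_def D1_def using fin fin' fin'' by simp_all
  have pos: "0 \<le> O1" "0 \<le> I1" "0 \<le> Y1" "0 \<le> Y2" "0 \<le> D1"
    unfolding O1_def I1_def Y1_def Y2_def D1_def by simp_all
  have 1: "pi * r ^ 4 / 2 * unit_lens \<le> Y1" using a pos unfolding n by (simp add: ennreal_le_iff)
  have 2: "Y1 \<le> Y2 + Y2" using half pos unfolding n by (simp add: ennreal_plus[symmetric] ennreal_le_iff del: ennreal_plus)
  have 3: "Y2 \<le> D1" using y1 pos unfolding n by (simp add: ennreal_le_iff)
  have 4: "Y1 + D1 \<le> I1" using split_in pos unfolding n by (simp add: ennreal_plus[symmetric] ennreal_le_iff del: ennreal_plus)
  have 5: "O1 + I1 = (pi * r\<^sup>2)\<^sup>2" using split_all pos unfolding n by (simp add: ennreal_plus[symmetric] ennreal_inj del: ennreal_plus)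
  have "O1 \<le> (pi * r\<^sup>2)\<^sup>2 - 3 / 2 * (pi * r ^ 4 / 2 * unit_lens)" using 1 2 3 4 5 by linarith
  also have "\<dots> = (1 / 2 + 3 * sqrt 3 / (8 * pi)) * (pi * r\<^sup>2)\<^sup>2"
    unfolding unit_lens_def by (simp add: power2_eq_square power4_eq_xxxx field_simps)
  finally show ?thesis unfolding n by (simp add: ennreal_leI)
qed

definition two_step_volume :: "real \<Rightarrow> real" where
  "two_step_volume r = (1 / 2 + 3 * sqrt 3 / (8 * pi)) * (pi * r\<^sup>2)\<^sup>2"

text \<open>Enlarging \<open>S\<close> to the whole plane leaves only the constraint that the ball around \<open>x\<close> up to the distance of
  \<open>y\<close> is gone, that is, \<open>norm (y - x) \<le> norm (w - x)\<close>. Translating \<open>x\<close> to \<open>0\<close> gives the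
  situation of \<open>second_step_escapes\<close>.\<close>

lemma two_step_volume_bound:
  assumes r: "0 < r" and S: "S \<in> sets borel"
  shows "(LINT y:ball x r \<inter> S|lborel. area (ball y r \<inter> (S - ball x (dist x y)))) \<le> two_step_volume r"
proof (cases "integrable lborel (\<lambda>y. indicator (ball x r \<inter> S) y *\<^sub>R area (ball y r \<inter> (S - ball x (dist x y))))")
  case False
  thus ?thesis by (simp add: set_lebesgue_integral_def not_integrable_integral_eq two_step_volume_def)
next
  case True
  define f :: "plane \<Rightarrow> plane \<Rightarrow> ennreal"
    where "f y w = (if norm (y - x) < r \<and> norm (w - y) < r \<and> 0 \<le> norm (w - x) - norm (y - x) then 1 else 0)" for y w
  have "ennreal (LINT y:ball x r \<inter> S|lborel. area (ball y r \<inter> (S - ball x (dist x y))))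
     = (\<integral>\<^sup>+ y. ennreal (indicator (ball x r \<inter> S) y *\<^sub>R area (ball y r \<inter> (S - ball x (dist x y)))) \<partial>lborel)"
    unfolding set_lebesgue_integral_def by (rule nn_integral_eq_integral[OF True, symmetric]) auto
  also have "\<dots> \<le> (\<integral>\<^sup>+ y. (\<integral>\<^sup>+ w. (if norm (y - x) < r \<and> norm (w - y) < r \<and> 0 \<le> norm (w - x) - norm (y - x) then 1 else 0) \<partial>lborel) \<partial>lborel)"
  proof (intro nn_integral_mono)
    fix y
    show "ennreal (indicator (ball x r \<inter> S) y *\<^sub>R area (ball y r \<inter> (S - ball x (dist x y)))) \<le> (\<integral>\<^sup>+ w. (if norm (y - x) < r \<and> norm (w - y) < r \<and> 0 \<le> norm (w - x) - norm (y - x) then 1 else 0) \<partial>lborel)"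
    proof (cases "y \<in> ball x r \<inter> S")
      case True
      have "ennreal (area (ball y r \<inter> (S - ball x (dist x y)))) = emeasure lborel (ball y r \<inter> (S - ball x (dist x y)))"
        by (rule emeasure_area[symmetric]) (rule bounded_subset[OF bounded_ball], auto)
      also have "\<dots> = (\<integral>\<^sup>+ w. indicator (ball y r \<inter> (S - ball x (dist x y))) w \<partial>lborel)"
        using S by (intro nn_integral_indicator[symmetric]) auto
      also have "\<dots> \<le> (\<integral>\<^sup>+ w. (if norm (y - x) < r \<and> norm (w - y) < r \<and> 0 \<le> norm (w - x) - norm (y - x) then 1 else 0) \<partial>lborel)"
        using True by (intro nn_integral_mono) (auto simp: indicator_def dist_norm norm_minus_commute)
      finally show ?thesis using True by simp
    qed simp
  qed
  also have "\<dots> = (\<integral>\<^sup>+ y. (\<integral>\<^sup>+ w. f y w \<partial>lborel) \<partial>lborel)" unfolding f_def ..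
  also have "\<dots> = (\<integral>\<^sup>+ y. (\<integral>\<^sup>+ w. f (x + y) w \<partial>lborel) \<partial>lborel)"
  proof (rule nn_integral_plane_translate[where f="\<lambda>y. \<integral>\<^sup>+ w. f y w \<partial>lborel", symmetric])
    have P: "Measurable.pred (borel \<Otimes>\<^sub>M borel)
      (\<lambda>p. norm (fst p - x) < r \<and> norm (snd p - fst p) < r \<and> 0 \<le> norm (snd p - x) - norm (fst p - x))"
      by measurable
    have "(\<lambda>p. f (fst p) (snd p)) \<in> borel_measurable (borel \<Otimes>\<^sub>M borel)"
      unfolding f_def by (rule measurable_If[OF _ _ P[unfolded pred_def]]) simp_all
    hence "(\<lambda>(y, w). f y w) \<in> borel_measurable (borel \<Otimes>\<^sub>M lborel)" by (simp add: case_prod_beta')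
    from lborel.borel_measurable_nn_integral[OF this] show "(\<lambda>y. \<integral>\<^sup>+ w. f y w \<partial>lborel) \<in> borel_measurable borel" .
  qed
  also have "\<dots> = (\<integral>\<^sup>+ y. (\<integral>\<^sup>+ w. f (x + y) (x + w) \<partial>lborel) \<partial>lborel)"
  proof (rule nn_integral_cong)
    fix y
    have "(\<lambda>w. f (x + y) w) \<in> borel_measurable borel" unfolding f_def by measurable
    thus "(\<integral>\<^sup>+ w. f (x + y) w \<partial>lborel) = (\<integral>\<^sup>+ w. f (x + y) (x + w) \<partial>lborel)"
      by (rule nn_integral_plane_translate[where f="f (x + y)", symmetric])
  qed
  also have "\<dots> = pairs (\<lambda>y w. norm y < r \<and> norm (w - y) < r \<and> norm y \<le> norm w)"
    unfolding pairs_def f_def by simp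
  also have "\<dots> \<le> ennreal (two_step_volume r)" unfolding two_step_volume_def by (rule second_step_escapes[OF r])
  finally show ?thesis by (subst (asm) ennreal_le_iff) (auto simp: two_step_volume_def)
qed

section \<open>The hard sphere partition function\<close>

text \<open>The volume of the \<open>k\<close>-tuples of points of \<open>S\<close> at mutual distance at least \<open>r\<close>. Placing the points one after
  the other makes visible that each placed point only shrinks the region.\<close>

primrec hc_volume :: "real \<Rightarrow> nat \<Rightarrow> plane set \<Rightarrow> ennreal" where
  "hc_volume r 0 S = 1"
| "hc_volume r (Suc k) S = (\<integral>\<^sup>+ x. indicator S x * hc_volume r k (S - ball x r) \<partial>lborel)"

lemma hc_volume_measurable:
  assumes [measurable]: "T \<in> sets borel"
  shows "(\<lambda>\<omega>. hc_volume r k (minus_balls T \<omega>)) \<in> borel_measurable ball_seqs"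
proof (induction k)
  case (Suc k)
  note [measurable] = Suc
  have "(\<lambda>(\<omega>, x). hc_volume r k (minus_balls T (case_nat (x, r) \<omega>)))
      \<in> borel_measurable (ball_seqs \<Otimes>\<^sub>M borel)"
    by measurable
  hence [measurable]: "(\<lambda>(\<omega>, x). hc_volume r k (minus_balls T \<omega> - ball x r))
      \<in> borel_measurable (ball_seqs \<Otimes>\<^sub>M borel)"
    by (simp add: minus_balls_cons)
  show ?case by simp
qed simp

lemma hc_volume_measurable_ball [measurable]:
  assumes "S \<in> sets borel"
  shows "(\<lambda>x. hc_volume r k (S - ball x r)) \<in> borel_measurable borel"
proof -
  note [measurable] = hc_volume_measurable[OF assms, of r k]
  have "(\<lambda>x. hc_volume r k (minus_balls S (case_nat (x, r) (\<lambda>_. (0,0))))) \<in> borel_measurable borel"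
    by measurable
  thus ?thesis by (simp add: minus_balls_cons)
qed

lemma hc_volume_measurable_ball2 [measurable]:
  assumes "S \<in> sets borel"
  shows "(\<lambda>(x, y). hc_volume r k (S - ball x r - ball y r)) \<in> borel_measurable (borel \<Otimes>\<^sub>M borel)"
proof -
  note [measurable] = hc_volume_measurable[OF assms, of r k]
  have "(\<lambda>(x, y). hc_volume r k (minus_balls S (case_nat (y, r) (case_nat (x, r) (\<lambda>_. (0,0))))))
     \<in> borel_measurable (borel \<Otimes>\<^sub>M borel)"
    by measurable
  thus ?thesis by (simp add: minus_balls_cons)
qed

text \<open>The removal identity at a fixed number of points. At most one of the \<open>k + 1\<close> points lies in the small
  set \<open>B\<close>, and it can be any of them, which gives the factor \<open>k + 1\<close>. The induction distinguishes
  whether the first point is this one.\<close>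

lemma hc_volume_remove:
  assumes "B \<in> sets borel" "\<And>x y. x \<in> B \<Longrightarrow> y \<in> B \<Longrightarrow> dist x y < r" "S \<in> sets borel"
  shows "hc_volume r (Suc k) S = hc_volume r (Suc k) (S - B)
    + of_nat (Suc k) * (\<integral>\<^sup>+ x. indicator (B \<inter> S) x * hc_volume r k (S - ball x r) \<partial>lborel)"
  using assms(3)
proof (induction k arbitrary: S)
  case 0
  have "emeasure lborel S = emeasure lborel (S - B) + emeasure lborel (B \<inter> S)"
    using 0 assms(1) by (subst plus_emeasure) (auto intro!: arg_cong[where f="emeasure lborel"])
  thus ?case using 0 assms(1) by simp
next
  case (Suc k)
  have [measurable]: "S \<in> sets borel" "B \<in> sets borel" by fact+
  define V where "V = hc_volume r k"
  have V2[measurable]: "(\<lambda>(x, y). V (S - ball x r - ball y r)) \<in> borel_measurable (borel \<Otimes>\<^sub>M borel)"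
    unfolding V_def by measurable
  have mball[measurable]: "S - ball x r \<in> sets borel" for x by measurable
  let ?I = "\<integral>\<^sup>+ x. indicator (B \<inter> S) x * hc_volume r (Suc k) (S - ball x r) \<partial>lborel"
  have sub: "B \<subseteq> ball x r" if "x \<in> B" for x using assms(2)[OF that] by auto
  have m: "(\<lambda>(x,y). indicator (B \<inter> S) y * (indicator (S - ball y r) x * V (S - ball y r - ball x r)))
       \<in> borel_measurable (lborel \<Otimes>\<^sub>M lborel)"
    proof -
      have "(\<lambda>(x,y). indicator (B \<inter> S) y * (indicator S x * (if dist y x < r then 0 else 1) * V (S - ball x r - ball y r)))
       \<in> borel_measurable (lborel \<Otimes>\<^sub>M lborel)" by measurable
      moreover have "S - ball y r - ball x r = S - ball x r - ball y r" for x y by auto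
      ultimately show ?thesis
        by (elim measurable_cong[THEN iffD1, rotated]) (auto simp: indicator_def)
    qed
  have "hc_volume r (Suc (Suc k)) S = (\<integral>\<^sup>+ x. indicator S x * hc_volume r (Suc k) (S - ball x r) \<partial>lborel)"
    by simp
  also have "\<dots> = (\<integral>\<^sup>+ x. indicator S x * (hc_volume r (Suc k) (S - ball x r - B)
     + of_nat (Suc k) * (\<integral>\<^sup>+ y. indicator (B \<inter> (S - ball x r)) y * V (S - ball x r - ball y r) \<partial>lborel)) \<partial>lborel)"
    unfolding V_def by (subst Suc.IH[OF mball]) simp
  also have "\<dots> = (\<integral>\<^sup>+ x. (indicator (S - B) x * hc_volume r (Suc k) (S - B - ball x r)
      + indicator (B \<inter> S) x * hc_volume r (Suc k) (S - ball x r))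
     + of_nat (Suc k) * (\<integral>\<^sup>+ y. indicator (B \<inter> S) y * (indicator (S - ball y r) x * V (S - ball y r - ball x r)) \<partial>lborel) \<partial>lborel)"
  proof (intro nn_integral_cong, goal_cases)
    case (1 x)
    have a: "indicator S x * hc_volume r (Suc k) (S - ball x r - B) =
      indicator (S - B) x * hc_volume r (Suc k) (S - B - ball x r)
      + indicator (B \<inter> S) x * hc_volume r (Suc k) (S - ball x r)"
    proof (cases "x \<in> B")
      case True
      hence "S - ball x r - B = S - ball x r" using sub by auto
      thus ?thesis using True by (simp add: indicator_def del: hc_volume.simps)
    next
      case False
      have "S - ball x r - B = S - B - ball x r" by auto
      thus ?thesis using False by (simp add: indicator_def del: hc_volume.simps)
    qed
    have b: "indicator S x * (\<integral>\<^sup>+ y. indicator (B \<inter> (S - ball x r)) y * V (S - ball x r - ball y r) \<partial>lborel)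
       = (\<integral>\<^sup>+ y. indicator (B \<inter> S) y * (indicator (S - ball y r) x * V (S - ball y r - ball x r)) \<partial>lborel)"
    proof (subst nn_integral_cmult[symmetric])
      show "(\<lambda>y. indicator (B \<inter> (S - ball x r)) y * V (S - ball x r - ball y r)) \<in> borel_measurable lborel"
        by measurable
      have eq: "S - ball x r - ball y r = S - ball y r - ball x r" for y by auto
      show "(\<integral>\<^sup>+ y. indicator S x * (indicator (B \<inter> (S - ball x r)) y * V (S - ball x r - ball y r)) \<partial>lborel)
       = (\<integral>\<^sup>+ y. indicator (B \<inter> S) y * (indicator (S - ball y r) x * V (S - ball y r - ball x r)) \<partial>lborel)"
        by (intro nn_integral_cong) (auto simp: indicator_def eq dist_commute)
    qed
    show ?case
      unfolding distrib_left a b[symmetric] by (simp add: mult.left_commute)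
  qed
  also have "(\<integral>\<^sup>+ x. (indicator (S - B) x * hc_volume r (Suc k) (S - B - ball x r)
      + indicator (B \<inter> S) x * hc_volume r (Suc k) (S - ball x r))
     + of_nat (Suc k) * (\<integral>\<^sup>+ y. indicator (B \<inter> S) y * (indicator (S - ball y r) x * V (S - ball y r - ball x r)) \<partial>lborel) \<partial>lborel)
    = (hc_volume r (Suc (Suc k)) (S - B) + ?I) +
     of_nat (Suc k) * (\<integral>\<^sup>+ x. (\<integral>\<^sup>+ y. indicator (B \<inter> S) y * (indicator (S - ball y r) x * V (S - ball y r - ball x r)) \<partial>lborel) \<partial>lborel)"
      using m hc_volume_measurable_ball[of S r "Suc k"] hc_volume_measurable_ball[of "S - B" r "Suc k"]
      by (subst nn_integral_add, (measurable; simp), measurable)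
         (subst nn_integral_add, simp_all add: nn_integral_cmult del: hc_volume.simps,
          simp add: hc_volume.simps)
  also have "(\<integral>\<^sup>+ x. (\<integral>\<^sup>+ y. indicator (B \<inter> S) y * (indicator (S - ball y r) x * V (S - ball y r - ball x r)) \<partial>lborel) \<partial>lborel)
     = (\<integral>\<^sup>+ y. (\<integral>\<^sup>+ x. indicator (B \<inter> S) y * (indicator (S - ball y r) x * V (S - ball y r - ball x r)) \<partial>lborel) \<partial>lborel)"
    by (rule lborel_pair.Fubini'[symmetric]) (use m in simp)
  also have "\<dots> = ?I"
    unfolding hc_volume.simps V_def
    by (intro nn_integral_cong nn_integral_cmult) measurable
  finally show ?case by (simp add: algebra_simps del: hc_volume.simps)
qed

lemma hc_volume_mono: "S \<subseteq> T \<Longrightarrow> hc_volume r k S \<le> hc_volume r k T"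
proof (induction k arbitrary: S T)
  case (Suc k)
  have "hc_volume r k (S - ball x r) \<le> hc_volume r k (T - ball x r)" for x
    using Suc.prems by (intro Suc.IH) auto
  thus ?case using Suc.prems
    by (auto intro!: nn_integral_mono mult_mono simp: indicator_def)
qed simp

lemma hc_volume_le: "S \<in> sets borel \<Longrightarrow> hc_volume r k S \<le> emeasure lborel S ^ k"
proof (induction k)
  case (Suc k)
  have "hc_volume r (Suc k) S \<le> (\<integral>\<^sup>+ x. indicator S x * hc_volume r k S \<partial>lborel)"
    unfolding hc_volume.simps by (intro nn_integral_mono mult_left_mono hc_volume_mono) auto
  also have "\<dots> = emeasure lborel S * hc_volume r k S"
    using Suc.prems by (subst nn_integral_multc) auto
  also have "\<dots> \<le> emeasure lborel S * emeasure lborel S ^ k"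
    by (intro mult_left_mono Suc) auto
  finally show ?case by simp
qed simp

definition grand_sum :: "real \<Rightarrow> real \<Rightarrow> plane set \<Rightarrow> ennreal" where
  "grand_sum r z S = (\<Sum>k. ennreal (z ^ k / fact k) * hc_volume r k S)"

lemma grand_sum_head:
  "grand_sum r z S = 1 + (\<Sum>k. ennreal (z ^ Suc k / fact (Suc k)) * hc_volume r (Suc k) S)"
proof -
  have "(\<lambda>k. ennreal (z ^ Suc k / fact (Suc k)) * hc_volume r (Suc k) S) sums
     (\<Sum>k. ennreal (z ^ Suc k / fact (Suc k)) * hc_volume r (Suc k) S)"
    by (intro summable_sums summableI)
  from sums_Suc[OF this] have "(\<lambda>k. ennreal (z ^ k / fact k) * hc_volume r k S) sums
    ((\<Sum>k. ennreal (z ^ Suc k / fact (Suc k)) * hc_volume r (Suc k) S) + 1)"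
    by (simp del: hc_volume.simps(2) power_Suc fact_Suc)
  thus ?thesis unfolding grand_sum_def by (simp add: sums_iff add.commute)
qed

text \<open>In the sum over the number of points, the factor \<open>k + 1\<close> of \<open>hc_volume_remove\<close> cancels against the factorial,
  and one power of the activity is left over.\<close>

lemma grand_sum_remove:
  assumes "B \<in> sets borel" "\<And>x y. x \<in> B \<Longrightarrow> y \<in> B \<Longrightarrow> dist x y < r" "S \<in> sets borel" "0 \<le> z"
  shows "grand_sum r z S = grand_sum r z (S - B)
    + ennreal z * (\<integral>\<^sup>+ x. indicator (B \<inter> S) x * grand_sum r z (S - ball x r) \<partial>lborel)"
proof -
  have [measurable]: "S \<in> sets borel" "B \<in> sets borel" by fact+
  have coef: "ennreal (z ^ Suc k / fact (Suc k)) * (of_nat (Suc k) * X) = ennreal z * (ennreal (z ^ k / fact k) * X)" for k X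
  proof -
    have "ennreal (z ^ Suc k / fact (Suc k)) * of_nat (Suc k) = ennreal (z ^ Suc k / fact (Suc k) * real (Suc k))"
      using assms(4) by (subst ennreal_mult) (auto simp: ennreal_of_nat_eq_real_of_nat simp del: fact_Suc of_nat_Suc)
    also have "z ^ Suc k / fact (Suc k) * real (Suc k) = z * (z ^ k / fact k)"
      unfolding fact_Suc power_Suc by (simp add: divide_simps del: of_nat_Suc)
    also have "ennreal \<dots> = ennreal z * ennreal (z ^ k / fact k)"
      using assms(4) by (subst ennreal_mult) auto
    finally show ?thesis by (simp add: mult.assoc[symmetric] del: fact_Suc of_nat_Suc power_Suc)
  qed
  have lin: "(\<Sum>k. a k + ennreal z * b k) = (\<Sum>k. a k) + ennreal z * (\<Sum>k. b k)" for a b :: "nat \<Rightarrow> ennreal"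
    by (simp only: ennreal_suminf_cmult[symmetric] suminf_add[OF summableI summableI])
  have "grand_sum r z S = 1 + (\<Sum>k. ennreal (z ^ Suc k / fact (Suc k)) * hc_volume r (Suc k) (S - B)
      + ennreal z * (ennreal (z ^ k / fact k) * (\<integral>\<^sup>+ x. indicator (B \<inter> S) x * hc_volume r k (S - ball x r) \<partial>lborel)))"
    unfolding grand_sum_head
    by (subst hc_volume_remove[OF assms(1-3)], assumption, assumption)
       (simp only: distrib_left coef)
  also have "\<dots> = grand_sum r z (S - B) + ennreal z * (\<Sum>k. ennreal (z ^ k / fact k) * (\<integral>\<^sup>+ x. indicator (B \<inter> S) x * hc_volume r k (S - ball x r) \<partial>lborel))"
    unfolding grand_sum_head lin by (simp only: add.assoc)
  also have "(\<Sum>k. ennreal (z ^ k / fact k) * (\<integral>\<^sup>+ x. indicator (B \<inter> S) x * hc_volume r k (S - ball x r) \<partial>lborel))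
     = (\<Sum>k. (\<integral>\<^sup>+ x. ennreal (z ^ k / fact k) * (indicator (B \<inter> S) x * hc_volume r k (S - ball x r)) \<partial>lborel))"
    by (subst nn_integral_cmult) auto
  also have "\<dots> = (\<integral>\<^sup>+ x. (\<Sum>k. ennreal (z ^ k / fact k) * (indicator (B \<inter> S) x * hc_volume r k (S - ball x r))) \<partial>lborel)"
    by (rule nn_integral_suminf[symmetric]) measurable
  also have "\<dots> = (\<integral>\<^sup>+ x. indicator (B \<inter> S) x * grand_sum r z (S - ball x r) \<partial>lborel)"
    unfolding grand_sum_def by (intro nn_integral_cong) (auto simp: indicator_def)
  finally show ?thesis .
qed

lemma grand_sum_measurable_ball [measurable]:
  assumes [measurable]: "S \<in> sets borel"
  shows "(\<lambda>x. grand_sum r z (S - ball x r)) \<in> borel_measurable borel"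
  unfolding grand_sum_def by measurable

lemma grand_sum_empty: "grand_sum r z {} = 1"
  unfolding grand_sum_head by simp

lemma grand_sum_finite:
  assumes "S \<in> sets borel" "bounded S" "0 \<le> z" shows "grand_sum r z S < \<top>"
proof -
  have "grand_sum r z S \<le> (\<Sum>k. ennreal ((z * area S) ^ k / fact k))"
    unfolding grand_sum_def
  proof (intro suminf_le summableI)
    fix k
    have "ennreal (z ^ k / fact k) * hc_volume r k S \<le> ennreal (z ^ k / fact k) * emeasure lborel S ^ k"
      by (intro mult_left_mono hc_volume_le assms) auto
    also have "\<dots> = ennreal ((z * area S) ^ k / fact k)"
      using assms(3) by (simp add: emeasure_area[OF assms(2)] ennreal_power ennreal_mult[symmetric] power_mult_distrib)
    finally show "ennreal (z ^ k / fact k) * hc_volume r k S \<le> ennreal ((z * area S) ^ k / fact k)" .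
  qed
  also have "\<dots> = ennreal (\<Sum>k. (z * area S) ^ k / fact k)"
    using summable_exp[of "z * area S"] assms(3)
    by (intro suminf_ennreal2) (auto simp: divide_inverse mult.commute)
  finally show ?thesis by (rule order_le_less_trans[OF _ ennreal_less_top])
qed

definition partition_sum :: "real \<Rightarrow> real \<Rightarrow> plane set \<Rightarrow> real" where
  "partition_sum r z S = enn2real (grand_sum r z S)"

lemma partition_sum_ennreal:
  assumes "S \<in> sets borel" "bounded S" "0 \<le> z"
  shows "ennreal (partition_sum r z S) = grand_sum r z S"
  using grand_sum_finite[OF assms] by (simp add: partition_sum_def)

lemma partition_sum_ge_1:
  assumes "S \<in> sets borel" "bounded S" "0 \<le> z"
  shows "1 \<le> partition_sum r z S"
proof -
  have "1 \<le> grand_sum r z S" unfolding grand_sum_head by simp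
  hence "ennreal 1 \<le> ennreal (partition_sum r z S)" using partition_sum_ennreal[OF assms] by simp
  thus ?thesis by (subst (asm) ennreal_le_iff) (auto simp: partition_sum_def)
qed

lemma partition_sum_empty: "partition_sum r z {} = 1"
  by (simp add: partition_sum_def grand_sum_empty)

lemma partition_sum_measurable_ball:
  assumes [measurable]: "S \<in> sets borel"
  shows "(\<lambda>x. partition_sum r z (S - ball x r)) \<in> borel_measurable borel"
  unfolding partition_sum_def by measurable

lemma partition_sum_remove:
  assumes "B \<in> sets borel" "\<And>x y. x \<in> B \<Longrightarrow> y \<in> B \<Longrightarrow> dist x y < r" "S \<in> sets borel" "bounded S" "0 \<le> z"
  shows "partition_sum r z S - partition_sum r z (S - B)
    = z * (LINT x:B \<inter> S|lborel. partition_sum r z (S - ball x r))"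
proof -
  have [measurable]: "S \<in> sets borel" "B \<in> sets borel" by fact+
  have *: "grand_sum r z (S - C) = ennreal (partition_sum r z (S - C))" if "C \<in> sets borel" for C
    using assms that by (intro partition_sum_ennreal[symmetric]) (auto intro: bounded_subset)
  have nn: "0 \<le> partition_sum r z T" for T by (simp add: partition_sum_def)
  define J where "J = (\<integral>\<^sup>+ x. indicator (B \<inter> S) x * grand_sum r z (S - ball x r) \<partial>lborel)"
  have J: "J = (\<integral>\<^sup>+ x. ennreal (indicator (B \<inter> S) x * partition_sum r z (S - ball x r)) \<partial>lborel)"
    unfolding J_def by (intro nn_integral_cong) (auto simp: indicator_def *)
  have eq: "grand_sum r z S = grand_sum r z (S - B) + ennreal z * J"
    unfolding J_def by (rule grand_sum_remove) (use assms in auto)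
  have int: "(LINT x:B \<inter> S|lborel. partition_sum r z (S - ball x r)) = enn2real J"
    unfolding J set_lebesgue_integral_def real_scaleR_def
    by (rule integral_eq_nn_integral) (use nn partition_sum_measurable_ball[OF assms(3), of r z] in auto)
  have "ennreal z * J < \<top>" using eq grand_sum_finite[OF assms(3-5), of r]
    by (metis add_top ennreal_add_eq_top top.not_eq_extremum)
  hence "enn2real (grand_sum r z S) = enn2real (grand_sum r z (S - B)) + enn2real (ennreal z * J)"
    unfolding eq by (subst enn2real_plus) (auto simp: * assms(1))
  also have "enn2real (ennreal z * J) = z * enn2real J"
    using assms(5) by (simp add: enn2real_mult)
  finally show ?thesis using int unfolding partition_sum_def by simp
qed

lemma hc_pred_measurable:
  assumes "finite J" "S \<in> sets borel"
  shows "Measurable.pred (\<Pi>\<^sub>M i\<in>J. (lborel :: plane measure))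
    (\<lambda>x. (\<forall>i\<in>J. x i \<in> S) \<and> (\<forall>i\<in>J. \<forall>j\<in>J. i \<noteq> j \<longrightarrow> r \<le> dist (x i) (x j)))"
proof -
  let ?M = "\<Pi>\<^sub>M i\<in>J. (lborel :: plane measure)"
  have c: "(\<lambda>x. x i) \<in> measurable ?M borel" if "i \<in> J" for i
    by (rule measurable_compose[OF measurable_component_singleton[OF that]]) simp
  have a: "Measurable.pred ?M (\<lambda>x. x i \<in> S)" if "i \<in> J" for i
    by (rule pred_sets2[OF assms(2) c[OF that]])
  have b: "Measurable.pred ?M (\<lambda>x. i \<noteq> j \<longrightarrow> r \<le> dist (x i) (x j))" if "i \<in> J" "j \<in> J" for i j
  proof -
    note [measurable] = c[OF that(1)] c[OF that(2)]
    show ?thesis by measurable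
  qed
  show ?thesis
    by (intro pred_intros_logic(3) pred_intros_finite(3) a b assms(1))
qed

lemma hc_volume_eq_PiM:
  assumes "finite J" and S[measurable]: "S \<in> sets borel"
  shows "(\<integral>\<^sup>+ x. indicator {x. (\<forall>i\<in>J. x i \<in> S) \<and> (\<forall>i\<in>J. \<forall>j\<in>J. i \<noteq> j \<longrightarrow> r \<le> dist (x i) (x j))} x
      \<partial>(\<Pi>\<^sub>M i\<in>J. lborel)) = hc_volume r (card J) S"
  using assms
proof (induction J arbitrary: S rule: finite_induct)
  case empty
  interpret product_sigma_finite "\<lambda>_::'a. lborel :: plane measure" by standard
  show ?case by (simp add: PiM_empty nn_integral_count_space_finite)
next
  case (insert i J)
  have [measurable]: "S \<in> sets borel" by fact
  interpret product_sigma_finite "\<lambda>_::'a. lborel :: plane measure" by standard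
  have fin: "finite (insert i J)" using insert by simp
  let ?A = "\<lambda>J S. {x. (\<forall>i\<in>J. x i \<in> S) \<and> (\<forall>i\<in>J. \<forall>j\<in>J. i \<noteq> j \<longrightarrow> r \<le> dist (x i) (x j))}"
  have meas: "Measurable.pred (\<Pi>\<^sub>M i\<in>insert i J. lborel) (\<lambda>x. x \<in> ?A (insert i J) S)"
    using hc_pred_measurable[OF fin, of S r] insert.prems by simp
  have "(\<integral>\<^sup>+ x. indicator (?A (insert i J) S) x \<partial>(\<Pi>\<^sub>M i\<in>insert i J. lborel))
     = (\<integral>\<^sup>+ y. \<integral>\<^sup>+ x. indicator (?A (insert i J) S) (x(i := y)) \<partial>(\<Pi>\<^sub>M i\<in>J. lborel) \<partial>lborel)"
    using insert meas by (intro product_nn_integral_insert_rev) auto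
  also have "\<dots> = (\<integral>\<^sup>+ y. indicator S y * hc_volume r (card J) (S - ball y r) \<partial>lborel)"
  proof (intro nn_integral_cong, goal_cases)
    case (1 y)
    have "indicator (?A (insert i J) S) (x(i := y)) = (indicator S y * indicator (?A J (S - ball y r)) x :: ennreal)" for x
      using insert(2) by (auto simp: indicator_def dist_commute not_less)
    hence "(\<integral>\<^sup>+ x. indicator (?A (insert i J) S) (x(i := y)) \<partial>(\<Pi>\<^sub>M i\<in>J. lborel))
       = (\<integral>\<^sup>+ x. indicator S y * indicator (?A J (S - ball y r)) x \<partial>(\<Pi>\<^sub>M i\<in>J. lborel))"
      by simp
    also have "\<dots> = indicator S y * hc_volume r (card J) (S - ball y r)"
      using insert.IH[of "S - ball y r"] by (cases "y \<in> S") auto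
    finally show ?case .
  qed
  finally show ?case using insert by simp
qed

lemma exp_neg_hard_sphere_sum:
  fixes k :: nat
  shows "exp_neg (\<Sum>(i, j)\<in>{(i, j). 1 \<le> i \<and> i < j \<and> j \<le> k}. hard_sphere r (x i) (x j))
   = indicator {x. \<forall>i\<in>{1..k}. \<forall>j\<in>{1..k}. i \<noteq> j \<longrightarrow> r \<le> dist (x i) (x j)} x"
proof -
  let ?P = "{(i, j). 1 \<le> i \<and> i < j \<and> j \<le> k}"
  have "?P \<subseteq> {1..k} \<times> {1..k}" by auto
  hence fin: "finite ?P" by (rule finite_subset) simp
  show ?thesis
  proof (cases "\<forall>i\<in>{1..k}. \<forall>j\<in>{1..k}. i \<noteq> j \<longrightarrow> r \<le> dist (x i) (x j)")
    case True
    have "(\<Sum>(i, j)\<in>?P. hard_sphere r (x i) (x j)) = 0"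
    proof (intro sum.neutral ballI)
      fix p assume "p \<in> ?P"
      then obtain i j where p: "p = (i, j)" "1 \<le> i" "i < j" "j \<le> k" by auto
      hence "i \<in> {1..k}" "j \<in> {1..k}" "i \<noteq> j" by auto
      with True have "r \<le> dist (x i) (x j)" by blast
      thus "(case p of (i, j) \<Rightarrow> hard_sphere r (x i) (x j)) = 0"
        by (simp add: p hard_sphere_def dist_norm[symmetric] not_less)
    qed
    thus ?thesis using True by (simp add: exp_neg_def)
  next
    case False
    then obtain i j where ij: "i \<in> {1..k}" "j \<in> {1..k}" "i \<noteq> j" "dist (x i) (x j) < r" by (auto simp: not_le)
    have "\<exists>p\<in>?P. (case p of (i, j) \<Rightarrow> hard_sphere r (x i) (x j)) = \<top>"
    proof (cases "i < j")
      case True thus ?thesis using ij by (intro bexI[of _ "(i, j)"]) (auto simp: hard_sphere_def dist_norm)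
    next
      case False thus ?thesis using ij by (intro bexI[of _ "(j, i)"]) (auto simp: hard_sphere_def dist_norm norm_minus_commute)
    qed
    then obtain p where p: "p \<in> ?P" "(case p of (i, j) \<Rightarrow> hard_sphere r (x i) (x j)) = \<top>" by blast
    have "(\<Sum>(i, j)\<in>?P. hard_sphere r (x i) (x j)) = \<top>"
      using fin p by (subst sum.remove[OF fin p(1)]) auto
    thus ?thesis using False by (simp add: exp_neg_def)
  qed
qed

text \<open>For hard spheres the Boltzmann factor is the indicator of the admissible tuples, so the integrals
  are the volumes \<open>hc_volume\<close>.\<close>

lemma partition_function_eq:
  assumes [measurable]: "S \<in> sets borel" and "bounded S" "0 \<le> z"
  shows "partition_function (hard_sphere r) S z = partition_sum r z S"
proof -
  have int: "(LINT x : ({1..k} \<rightarrow>\<^sub>E S) | (\<Pi>\<^sub>M i\<in>{1..k}. lborel).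
        exp_neg (\<Sum>(i, j) \<in> {(i, j). 1 \<le> i \<and> i < j \<and> j \<le> k}. hard_sphere r (x i) (x j)))
      = enn2real (hc_volume r k S)" for k :: nat
  proof -
    let ?M = "\<Pi>\<^sub>M i\<in>{1..k}. (lborel :: plane measure)"
    let ?A = "{x. (\<forall>i\<in>{1..k}. x i \<in> S) \<and> (\<forall>i\<in>{1..k}. \<forall>j\<in>{1..k}. i \<noteq> j \<longrightarrow> r \<le> dist (x i) (x j))}"
    have meas: "Measurable.pred ?M (\<lambda>x. x \<in> ?A)"
      using hc_pred_measurable[of "{1..k}" S r] assms(1) by simp
    have "(LINT x : ({1..k} \<rightarrow>\<^sub>E S) | ?M.
        exp_neg (\<Sum>(i, j) \<in> {(i, j). 1 \<le> i \<and> i < j \<and> j \<le> k}. hard_sphere r (x i) (x j)))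
      = (LINT x|?M. indicator ?A x)"
      unfolding set_lebesgue_integral_def exp_neg_hard_sphere_sum
      by (intro Bochner_Integration.integral_cong refl) (auto simp: indicator_def space_PiM PiE_def)
    also have "\<dots> = enn2real (\<integral>\<^sup>+ x. ennreal (indicator ?A x) \<partial>?M)"
      using meas by (intro integral_eq_nn_integral) auto
    also have "\<dots> = enn2real (hc_volume r k S)"
      using hc_volume_eq_PiM[of "{1..k}" S r] by (simp add: ennreal_indicator)
    finally show ?thesis .
  qed
  define c where "c m = z ^ Suc m / fact (Suc m) * enn2real (hc_volume r (Suc m) S)" for m
  have cnn: "0 \<le> c m" for m unfolding c_def using assms(3) by simp
  have fin: "hc_volume r m S < \<top>" for m
    using hc_volume_le[of S r m] assms(1)
    by (simp add: emeasure_area[OF assms(2)] ennreal_power order_le_less_trans[OF _ ennreal_less_top])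
  have c: "ennreal (c m) = ennreal (z ^ Suc m / fact (Suc m)) * hc_volume r (Suc m) S" for m
    unfolding c_def using assms(3) fin[of "Suc m"] by (subst ennreal_mult) auto
  have gs: "grand_sum r z S = 1 + (\<Sum>m. ennreal (c m))" unfolding grand_sum_head c ..
  have ne: "(\<Sum>m. ennreal (c m)) \<noteq> \<top>" using gs grand_sum_finite[OF assms, of r] by auto
  have "summable c" by (rule summable_suminf_not_top[OF cnn ne])
  have "(\<Sum>m. ennreal (c m)) = ennreal (suminf c)"
    by (rule suminf_ennreal[OF cnn ne])
  hence "grand_sum r z S = ennreal (1 + suminf c)"
    unfolding gs using suminf_nonneg[OF \<open>summable c\<close> cnn] by (subst ennreal_plus) auto
  hence "partition_sum r z S = 1 + suminf c"
    unfolding partition_sum_def using suminf_nonneg[OF \<open>summable c\<close> cnn] by simp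
  thus ?thesis unfolding partition_function_def Let_def int c_def by simp
qed

section \<open>Functionals with a removal identity\<close>

lemma set_integral_norm_bound:
  fixes f :: "plane \<Rightarrow> 'b::{banach,second_countable_topology}"
  assumes "A \<in> sets borel" "bounded A" "\<And>x. x \<in> A \<Longrightarrow> norm (f x) \<le> K"
  shows "norm (LINT x:A|lborel. f x) \<le> K * area A"
proof (cases "A = {}")
  case True thus ?thesis by (simp add: set_lebesgue_integral_def)
next
  case False
  then obtain a where "a \<in> A" by auto
  hence K: "0 \<le> K" using assms(3)[of a] norm_ge_zero order_trans by blast
  have ind: "integrable lborel (\<lambda>x. indicator A x * K)"
    using assms(1) finite_area[OF assms(2)] by (intro integrable_mult_left) auto
  show ?thesis
  proof (cases "integrable lborel (\<lambda>x. indicator A x *\<^sub>R f x)")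
    case True
    have "norm (LINT x:A|lborel. f x) \<le> (LINT x|lborel. norm (indicator A x *\<^sub>R f x))"
      unfolding set_lebesgue_integral_def by (rule integral_norm_bound)
    also have "\<dots> \<le> (LINT x|lborel. indicator A x * K)"
      using True ind assms(3) by (intro integral_mono integrable_norm) (auto simp: indicator_def)
    also have "\<dots> = K * area A" using assms(1) by (simp add: mult.commute)
    finally show ?thesis .
  next
    case False
    thus ?thesis using K by (simp add: set_lebesgue_integral_def not_integrable_integral_eq)
  qed
qed

lemma set_integrable_bounded:
  fixes f :: "plane \<Rightarrow> 'b::{banach,second_countable_topology}"
  assumes "A \<in> sets borel" "bounded A" "\<And>x. x \<in> A \<Longrightarrow> norm (f x) \<le> K" "f \<in> borel_measurable borel"
  shows "set_integrable lborel A f"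
  unfolding set_integrable_def
  using assms finite_area[OF assms(2)]
  by (intro integrableI_bounded_set_indicator[where B=K]) auto

text \<open>The removal identity only treats sets of diameter less than \<open>r\<close>. A bounded set is a finite disjoint union of such
  pieces, so its consequences extend to bounded sets by adding one piece at a time.\<close>

lemma bounded_borel_induct [consumes 3, case_names empty step]:
  fixes C :: "plane set"
  assumes "C \<in> sets borel" "bounded C" "0 < r"
    and empty: "P {}"
    and step: "\<And>A B. A \<in> sets borel \<Longrightarrow> B \<in> sets borel \<Longrightarrow> bounded A \<Longrightarrow> bounded B \<Longrightarrow> A \<inter> B = {}
        \<Longrightarrow> (\<And>x y. x \<in> A \<Longrightarrow> y \<in> A \<Longrightarrow> dist x y < r) \<Longrightarrow> P B \<Longrightarrow> P (A \<union> B)"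
  shows "P C"
proof -
  have "compact (closure C)" using assms(2) by (simp add: compact_closure)
  moreover have "closure C \<subseteq> (\<Union>c\<in>UNIV. ball c (r/2))"
  proof
    fix x show "x \<in> (\<Union>c\<in>UNIV. ball c (r/2))" by (rule UN_I[of x]) (use \<open>0 < r\<close> in auto)
  qed
  ultimately obtain F where F: "finite F" "closure C \<subseteq> (\<Union>c\<in>F. ball c (r/2))"
    using compactE_image[of "closure C" UNIV "\<lambda>c. ball c (r/2)"] by auto
  have "\<And>D. D \<in> sets borel \<Longrightarrow> bounded D \<Longrightarrow> D \<subseteq> (\<Union>c\<in>F. ball c (r/2)) \<Longrightarrow> P D"
    using F(1)
  proof (induction F rule: finite_induct)
    case empty thus ?case using assms(4) by simp
  next
    case (insert c F)
    let ?A = "D \<inter> ball c (r/2)" and ?B = "D - ball c (r/2)"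
    have "P (?A \<union> ?B)"
    proof (rule step)
      show "P ?B" using insert by (intro insert.IH) (auto intro: bounded_subset)
      fix x y assume "x \<in> ?A" "y \<in> ?A"
      thus "dist x y < r" using dist_triangle_half_r[of c x r y] by (auto simp: dist_commute)
    qed (use insert in \<open>auto intro: bounded_subset\<close>)
    moreover have "?A \<union> ?B = D" by auto
    ultimately show ?case by simp
  qed
  thus ?thesis using F(2) closure_subset assms by blast
qed

text \<open>A substitute for a derivative that vanishes everywhere: cut \<open>[a, b]\<close> into \<open>N\<close> equal
  parts, and the increments add up to \<open>O(1/N)\<close>.\<close>

lemma constant_if_quadratic_increments:
  fixes f :: "real \<Rightarrow> real"
  assumes "a \<le> b" and "\<And>s t. a \<le> s \<Longrightarrow> s \<le> t \<Longrightarrow> t \<le> b \<Longrightarrow> \<bar>f t - f s\<bar> \<le> B * (t - s)\<^sup>2"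
  shows "f b = f a"
proof -
  have le: "\<bar>f b - f a\<bar> * real (Suc N) \<le> B * (b - a)\<^sup>2" for N
  proof -
    define h where "h = (b - a) / real (Suc N)"
    have h: "0 \<le> h" "real (Suc N) * h = b - a" using assms(1) by (auto simp: h_def)
    have "f b - f a = (\<Sum>i<Suc N. f (a + real (Suc i) * h) - f (a + real i * h))"
      using h(2) by (subst sum_lessThan_telescope) auto
    also have "\<bar>\<dots>\<bar> \<le> (\<Sum>i<Suc N. \<bar>f (a + real (Suc i) * h) - f (a + real i * h)\<bar>)" by (rule sum_abs)
    also have "\<dots> \<le> (\<Sum>i<Suc N. B * h\<^sup>2)"
    proof (intro sum_mono)
      fix i assume i: "i \<in> {..<Suc N}"
      have "real (Suc i) * h \<le> real (Suc N) * h" using i h(1) by (intro mult_right_mono) auto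
      hence "\<bar>f (a + real (Suc i) * h) - f (a + real i * h)\<bar> \<le> B * ((a + real (Suc i) * h) - (a + real i * h))\<^sup>2"
        using h by (intro assms(2)) (auto simp: algebra_simps)
      thus "\<bar>f (a + real (Suc i) * h) - f (a + real i * h)\<bar> \<le> B * h\<^sup>2" by (simp add: algebra_simps)
    qed
    also have "\<dots> = real (Suc N) * (B * h\<^sup>2)" by simp
    finally have "\<bar>f b - f a\<bar> * real (Suc N) \<le> real (Suc N) * (B * h\<^sup>2) * real (Suc N)"
      by (intro mult_right_mono) auto
    also have "\<dots> = B * (real (Suc N) * h)\<^sup>2" by (simp add: power2_eq_square)
    finally show ?thesis using h(2) by simp
  qed
  show ?thesis
  proof (rule ccontr)
    assume "f b \<noteq> f a"
    hence p: "0 < \<bar>f b - f a\<bar>" by simp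
    obtain N where "B * (b - a)\<^sup>2 / \<bar>f b - f a\<bar> < real N" using reals_Archimedean2 by blast
    hence "B * (b - a)\<^sup>2 < real (Suc N) * \<bar>f b - f a\<bar>" using p by (simp add: field_simps)
    thus False using le[of N] by (simp add: mult.commute)
  qed
qed

text \<open>Joint measurability for free: round the parameter \<open>\<tau> y\<close> down to a multiple of \<open>1/n\<close>, which
  leaves countably many measurable cases, and let \<open>n\<close> tend to infinity.\<close>

lemma measurable_Lipschitz_diagonal:
  fixes F :: "real \<Rightarrow> plane \<Rightarrow> real"
  assumes F: "\<And>t. F t \<in> borel_measurable borel" and \<tau>[measurable]: "\<tau> \<in> borel_measurable borel"
    and L: "\<And>s t y. \<bar>F s y - F t y\<bar> \<le> L * \<bar>s - t\<bar>"
  shows "(\<lambda>y. F (\<tau> y) y) \<in> borel_measurable borel"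
proof (rule borel_measurable_LIMSEQ_real)
  fix n :: nat
  show "(\<lambda>y. F (real_of_int \<lfloor>real (Suc n) * \<tau> y\<rfloor> / real (Suc n)) y) \<in> borel_measurable borel"
  proof (rule measurable_compose_countable[where f="\<lambda>i y. F (real_of_int i / real (Suc n)) y"])
    show "(\<lambda>y. \<lfloor>real (Suc n) * \<tau> y\<rfloor>) \<in> measurable borel (count_space UNIV)" by measurable
  qed (rule F)
next
  fix y :: plane
  have "(\<lambda>n. F (real_of_int \<lfloor>real (Suc n) * \<tau> y\<rfloor> / real (Suc n)) y - F (\<tau> y) y) \<longlonglongrightarrow> 0"
  proof (rule Lim_null_comparison)
    show "(\<lambda>n. \<bar>L\<bar> / real (Suc n)) \<longlonglongrightarrow> 0"
      using tendsto_mult_right_zero[OF LIMSEQ_inverse_real_of_nat, of "\<bar>L\<bar>"] by (simp add: divide_inverse)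
    show "\<forall>\<^sub>F n in sequentially. norm (F (real_of_int \<lfloor>real (Suc n) * \<tau> y\<rfloor> / real (Suc n)) y - F (\<tau> y) y) \<le> \<bar>L\<bar> / real (Suc n)"
    proof (intro always_eventually allI)
      fix n
      let ?t = "real_of_int \<lfloor>real (Suc n) * \<tau> y\<rfloor> / real (Suc n)"
      have "?t - \<tau> y = (real_of_int \<lfloor>real (Suc n) * \<tau> y\<rfloor> - real (Suc n) * \<tau> y) / real (Suc n)"
        by (simp add: diff_divide_distrib)
      moreover have "\<bar>real_of_int \<lfloor>real (Suc n) * \<tau> y\<rfloor> - real (Suc n) * \<tau> y\<bar> \<le> 1" by linarith
      ultimately have "\<bar>?t - \<tau> y\<bar> \<le> 1 / real (Suc n)" by (simp add: abs_divide divide_right_mono)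
      hence "\<bar>L\<bar> * \<bar>?t - \<tau> y\<bar> \<le> \<bar>L\<bar> * (1 / real (Suc n))" by (rule mult_left_mono) simp
      moreover have "L * \<bar>?t - \<tau> y\<bar> \<le> \<bar>L\<bar> * \<bar>?t - \<tau> y\<bar>" by (intro mult_right_mono) auto
      ultimately show "norm (F ?t y - F (\<tau> y) y) \<le> \<bar>L\<bar> / real (Suc n)" using L[of ?t y "\<tau> y"] by simp
    qed
  qed
  thus "(\<lambda>n. F (real_of_int \<lfloor>real (Suc n) * \<tau> y\<rfloor> / real (Suc n)) y) \<longlonglongrightarrow> F (\<tau> y) y"
    by (simp add: LIM_zero_iff)
qed

text \<open>The common structure of partition functions, where \<open>\<S>\<close> consists of the bounded regions, and of
  void probabilities, where \<open>\<S>\<close> consists of the regions with bounded complement.\<close>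

locale removal_functional =
  fixes r z :: real and \<S> :: "plane set set" and q :: "plane set \<Rightarrow> real"
  assumes r_pos: "0 < r" and z_nonneg: "0 \<le> z"
    and region_borel: "S \<in> \<S> \<Longrightarrow> S \<in> sets borel"
    and region_diff: "S \<in> \<S> \<Longrightarrow> C \<in> sets borel \<Longrightarrow> bounded C \<Longrightarrow> S - C \<in> \<S>"
    and q_nonneg: "S \<in> \<S> \<Longrightarrow> 0 \<le> q S"
    and q_measurable: "S \<in> \<S> \<Longrightarrow> (\<lambda>x. q (S - ball x r)) \<in> borel_measurable borel"
    and removal: "S \<in> \<S> \<Longrightarrow> B \<in> sets borel \<Longrightarrow> (\<And>x y. x \<in> B \<Longrightarrow> y \<in> B \<Longrightarrow> dist x y < r) \<Longrightarrow>
      q S - q (S - B) = z * (LINT x:B \<inter> S|lborel. q (S - ball x r))"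
begin

lemma q_antimono:
  assumes "C \<in> sets borel" "bounded C" "S \<in> \<S>"
  shows "q (S - C) \<le> q S"
  using assms(1,2) r_pos assms(3)
proof (induction arbitrary: S rule: bounded_borel_induct)
  case (step A B)
  have "0 \<le> z * (LINT x:A \<inter> S|lborel. q (S - ball x r))"
    unfolding set_lebesgue_integral_def
    by (intro mult_nonneg_nonneg z_nonneg Bochner_Integration.integral_nonneg) (auto intro!: mult_nonneg_nonneg q_nonneg region_diff step)
  hence "q (S - A) \<le> q S" using removal[OF step.prems, of A] step by simp
  moreover have "q (S - A - B) \<le> q (S - A)" using step by (intro step.IH region_diff) auto
  moreover have "S - (A \<union> B) = S - A - B" by auto
  ultimately show ?case by simp
qed simp

lemma q_ball_le: "S \<in> \<S> \<Longrightarrow> q (S - ball x r) \<le> q S"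
  by (intro q_antimono) auto

lemma q_ball_nonneg: "S \<in> \<S> \<Longrightarrow> 0 \<le> q (S - ball x r)"
  by (intro q_nonneg region_diff) auto

lemma q_ball_integrable:
  assumes "C \<in> sets borel" "bounded C" "S \<in> \<S>"
  shows "set_integrable lborel C (\<lambda>x. q (S - ball x r))"
  using assms q_ball_le[OF assms(3)] q_ball_nonneg[OF assms(3)] q_measurable
  by (intro set_integrable_bounded[where K="q S"]) auto

lemma q_ball_integral_le:
  assumes "C \<in> sets borel" "bounded C" "S \<in> \<S>"
  shows "0 \<le> (LINT x:C|lborel. q (S - ball x r))" "(LINT x:C|lborel. q (S - ball x r)) \<le> q S * area C"
proof -
  show "0 \<le> (LINT x:C|lborel. q (S - ball x r))"
    unfolding set_lebesgue_integral_def by (intro Bochner_Integration.integral_nonneg) (auto intro!: mult_nonneg_nonneg q_ball_nonneg assms)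
  have "norm (LINT x:C|lborel. q (S - ball x r)) \<le> q S * area C"
    using assms q_ball_le q_ball_nonneg by (intro set_integral_norm_bound) auto
  thus "(LINT x:C|lborel. q (S - ball x r)) \<le> q S * area C" by simp
qed

text \<open>For a bounded \<open>C\<close> of any size the removal identity still holds up to an error quadratic in the
  area of \<open>C\<close>. Removing \<open>C\<close> piece by piece is exact for each piece; the error comes from evaluating
  the integrand after earlier pieces are gone, which changes it by at most \<open>q S\<close> times \<open>z\<close> times
  the area removed so far.\<close>

lemma removal_error:
  assumes "C \<in> sets borel" "bounded C" "S \<in> \<S>"
  shows "0 \<le> z * (LINT x:C \<inter> S|lborel. q (S - ball x r)) - (q S - q (S - C))"
    and "z * (LINT x:C \<inter> S|lborel. q (S - ball x r)) - (q S - q (S - C)) \<le> (z * area (C \<inter> S))\<^sup>2 * q S"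
proof -
  have "0 \<le> z * (LINT x:C \<inter> S|lborel. q (S - ball x r)) - (q S - q (S - C)) \<and>
    z * (LINT x:C \<inter> S|lborel. q (S - ball x r)) - (q S - q (S - C)) \<le> (z * area (C \<inter> S))\<^sup>2 * q S"
    using assms(1,2) r_pos assms(3)
  proof (induction arbitrary: S rule: bounded_borel_induct)
    case (step A B)
    have S[measurable]: "S \<in> sets borel" using step.prems region_borel by auto
    have T: "S - A \<in> \<S>" using step by (intro region_diff) auto
    have m: "A \<inter> S \<in> sets borel" "B \<inter> S \<in> sets borel" using step by auto
    have b: "bounded (A \<inter> S)" "bounded (B \<inter> S)" using step by (auto intro: bounded_subset)
    have BT: "B \<inter> (S - A) = B \<inter> S" using step by auto
    define a1 where "a1 = z * area (A \<inter> S)"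
    define a2 where "a2 = z * area (B \<inter> S)"
    have a: "0 \<le> a1" "0 \<le> a2" using z_nonneg by (auto simp: a1_def a2_def)
    have qS: "0 \<le> q S" "q (S - A) \<le> q S" using q_nonneg q_antimono step by auto
    have IH: "0 \<le> z * (LINT x:B \<inter> S|lborel. q (S - A - ball x r)) - (q (S - A) - q (S - A - B))"
      "z * (LINT x:B \<inter> S|lborel. q (S - A - ball x r)) - (q (S - A) - q (S - A - B)) \<le> a2\<^sup>2 * q (S - A)"
      using step.IH[OF T] unfolding BT a2_def by auto
    have rem: "q S - q (S - A) = z * (LINT x:A \<inter> S|lborel. q (S - ball x r))"
      using step by (intro removal) auto
    have split: "(LINT x:(A \<union> B) \<inter> S|lborel. q (S - ball x r)) =
      (LINT x:A \<inter> S|lborel. q (S - ball x r)) + (LINT x:B \<inter> S|lborel. q (S - ball x r))"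
      using step m b by (subst set_integral_Un[symmetric]) (auto intro!: q_ball_integrable simp: Int_Un_distrib2)
    define dlt where "dlt = (LINT x:B \<inter> S|lborel. q (S - ball x r)) - (LINT x:B \<inter> S|lborel. q (S - A - ball x r))"
    have dlt: "dlt = (LINT x:B \<inter> S|lborel. q (S - ball x r) - q (S - A - ball x r))"
      unfolding dlt_def using m b step.prems T by (intro set_integral_diff(2)[symmetric] q_ball_integrable)
    have pw: "0 \<le> q (S - ball x r) - q (S - A - ball x r) \<and> q (S - ball x r) - q (S - A - ball x r) \<le> a1 * q S" for x
    proof -
      have Tx: "S - ball x r \<in> \<S>" using step.prems by (intro region_diff) auto
      have e: "S - ball x r - A = S - A - ball x r" by auto
      have "q (S - ball x r) - q (S - ball x r - A) = z * (LINT y:A \<inter> (S - ball x r)|lborel. q (S - ball x r - ball y r))"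
        using step Tx by (intro removal) auto
      also have "\<dots> \<le> z * (q (S - ball x r) * area (A \<inter> (S - ball x r)))"
        using step b Tx by (intro mult_left_mono z_nonneg q_ball_integral_le) (auto intro: bounded_subset)
      also have "\<dots> \<le> z * (q S * area (A \<inter> S))"
        using step b m by (intro mult_left_mono mult_mono z_nonneg area_mono q_ball_le qS) auto
      finally show ?thesis using q_antimono[of A "S - ball x r"] step Tx unfolding e a1_def
        by (auto simp: algebra_simps)
    qed
    have "0 \<le> dlt" unfolding dlt set_lebesgue_integral_def
      using pw by (intro Bochner_Integration.integral_nonneg) (auto simp: indicator_def)
    have "norm dlt \<le> a1 * q S * area (B \<inter> S)" unfolding dlt
      using pw m b by (intro set_integral_norm_bound) auto
    hence zd: "z * dlt \<le> a1 * a2 * q S" using mult_left_mono[OF _ z_nonneg, of "dlt" "a1 * q S * area (B \<inter> S)"]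
      unfolding a2_def by (auto simp: algebra_simps)
    have zd0: "0 \<le> z * dlt" using \<open>0 \<le> dlt\<close> z_nonneg by simp
    have ar: "area ((A \<union> B) \<inter> S) = area (A \<inter> S) + area (B \<inter> S)"
      using m b step by (subst area_Un_disjoint[symmetric]) (auto simp: Int_Un_distrib2)
    have D: "S - (A \<union> B) = S - A - B" by auto
    have E: "z * (LINT x:(A \<union> B) \<inter> S|lborel. q (S - ball x r)) - (q S - q (S - (A \<union> B))) =
      z * dlt + (z * (LINT x:B \<inter> S|lborel. q (S - A - ball x r)) - (q (S - A) - q (S - A - B)))"
      unfolding split D dlt_def using rem by (simp add: algebra_simps)
    have "a2\<^sup>2 * q (S - A) \<le> a2\<^sup>2 * q S" using qS by (intro mult_left_mono) auto
    moreover have "a1 * a2 * q S + a2\<^sup>2 * q S \<le> (a1 + a2)\<^sup>2 * q S"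
    proof -
      have "a1 * a2 + a2\<^sup>2 \<le> (a1 + a2)\<^sup>2" using a by (simp add: power2_eq_square algebra_simps)
      from mult_right_mono[OF this qS(1)] show ?thesis by (simp add: algebra_simps)
    qed
    moreover have "z * area ((A \<union> B) \<inter> S) = a1 + a2" unfolding ar a1_def a2_def by (simp add: algebra_simps)
    ultimately show ?case unfolding E using zd zd0 IH by simp
  qed (auto simp: set_lebesgue_integral_def)
  thus "0 \<le> z * (LINT x:C \<inter> S|lborel. q (S - ball x r)) - (q S - q (S - C))"
    and "z * (LINT x:C \<inter> S|lborel. q (S - ball x r)) - (q S - q (S - C)) \<le> (z * area (C \<inter> S))\<^sup>2 * q S" by auto
qed

lemma q_Lipschitz:
  assumes "C \<in> sets borel" "bounded C" "S \<in> \<S>"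
  shows "q S - q (S - C) \<le> z * area (C \<inter> S) * q S"
proof -
  have "(LINT x:C \<inter> S|lborel. q (S - ball x r)) \<le> q S * area (C \<inter> S)"
    using assms region_borel by (intro q_ball_integral_le) (auto intro: bounded_subset)
  from mult_left_mono[OF this z_nonneg] show ?thesis
    using removal_error(1)[OF assms] by (simp add: algebra_simps)
qed

text \<open>Removing a set of area below \<open>1/z\<close> cannot lose all of \<open>q\<close>, by \<open>q_Lipschitz\<close>. A bounded set is removed in
  finitely many such steps.\<close>

lemma q_positive:
  assumes "C \<in> sets borel" "bounded C" "S \<in> \<S>" "0 < q S"
  shows "0 < q (S - C)"
proof -
  \<comment> \<open>A disk of this radius has area at most \<open>1 / (2 (z + 1))\<close>, so one piece loses less than half of \<open>q\<close>.\<close>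
  define \<rho> where "\<rho> = sqrt (1 / (2 * pi * (z + 1)))"
  have p: "0 < 2 * pi * (z + 1)" using z_nonneg pi_gt_zero by (intro mult_pos_pos) auto
  have "z * (pi * \<rho>\<^sup>2) = z / (2 * (z + 1))" using p z_nonneg by (simp add: \<rho>_def)
  hence \<rho>: "0 < \<rho>" "z * (pi * \<rho>\<^sup>2) < 1" using p z_nonneg by (auto simp: \<rho>_def)
  show ?thesis using assms(1,2) \<rho>(1) assms(3,4)
  proof (induction arbitrary: S rule: bounded_borel_induct)
    case (step A B)
    have "area (A \<inter> S) \<le> pi * \<rho>\<^sup>2"
    proof (cases "A = {}")
      case False
      then obtain x where "x \<in> A" by auto
      hence "A \<subseteq> ball x \<rho>" using step(6) by auto
      hence "area (A \<inter> S) \<le> area (ball x \<rho>)" using step region_borel by (intro area_mono) auto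
      thus ?thesis using \<rho>(1) by (simp add: area_ball)
    qed simp
    hence "z * area (A \<inter> S) < 1" using \<rho>(2) mult_left_mono[OF _ z_nonneg] by (meson order_le_less_trans)
    hence "z * area (A \<inter> S) * q S < q S" using step.prems by simp
    moreover have "q S - q (S - A) \<le> z * area (A \<inter> S) * q S" using step by (intro q_Lipschitz)
    ultimately have "0 < q (S - A)" by linarith
    hence "0 < q (S - A - B)" using step by (intro step.IH region_diff) auto
    moreover have "S - (A \<union> B) = S - A - B" by auto
    ultimately show ?case by simp
  qed simp
qed

end

locale positive_removal_functional = removal_functional +
  assumes q_pos: "S \<in> \<S> \<Longrightarrow> 0 < q S"
begin

text \<open>If \<open>q\<close> is a partition function, this is the probability that the disk around \<open>x\<close> is vacant.\<close>

definition vacancy_ratio :: "plane set \<Rightarrow> plane \<Rightarrow> real" where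
  "vacancy_ratio S x = q (S - ball x r) / q S"

lemma vacancy_ratio_bounds:
  assumes "S \<in> \<S>" shows "0 \<le> vacancy_ratio S x" "vacancy_ratio S x \<le> 1"
  using q_pos[OF assms] q_ball_le[OF assms] q_ball_nonneg[OF assms] by (auto simp: vacancy_ratio_def)

text \<open>\<open>q_Lipschitz\<close> makes \<open>q\<close> Lipschitz continuous in the level at which the removal is stopped, and for a
  fixed level it is measurable in the point; this is the situation of \<open>measurable_Lipschitz_diagonal\<close>. The level is
  clamped to \<open>[a, b]\<close> because the layers are only controlled there.\<close>

lemma vacancy_ratio_family_measurable:
  assumes S: "S \<in> \<S>" and D[measurable]: "D \<in> sets borel" "bounded D" and l[measurable]: "lev \<in> borel_measurable borel"
    and "a \<le> b" and K: "\<And>s t. a \<le> s \<Longrightarrow> s \<le> t \<Longrightarrow> t \<le> b \<Longrightarrow> area {y \<in> D. s \<le> lev y \<and> lev y < t} \<le> K * (t - s)"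
  shows "(\<lambda>y. vacancy_ratio (S - {x \<in> D. lev x < max a (min b (lev y))}) y) \<in> borel_measurable borel"
proof -
  have Sb[measurable]: "S \<in> sets borel" using S by (rule region_borel)
  define T where "T t = S - {y \<in> D. lev y < t}" for t
  define lay where "lay s t = {y \<in> D. s \<le> lev y \<and> lev y < t}" for s t
  have lay_borel[measurable]: "lay s t \<in> sets borel" for s t unfolding lay_def by measurable
  have lay_bdd: "bounded (lay s t)" for s t using D(2) by (rule bounded_subset) (auto simp: lay_def)
  have TS: "T t \<in> \<S>" for t unfolding T_def
    by (rule region_diff[OF S]) (measurable, rule bounded_subset[OF D(2)], auto)
  have T_lay: "T t = T s - lay s t" if "s \<le> t" for s t using that by (auto simp: T_def lay_def)
  have K': "area (lay s t) \<le> \<bar>K\<bar> * (t - s)" if "a \<le> s" "s \<le> t" "t \<le> b" for s t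
    using K[OF that] mult_right_mono[of K "\<bar>K\<bar>" "t - s"] that unfolding lay_def by linarith
  have qT: "0 \<le> q (T t)" "q (T t) \<le> q S" for t
    using q_nonneg[OF TS] q_antimono[OF _ _ S, of "{y \<in> D. lev y < t}"] bounded_subset[OF D(2), of "{y \<in> D. lev y < t}"]
    unfolding T_def by auto
  define cl where "cl t = max a (min b t)" for t :: real
  have cl: "a \<le> cl t" "cl t \<le> b" "\<bar>cl s - cl t\<bar> \<le> \<bar>s - t\<bar>" for s t using \<open>a \<le> b\<close> by (auto simp: cl_def)
  have lip: "\<bar>q (T (cl s) - E) - q (T (cl t) - E)\<bar> \<le> z * \<bar>K\<bar> * q S * \<bar>s - t\<bar>" if E: "E \<in> sets borel" "bounded E" for s t E
  proof -
    have *: "\<bar>q (T s - E) - q (T t - E)\<bar> \<le> z * \<bar>K\<bar> * q S * (t - s)" if st: "a \<le> s" "s \<le> t" "t \<le> b" for s t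
    proof -
      have TE: "T s - E \<in> \<S>" using E TS by (intro region_diff)
      have e: "T t - E = T s - E - lay s t" using T_lay[OF st(2)] by auto
      have "area (lay s t \<inter> (T s - E)) \<le> \<bar>K\<bar> * (t - s)"
        using area_mono[OF lay_bdd, of "lay s t \<inter> (T s - E)" s t] K'[OF st] region_borel[OF TE] by auto
      hence "z * area (lay s t \<inter> (T s - E)) * q (T s - E) \<le> z * (\<bar>K\<bar> * (t - s)) * q S"
        using q_antimono[OF E TS[of s]] qT[of s] q_nonneg[OF TE] z_nonneg st
        by (intro mult_mono mult_nonneg_nonneg) auto
      thus ?thesis
        using q_Lipschitz[OF lay_borel lay_bdd TE, of s t] q_antimono[OF lay_borel lay_bdd TE, of s t] unfolding e
        by (auto simp: algebra_simps)
    qed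
    have "\<bar>q (T (cl s) - E) - q (T (cl t) - E)\<bar> \<le> z * \<bar>K\<bar> * q S * \<bar>cl s - cl t\<bar>"
    proof (cases "cl s \<le> cl t")
      case True thus ?thesis using *[of "cl s" "cl t"] cl by auto
    next
      case False thus ?thesis using *[of "cl t" "cl s"] cl by (auto simp: abs_minus_commute)
    qed
    also have "\<dots> \<le> z * \<bar>K\<bar> * q S * \<bar>s - t\<bar>"
      using cl q_nonneg[OF S] z_nonneg by (intro mult_left_mono) auto
    finally show ?thesis .
  qed
  define \<rho> where "\<rho> y = vacancy_ratio (T (cl (lev y))) y" for y
  have \<rho>_meas[measurable]: "\<rho> \<in> borel_measurable borel"
  proof -
    have [measurable]: "(\<lambda>y. q (T (cl (lev y)) - ball y r)) \<in> borel_measurable borel"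
      by (rule measurable_Lipschitz_diagonal[where F="\<lambda>t y. q (T (cl t) - ball y r)" and L="z * \<bar>K\<bar> * q S"])
         (use TS lip in \<open>auto intro: q_measurable\<close>)
    have [measurable]: "(\<lambda>y. q (T (cl (lev y)))) \<in> borel_measurable borel"
      by (rule measurable_Lipschitz_diagonal[where F="\<lambda>t y. q (T (cl t))" and L="z * \<bar>K\<bar> * q S"])
         (use lip[of "{}"] in auto)
    show ?thesis unfolding \<rho>_def vacancy_ratio_def by measurable
  qed
  thus ?thesis unfolding \<rho>_def T_def cl_def .
qed

text \<open>Removing \<open>D\<close> in layers of increasing \<open>lev\<close> is a differential equation for \<open>q\<close>: a thin layer
  at level \<open>t\<close> multiplies \<open>q\<close> by \<open>1 - z \<integral> vacancy_ratio\<close> up to second order, by \<open>removal_error\<close>. Hence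
  \<open>q\<close> times the exponential of the accumulated integral has quadratically small increments, and is
  constant. The lemma is applied to the distance from a point and to the first coordinate.\<close>

lemma q_diff_family:
  assumes S: "S \<in> \<S>" and D[measurable]: "D \<in> sets borel" "bounded D" and l[measurable]: "lev \<in> borel_measurable borel"
    and "a \<le> b" and K: "\<And>s t. a \<le> s \<Longrightarrow> s \<le> t \<Longrightarrow> t \<le> b \<Longrightarrow> area {y \<in> D. s \<le> lev y \<and> lev y < t} \<le> K * (t - s)"
  shows "q (S - {y \<in> D. lev y < b}) =
    q (S - {y \<in> D. lev y < a}) * exp (- z * (LINT y:{y \<in> D. a \<le> lev y \<and> lev y < b} \<inter> S|lborel.
       vacancy_ratio (S - {x \<in> D. lev x < lev y}) y))"
proof -
  have Sb[measurable]: "S \<in> sets borel" using S by (rule region_borel)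
  define T where "T t = S - {y \<in> D. lev y < t}" for t
  define lay where "lay s t = {y \<in> D. s \<le> lev y \<and> lev y < t}" for s t
  have lay_borel[measurable]: "lay s t \<in> sets borel" for s t unfolding lay_def by measurable
  have lay_bdd: "bounded (lay s t)" for s t using D(2) by (rule bounded_subset) (auto simp: lay_def)
  have TS: "T t \<in> \<S>" for t unfolding T_def
    by (rule region_diff[OF S]) (measurable, rule bounded_subset[OF D(2)], auto)
  have T_lay: "T t = T s - lay s t" if "s \<le> t" for s t using that by (auto simp: T_def lay_def)
  have layT: "lay s t \<inter> T s = lay s t \<inter> S" for s t by (auto simp: T_def lay_def)
  have K': "area (lay s t) \<le> \<bar>K\<bar> * (t - s)" if "a \<le> s" "s \<le> t" "t \<le> b" for s t
    using K[OF that] mult_right_mono[of K "\<bar>K\<bar>" "t - s"] that unfolding lay_def by linarith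
  have qT: "0 \<le> q (T t)" "q (T t) \<le> q S" for t
    using q_nonneg[OF TS] q_antimono[OF _ _ S, of "{y \<in> D. lev y < t}"] bounded_subset[OF D(2), of "{y \<in> D. lev y < t}"]
    unfolding T_def by auto
  define cl where "cl t = max a (min b t)" for t :: real
  have cl: "a \<le> cl t" "cl t \<le> b" "\<bar>cl s - cl t\<bar> \<le> \<bar>s - t\<bar>" for s t using \<open>a \<le> b\<close> by (auto simp: cl_def)
  define \<rho> where "\<rho> y = vacancy_ratio (T (cl (lev y))) y" for y
  have \<rho>_meas[measurable]: "\<rho> \<in> borel_measurable borel"
    using vacancy_ratio_family_measurable[OF S D l \<open>a \<le> b\<close> K] unfolding \<rho>_def T_def cl_def .
  have \<rho>: "0 \<le> \<rho> y" "\<rho> y \<le> 1" for y unfolding \<rho>_def using vacancy_ratio_bounds[OF TS] by auto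
  define M where "M t = z * (LINT y:lay a t \<inter> S|lborel. \<rho> y)" for t
  have \<rho>_int: "set_integrable lborel (lay s t \<inter> S) \<rho>" for s t
    using \<rho> by (intro set_integrable_bounded[where K=1]) (auto intro: bounded_subset[OF lay_bdd])
  have \<rho>_le: "0 \<le> (LINT y:lay s t \<inter> S|lborel. \<rho> y) \<and> (LINT y:lay s t \<inter> S|lborel. \<rho> y) \<le> area (lay s t \<inter> S)" for s t
  proof
    show "0 \<le> (LINT y:lay s t \<inter> S|lborel. \<rho> y)" unfolding set_lebesgue_integral_def using \<rho> by (intro Bochner_Integration.integral_nonneg) auto
    have "norm (LINT y:lay s t \<inter> S|lborel. \<rho> y) \<le> 1 * area (lay s t \<inter> S)"
      using \<rho> by (intro set_integral_norm_bound) (auto intro: bounded_subset[OF lay_bdd])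
    thus "(LINT y:lay s t \<inter> S|lborel. \<rho> y) \<le> area (lay s t \<inter> S)" by simp
  qed
  have M_diff: "M t - M s = z * (LINT y:lay s t \<inter> S|lborel. \<rho> y)" if "a \<le> s" "s \<le> t" for s t
  proof -
    have "lay a t \<inter> S = (lay a s \<inter> S) \<union> (lay s t \<inter> S)" using that by (auto simp: lay_def)
    moreover have "(lay a s \<inter> S) \<inter> (lay s t \<inter> S) = {}" by (auto simp: lay_def)
    ultimately show ?thesis unfolding M_def using \<rho>_int by (simp add: set_integral_Un algebra_simps)
  qed
  define A where "A = z * area D"
  define c where "c = z * \<bar>K\<bar>"
  have layD: "area (lay s t \<inter> S) \<le> area D" for s t
    by (rule area_mono[OF D(2)]) (auto simp: lay_def[of s t])
  \<comment> \<open>\<open>T t\<close> is the region left at level \<open>t\<close>, and \<open>M t\<close> is the integral accumulated up to that level.\<close>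
  have quad: "\<bar>q (T t) * exp (M t) - q (T s) * exp (M s)\<bar> \<le> exp A * (exp A + 3) * q S * c\<^sup>2 * (t - s)\<^sup>2"
    if st: "a \<le> s" "s \<le> t" "t \<le> b" for s t
  proof -
    define u where "u = z * area (lay s t \<inter> S)"
    define x where "x = M t - M s"
    have u0: "0 \<le> u" "u \<le> A" using z_nonneg layD by (auto simp: u_def A_def intro: mult_left_mono)
    have uc: "u \<le> c * (t - s)"
    proof -
      have "area (lay s t \<inter> S) \<le> area (lay s t)" by (rule area_mono[OF lay_bdd]) auto
      with K'[OF st] have "area (lay s t \<inter> S) \<le> \<bar>K\<bar> * (t - s)" by simp
      from mult_left_mono[OF this z_nonneg] show ?thesis by (simp add: u_def c_def mult.assoc)
    qed
    have x: "0 \<le> x" "x \<le> u" unfolding x_def M_diff[OF st(1,2)] u_def using \<rho>_le[of s t] z_nonneg by (auto intro: mult_left_mono)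
    have e1: "0 \<le> z * (LINT y:lay s t \<inter> S|lborel. q (T s - ball y r)) - (q (T s) - q (T t))"
      "z * (LINT y:lay s t \<inter> S|lborel. q (T s - ball y r)) - (q (T s) - q (T t)) \<le> u\<^sup>2 * q (T s)"
      using removal_error[OF lay_borel lay_bdd TS, of s t s] unfolding layT T_lay[OF st(2), symmetric] u_def by auto
    \<comment> \<open>Within the layer the vacancy ratio may be evaluated at the region \<open>T s\<close>, up to first order.\<close>
    have pw: "\<bar>\<rho> y * q (T s) - q (T s - ball y r)\<bar> \<le> u * q (T s)" if y: "y \<in> lay s t" for y
    proof -
      have ly: "cl (lev y) = lev y" "s \<le> lev y" "lev y \<le> t" using y st by (auto simp: lay_def cl_def)
      have T': "T (lev y) = T s - lay s (lev y)" using ly by (intro T_lay) auto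
      have small: "z * area (lay s (lev y) \<inter> X) \<le> u" if "X \<in> sets borel" "X \<subseteq> T s" for X
        unfolding u_def using that ly layT[of s "lev y"]
        by (intro mult_left_mono z_nonneg area_mono) (auto simp: lay_def intro: bounded_subset[OF lay_bdd[of s t]])
      have TE: "T s - ball y r \<in> \<S>" by (intro region_diff TS) auto
      have 1: "0 \<le> q (T s) - q (T (lev y))" "q (T s) - q (T (lev y)) \<le> u * q (T s)"
        using q_antimono[of "lay s (lev y)" "T s", OF lay_borel lay_bdd TS] q_Lipschitz[of "lay s (lev y)" "T s", OF lay_borel lay_bdd TS]
          mult_right_mono[OF small[OF region_borel[OF TS[of s]] order.refl] qT(1)[of s]] unfolding T' by auto
      have e: "T (lev y) - ball y r = T s - ball y r - lay s (lev y)" using T' by auto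
      have "z * area (lay s (lev y) \<inter> (T s - ball y r)) * q (T s - ball y r) \<le> u * q (T s)"
        using small[of "T s - ball y r"] region_borel[OF TE] q_nonneg[OF TE] q_ball_le[OF TS, of s y] u0
        by (intro mult_mono) auto
      hence 2: "0 \<le> q (T s - ball y r) - q (T (lev y) - ball y r)" "q (T s - ball y r) - q (T (lev y) - ball y r) \<le> u * q (T s)"
        using q_antimono[OF lay_borel lay_bdd TE, of s "lev y"] q_Lipschitz[OF lay_borel lay_bdd TE, of s "lev y"] unfolding e by auto
      have "\<rho> y * q (T (lev y)) = q (T (lev y) - ball y r)"
        unfolding \<rho>_def ly vacancy_ratio_def using q_pos[OF TS] by (simp add: less_imp_neq[symmetric])
      hence "\<rho> y * q (T s) - q (T s - ball y r) = \<rho> y * (q (T s) - q (T (lev y))) - (q (T s - ball y r) - q (T (lev y) - ball y r))"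
        by (simp add: algebra_simps)
      moreover have "0 \<le> \<rho> y * (q (T s) - q (T (lev y)))" "\<rho> y * (q (T s) - q (T (lev y))) \<le> u * q (T s)"
        using 1 \<rho>[of y] mult_mono[OF \<rho>(2)[of y] 1(2)] by auto
      ultimately show ?thesis using 2 by auto
    qed
    have "z * norm (LINT y:lay s t \<inter> S|lborel. \<rho> y * q (T s) - q (T s - ball y r)) \<le> z * (u * q (T s) * area (lay s t \<inter> S))"
      using pw by (intro mult_left_mono z_nonneg set_integral_norm_bound) (auto intro: bounded_subset[OF lay_bdd])
    also have "\<dots> = u\<^sup>2 * q (T s)" by (simp add: u_def power2_eq_square)
    also have "(LINT y:lay s t \<inter> S|lborel. \<rho> y * q (T s) - q (T s - ball y r)) =
      (LINT y:lay s t \<inter> S|lborel. \<rho> y) * q (T s) - (LINT y:lay s t \<inter> S|lborel. q (T s - ball y r))"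
      using \<rho>_int q_ball_integrable[OF _ _ TS, of "lay s t \<inter> S" s] bounded_subset[OF lay_bdd[of s t]]
      by (subst set_integral_diff) auto
    also have "z * norm ((LINT y:lay s t \<inter> S|lborel. \<rho> y) * q (T s) - (LINT y:lay s t \<inter> S|lborel. q (T s - ball y r)))
      = \<bar>x * q (T s) - z * (LINT y:lay s t \<inter> S|lborel. q (T s - ball y r))\<bar>"
    proof -
      have "z * norm (a - b) = \<bar>z * a - z * b\<bar>" for a b :: real
        unfolding right_diff_distrib[symmetric] abs_mult using z_nonneg by simp
      thus ?thesis unfolding x_def M_diff[OF st(1,2)] by (simp only: mult.assoc)
    qed
    finally have e2: "\<bar>x * q (T s) - z * (LINT y:lay s t \<inter> S|lborel. q (T s - ball y r))\<bar> \<le> u\<^sup>2 * q (T s)" .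
    have e3: "\<bar>q (T t) - q (T s) + q (T s) * x\<bar> \<le> 2 * (u\<^sup>2 * q (T s))" using e1 e2 by (auto simp: algebra_simps)
    have e4: "0 \<le> q (T s) - q (T t)" "q (T s) - q (T t) \<le> u * q (T s)"
      using q_antimono[of "lay s t" "T s", OF lay_borel lay_bdd TS] q_Lipschitz[of "lay s t" "T s", OF lay_borel lay_bdd TS]
      unfolding layT T_lay[OF st(2), symmetric] u_def by auto
    have e5: "0 \<le> exp x - 1 - x" "exp x - 1 - x \<le> u\<^sup>2 * exp A"
    proof -
      show "0 \<le> exp x - 1 - x" using exp_ge_add_one_self[of x] by linarith
      have "exp x * (1 - x) \<le> exp x * exp (- x)" using exp_ge_add_one_self[of "- x"] by (intro mult_left_mono) auto
      hence 1: "exp x - 1 \<le> x * exp x" by (simp add: exp_minus_inverse algebra_simps)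
      have "x \<le> x * exp x" using x(1) by (simp add: mult_le_cancel_left1)
      have "exp x - 1 - x \<le> x * exp x - x" using 1 by simp
      also have "\<dots> = x * (exp x - 1)" by (simp add: algebra_simps)
      also have "\<dots> \<le> x * (x * exp x)" using 1 x by (intro mult_left_mono) auto
      also have "\<dots> \<le> u * (u * exp A)" using x u0 by (intro mult_mono) auto
      finally show "exp x - 1 - x \<le> u\<^sup>2 * exp A" by (simp add: power2_eq_square)
    qed
    have "\<bar>q (T t) * exp x - q (T s)\<bar> \<le> (exp A + 3) * (u\<^sup>2 * q (T s))"
    proof -
      have "q (T t) * exp x - q (T s) = q (T t) * (exp x - 1 - x) + (q (T t) - q (T s) + q (T s) * x) - (q (T s) - q (T t)) * x"
        by (simp add: algebra_simps)
      moreover have "0 \<le> q (T t) * (exp x - 1 - x)" "q (T t) * (exp x - 1 - x) \<le> q (T s) * (u\<^sup>2 * exp A)"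
        using e5 e4 qT by (auto intro!: mult_mono)
      moreover have "0 \<le> (q (T s) - q (T t)) * x" "(q (T s) - q (T t)) * x \<le> u * q (T s) * u"
        using e4 x u0 qT by (auto intro!: mult_mono)
      ultimately show ?thesis using e3 by (auto simp: algebra_simps power2_eq_square)
    qed
    moreover have "(exp A + 3) * (u\<^sup>2 * q (T s)) \<le> (exp A + 3) * ((c * (t - s))\<^sup>2 * q S)"
      using uc u0 qT[of s] by (intro mult_left_mono mult_mono power_mono) (auto simp: add_nonneg_nonneg)
    ultimately have 6: "\<bar>q (T t) * exp x - q (T s)\<bar> \<le> (exp A + 3) * ((c * (t - s))\<^sup>2 * q S)" by linarith
    have Ms: "exp (M s) \<le> exp A"
      unfolding M_def A_def using \<rho>_le[of a s] layD[of a s] z_nonneg by (auto intro!: mult_left_mono)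
    have "q (T t) * exp (M t) - q (T s) * exp (M s) = exp (M s) * (q (T t) * exp x - q (T s))"
      by (simp add: x_def exp_diff algebra_simps)
    hence "\<bar>q (T t) * exp (M t) - q (T s) * exp (M s)\<bar> = exp (M s) * \<bar>q (T t) * exp x - q (T s)\<bar>"
      by (simp add: abs_mult)
    also have "\<dots> \<le> exp A * ((exp A + 3) * ((c * (t - s))\<^sup>2 * q S))"
      using 6 Ms by (intro mult_mono) auto
    finally show ?thesis by (simp only: power_mult_distrib mult.assoc mult.left_commute mult.commute)
  qed
  have "q (T b) * exp (M b) = q (T a) * exp (M a)"
    by (rule constant_if_quadratic_increments[OF \<open>a \<le> b\<close>, where B="exp A * (exp A + 3) * q S * c\<^sup>2"]) (rule quad)
  moreover have "M a = 0"
  proof -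
    have "lay a a = {}" by (auto simp: lay_def)
    thus ?thesis by (simp add: M_def set_lebesgue_integral_def)
  qed
  ultimately have "q (T b) * exp (M b) = q (T a)" by simp
  hence "q (T b) = q (T a) * exp (- M b)" by (simp add: exp_minus field_simps)
  also have "M b = z * (LINT y:{y \<in> D. a \<le> lev y \<and> lev y < b} \<inter> S|lborel. vacancy_ratio (S - {x \<in> D. lev x < lev y}) y)"
    unfolding M_def lay_def[symmetric]
    by (rule arg_cong[where f="\<lambda>u. z * u"], rule set_lebesgue_integral_cong)
       (auto simp: \<rho>_def T_def cl_def lay_def)
  finally show ?thesis unfolding T_def by simp
qed

lemma area_shell_le:
  assumes "0 \<le> s" "s \<le> t" "t \<le> r"
  shows "area {y \<in> ball x r. s \<le> dist x y \<and> dist x y < t} \<le> 2 * pi * r * (t - s)"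
proof -
  have "area {y \<in> ball x r. s \<le> dist x y \<and> dist x y < t} = area (ball x t - ball x s)"
    using assms by (intro arg_cong[where f=area]) auto
  also have "\<dots> = area (ball x t) - area (ball x s)"
    using assms finite_area[OF bounded_ball[of x t]] by (intro measure_Diff) auto
  also have "\<dots> = pi * ((t - s) * (t + s))" using assms by (simp add: area_ball power2_eq_square algebra_simps)
  also have "\<dots> \<le> pi * ((t - s) * (2 * r))" using assms pi_gt_zero by (intro mult_left_mono) auto
  finally show ?thesis by (simp add: algebra_simps)
qed

lemma vacancy_ratio_shell_measurable:
  assumes "S \<in> \<S>"
  shows "(\<lambda>y. indicator (ball x r) y * vacancy_ratio (S - ball x (dist x y)) y) \<in> borel_measurable borel"
proof -
  have "(\<lambda>y. vacancy_ratio (S - {w \<in> ball x r. dist x w < max 0 (min r (dist x y))}) y) \<in> borel_measurable borel"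
    by (rule vacancy_ratio_family_measurable[where K="2 * pi * r"]) (use assms r_pos area_shell_le in auto)
  hence "(\<lambda>y. indicator (ball x r) y * vacancy_ratio (S - {w \<in> ball x r. dist x w < max 0 (min r (dist x y))}) y) \<in> borel_measurable borel"
    by (intro borel_measurable_times borel_measurable_indicator) auto
  also have "(\<lambda>y. indicator (ball x r) y * vacancy_ratio (S - {w \<in> ball x r. dist x w < max 0 (min r (dist x y))}) y)
     = (\<lambda>y. indicator (ball x r) y * vacancy_ratio (S - ball x (dist x y)) y)"
  proof
    fix y
    show "indicator (ball x r) y * vacancy_ratio (S - {w \<in> ball x r. dist x w < max 0 (min r (dist x y))}) y
      = indicator (ball x r) y * vacancy_ratio (S - ball x (dist x y)) y"
    proof (cases "y \<in> ball x r")
      case True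
      hence "{w \<in> ball x r. dist x w < max 0 (min r (dist x y))} = ball x (dist x y)" by auto
      thus ?thesis by simp
    qed simp
  qed
  finally show ?thesis .
qed

text \<open>The disk around \<open>x\<close> is emptied from the centre outwards. When the point \<open>y\<close> is reached, exactly the
  points closer to \<open>x\<close> have been removed.\<close>

theorem vacancy_recursion:
  assumes S: "S \<in> \<S>"
  shows "vacancy_ratio S x = exp (- z * (LINT y:ball x r \<inter> S|lborel. vacancy_ratio (S - ball x (dist x y)) y))"
proof -
  have "q (S - {y \<in> ball x r. dist x y < r}) = q (S - {y \<in> ball x r. dist x y < 0}) *
     exp (- z * (LINT y:{y \<in> ball x r. 0 \<le> dist x y \<and> dist x y < r} \<inter> S|lborel.
       vacancy_ratio (S - {w \<in> ball x r. dist x w < dist x y}) y))"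
  proof (rule q_diff_family[OF S, where K="2 * pi * r"])
    fix s t assume "0 \<le> s" "s \<le> t" "t \<le> r"
    thus "area {y \<in> ball x r. s \<le> dist x y \<and> dist x y < t} \<le> 2 * pi * r * (t - s)" by (rule area_shell_le)
  qed (use r_pos in auto)
  moreover have "{y \<in> ball x r. dist x y < r} = ball x r" "{y \<in> ball x r. dist x y < 0} = {}"
    "{y \<in> ball x r. 0 \<le> dist x y \<and> dist x y < r} = ball x r" by (auto simp: not_less)
  moreover have "(LINT y:ball x r \<inter> S|lborel. vacancy_ratio (S - {w \<in> ball x r. dist x w < dist x y}) y)
     = (LINT y:ball x r \<inter> S|lborel. vacancy_ratio (S - ball x (dist x y)) y)"
  proof (rule set_lebesgue_integral_cong)
    show "ball x r \<inter> S \<in> sets lborel" using region_borel[OF S] by simp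
    show "\<forall>y. y \<in> ball x r \<inter> S \<longrightarrow> vacancy_ratio (S - {w \<in> ball x r. dist x w < dist x y}) y = vacancy_ratio (S - ball x (dist x y)) y"
      by (auto intro!: arg_cong[where f="\<lambda>A. vacancy_ratio (S - A) _"])
  qed
  ultimately show ?thesis unfolding vacancy_ratio_def[of S x] using q_pos[OF S] by simp
qed

end

section \<open>The vacancy recursion for complex activities\<close>

lemma shell_measurable:
  fixes \<Phi> :: "plane set \<Rightarrow> plane \<Rightarrow> 'b::topological_space"
  assumes "(\<lambda>(\<omega>, x). \<Phi> (minus_balls S \<omega>) x) \<in> borel_measurable (ball_seqs \<Otimes>\<^sub>M borel)"
  shows "(\<lambda>y. \<Phi> (S - ball x (dist x y)) y) \<in> borel_measurable borel"
proof -
  have [measurable]: "(\<lambda>y. (case_nat (x, dist x y) (\<lambda>_. (0, 0)), y)) \<in> measurable borel (ball_seqs \<Otimes>\<^sub>M borel)"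
    by measurable
  from measurable_compose[OF this assms] show ?thesis by (simp add: minus_balls_cons)
qed

text \<open>Prepending the ball around \<open>x\<close> to the sequence that encodes the region turns the
  integrand into a function of known measurability.\<close>

lemma ball_integral_measurable:
  fixes \<Phi> :: "plane set \<Rightarrow> plane \<Rightarrow> 'b::{banach,second_countable_topology}"
  assumes "T \<in> sets borel"
    and [measurable]: "(\<lambda>(\<omega>, x). \<Phi> (minus_balls T \<omega>) x) \<in> borel_measurable (ball_seqs \<Otimes>\<^sub>M borel)"
  shows "(\<lambda>(\<omega>, x). LINT y:ball x r \<inter> minus_balls T \<omega>|lborel. \<Phi> (minus_balls T \<omega> - ball x (dist x y)) y)
    \<in> borel_measurable (ball_seqs \<Otimes>\<^sub>M borel)"
proof -
  note [measurable] = assms(1)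
  have "(\<lambda>p. (\<lambda>(\<omega>, x). \<Phi> (minus_balls T \<omega>) x) (case_nat (snd (fst p), dist (snd (fst p)) (snd p)) (fst (fst p)), snd p))
    \<in> borel_measurable ((ball_seqs \<Otimes>\<^sub>M borel) \<Otimes>\<^sub>M borel)"
    by measurable
  hence [measurable]: "(\<lambda>p. \<Phi> (minus_balls T (fst (fst p)) - ball (snd (fst p)) (dist (snd (fst p)) (snd p))) (snd p))
    \<in> borel_measurable ((ball_seqs \<Otimes>\<^sub>M borel) \<Otimes>\<^sub>M borel)"
    by (simp add: minus_balls_cons)
  have "(\<lambda>p. if dist (snd (fst p)) (snd p) < r \<and> snd p \<in> minus_balls T (fst (fst p))
       then \<Phi> (minus_balls T (fst (fst p)) - ball (snd (fst p)) (dist (snd (fst p)) (snd p))) (snd p) else 0)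
    \<in> borel_measurable ((ball_seqs \<Otimes>\<^sub>M borel) \<Otimes>\<^sub>M borel)"
    by measurable
  also have "(\<lambda>p. if dist (snd (fst p)) (snd p) < r \<and> snd p \<in> minus_balls T (fst (fst p))
       then \<Phi> (minus_balls T (fst (fst p)) - ball (snd (fst p)) (dist (snd (fst p)) (snd p))) (snd p) else 0)
    = (\<lambda>(u, y). indicator (ball (snd u) r \<inter> minus_balls T (fst u)) y *\<^sub>R \<Phi> (minus_balls T (fst u) - ball (snd u) (dist (snd u) y)) y)"
    by (auto simp: fun_eq_iff indicator_def)
  finally have m: "(\<lambda>(u, y). indicator (ball (snd u) r \<inter> minus_balls T (fst u)) y *\<^sub>R \<Phi> (minus_balls T (fst u) - ball (snd u) (dist (snd u) y)) y)
     \<in> borel_measurable ((ball_seqs \<Otimes>\<^sub>M borel) \<Otimes>\<^sub>M lborel)" by simp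
  have "(\<lambda>u. LINT y|lborel. indicator (ball (snd u) r \<inter> minus_balls T (fst u)) y *\<^sub>R \<Phi> (minus_balls T (fst u) - ball (snd u) (dist (snd u) y)) y)
     \<in> borel_measurable (ball_seqs \<Otimes>\<^sub>M borel)"
    by (rule lborel.borel_measurable_lebesgue_integral[OF m])
  thus ?thesis unfolding set_lebesgue_integral_def by (simp add: case_prod_beta)
qed

lemma set_integral_Cauchy_Schwarz:
  fixes f g :: "plane \<Rightarrow> real"
  assumes A: "A \<in> sets borel" "bounded A" and [measurable]: "f \<in> borel_measurable borel" "g \<in> borel_measurable borel"
    and K: "\<And>x. x \<in> A \<Longrightarrow> \<bar>f x\<bar> \<le> K" "\<And>x. x \<in> A \<Longrightarrow> \<bar>g x\<bar> \<le> K"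
  shows "(LINT x:A|lborel. f x * g x)\<^sup>2 \<le> (LINT x:A|lborel. (f x)\<^sup>2) * (LINT x:A|lborel. (g x)\<^sup>2)"
proof -
  have b: "\<bar>u\<bar> \<le> K \<Longrightarrow> \<bar>w\<bar> \<le> K \<Longrightarrow> norm (u * w) \<le> K * K" for u w :: real
    by (auto simp: abs_mult intro!: mult_mono)
  have i: "set_integrable lborel A (\<lambda>x. (f x)\<^sup>2)" "set_integrable lborel A (\<lambda>x. (g x)\<^sup>2)" "set_integrable lborel A (\<lambda>x. f x * g x)"
    unfolding power2_eq_square using K A by (auto intro!: set_integrable_bounded[where K="K*K"] b)
  define F where "F = (LINT x:A|lborel. (f x)\<^sup>2)"
  define G where "G = (LINT x:A|lborel. (g x)\<^sup>2)"
  define H where "H = (LINT x:A|lborel. f x * g x)"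
  have F0: "0 \<le> F" unfolding F_def set_lebesgue_integral_def by (intro Bochner_Integration.integral_nonneg) auto
  have q: "0 \<le> t\<^sup>2 * F - 2 * t * H + G" for t
  proof -
    have "0 \<le> (LINT x:A|lborel. (t * f x - g x)\<^sup>2)"
      unfolding set_lebesgue_integral_def by (intro Bochner_Integration.integral_nonneg) auto
    also have "(\<lambda>x. (t * f x - g x)\<^sup>2) = (\<lambda>x. (t\<^sup>2 * (f x)\<^sup>2 - (2 * t) * (f x * g x)) + (g x)\<^sup>2)"
      by (auto simp: power2_eq_square algebra_simps)
    also have "(LINT x:A|lborel. (t\<^sup>2 * (f x)\<^sup>2 - (2 * t) * (f x * g x)) + (g x)\<^sup>2) = t\<^sup>2 * F - 2 * t * H + G"
      unfolding F_def G_def H_def using i by (simp add: set_integral_add set_integral_diff)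
    finally show ?thesis .
  qed
  show ?thesis unfolding F_def[symmetric] G_def[symmetric] H_def[symmetric]
  proof (cases "F = 0")
    case True
    have "H = 0"
    proof (rule ccontr)
      assume "H \<noteq> 0"
      thus False using q[of "(G + 1) / (2 * H)"] True by (simp add: field_simps)
    qed
    thus "H\<^sup>2 \<le> F * G" using True by simp
  next
    case False
    hence "0 < F" using F0 by simp
    thus "H\<^sup>2 \<le> F * G" using q[of "H / F"] by (simp add: power2_eq_square field_simps)
  qed
qed

text \<open>The square roots of vacancy ratios are real numbers in \<open>[0, 1]\<close>; for complex activities they
  are kept in a convex neighbourhood of this interval.\<close>

definition unit_tube :: "real \<Rightarrow> complex set" where
  "unit_tube \<epsilon> = {w. \<exists>t\<in>{0..1}. norm (w - of_real t) \<le> \<epsilon>}"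

lemma unit_tube_convex:
  assumes "w \<in> unit_tube \<epsilon>" "w' \<in> unit_tube \<epsilon>" "\<tau> \<in> {0..1}"
  shows "w' + of_real \<tau> * (w - w') \<in> unit_tube \<epsilon>"
proof -
  obtain t t' where t: "t \<in> {0..1}" "norm (w - of_real t) \<le> \<epsilon>" "t' \<in> {0..1}" "norm (w' - of_real t') \<le> \<epsilon>"
    using assms by (auto simp: unit_tube_def)
  have "(1 - \<tau>) * t' + \<tau> * t \<le> (1 - \<tau>) * 1 + \<tau> * 1" using t assms(3) by (intro add_mono mult_left_mono) auto
  hence "(1 - \<tau>) * t' + \<tau> * t \<in> {0..1}" using t assms(3) by auto
  moreover have "norm (w' + of_real \<tau> * (w - w') - of_real ((1 - \<tau>) * t' + \<tau> * t)) \<le> \<epsilon>"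
  proof -
    have "w' + of_real \<tau> * (w - w') - of_real ((1 - \<tau>) * t' + \<tau> * t) =
      of_real (1 - \<tau>) * (w' - of_real t') + of_real \<tau> * (w - of_real t)" by (simp add: algebra_simps)
    also have "norm \<dots> \<le> (1 - \<tau>) * norm (w' - of_real t') + \<tau> * norm (w - of_real t)"
      using assms(3) by (intro order.trans[OF norm_triangle_ineq]) (simp add: norm_mult del: of_real_diff)
    also have "\<dots> \<le> (1 - \<tau>) * \<epsilon> + \<tau> * \<epsilon>" using t assms(3) by (intro add_mono mult_left_mono) auto
    finally show ?thesis by (simp add: algebra_simps)
  qed
  ultimately show ?thesis unfolding unit_tube_def by blast
qed

lemma unit_tube_norm: "w \<in> unit_tube \<epsilon> \<Longrightarrow> norm w \<le> 1 + \<epsilon>"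
proof -
  assume "w \<in> unit_tube \<epsilon>"
  then obtain t :: real where "t \<in> {0..1}" "norm (w - of_real t) \<le> \<epsilon>" by (auto simp: unit_tube_def)
  thus ?thesis using norm_triangle_sub[of w "of_real t"] by simp
qed

lemma unit_tube_Re_square:
  assumes "w \<in> unit_tube \<epsilon>" shows "(norm w)\<^sup>2 - 2 * \<epsilon>\<^sup>2 \<le> Re (w\<^sup>2)"
proof -
  obtain t where "norm (w - of_real t) \<le> \<epsilon>" using assms by (auto simp: unit_tube_def)
  hence "\<bar>Im w\<bar> \<le> \<epsilon>" using abs_Im_le_cmod[of "w - of_real t"] by simp
  hence "(Im w)\<^sup>2 \<le> \<epsilon>\<^sup>2" by (metis abs_ge_zero power2_abs power_mono)
  moreover have "Re (w\<^sup>2) = (Re w)\<^sup>2 - (Im w)\<^sup>2" by (simp add: power2_eq_square)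
  ultimately show ?thesis using cmod_power2[of w] by linarith
qed

text \<open>Move along the segment \<open>k = g + \<tau> h\<close> with \<open>h = f - g\<close>. The derivative of \<open>exp (-(z/2) \<integral> k\<^sup>2)\<close> is
  \<open>-z (\<integral> k h) exp (-(z/2) \<integral> k\<^sup>2)\<close>, whose square is at most \<open>z\<^sup>2 J e\<^sup>-\<^sup>z\<^sup>J \<integral> h\<^sup>2\<close> with \<open>J = \<integral> k\<^sup>2\<close> by
  Cauchy--Schwarz, and \<open>z J e\<^sup>-\<^sup>z\<^sup>J \<le> 1/e\<close>. This is where passing to square roots pays off: the
  factor \<open>J\<close> produced by Cauchy--Schwarz is compensated by the exponential. For complex data in the tube the
  exponent changes by a small amount, which is the last factor in the bound on \<open>\<kappa>\<close>.\<close>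

lemma exp_square_contraction:
  fixes f g :: "plane \<Rightarrow> complex"
  assumes D: "D \<in> sets borel" "bounded D" "area D \<le> v"
    and [measurable]: "f \<in> borel_measurable borel" "g \<in> borel_measurable borel"
    and tube: "\<And>y. y \<in> D \<Longrightarrow> f y \<in> unit_tube \<epsilon>" "\<And>y. y \<in> D \<Longrightarrow> g y \<in> unit_tube \<epsilon>"
    and z: "norm (z - of_real x0) \<le> \<delta>" "0 \<le> x0" "0 \<le> \<epsilon>"
    and \<kappa>: "(x0 + \<delta>) * exp (-1) * exp ((2 * \<epsilon>\<^sup>2 * x0 + 2 * \<delta> * (1 + \<epsilon>)\<^sup>2) * v) \<le> \<kappa>"
  shows "(norm (exp (- (z / 2) * (LINT y:D|lborel. (f y)\<^sup>2)) - exp (- (z / 2) * (LINT y:D|lborel. (g y)\<^sup>2))))\<^sup>2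
    \<le> \<kappa> * (LINT y:D|lborel. (norm (f y - g y))\<^sup>2)"
proof -
  have \<delta>: "0 \<le> \<delta>" using z(1) norm_ge_zero order_trans by blast
  have fb: "norm (f y) \<le> 1 + \<epsilon>" "norm (g y) \<le> 1 + \<epsilon>" if "y \<in> D" for y using unit_tube_norm tube that by auto
  define B where "B = 1 + \<epsilon>"
  have B: "1 \<le> B" using z by (simp add: B_def)
  have int: "set_integrable lborel D (\<lambda>y. u y * w y)"
    if "\<And>y. y \<in> D \<Longrightarrow> norm (u y) \<le> 2 * B" "\<And>y. y \<in> D \<Longrightarrow> norm (w y) \<le> 2 * B" "u \<in> borel_measurable borel" "w \<in> borel_measurable borel"
    for u w :: "plane \<Rightarrow> complex"
  proof (rule set_integrable_bounded[OF D(1,2), where K="2*B*(2*B)"])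
    fix y assume "y \<in> D"
    thus "norm (u y * w y) \<le> 2*B*(2*B)" unfolding norm_mult using that(1,2)[of y] B by (intro mult_mono) auto
  qed (use that in measurable)
  have rint: "set_integrable lborel D (\<lambda>y. (u y)\<^sup>2)"
    if "\<And>y. y \<in> D \<Longrightarrow> \<bar>u y\<bar> \<le> 2 * B" "u \<in> borel_measurable borel"
    for u :: "plane \<Rightarrow> real" unfolding power2_eq_square
  proof (rule set_integrable_bounded[OF D(1,2), where K="2*B*(2*B)"])
    fix y assume "y \<in> D"
    thus "norm (u y * u y) \<le> 2*B*(2*B)" unfolding norm_mult using that(1)[of y] B by (intro mult_mono) auto
  qed (use that in measurable)
  define h where "h y = f y - g y" for y
  have [measurable]: "h \<in> borel_measurable borel" unfolding h_def by measurable
  have hb: "norm (h y) \<le> 2 * B" if "y \<in> D" for y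
    unfolding h_def B_def using fb[OF that] norm_triangle_ineq4[of "f y" "g y"] by simp
  have fb': "norm (f y) \<le> 2 * B" "norm (g y) \<le> 2 * B" if "y \<in> D" for y using fb[OF that] B by (auto simp: B_def)
  define a where "a = (LINT y:D|lborel. g y * g y)"
  define b where "b = (LINT y:D|lborel. g y * h y)"
  define c where "c = (LINT y:D|lborel. h y * h y)"
  define E where "E = (LINT y:D|lborel. (norm (h y))\<^sup>2)"
  have E0: "0 \<le> E" unfolding E_def set_lebesgue_integral_def by (intro Bochner_Integration.integral_nonneg) auto
  define \<phi> where "\<phi> \<tau> = exp (- (z / 2) * (a + 2 * b * \<tau> + c * \<tau>\<^sup>2))" for \<tau> :: complex
  define \<phi>' where "\<phi>' \<tau> = - z * (b + c * \<tau>) * \<phi> \<tau>" for \<tau> :: complex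
  have quad: "(LINT y:D|lborel. (g y + \<tau> * h y)\<^sup>2) = a + 2 * b * \<tau> + c * \<tau>\<^sup>2" for \<tau>
  proof -
    have "(\<lambda>y. (g y + \<tau> * h y)\<^sup>2) = (\<lambda>y. (g y * g y + (2 * \<tau>) * (g y * h y)) + \<tau>\<^sup>2 * (h y * h y))"
      by (auto simp: power2_eq_square algebra_simps)
    hence "(LINT y:D|lborel. (g y + \<tau> * h y)\<^sup>2) = a + (2 * \<tau>) * b + \<tau>\<^sup>2 * c" unfolding a_def b_def c_def
      using int[of g g] int[of g h] int[of h h] hb fb' by (simp add: set_integral_add)
    thus ?thesis by (simp add: mult_ac)
  qed
  have deriv: "(\<phi> has_field_derivative \<phi>' \<tau>) (at \<tau> within X)" for \<tau> X
    unfolding \<phi>_def \<phi>'_def by (auto intro!: derivative_eq_intros simp: algebra_simps)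
  have bound: "(norm (\<phi>' \<tau>))\<^sup>2 \<le> \<kappa> * E" if \<tau>: "\<tau> = of_real s" "s \<in> {0..1}" for \<tau> s
  proof -
    define k where "k y = g y + \<tau> * h y" for y
    have [measurable]: "k \<in> borel_measurable borel" unfolding k_def by measurable
    have kt: "k y \<in> unit_tube \<epsilon>" if "y \<in> D" for y
      unfolding k_def h_def \<tau>(1) using unit_tube_convex[OF tube(1)[OF that] tube(2)[OF that] \<tau>(2)] .
    have kb: "norm (k y) \<le> B" if "y \<in> D" for y using unit_tube_norm[OF kt[OF that]] by (simp add: B_def)
    have kb': "norm (k y) \<le> 2 * B" if "y \<in> D" for y using kb[OF that] B by auto
    define J where "J = (LINT y:D|lborel. (norm (k y))\<^sup>2)"
    have J0: "0 \<le> J" unfolding J_def set_lebesgue_integral_def by (intro Bochner_Integration.integral_nonneg) auto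
    have Jv: "J \<le> B\<^sup>2 * v"
    proof -
      have "norm J \<le> B\<^sup>2 * area D" unfolding J_def using kb D by (intro set_integral_norm_bound) (auto intro: power_mono)
      also have "\<dots> \<le> B\<^sup>2 * v" using D by (intro mult_left_mono) auto
      finally show ?thesis by simp
    qed
    have v: "0 \<le> v" using D(3) measure_nonneg order_trans by blast
    have "b + c * \<tau> = (LINT y:D|lborel. k y * h y)"
    proof -
      have "(\<lambda>y. k y * h y) = (\<lambda>y. g y * h y + \<tau> * (h y * h y))" by (auto simp: k_def algebra_simps)
      thus ?thesis unfolding b_def c_def using int[of g h] int[of h h] hb fb' by (simp add: set_integral_add mult_ac)
    qed
    also have "norm \<dots> \<le> (LINT y:D|lborel. norm (k y) * norm (h y))"
      using int[of k h] kb' hb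
      unfolding set_lebesgue_integral_def set_integrable_def
      by (intro order.trans[OF integral_norm_bound]) (auto intro!: Bochner_Integration.integral_mono integrable_norm simp: norm_mult indicator_def)
    finally have "(norm (b + c * \<tau>))\<^sup>2 \<le> (LINT y:D|lborel. norm (k y) * norm (h y))\<^sup>2" by (intro power_mono) auto
    also have "\<dots> \<le> J * E" unfolding J_def E_def
      by (rule set_integral_Cauchy_Schwarz[where K="2*B"]) (use D kb' hb in auto)
    finally have CS: "(norm (b + c * \<tau>))\<^sup>2 \<le> J * E" .
    \<comment> \<open>For real data the left-hand side would be \<open>z J\<close>; the tube and the complex activity cost the last term.\<close>
    have ReI: "Re (z * (a + 2 * b * \<tau> + c * \<tau>\<^sup>2)) \<ge> x0 * J - (2 * \<epsilon>\<^sup>2 * x0 + \<delta> * B\<^sup>2) * v"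
    proof -
      have ik: "set_integrable lborel D (\<lambda>y. z * (k y * k y))" using int[of k k] kb' by simp
      have "z * (a + 2 * b * \<tau> + c * \<tau>\<^sup>2) = (LINT y:D|lborel. z * (k y * k y))"
        unfolding quad[symmetric] unfolding k_def power2_eq_square by simp
      hence "Re (z * (a + 2 * b * \<tau> + c * \<tau>\<^sup>2)) = (LINT y:D|lborel. Re (z * (k y * k y)))"
        using integral_Re[OF ik[unfolded set_integrable_def]] unfolding set_lebesgue_integral_def by simp
      also have "\<dots> \<ge> (LINT y:D|lborel. x0 * (norm (k y))\<^sup>2 - (2 * \<epsilon>\<^sup>2 * x0 + \<delta> * B\<^sup>2))"
      proof (rule set_integral_mono)
        show "set_integrable lborel D (\<lambda>y. x0 * (norm (k y))\<^sup>2 - (2 * \<epsilon>\<^sup>2 * x0 + \<delta> * B\<^sup>2))"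
        proof (rule set_integral_diff)
          show "set_integrable lborel D (\<lambda>y. x0 * (norm (k y))\<^sup>2)"
            using rint[of "\<lambda>y. norm (k y)"] kb' by simp
          show "set_integrable lborel D (\<lambda>y. 2 * \<epsilon>\<^sup>2 * x0 + \<delta> * B\<^sup>2)"
            using D finite_area[OF D(2)] by (simp add: set_integrable_def)
        qed
        show "set_integrable lborel D (\<lambda>y. Re (z * (k y * k y)))"
          using integrable_Re[OF ik[unfolded set_integrable_def]] by (simp add: set_integrable_def)
        fix y assume y: "y \<in> D"
        have "Re (z * (k y * k y)) = x0 * Re ((k y)\<^sup>2) + Re ((z - of_real x0) * (k y)\<^sup>2)"
          by (simp add: power2_eq_square algebra_simps)
        moreover have "x0 * Re ((k y)\<^sup>2) \<ge> x0 * ((norm (k y))\<^sup>2 - 2 * \<epsilon>\<^sup>2)"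
          using unit_tube_Re_square[OF kt[OF y]] z by (intro mult_left_mono)
        moreover have "\<bar>Re ((z - of_real x0) * (k y)\<^sup>2)\<bar> \<le> \<delta> * B\<^sup>2"
          using kb[OF y] z \<delta> by (intro order.trans[OF abs_Re_le_cmod]) (auto simp: norm_mult norm_power intro!: mult_mono power_mono)
        ultimately show "x0 * (norm (k y))\<^sup>2 - (2 * \<epsilon>\<^sup>2 * x0 + \<delta> * B\<^sup>2) \<le> Re (z * (k y * k y))" by (simp add: algebra_simps)
      qed
      moreover have "(LINT y:D|lborel. x0 * (norm (k y))\<^sup>2 - (2 * \<epsilon>\<^sup>2 * x0 + \<delta> * B\<^sup>2)) = x0 * J - (2 * \<epsilon>\<^sup>2 * x0 + \<delta> * B\<^sup>2) * area D"
      proof -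
        have "set_integrable lborel D (\<lambda>y. x0 * (norm (k y))\<^sup>2)"
          using rint[of "\<lambda>y. norm (k y)"] kb' by simp
        moreover have "set_integrable lborel D (\<lambda>y. 2 * \<epsilon>\<^sup>2 * x0 + \<delta> * B\<^sup>2)"
          using D finite_area[OF D(2)] by (simp add: set_integrable_def)
        moreover have "(LINT y:D|lborel. 2 * \<epsilon>\<^sup>2 * x0 + \<delta> * B\<^sup>2) = (2 * \<epsilon>\<^sup>2 * x0 + \<delta> * B\<^sup>2) * area D"
          using D by (simp add: set_lebesgue_integral_def)
        ultimately show ?thesis unfolding J_def by (simp add: set_integral_diff)
      qed
      moreover have "(2 * \<epsilon>\<^sup>2 * x0 + \<delta> * B\<^sup>2) * area D \<le> (2 * \<epsilon>\<^sup>2 * x0 + \<delta> * B\<^sup>2) * v"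
        using D z \<delta> by (intro mult_left_mono) auto
      ultimately show ?thesis by linarith
    qed
    define x1 where "x1 = x0 + \<delta>"
    have x1: "norm z \<le> x1" "0 \<le> x1" using norm_triangle_sub[of z "of_real x0"] z \<delta> by (auto simp: x1_def)
    have n\<phi>: "(norm (\<phi> \<tau>))\<^sup>2 = exp (- Re (z * (a + 2 * b * \<tau> + c * \<tau>\<^sup>2)))"
      unfolding \<phi>_def norm_exp_eq_Re by (simp add: power2_eq_square exp_add[symmetric])
    have "(norm (\<phi> \<tau>))\<^sup>2 \<le> exp (- (x1 * J) + (2 * \<epsilon>\<^sup>2 * x0 + 2 * \<delta> * B\<^sup>2) * v)"
    proof -
      have "\<delta> * J \<le> \<delta> * (B\<^sup>2 * v)" using Jv \<delta> by (rule mult_left_mono)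
      thus ?thesis unfolding n\<phi> using ReI by (simp add: x1_def algebra_simps)
    qed
    hence "(norm z)\<^sup>2 * J * (norm (\<phi> \<tau>))\<^sup>2 \<le> x1\<^sup>2 * J * exp (- (x1 * J) + (2 * \<epsilon>\<^sup>2 * x0 + 2 * \<delta> * B\<^sup>2) * v)"
      using x1 J0 by (intro mult_mono power_mono) auto
    also have "\<dots> = x1 * ((x1 * J) * exp (- (x1 * J))) * exp ((2 * \<epsilon>\<^sup>2 * x0 + 2 * \<delta> * B\<^sup>2) * v)"
      by (simp only: exp_add power2_eq_square mult_ac)
    also have "\<dots> \<le> x1 * exp (-1) * exp ((2 * \<epsilon>\<^sup>2 * x0 + 2 * \<delta> * B\<^sup>2) * v)"
    proof (intro mult_right_mono mult_left_mono)
      \<comment> \<open>This is \<open>t e\<^sup>-\<^sup>t \<le> 1/e\<close> at \<open>t = x1 J\<close>.\<close>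
      have "x1 * J \<le> exp (x1 * J - 1)" using exp_ge_add_one_self[of "x1 * J - 1"] by simp
      hence "x1 * J * exp (- (x1 * J)) \<le> exp (x1 * J - 1) * exp (- (x1 * J))" by (intro mult_right_mono) auto
      thus "x1 * J * exp (- (x1 * J)) \<le> exp (-1)" by (simp add: exp_add[symmetric])
    qed (use x1 in auto)
    also have "\<dots> \<le> \<kappa>" using \<kappa> unfolding x1_def B_def .
    finally have "(norm z)\<^sup>2 * J * (norm (\<phi> \<tau>))\<^sup>2 * E \<le> \<kappa> * E" using E0 by (rule mult_right_mono)
    moreover have "(norm (\<phi>' \<tau>))\<^sup>2 \<le> (norm z)\<^sup>2 * (J * E) * (norm (\<phi> \<tau>))\<^sup>2"
      unfolding \<phi>'_def norm_mult norm_minus_cancel power_mult_distrib using CS J0 E0 by (intro mult_mono) auto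
    ultimately show ?thesis by (simp add: mult_ac)
  qed
  have "\<kappa> * E \<ge> 0" using bound[of 0 0] by (auto intro: order.trans[OF zero_le_power2])
  have "norm (\<phi> 1 - \<phi> 0) \<le> sqrt (\<kappa> * E) * norm (1 - 0 :: complex)"
  proof (rule field_differentiable_bound[where S="closed_segment 0 1" and f'=\<phi>'])
    fix \<tau> :: complex assume "\<tau> \<in> closed_segment 0 1"
    then obtain s where "\<tau> = of_real s" "s \<in> {0..1}" by (auto simp: closed_segment_def scaleR_conv_of_real)
    from bound[OF this] show "norm (\<phi>' \<tau>) \<le> sqrt (\<kappa> * E)" by (rule real_le_rsqrt)
  qed (auto intro: deriv)
  hence "(norm (\<phi> 1 - \<phi> 0))\<^sup>2 \<le> (sqrt (\<kappa> * E))\<^sup>2" by (intro power_mono) auto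
  also have "\<dots> = \<kappa> * E" using \<open>\<kappa> * E \<ge> 0\<close> by simp
  also have "\<phi> 1 = exp (- (z / 2) * (LINT y:D|lborel. (f y)\<^sup>2))"
    unfolding \<phi>_def quad[symmetric] h_def by simp
  also have "\<phi> 0 = exp (- (z / 2) * (LINT y:D|lborel. (g y)\<^sup>2))"
    unfolding \<phi>_def quad[symmetric] by simp
  finally show ?thesis unfolding E_def h_def .
qed

text \<open>Iteration of the recursion for the square root of the vacancy ratio, which explains the factors \<open>1/2\<close> and the
  square, at a complex activity \<open>z\<close>.\<close>

primrec iterate :: "real \<Rightarrow> nat \<Rightarrow> complex \<Rightarrow> plane set \<Rightarrow> plane \<Rightarrow> complex" where
  "iterate r 0 z S x = 1"
| "iterate r (Suc n) z S x =
    exp (- (z / 2) * (LINT y:ball x r \<inter> S|lborel. (iterate r n z (S - ball x (dist x y)) y)\<^sup>2))"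

lemma iterate_measurable:
  assumes "T \<in> sets borel"
  shows "(\<lambda>(\<omega>, x). iterate r n z (minus_balls T \<omega>) x) \<in> borel_measurable (ball_seqs \<Otimes>\<^sub>M borel)"
proof (induction n)
  case (Suc n)
  note [measurable] = Suc
  have "(\<lambda>(\<omega>, x). (iterate r n z (minus_balls T \<omega>) x)\<^sup>2) \<in> borel_measurable (ball_seqs \<Otimes>\<^sub>M borel)" by measurable
  from ball_integral_measurable[OF assms this, of r] show ?case by simp
qed simp

lemma iterate_shell_measurable [measurable]:
  "S \<in> sets borel \<Longrightarrow> (\<lambda>y. iterate r n z (S - ball x (dist x y)) y) \<in> borel_measurable borel"
  by (rule shell_measurable) (rule iterate_measurable)

lemma area_shell_measurable [measurable]:
  assumes [measurable]: "S \<in> sets borel"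
  shows "(\<lambda>y. area (ball y r \<inter> (S - ball x (dist x y)))) \<in> borel_measurable borel"
proof (rule shell_measurable)
  have "(\<lambda>(\<omega>, x). LINT y:ball x r \<inter> minus_balls S \<omega>|lborel. (1::real)) \<in> borel_measurable (ball_seqs \<Otimes>\<^sub>M borel)"
    by (rule ball_integral_measurable[where \<Phi>="\<lambda>_ _. 1"]) auto
  also have "(\<lambda>(\<omega>, x). LINT y:ball x r \<inter> minus_balls S \<omega>|lborel. (1::real)) = (\<lambda>(\<omega>, x). area (ball x r \<inter> minus_balls S \<omega>))"
    using minus_balls_borel[OF assms] by (auto simp: set_lebesgue_integral_def fun_eq_iff)
  finally show "(\<lambda>(\<omega>, x). area (ball x r \<inter> minus_balls S \<omega>)) \<in> borel_measurable (ball_seqs \<Otimes>\<^sub>M borel)" .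
qed

text \<open>Each step looks one radius further.\<close>

lemma iterate_local:
  assumes "S \<inter> ball x (real n * r) = S' \<inter> ball x (real n * r)" "0 < r"
  shows "iterate r n z S x = iterate r n z S' x"
  using assms(1)
proof (induction n arbitrary: S S' x)
  case (Suc n)
  have "r \<le> real (Suc n) * r" using assms(2) by (simp add: algebra_simps)
  hence "ball x r \<inter> S = ball x r \<inter> S'" using Suc.prems subset_ball[of r "real (Suc n) * r" x] by blast
  moreover have "iterate r n z (S - ball x (dist x y)) y = iterate r n z (S' - ball x (dist x y)) y" if "y \<in> ball x r" for y
  proof (rule Suc.IH)
    have "ball y (real n * r) \<subseteq> ball x (real (Suc n) * r)"
    proof
      fix w assume "w \<in> ball y (real n * r)"
      thus "w \<in> ball x (real (Suc n) * r)" using that dist_triangle[of x w y] by (auto simp: algebra_simps)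
    qed
    thus "(S - ball x (dist x y)) \<inter> ball y (real n * r) = (S' - ball x (dist x y)) \<inter> ball y (real n * r)"
      using Suc.prems by blast
  qed
  ultimately have "(\<lambda>y. indicator (ball x r \<inter> S) y *\<^sub>R (iterate r n z (S - ball x (dist x y)) y)\<^sup>2)
     = (\<lambda>y. indicator (ball x r \<inter> S') y *\<^sub>R (iterate r n z (S' - ball x (dist x y)) y)\<^sup>2)"
    by (auto simp: fun_eq_iff indicator_def)
  thus ?case by (simp add: set_lebesgue_integral_def)
qed simp

text \<open>The regions in \<open>iterate_translate\<close> are arbitrary sets, so the integrand may be non-measurable; both
  integrals are then \<open>0\<close> by convention.\<close>

lemma integral_lborel_translate:
  fixes f :: "plane \<Rightarrow> complex"
  shows "(LINT y|lborel. f (a + y)) = (LINT y|lborel. f y)"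
proof (cases "f \<in> borel_measurable borel")
  case True
  have "(LINT y|lborel. f y) = (LINT y|distr lborel borel ((+) a). f y)" by (simp add: lborel_distr_plus)
  also have "\<dots> = (LINT y|lborel. f (a + y))" using True by (subst integral_distr) auto
  finally show ?thesis ..
next
  case False
  have "(\<lambda>y. f (a + y)) \<notin> borel_measurable borel"
  proof
    assume "(\<lambda>y. f (a + y)) \<in> borel_measurable borel"
    hence "(\<lambda>y. f (a + (y - a))) \<in> borel_measurable borel"
      by (rule measurable_compose[rotated]) measurable
    thus False using False by simp
  qed
  hence "\<not> integrable lborel (\<lambda>y. f (a + y))" using borel_measurable_integrable by force
  moreover have "\<not> integrable lborel f" using False borel_measurable_integrable by force
  ultimately show ?thesis by (simp add: not_integrable_integral_eq)
qed

lemma iterate_translate: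
  "iterate r n z ((+) a ` S) (a + x) = iterate r n z S x"
proof (induction n arbitrary: S x)
  case (Suc n)
  have "(LINT y:ball (a + x) r \<inter> (+) a ` S|lborel. (iterate r n z ((+) a ` S - ball (a + x) (dist (a + x) y)) y)\<^sup>2)
     = (LINT y|lborel. indicator (ball (a + x) r \<inter> (+) a ` S) (a + y) *\<^sub>R
          (iterate r n z ((+) a ` S - ball (a + x) (dist (a + x) (a + y))) (a + y))\<^sup>2)"
    unfolding set_lebesgue_integral_def by (rule integral_lborel_translate[symmetric])
  also have "\<dots> = (LINT y:ball x r \<inter> S|lborel. (iterate r n z (S - ball x (dist x y)) y)\<^sup>2)"
    unfolding set_lebesgue_integral_def
  proof (intro Bochner_Integration.integral_cong refl)
    fix y
    have "(+) a ` S - ball (a + x) (dist (a + x) (a + y)) = (+) a ` (S - ball x (dist x y))" by (auto simp: image_iff)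
    hence "iterate r n z ((+) a ` S - ball (a + x) (dist (a + x) (a + y))) (a + y) = iterate r n z (S - ball x (dist x y)) y"
      using Suc.IH by simp
    thus "indicator (ball (a + x) r \<inter> (+) a ` S) (a + y) *\<^sub>R (iterate r n z ((+) a ` S - ball (a + x) (dist (a + x) (a + y))) (a + y))\<^sup>2
      = indicator (ball x r \<inter> S) y *\<^sub>R (iterate r n z (S - ball x (dist x y)) y)\<^sup>2"
      by (auto simp: indicator_def)
  qed
  finally show ?case by simp
qed simp

lemma iterate_real:
  assumes "0 \<le> t" shows "\<exists>u\<in>{0..1}. iterate r n (of_real t) S x = of_real u"
proof (induction n arbitrary: S x)
  case (Suc n)
  define u where "u S x = Re (iterate r n (of_real t) S x)" for S x
  have u: "iterate r n (of_real t) S x = of_real (u S x)" for S x using Suc[of S x] by (auto simp: u_def)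
  have "(LINT y:ball x r \<inter> S|lborel. (iterate r n (of_real t) (S - ball x (dist x y)) y)\<^sup>2)
     = of_real (LINT y:ball x r \<inter> S|lborel. (u (S - ball x (dist x y)) y)\<^sup>2)"
    unfolding u by (simp add: set_integral_complex_of_real[symmetric])
  hence "iterate r (Suc n) (of_real t) S x = of_real (exp (- (t / 2) * (LINT y:ball x r \<inter> S|lborel. (u (S - ball x (dist x y)) y)\<^sup>2)))"
    by (simp add: exp_of_real[symmetric])
  moreover have "0 \<le> (LINT y:ball x r \<inter> S|lborel. (u (S - ball x (dist x y)) y)\<^sup>2)"
    unfolding set_lebesgue_integral_def by (intro Bochner_Integration.integral_nonneg) auto
  hence "exp (- (t / 2) * (LINT y:ball x r \<inter> S|lborel. (u (S - ball x (dist x y)) y)\<^sup>2)) \<in> {0..1}"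
    using assms by simp
  ultimately show ?case by blast
next
  case 0
  show ?case by (intro bexI[of _ 1]) auto
qed

text \<open>Differentiation under the integral sign: Cauchy's inequality bounds the derivatives, hence the difference
  quotients, uniformly, and dominated convergence applies.\<close>

lemma holomorphic_set_integral:
  fixes f :: "complex \<Rightarrow> plane \<Rightarrow> complex"
  assumes A: "A \<in> sets borel" "bounded A"
    and hol: "\<And>y. (\<lambda>z. f z y) holomorphic_on UNIV"
    and meas: "\<And>z. f z \<in> borel_measurable borel"
    and bdd: "\<And>R. \<exists>B. \<forall>z y. norm z \<le> R \<longrightarrow> norm (f z y) \<le> B"
  shows "(\<lambda>z. LINT y:A|lborel. f z y) holomorphic_on UNIV"
proof -
  have "\<exists>d. ((\<lambda>z. LINT y:A|lborel. f z y) has_field_derivative d) (at z)" for z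
  proof -
    define R where "R = norm z + 2"
    obtain B where B: "\<And>w y. norm w \<le> R \<Longrightarrow> norm (f w y) \<le> B" using bdd[of R] by blast
    have int: "set_integrable lborel A (f w)" if "norm w \<le> R" for w
      by (rule set_integrable_bounded[OF A]) (use B that meas in auto)
    have der: "((\<lambda>w. f w y) has_field_derivative deriv (\<lambda>w. f w y) w) (at w)" for w y
      using hol[of y] by (simp add: holomorphic_derivI)
    have derb: "norm (deriv (\<lambda>w. f w y) w) \<le> B" if "w \<in> ball z 1" for w y
    proof -
      have "norm ((deriv ^^ 1) (\<lambda>w. f w y) w) \<le> fact 1 * B / 1 ^ 1"
      proof (rule Cauchy_inequality)
        fix x assume "norm (w - x) = 1"
        hence "norm x \<le> R" using that norm_triangle_sub[of x w] norm_triangle_sub[of w z]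
          by (simp add: R_def dist_norm norm_minus_commute)
        thus "norm (f x y) \<le> B" by (rule B)
      qed (use hol[of y] in \<open>auto intro: holomorphic_on_subset holomorphic_on_imp_continuous_on\<close>)
      thus ?thesis by simp
    qed
    define Q where "Q w y = (f w y - f z y) / (w - z)" for w y
    have Qb: "norm (Q w y) \<le> B" if "w \<in> ball z 1" "w \<noteq> z" for w y
    proof -
      have "norm (f w y - f z y) \<le> B * norm (w - z)"
        by (rule field_differentiable_bound[where S="ball z 1" and f'="\<lambda>w. deriv (\<lambda>w. f w y) w"])
           (use that der derb in \<open>auto intro: has_field_derivative_at_within\<close>)
      thus ?thesis using that by (simp add: Q_def norm_divide divide_le_eq)
    qed
    have Ql: "((\<lambda>w. Q w y) \<longlongrightarrow> deriv (\<lambda>w. f w y) z) (at z)" for y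
      using der[of y z] unfolding Q_def has_field_derivative_iff .
    have Qm[measurable]: "Q w \<in> borel_measurable borel" for w
      using meas[of w] meas[of z] unfolding Q_def by measurable
    define d where "d y = deriv (\<lambda>w. f w y) z" for y
    have dm[measurable]: "d \<in> borel_measurable borel"
    proof (rule borel_measurable_LIMSEQ_metric)
      fix y
      have "(\<lambda>n. z + of_real (1 / real (Suc n))) \<longlonglongrightarrow> z + of_real 0"
        by (intro tendsto_add tendsto_of_real tendsto_const) (use LIMSEQ_inverse_real_of_nat in \<open>simp add: divide_inverse\<close>)
      hence "filterlim (\<lambda>n. z + of_real (1 / real (Suc n))) (at z) sequentially"
        unfolding filterlim_at by (auto intro!: always_eventually simp del: of_real_divide)
      from filterlim_compose[OF Ql this, of y] show "(\<lambda>n. Q (z + of_real (1 / real (Suc n))) y) \<longlonglongrightarrow> d y"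
        unfolding d_def .
    qed measurable
    have "((\<lambda>w. LINT y:A|lborel. Q w y) \<longlongrightarrow> (LINT y:A|lborel. d y)) (at z)"
      unfolding tendsto_at_iff_sequentially comp_def
    proof (intro allI impI)
      fix X assume X: "\<forall>i. X i \<in> UNIV - {z}" "X \<longlonglongrightarrow> z"
      obtain N where N: "\<And>n. n \<ge> N \<Longrightarrow> X n \<in> ball z 1"
        using X(2) by (metis (no_types) eventually_sequentially open_ball centre_in_ball topological_tendstoD zero_less_one)
      have "(\<lambda>n. LINT y:A|lborel. Q (X (n + N)) y) \<longlonglongrightarrow> (LINT y:A|lborel. d y)"
        unfolding set_lebesgue_integral_def
      proof (rule integral_dominated_convergence[where w="\<lambda>y. indicator A y * B"])
        show "integrable lborel (\<lambda>y. indicator A y * B)" using A finite_area by (intro integrable_mult_left) auto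
        show "AE y in lborel. (\<lambda>n. indicator A y *\<^sub>R Q (X (n + N)) y) \<longlonglongrightarrow> indicator A y *\<^sub>R d y"
        proof (intro AE_I2 tendsto_scaleR tendsto_const)
          fix y
          have "(\<lambda>n. Q (X n) y) \<longlonglongrightarrow> d y"
            using Ql[of y] X unfolding tendsto_at_iff_sequentially comp_def d_def by blast
          thus "(\<lambda>n. Q (X (n + N)) y) \<longlonglongrightarrow> d y" by (rule LIMSEQ_ignore_initial_segment)
        qed
        show "AE y in lborel. norm (indicator A y *\<^sub>R Q (X (n + N)) y) \<le> indicator A y * B" for n
          using Qb[OF N[of "n + N"]] X(1) by (auto simp: indicator_def)
      qed (use A in measurable)
      thus "(\<lambda>n. LINT y:A|lborel. Q (X n) y) \<longlonglongrightarrow> (LINT y:A|lborel. d y)"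
        by (rule LIMSEQ_offset)
    qed
    moreover have "\<forall>\<^sub>F w in at z. (LINT y:A|lborel. Q w y) = ((LINT y:A|lborel. f w y) - (LINT y:A|lborel. f z y)) / (w - z)"
    proof -
      have "\<forall>\<^sub>F w in at z. w \<in> ball z 1" by (intro eventually_at_in_open') auto
      thus ?thesis
      proof (rule eventually_mono)
        fix w assume "w \<in> ball z 1"
        hence "norm w \<le> R" using norm_triangle_sub[of w z] by (simp add: R_def dist_norm norm_minus_commute)
        thus "(LINT y:A|lborel. Q w y) = ((LINT y:A|lborel. f w y) - (LINT y:A|lborel. f z y)) / (w - z)"
          unfolding Q_def using int[of w] int[of z] by (simp add: R_def set_integral_diff)
      qed
    qed
    ultimately have "((\<lambda>w. ((LINT y:A|lborel. f w y) - (LINT y:A|lborel. f z y)) / (w - z)) \<longlongrightarrow> (LINT y:A|lborel. d y)) (at z)"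
      by (rule Lim_transform_eventually)
    thus ?thesis unfolding has_field_derivative_iff by blast
  qed
  thus ?thesis by (auto simp: holomorphic_on_def field_differentiable_def)
qed

lemma iterate_bounded: "\<exists>B. \<forall>z S x. norm z \<le> R \<longrightarrow> norm (iterate r n z S x) \<le> B"
proof (induction n)
  case (Suc n)
  then obtain B where B: "\<And>z S x. norm z \<le> R \<Longrightarrow> norm (iterate r n z S x) \<le> B" by blast
  show ?case
  proof (intro exI allI impI)
    fix z :: complex and S x assume z: "norm z \<le> R"
    have R: "0 \<le> R" using z norm_ge_zero order_trans by blast
    let ?I = "\<lambda>S x. LINT y:ball x r \<inter> S|lborel. (iterate r n z (S - ball x (dist x y)) y)\<^sup>2"
    have I: "norm (?I S x) \<le> B\<^sup>2 * (pi * r\<^sup>2)"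
    proof (cases "integrable lborel (\<lambda>y. indicator (ball x r \<inter> S) y *\<^sub>R (iterate r n z (S - ball x (dist x y)) y)\<^sup>2)")
      case True
      have "norm (?I S x) \<le> (LINT y|lborel. norm (indicator (ball x r \<inter> S) y *\<^sub>R (iterate r n z (S - ball x (dist x y)) y)\<^sup>2))"
        unfolding set_lebesgue_integral_def by (rule integral_norm_bound)
      also have "\<dots> \<le> (LINT y|lborel. indicator (ball x r) y * B\<^sup>2)"
      proof (rule integral_mono[OF integrable_norm[OF True]])
        show "integrable lborel (\<lambda>y. indicator (ball x r) y * B\<^sup>2)"
          using finite_area[OF bounded_ball[of x r]] by (intro integrable_mult_left integrable_real_indicator) auto
        show "norm (indicator (ball x r \<inter> S) y *\<^sub>R (iterate r n z (S - ball x (dist x y)) y)\<^sup>2) \<le> indicator (ball x r) y * B\<^sup>2" for y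
          using B[OF z] by (auto simp: indicator_def norm_power intro!: power_mono)
      qed
      also have "\<dots> = B\<^sup>2 * area (ball x r)" by simp
      also have "\<dots> \<le> B\<^sup>2 * (pi * r\<^sup>2)" by (cases "0 \<le> r") (auto simp: area_ball ball_empty)
      finally show ?thesis .
    next
      case False thus ?thesis by (simp add: set_lebesgue_integral_def not_integrable_integral_eq)
    qed
    have "Re (- (z / 2) * ?I S x) \<le> norm (- (z / 2) * ?I S x)" by (rule complex_Re_le_cmod)
    also have "\<dots> \<le> R * (B\<^sup>2 * (pi * r\<^sup>2))"
    proof -
      have "norm (- (z / 2) * ?I S x) = norm z / 2 * norm (?I S x)" by (simp add: norm_mult norm_divide)
      also have "\<dots> \<le> R * (B\<^sup>2 * (pi * r\<^sup>2))" using z I R by (intro mult_mono) auto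
      finally show ?thesis .
    qed
    finally show "norm (iterate r (Suc n) z S x) \<le> exp (R * (B\<^sup>2 * (pi * r\<^sup>2)))" by (simp add: norm_exp_eq_Re)
  qed
qed (auto intro: exI[of _ 1])

lemma iterate_holomorphic:
  assumes "S \<in> sets borel" shows "(\<lambda>z. iterate r n z S x) holomorphic_on UNIV"
  using assms
proof (induction n arbitrary: S x)
  case (Suc n)
  have "(\<lambda>z. LINT y:ball x r \<inter> S|lborel. (iterate r n z (S - ball x (dist x y)) y)\<^sup>2) holomorphic_on UNIV"
  proof (rule holomorphic_set_integral)
    show "(\<lambda>z. (iterate r n z (S - ball x (dist x y)) y)\<^sup>2) holomorphic_on UNIV" for y
      using Suc by (intro holomorphic_on_power) auto
    show "(\<lambda>y. (iterate r n z (S - ball x (dist x y)) y)\<^sup>2) \<in> borel_measurable borel" for z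
      using iterate_shell_measurable[OF Suc.prems, of r n z x] by measurable
    show "\<exists>B. \<forall>z y. norm z \<le> R \<longrightarrow> norm ((iterate r n z (S - ball x (dist x y)) y)\<^sup>2) \<le> B" for R
    proof -
      obtain B where "\<And>z S x. norm z \<le> R \<Longrightarrow> norm (iterate r n z S x) \<le> B" using iterate_bounded by blast
      thus ?thesis by (intro exI[of _ "B\<^sup>2"]) (auto simp: norm_power intro!: power_mono)
    qed
  qed (use Suc.prems in auto)
  thus ?case by (simp only: iterate.simps) (intro holomorphic_intros, auto)
qed simp

section \<open>The weighted contraction\<close>

text \<open>\<open>xm\<close> is the largest real activity considered, \<open>\<delta>\<close> the radius of the complex neighbourhood, \<open>\<epsilon>\<close> the width of
  the tube, \<open>\<kappa>\<close> the constant of \<open>exp_square_contraction\<close>, \<open>\<theta>\<close> the contraction rate, and \<open>M\<close> the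
  weighted distance allowed between the iterates at a complex activity and at a nearby real one.
  The assumption \<open>M_tube\<close> keeps this distance within the tube, and \<open>M_drift\<close> says that the change of the
  activity in one step is absorbed by the contraction.\<close>

locale contraction =
  fixes r xm \<delta> \<epsilon> \<kappa> \<theta> M :: real
  assumes r_pos: "0 < r" and xm: "0 \<le> xm" and \<delta>: "0 \<le> \<delta>" and \<epsilon>: "0 \<le> \<epsilon>" and \<theta>: "0 < \<theta>" "\<theta> < 1" and M: "0 \<le> M"
    and \<kappa>_big: "(xm + \<delta>) * exp (-1) * exp ((2 * \<epsilon>\<^sup>2 * xm + 2 * \<delta> * (1 + \<epsilon>)\<^sup>2) * (pi * r\<^sup>2)) \<le> \<kappa>"
    and two_step: "\<kappa>\<^sup>2 * two_step_volume r \<le> \<theta> ^ 4"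
    and M_tube: "M * sqrt (1 + \<kappa> / \<theta>\<^sup>2 * (pi * r\<^sup>2)) \<le> \<epsilon>"
    and M_drift: "\<delta> * (pi * r\<^sup>2 / 2) * exp (\<delta> * (pi * r\<^sup>2 / 2)) \<le> (1 - \<theta>) * M"
begin

lemma \<kappa>_nonneg: "0 \<le> \<kappa>"
  using xm \<delta> by (intro order.trans[OF _ \<kappa>_big]) auto

text \<open>One step bounds the squared perturbation by \<open>\<kappa>\<close> times an integral over the disk, which contracts only
  when two steps are taken together. Writing \<open>T\<close> for the map \<open>u \<mapsto> \<kappa> \<integral> u\<close> over the free part of the disk, the squared weight is
  \<open>1 + T 1 / \<theta>\<^sup>2\<close>; as \<open>T (T 1) \<le> \<theta>\<^sup>4\<close>, it satisfies \<open>T (weight\<^sup>2) \<le> \<theta>\<^sup>2 weight\<^sup>2\<close>.\<close>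

definition weight :: "plane set \<Rightarrow> plane \<Rightarrow> real" where
  "weight S x = sqrt (1 + \<kappa> / \<theta>\<^sup>2 * area (ball x r \<inter> S))"

definition weight_max :: real where
  "weight_max = sqrt (1 + \<kappa> / \<theta>\<^sup>2 * (pi * r\<^sup>2))"

lemma area_ball_Int_le: "S \<in> sets borel \<Longrightarrow> area (ball x r \<inter> S) \<le> pi * r\<^sup>2"
  using area_mono[of "ball x r" "ball x r \<inter> S"] r_pos by (simp add: area_ball)

lemma weight_ge_1: "1 \<le> weight S x"
  using \<kappa>_nonneg by (simp add: weight_def)

lemma weight_le: "S \<in> sets borel \<Longrightarrow> weight S x \<le> weight_max"
  unfolding weight_def weight_max_def using \<kappa>_nonneg
  by (intro real_sqrt_le_mono add_left_mono mult_left_mono area_ball_Int_le) auto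

lemma weight_square: "(weight S x)\<^sup>2 = 1 + \<kappa> / \<theta>\<^sup>2 * area (ball x r \<inter> S)"
  unfolding weight_def using \<kappa>_nonneg by (intro real_sqrt_pow2) auto

lemma weight_contraction:
  assumes S[measurable]: "S \<in> sets borel"
  shows "\<kappa> * (LINT y:ball x r \<inter> S|lborel. (weight (S - ball x (dist x y)) y)\<^sup>2) \<le> \<theta>\<^sup>2 * (weight S x)\<^sup>2"
proof -
  let ?D = "ball x r \<inter> S" and ?a = "\<lambda>y. area (ball y r \<inter> (S - ball x (dist x y)))"
  have D: "?D \<in> sets borel" "bounded ?D" by (auto intro: bounded_subset[OF bounded_ball])
  have i1: "set_integrable lborel ?D (\<lambda>_. 1::real)" using D by (intro set_integrable_bounded[where K=1]) auto
  have i2: "set_integrable lborel ?D ?a"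
    using D area_ball_Int_le by (intro set_integrable_bounded[where K="pi * r\<^sup>2"]) auto
  have "(LINT y:?D|lborel. (weight (S - ball x (dist x y)) y)\<^sup>2) = (LINT y:?D|lborel. 1 + \<kappa> / \<theta>\<^sup>2 * ?a y)"
    unfolding weight_square ..
  also have "\<dots> = (LINT y:?D|lborel. 1) + \<kappa> / \<theta>\<^sup>2 * (LINT y:?D|lborel. ?a y)"
    using i1 i2 by (subst set_integral_add) auto
  also have "(LINT y:?D|lborel. 1::real) = area ?D" by (simp add: set_lebesgue_integral_def)
  also have "area ?D + \<kappa> / \<theta>\<^sup>2 * (LINT y:?D|lborel. ?a y) \<le> area ?D + \<kappa> / \<theta>\<^sup>2 * two_step_volume r"
    using \<kappa>_nonneg two_step_volume_bound[OF r_pos S] by (intro add_left_mono mult_left_mono) auto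
  finally have "\<kappa> * (LINT y:?D|lborel. (weight (S - ball x (dist x y)) y)\<^sup>2) \<le> \<kappa> * (area ?D + \<kappa> / \<theta>\<^sup>2 * two_step_volume r)"
    using \<kappa>_nonneg by (intro mult_left_mono)
  also have "\<dots> = \<kappa> * area ?D + (\<kappa>\<^sup>2 * two_step_volume r) / \<theta>\<^sup>2" by (simp add: power2_eq_square algebra_simps)
  also have "\<dots> \<le> \<kappa> * area ?D + \<theta> ^ 4 / \<theta>\<^sup>2" using two_step by (intro add_left_mono divide_right_mono) auto
  also have "\<dots> = \<theta>\<^sup>2 * (weight S x)\<^sup>2"
    unfolding weight_square using \<theta> by (simp add: field_simps power2_eq_square power4_eq_xxxx)
  finally show ?thesis .
qed

lemma weighted_step:
  assumes S: "S \<in> sets borel"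
    and m[measurable]: "f \<in> borel_measurable borel" "g \<in> borel_measurable borel"
    and tube: "\<And>y. y \<in> ball x r \<inter> S \<Longrightarrow> f y \<in> unit_tube \<epsilon>" "\<And>y. y \<in> ball x r \<inter> S \<Longrightarrow> g y \<in> unit_tube \<epsilon>"
    and z: "norm (z - of_real t) \<le> \<delta>" "0 \<le> t" "t \<le> xm"
    and c: "0 \<le> c" "\<And>y. y \<in> ball x r \<inter> S \<Longrightarrow> norm (f y - g y) \<le> c * weight (S - ball x (dist x y)) y"
  shows "norm (exp (- (z / 2) * (LINT y:ball x r \<inter> S|lborel. (f y)\<^sup>2))
     - exp (- (z / 2) * (LINT y:ball x r \<inter> S|lborel. (g y)\<^sup>2))) \<le> c * \<theta> * weight S x"
proof -
  let ?D = "ball x r \<inter> S" and ?w = "\<lambda>y. weight (S - ball x (dist x y)) y"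
  have D: "?D \<in> sets borel" "bounded ?D" "area ?D \<le> pi * r\<^sup>2"
    using S area_ball_Int_le by (auto intro: bounded_subset[OF bounded_ball])
  have \<kappa>': "(t + \<delta>) * exp (-1) * exp ((2 * \<epsilon>\<^sup>2 * t + 2 * \<delta> * (1 + \<epsilon>)\<^sup>2) * (pi * r\<^sup>2)) \<le> \<kappa>"
    using z \<delta> xm by (intro order.trans[OF _ \<kappa>_big] mult_mono) (auto intro!: mult_right_mono mult_left_mono)
  have wm: "(\<lambda>y. (?w y)\<^sup>2) \<in> borel_measurable borel"
    unfolding weight_square using area_shell_measurable[OF S] by measurable
  have wmax: "(?w y)\<^sup>2 \<le> weight_max\<^sup>2" for y
    using weight_le[of "S - ball x (dist x y)" y] weight_ge_1[of "S - ball x (dist x y)" y] S by (intro power_mono) auto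
  have le: "(norm (f y - g y))\<^sup>2 \<le> c\<^sup>2 * (?w y)\<^sup>2" if "y \<in> ?D" for y
    using power_mono[OF c(2)[OF that], of 2] by (simp add: power_mult_distrib)
  have le': "(norm (f y - g y))\<^sup>2 \<le> c\<^sup>2 * weight_max\<^sup>2" if "y \<in> ?D" for y
    using le[OF that] mult_left_mono[OF wmax[of y], of "c\<^sup>2"] by simp
  have iw: "set_integrable lborel ?D (\<lambda>y. (?w y)\<^sup>2)"
    using wm wmax D by (intro set_integrable_bounded[where K="weight_max\<^sup>2"]) auto
  have "(norm (exp (- (z / 2) * (LINT y:?D|lborel. (f y)\<^sup>2)) - exp (- (z / 2) * (LINT y:?D|lborel. (g y)\<^sup>2))))\<^sup>2
    \<le> \<kappa> * (LINT y:?D|lborel. (norm (f y - g y))\<^sup>2)"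
    by (rule exp_square_contraction[OF D m tube z(1,2) \<epsilon> \<kappa>']) auto
  also have "\<dots> \<le> \<kappa> * (LINT y:?D|lborel. c\<^sup>2 * (?w y)\<^sup>2)"
  proof (intro mult_left_mono \<kappa>_nonneg set_integral_mono)
    show "set_integrable lborel ?D (\<lambda>y. (norm (f y - g y))\<^sup>2)"
      using le' D by (intro set_integrable_bounded[where K="c\<^sup>2 * weight_max\<^sup>2"]) auto
    show "set_integrable lborel ?D (\<lambda>y. c\<^sup>2 * (?w y)\<^sup>2)" using iw by simp
  qed (rule le)
  also have "\<dots> = c\<^sup>2 * (\<kappa> * (LINT y:?D|lborel. (?w y)\<^sup>2))" by simp
  also have "\<dots> \<le> c\<^sup>2 * (\<theta>\<^sup>2 * (weight S x)\<^sup>2)" using weight_contraction[OF S] by (intro mult_left_mono) auto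
  also have "\<dots> = (c * \<theta> * weight S x)\<^sup>2" by (simp add: power_mult_distrib)
  finally have sq: "(norm (exp (- (z / 2) * (LINT y:?D|lborel. (f y)\<^sup>2)) - exp (- (z / 2) * (LINT y:?D|lborel. (g y)\<^sup>2))))\<^sup>2
    \<le> (c * \<theta> * weight S x)\<^sup>2" .
  have "0 \<le> c * \<theta> * weight S x"
    using c(1) \<theta> order.trans[OF zero_le_one weight_ge_1[of S x]] by simp
  with sq show ?thesis by (rule power2_le_imp_le)
qed

text \<open>The effect of replacing only the outer activity by the real one.\<close>

lemma drift:
  fixes z :: complex
  assumes "norm (z - of_real t) \<le> \<delta>" "0 \<le> t" "0 \<le> I" "I \<le> pi * r\<^sup>2"
  shows "norm (exp (- (z / 2) * of_real I) - exp (- (of_real t / 2) * of_real I)) \<le> (1 - \<theta>) * M"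
proof -
  define u where "u = - (z / 2) * of_real I"
  define w where "w = - (of_real t / 2 :: complex) * of_real I"
  have n: "norm (u - w) \<le> \<delta> * (pi * r\<^sup>2 / 2)"
  proof -
    have "u - w = - (z - of_real t) * of_real (I / 2)" by (simp add: u_def w_def algebra_simps)
    hence "norm (u - w) = norm (z - of_real t) * (I / 2)"
      using assms(3) by (simp only: norm_mult norm_minus_cancel norm_of_real)
    also have "\<dots> \<le> \<delta> * (pi * r\<^sup>2 / 2)" using assms \<delta> by (intro mult_mono) auto
    finally show ?thesis .
  qed
  have "norm (exp u - exp w) \<le> exp (\<delta> * (pi * r\<^sup>2 / 2)) * norm (u - w)"
  proof (rule field_differentiable_bound[where S="closed_segment w u" and f'=exp])
    fix v assume v: "v \<in> closed_segment w u"
    have "Re v \<le> \<delta> * (pi * r\<^sup>2 / 2)"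
    proof -
      have "norm (v - w) \<le> norm (u - w)" using v segment_bound1 by blast
      hence "Re (v - w) \<le> \<delta> * (pi * r\<^sup>2 / 2)" using n complex_Re_le_cmod[of "v - w"] by linarith
      moreover have "Re w \<le> 0" using assms by (simp add: w_def)
      ultimately show ?thesis by simp
    qed
    thus "norm (exp v) \<le> exp (\<delta> * (pi * r\<^sup>2 / 2))" by (simp add: norm_exp_eq_Re)
  qed (auto intro: DERIV_exp has_field_derivative_at_within)
  also have "\<dots> \<le> exp (\<delta> * (pi * r\<^sup>2 / 2)) * (\<delta> * (pi * r\<^sup>2 / 2))" using n by (intro mult_left_mono) auto
  also have "\<dots> \<le> (1 - \<theta>) * M" using M_drift by (simp add: mult_ac)
  finally show ?thesis unfolding u_def w_def .
qed

lemma real_in_tube: "u \<in> {0..1} \<Longrightarrow> of_real u \<in> unit_tube \<epsilon>"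
  unfolding unit_tube_def using \<epsilon> by (auto intro!: bexI[of _ u])

text \<open>Both statements have to be proved together: the contraction estimate requires that the iterates stay in the
  tube, and they do so because they stay close to the real iterates, which lie in \<open>[0, 1]\<close>. The distance
  \<open>M\<close> reproduces itself, as \<open>\<theta> M\<close> comes from the contraction and \<open>(1 - \<theta>) M\<close> from the drift.\<close>

lemma iterate_in_tube:
  assumes z: "norm (z - of_real t) \<le> \<delta>" "0 \<le> t" "t \<le> xm" and "S \<in> sets borel"
  shows "norm (iterate r n z S x - iterate r n (of_real t) S x) \<le> M * weight S x"
    and "iterate r n z S x \<in> unit_tube \<epsilon>"
proof -
  have real: "iterate r n (of_real t) S x \<in> unit_tube \<epsilon>" for n S x
    using iterate_real[OF z(2)] real_in_tube by metis
  have tube: "w \<in> unit_tube \<epsilon>" if w: "norm (w - iterate r n (of_real t) S x) \<le> M * weight S x" and S: "S \<in> sets borel" for w S x n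
  proof -
    obtain u where "u \<in> {0..1}" "iterate r n (of_real t) S x = of_real u" using iterate_real[OF z(2)] by metis
    moreover have "M * weight S x \<le> \<epsilon>"
      using M_tube weight_le[OF S] M unfolding weight_max_def[symmetric] by (meson mult_left_mono order.trans)
    ultimately show ?thesis using w unfolding unit_tube_def by (auto intro!: bexI[of _ u])
  qed
  have *: "norm (iterate r n z S x - iterate r n (of_real t) S x) \<le> M * weight S x" if "S \<in> sets borel" for S x
    using that
  proof (induction n arbitrary: S x)
    case 0
    show ?case using M weight_ge_1[of S x] by simp
  next
    case (Suc n)
    let ?D = "ball x r \<inter> S"
    let ?f = "\<lambda>y. iterate r n z (S - ball x (dist x y)) y" and ?g = "\<lambda>y. iterate r n (of_real t) (S - ball x (dist x y)) y"
    let ?E = "\<lambda>z f. exp (- (z / 2) * (LINT y:?D|lborel. (f y)\<^sup>2)) :: complex"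
    have mS: "S - ball x (dist x y) \<in> sets borel" for y using Suc.prems by auto
    have 1: "norm (?E z ?f - ?E z ?g) \<le> M * \<theta> * weight S x"
      by (rule weighted_step[OF Suc.prems _ _ _ _ z M Suc.IH[OF mS]])
         (use Suc tube[OF Suc.IH[OF mS] mS] real in \<open>auto intro: iterate_shell_measurable\<close>)
    have 2: "norm (?E z ?g - ?E (of_real t) ?g) \<le> (1 - \<theta>) * M"
    proof -
      define u where "u y = Re (?g y)" for y
      have u: "?g y = of_real (u y)" "0 \<le> u y" "u y \<le> 1" for y
        using iterate_real[OF z(2), of r n "S - ball x (dist x y)" y] unfolding u_def by auto
      have I: "(LINT y:?D|lborel. (?g y)\<^sup>2) = of_real (LINT y:?D|lborel. (u y)\<^sup>2)"
        unfolding u(1) by (simp add: set_integral_complex_of_real[symmetric])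
      have "0 \<le> (LINT y:?D|lborel. (u y)\<^sup>2)"
        unfolding set_lebesgue_integral_def by (intro Bochner_Integration.integral_nonneg) auto
      moreover have "(LINT y:?D|lborel. (u y)\<^sup>2) \<le> pi * r\<^sup>2"
      proof -
        have "norm (LINT y:?D|lborel. (u y)\<^sup>2) \<le> 1 * area ?D"
          using u Suc.prems by (intro set_integral_norm_bound) (auto intro: bounded_subset[OF bounded_ball] power_le_one)
        thus ?thesis using area_ball_Int_le[OF Suc.prems, of x] by simp
      qed
      ultimately show ?thesis unfolding I by (intro drift[OF z(1,2)])
    qed
    have "norm (?E z ?f - ?E (of_real t) ?g) \<le> M * \<theta> * weight S x + (1 - \<theta>) * M"
      using norm_triangle_mono[OF 1 2] by simp
    also have "\<dots> \<le> M * \<theta> * weight S x + (1 - \<theta>) * M * weight S x"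
      using mult_left_mono[OF weight_ge_1[of S x], of "(1 - \<theta>) * M"] \<theta> M by simp
    finally show ?case by (simp add: algebra_simps)
  qed
  show "norm (iterate r n z S x - iterate r n (of_real t) S x) \<le> M * weight S x" by (rule *[OF assms(4)])
  thus "iterate r n z S x \<in> unit_tube \<epsilon>" using tube assms(4) by blast
qed

lemma iterate_step:
  assumes z: "norm (z - of_real t) \<le> \<delta>" "0 \<le> t" "t \<le> xm" and "S \<in> sets borel"
  shows "norm (iterate r (Suc n) z S x - iterate r n z S x) \<le> (2 + \<epsilon>) * \<theta> ^ n * weight S x"
  using assms(4)
proof (induction n arbitrary: S x)
  case 0
  have "norm (iterate r (Suc 0) z S x) \<le> 1 + \<epsilon>" by (rule unit_tube_norm[OF iterate_in_tube(2)[OF z 0]])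
  hence "norm (iterate r (Suc 0) z S x - iterate r 0 z S x) \<le> 2 + \<epsilon>"
    using norm_triangle_ineq4[of "iterate r (Suc 0) z S x" "iterate r 0 z S x"] by simp
  also have "\<dots> \<le> (2 + \<epsilon>) * weight S x" using weight_ge_1[of S x] \<epsilon> by (simp add: mult_le_cancel_left1)
  finally show ?case by simp
next
  case (Suc n)
  have mS: "S - ball x (dist x y) \<in> sets borel" for y using Suc.prems by auto
  have c: "0 \<le> (2 + \<epsilon>) * \<theta> ^ n" using \<epsilon> \<theta> by simp
  have "norm (iterate r (Suc (Suc n)) z S x - iterate r (Suc n) z S x) \<le> ((2 + \<epsilon>) * \<theta> ^ n) * \<theta> * weight S x"
    unfolding iterate.simps(2)[of r "Suc n" z S x] iterate.simps(2)[of r n z S x]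
    by (rule weighted_step[OF Suc.prems _ _ _ _ z c Suc.IH[OF mS]])
       (intro iterate_shell_measurable Suc.prems iterate_in_tube(2)[OF z] mS)+
  thus ?case by (simp add: mult_ac)
qed

definition ratio_error :: "nat \<Rightarrow> real" where
  "ratio_error n = (2 + \<epsilon>) * weight_max / (1 - \<theta>) * \<theta> ^ n"

lemma ratio_error_tendsto: "ratio_error \<longlonglongrightarrow> 0"
  unfolding ratio_error_def using \<theta> by (intro tendsto_mult_right_zero LIMSEQ_realpow_zero) auto

lemma iterate_limit:
  assumes z: "norm (z - of_real t) \<le> \<delta>" "0 \<le> t" "t \<le> xm" and S: "S \<in> sets borel"
  shows "(\<lambda>n. iterate r n z S x) \<longlonglongrightarrow> lim (\<lambda>n. iterate r n z S x)"
    and "norm (iterate r n z S x - lim (\<lambda>n. iterate r n z S x)) \<le> ratio_error n"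
proof -
  let ?a = "\<lambda>n. iterate r n z S x"
  define K where "K = (2 + \<epsilon>) * weight_max"
  have step: "norm (?a (Suc n) - ?a n) \<le> K * \<theta> ^ n" for n
  proof -
    have "(2 + \<epsilon>) * \<theta> ^ n * weight S x \<le> (2 + \<epsilon>) * \<theta> ^ n * weight_max"
      using weight_le[OF S] \<epsilon> \<theta> by (intro mult_left_mono) auto
    thus ?thesis using iterate_step[OF z S, of n x] unfolding K_def by (simp add: mult_ac)
  qed
  have sm: "summable (\<lambda>n. K * \<theta> ^ n)" using \<theta> by (intro summable_mult summable_geometric) auto
  have s: "summable (\<lambda>n. ?a (Suc n) - ?a n)" by (rule summable_comparison_test'[OF sm]) (rule step)
  have "(\<lambda>n. ?a n - ?a 0) \<longlonglongrightarrow> (\<Sum>n. ?a (Suc n) - ?a n)"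
  proof -
    have "(\<Sum>i<n. ?a (Suc i) - ?a i) = ?a n - ?a 0" for n by (rule sum_lessThan_telescope)
    thus ?thesis using summable_LIMSEQ[OF s] by (simp only:)
  qed
  hence "(\<lambda>n. ?a n - ?a 0 + ?a 0) \<longlonglongrightarrow> (\<Sum>n. ?a (Suc n) - ?a n) + ?a 0" by (intro tendsto_add tendsto_const)
  hence "convergent ?a" by (auto simp: convergent_def)
  thus L: "?a \<longlonglongrightarrow> lim ?a" by (simp add: convergent_LIMSEQ_iff)
  have tail: "norm (?a (n + m) - ?a n) \<le> ratio_error n" for m
  proof -
    have "norm (?a (n + m) - ?a n) = norm (\<Sum>i<m. ?a (Suc (n + i)) - ?a (n + i))"
      using sum_lessThan_telescope[of "\<lambda>i. ?a (n + i)" m] by simp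
    also have "\<dots> \<le> (\<Sum>i<m. K * \<theta> ^ (n + i))" by (rule sum_norm_le) (rule step)
    also have "\<dots> = K * \<theta> ^ n * (\<Sum>i<m. \<theta> ^ i)" by (simp add: sum_distrib_left power_add mult_ac)
    also have "\<dots> \<le> K * \<theta> ^ n * (1 / (1 - \<theta>))"
    proof (intro mult_left_mono)
      have "(\<Sum>i<m. \<theta> ^ i) \<le> (\<Sum>i. \<theta> ^ i)" using \<theta> by (intro sum_le_suminf summable_geometric) auto
      thus "(\<Sum>i<m. \<theta> ^ i) \<le> 1 / (1 - \<theta>)" using \<theta> by (simp add: suminf_geometric)
      have "0 \<le> K * \<theta> ^ n" using order.trans[OF norm_ge_zero step] .
      thus "0 \<le> K * \<theta> ^ n" .
    qed
    finally show ?thesis by (simp add: ratio_error_def K_def)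
  qed
  have "(\<lambda>m. norm (?a (n + m) - ?a n)) \<longlonglongrightarrow> norm (lim ?a - ?a n)"
    using LIMSEQ_ignore_initial_segment[OF L, of n] by (intro tendsto_norm tendsto_diff tendsto_const) (simp add: add.commute)
  hence "norm (lim ?a - ?a n) \<le> ratio_error n" by (rule LIMSEQ_le_const2) (use tail in blast)
  thus "norm (?a n - lim ?a) \<le> ratio_error n" by (simp add: norm_minus_commute)
qed

text \<open>Any solution of the recursion with values in \<open>[0, 1]\<close> is attracted to the iterates; in particular there is
  at most one. The hypotheses restrict to a family \<open>\<S>\<close> of regions since partition functions
  and void probabilities are defined on different regions.\<close>

lemma real_solution_close:
  fixes s :: "plane set \<Rightarrow> plane \<Rightarrow> real"
  assumes t: "0 \<le> t" "t \<le> xm"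
    and \<S>: "\<And>S. S \<in> \<S> \<Longrightarrow> S \<in> sets borel" "\<And>S x \<rho>. S \<in> \<S> \<Longrightarrow> S - ball x \<rho> \<in> \<S>"
    and s01: "\<And>S x. S \<in> \<S> \<Longrightarrow> 0 \<le> s S x \<and> s S x \<le> 1"
    and meas: "\<And>S x. S \<in> \<S> \<Longrightarrow> (\<lambda>y. indicator (ball x r) y * s (S - ball x (dist x y)) y) \<in> borel_measurable borel"
    and rec: "\<And>S x. S \<in> \<S> \<Longrightarrow> s S x = exp (- (t / 2) * (LINT y:ball x r \<inter> S|lborel. (s (S - ball x (dist x y)) y)\<^sup>2))"
    and "S \<in> \<S>"
  shows "norm (of_real (s S x) - iterate r n (of_real t) S x) \<le> ratio_error n"
proof -
  have z: "norm (of_real t - of_real t :: complex) \<le> \<delta>" using \<delta> by simp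
  have "norm (of_real (s S x) - iterate r n (of_real t) S x) \<le> \<theta> ^ n * weight S x" if "S \<in> \<S>" for S x
    using that
  proof (induction n arbitrary: S x)
    case 0
    have "norm (of_real (s S x) - 1 :: complex) = \<bar>s S x - 1\<bar>" by (metis norm_of_real of_real_1 of_real_diff)
    thus ?case using s01[OF 0, of x] weight_ge_1[of S x] by simp
  next
    case (Suc n)
    have S: "S \<in> sets borel" using \<S> Suc by auto
    \<comment> \<open>The indicator is kept because measurability is only available inside the disk.\<close>
    let ?f = "\<lambda>y. of_real (indicator (ball x r) y * s (S - ball x (dist x y)) y) :: complex"
    have f: "?f y = of_real (s (S - ball x (dist x y)) y)" if "y \<in> ball x r" for y using that by simp
    have mS: "S - ball x (dist x y) \<in> \<S>" for y using Suc \<S> by auto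
    have "of_real (s S x) = exp (- (of_real t / 2) * (LINT y:ball x r \<inter> S|lborel. (?f y)\<^sup>2))"
    proof -
      have "(LINT y:ball x r \<inter> S|lborel. (?f y)\<^sup>2) = (LINT y:ball x r \<inter> S|lborel. of_real ((s (S - ball x (dist x y)) y)\<^sup>2))"
        using S by (intro set_lebesgue_integral_cong) auto
      also have "\<dots> = of_real (LINT y:ball x r \<inter> S|lborel. (s (S - ball x (dist x y)) y)\<^sup>2)"
        by (rule set_integral_complex_of_real)
      finally show ?thesis by (subst rec[OF Suc.prems]) (simp add: exp_of_real[symmetric])
    qed
    moreover have "norm (exp (- (of_real t / 2) * (LINT y:ball x r \<inter> S|lborel. (?f y)\<^sup>2))
      - exp (- (of_real t / 2) * (LINT y:ball x r \<inter> S|lborel. (iterate r n (of_real t) (S - ball x (dist x y)) y)\<^sup>2))) \<le> \<theta> ^ n * \<theta> * weight S x"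
    proof (rule weighted_step[OF S _ _ _ _ z t])
      show "?f \<in> borel_measurable borel" using meas[OF Suc.prems, of x] by measurable
      show "(\<lambda>y. iterate r n (of_real t) (S - ball x (dist x y)) y) \<in> borel_measurable borel"
        using S by (rule iterate_shell_measurable)
      fix y assume y: "y \<in> ball x r \<inter> S"
      show "?f y \<in> unit_tube \<epsilon>" using y s01[OF mS, of y y] by (subst f) (auto intro!: real_in_tube)
      show "iterate r n (of_real t) (S - ball x (dist x y)) y \<in> unit_tube \<epsilon>"
        using \<S>(1)[OF mS] by (intro iterate_in_tube(2)[OF z t])
      show "norm (?f y - iterate r n (of_real t) (S - ball x (dist x y)) y) \<le> \<theta> ^ n * weight (S - ball x (dist x y)) y"
        using y Suc.IH[OF mS, of y y] by (subst f) auto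
    qed (use \<theta> in auto)
    ultimately show ?case by (simp add: mult_ac)
  qed
  hence "norm (of_real (s S x) - iterate r n (of_real t) S x) \<le> \<theta> ^ n * weight S x" using assms(8) .
  also have "\<dots> \<le> ratio_error n"
  proof -
    have w: "weight S x \<le> weight_max" "1 \<le> weight_max" using weight_le[of S x] weight_ge_1[of S x] \<S>(1)[OF assms(8)] by auto
    have "weight_max \<le> (2 + \<epsilon>) * weight_max / (1 - \<theta>)"
    proof -
      have "weight_max * (1 - \<theta>) \<le> weight_max * (2 + \<epsilon>)" using w \<theta> \<epsilon> by (intro mult_left_mono) auto
      thus ?thesis using \<theta> by (simp add: field_simps)
    qed
    hence "weight S x * \<theta> ^ n \<le> (2 + \<epsilon>) * weight_max / (1 - \<theta>) * \<theta> ^ n" using w \<theta> by (intro mult_right_mono) auto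
    thus ?thesis by (simp add: ratio_error_def mult.commute)
  qed
  finally show ?thesis .
qed

end

section \<open>The limiting vacancy ratio\<close>

text \<open>The choice of the parameters is where the threshold enters: with \<open>V = two_step_volume r\<close>, the hypothesis on \<open>xm\<close> says
  \<open>xm / e < 1 / sqrt V\<close>. Take \<open>\<kappa>\<close> strictly between, so that
  \<open>\<theta>\<^sup>2 = \<kappa> sqrt V < 1\<close>; the error terms vanish as \<open>\<epsilon>\<close> and then \<open>\<delta>\<close> tend to \<open>0\<close>.\<close>

lemma contraction_parameters:
  assumes "0 < r" "0 \<le> xm" "xm < exp 1 / (sqrt (1 / 2 + 3 * sqrt 3 / (8 * pi)) * (pi * r\<^sup>2))"
  shows "\<exists>\<delta> \<epsilon> \<kappa> \<theta> M. 0 < \<delta> \<and> contraction r xm \<delta> \<epsilon> \<kappa> \<theta> M"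
proof -
  define v where "v = pi * r\<^sup>2"
  define V where "V = two_step_volume r"
  have v: "0 < v" using assms(1) by (simp add: v_def)
  have c: "0 < 1 / 2 + 3 * sqrt 3 / (8 * pi)" by (intro add_pos_nonneg) auto
  have V: "0 < V" using c v unfolding V_def two_step_volume_def v_def by (intro mult_pos_pos) auto
  have sV: "sqrt V = sqrt (1 / 2 + 3 * sqrt 3 / (8 * pi)) * v"
    unfolding V_def two_step_volume_def v_def[symmetric] using v by (simp add: real_sqrt_mult)
  have sV0: "0 < sqrt V" using V by simp
  have xmV: "xm * exp (-1) < 1 / sqrt V"
  proof -
    have "xm < exp 1 / sqrt V" using assms(3) unfolding sV v_def by simp
    hence "xm * exp (-1) < exp 1 / sqrt V * exp (-1)" by (rule mult_strict_right_mono) simp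
    thus ?thesis by (simp add: exp_minus)
  qed
  define \<kappa> where "\<kappa> = (xm * exp (-1) + 1 / sqrt V) / 2"
  have \<kappa>: "xm * exp (-1) < \<kappa>" "\<kappa> < 1 / sqrt V" "0 < \<kappa>"
    using xmV assms(2) sV0 by (auto simp: \<kappa>_def add_nonneg_pos)
  define \<theta> where "\<theta> = sqrt (\<kappa> * sqrt V)"
  have \<theta>: "0 < \<theta>" "\<theta> < 1" using \<kappa> sV0 by (auto simp: \<theta>_def field_simps)
  have \<theta>4: "\<kappa>\<^sup>2 * V \<le> \<theta> ^ 4"
  proof -
    have "\<theta> ^ 4 = (\<theta>\<^sup>2)\<^sup>2" by simp
    also have "\<theta>\<^sup>2 = \<kappa> * sqrt V" using \<kappa> sV0 by (simp add: \<theta>_def)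
    finally show ?thesis using V by (simp add: power_mult_distrib)
  qed
  have "((\<lambda>\<epsilon>. xm * exp (-1) * exp (2 * \<epsilon>\<^sup>2 * xm * v)) \<longlongrightarrow> xm * exp (-1) * exp (2 * 0\<^sup>2 * xm * v)) (at_right 0)"
    by (intro tendsto_intros)
  hence "\<forall>\<^sub>F \<epsilon> in at_right 0. xm * exp (-1) * exp (2 * \<epsilon>\<^sup>2 * xm * v) < \<kappa>"
    using \<kappa>(1) by (intro order_tendstoD) auto
  moreover have "\<forall>\<^sub>F \<epsilon> in at_right (0::real). 0 < \<epsilon>" by (simp add: eventually_at_right_less)
  ultimately have "\<forall>\<^sub>F \<epsilon> in at_right (0::real). 0 < \<epsilon> \<and> xm * exp (-1) * exp (2 * \<epsilon>\<^sup>2 * xm * v) < \<kappa>"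
    by eventually_elim auto
  then obtain \<epsilon> :: real where \<epsilon>: "0 < \<epsilon>" "xm * exp (-1) * exp (2 * \<epsilon>\<^sup>2 * xm * v) < \<kappa>"
    using eventually_happens trivial_limit_at_right_real by blast
  define m where "m = sqrt (1 + \<kappa> / \<theta>\<^sup>2 * v)"
  have m: "0 < m" using \<kappa> \<theta> v by (simp add: m_def add_pos_nonneg)
  define M where "M = \<epsilon> / m"
  have M: "0 < M" using \<epsilon> m by (simp add: M_def)
  have "((\<lambda>\<delta>. (xm + \<delta>) * exp (-1) * exp ((2 * \<epsilon>\<^sup>2 * xm + 2 * \<delta> * (1 + \<epsilon>)\<^sup>2) * v)) \<longlongrightarrow>
     (xm + 0) * exp (-1) * exp ((2 * \<epsilon>\<^sup>2 * xm + 2 * 0 * (1 + \<epsilon>)\<^sup>2) * v)) (at_right 0)"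
    by (intro tendsto_intros)
  hence 1: "\<forall>\<^sub>F \<delta> in at_right 0. (xm + \<delta>) * exp (-1) * exp ((2 * \<epsilon>\<^sup>2 * xm + 2 * \<delta> * (1 + \<epsilon>)\<^sup>2) * v) < \<kappa>"
    using \<epsilon>(2) by (intro order_tendstoD) (auto simp: mult.assoc)
  have "((\<lambda>\<delta>. \<delta> * (v / 2) * exp (\<delta> * (v / 2))) \<longlongrightarrow> 0 * (v / 2) * exp (0 * (v / 2))) (at_right 0)"
    by (intro tendsto_intros)
  hence 2: "\<forall>\<^sub>F \<delta> in at_right 0. \<delta> * (v / 2) * exp (\<delta> * (v / 2)) < (1 - \<theta>) * M"
    using \<theta> M by (intro order_tendstoD) auto
  have 3: "\<forall>\<^sub>F \<delta> in at_right (0::real). 0 < \<delta>" by (simp add: eventually_at_right_less)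
  from 1 2 3 have "\<forall>\<^sub>F \<delta> in at_right 0. (xm + \<delta>) * exp (-1) * exp ((2 * \<epsilon>\<^sup>2 * xm + 2 * \<delta> * (1 + \<epsilon>)\<^sup>2) * v) < \<kappa>
     \<and> \<delta> * (v / 2) * exp (\<delta> * (v / 2)) < (1 - \<theta>) * M \<and> 0 < \<delta>" by eventually_elim auto
  then obtain \<delta> :: real where \<delta>: "(xm + \<delta>) * exp (-1) * exp ((2 * \<epsilon>\<^sup>2 * xm + 2 * \<delta> * (1 + \<epsilon>)\<^sup>2) * v) < \<kappa>"
     "\<delta> * (v / 2) * exp (\<delta> * (v / 2)) < (1 - \<theta>) * M" "0 < \<delta>"
    using eventually_happens trivial_limit_at_right_real by blast
  have "contraction r xm \<delta> \<epsilon> \<kappa> \<theta> M"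
  proof
    show "M * sqrt (1 + \<kappa> / \<theta>\<^sup>2 * (pi * r\<^sup>2)) \<le> \<epsilon>"
      unfolding v_def[symmetric] m_def[symmetric] M_def using m by simp
  qed (use assms \<delta> \<epsilon> \<theta> \<theta>4 M in \<open>auto simp: v_def V_def\<close>)
  thus ?thesis using \<delta>(3) by blast
qed

text \<open>The iterates approximate square roots of vacancy ratios, and at a real activity they are real numbers.\<close>

definition limit_ratio :: "real \<Rightarrow> real \<Rightarrow> plane set \<Rightarrow> plane \<Rightarrow> real" where
  "limit_ratio r t S x = (Re (lim (\<lambda>n. iterate r n (of_real t) S x)))\<^sup>2"

lemma limit_ratio_measurable:
  assumes "T \<in> sets borel"
  shows "(\<lambda>(\<omega>, x). limit_ratio r t (minus_balls T \<omega>) x) \<in> borel_measurable (ball_seqs \<Otimes>\<^sub>M borel)"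
proof -
  have [measurable]: "(\<lambda>p. iterate r n (of_real t) (minus_balls T (fst p)) (snd p)) \<in> borel_measurable (ball_seqs \<Otimes>\<^sub>M borel)" for n
    using iterate_measurable[OF assms, of r n "of_real t"] by (simp add: case_prod_beta)
  show ?thesis unfolding limit_ratio_def case_prod_beta by measurable
qed

lemma limit_ratio_translate: "limit_ratio r t ((+) a ` S) (a + x) = limit_ratio r t S x"
  by (simp add: limit_ratio_def iterate_translate)

context contraction
begin

lemma self_close: "norm (of_real t - of_real t :: complex) \<le> \<delta>" using \<delta> by simp

lemma limit_root:
  assumes "0 \<le> t" "t \<le> xm" "S \<in> sets borel"
  shows "lim (\<lambda>n. iterate r n (of_real t) S x) = of_real (Re (lim (\<lambda>n. iterate r n (of_real t) S x)))"
    and "Re (lim (\<lambda>n. iterate r n (of_real t) S x)) \<in> {0..1}"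
proof -
  let ?a = "\<lambda>n. iterate r n (of_real t) S x"
  have L: "?a \<longlonglongrightarrow> lim ?a" using iterate_limit(1)[OF self_close assms] .
  have "?a n = of_real (Re (?a n))" "Re (?a n) \<in> {0..1}" for n using iterate_real[OF assms(1), of r n S x] by auto
  note u = this
  have "(\<lambda>n. Im (?a n)) \<longlonglongrightarrow> Im (lim ?a)" using L by (rule tendsto_Im)
  moreover have "Im (?a n) = 0" for n using u(1)[of n] by (metis Im_complex_of_real)
  ultimately have "Im (lim ?a) = 0" by (simp add: LIMSEQ_const_iff)
  thus "lim ?a = of_real (Re (lim ?a))" by (simp add: complex_eq_iff)
  have "(\<lambda>n. Re (?a n)) \<longlonglongrightarrow> Re (lim ?a)" using L by (rule tendsto_Re)
  thus "Re (lim ?a) \<in> {0..1}" by (rule closed_sequentially[OF closed_real_atLeastAtMost, rotated]) (use u(2) in auto)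
qed

lemma limit_ratio_bounds:
  assumes "0 \<le> t" "t \<le> xm" "S \<in> sets borel"
  shows "0 \<le> limit_ratio r t S x" "limit_ratio r t S x \<le> 1"
  using limit_root(2)[OF assms, of x] by (auto simp: limit_ratio_def power_le_one)

text \<open>The \<open>n\<close>-th iterates at \<open>x\<close> agree, and each is within \<open>ratio_error n\<close> of its limit. Squaring numbers
  of \<open>[0, 1]\<close> costs another factor \<open>2\<close>.\<close>

lemma limit_ratio_local:
  assumes t: "0 \<le> t" "t \<le> xm" and S: "S \<in> sets borel" "S' \<in> sets borel"
    and eq: "S \<inter> ball x (real n * r) = S' \<inter> ball x (real n * r)"
  shows "\<bar>limit_ratio r t S x - limit_ratio r t S' x\<bar> \<le> 4 * ratio_error n"
proof -
  define a where "a S = Re (lim (\<lambda>n. iterate r n (of_real t) S x))" for S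
  let ?w = "iterate r n (of_real t) S x"
  have w: "?w = iterate r n (of_real t) S' x" using eq r_pos by (rule iterate_local)
  have a: "of_real (a S) = lim (\<lambda>n. iterate r n (of_real t) S x)" "a S \<in> {0..1}" if "S \<in> sets borel" for S
    using limit_root[OF t that, of x] unfolding a_def by auto
  have "norm (?w - of_real (a S)) \<le> ratio_error n" "norm (?w - of_real (a S')) \<le> ratio_error n"
    using iterate_limit(2)[OF self_close t S(1), of n x] iterate_limit(2)[OF self_close t S(2), of n x] w a(1)[OF S(1)] a(1)[OF S(2)] by auto
  hence "norm (of_real (a S) - of_real (a S') :: complex) \<le> 2 * ratio_error n"
    using norm_triangle_ineq4[of "?w - of_real (a S')" "?w - of_real (a S)"] by simp
  hence d: "\<bar>a S - a S'\<bar> \<le> 2 * ratio_error n" by (metis norm_of_real of_real_diff)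
  have "\<bar>(a S)\<^sup>2 - (a S')\<^sup>2\<bar> = \<bar>a S - a S'\<bar> * \<bar>a S + a S'\<bar>"
    by (simp add: power2_eq_square abs_mult[symmetric] algebra_simps)
  also have "\<dots> \<le> \<bar>a S - a S'\<bar> * 2" using a(2)[OF S(1)] a(2)[OF S(2)] by (intro mult_left_mono) auto
  finally show ?thesis using d unfolding limit_ratio_def a_def by simp
qed

lemma limit_ratio_tendsto:
  assumes t: "0 \<le> t" "t \<le> xm" and S: "\<And>n. S n \<in> sets borel" "S' \<in> sets borel"
    and eq: "\<And>\<rho>. \<forall>\<^sub>F n in sequentially. S n \<inter> ball x \<rho> = S' \<inter> ball x \<rho>"
  shows "(\<lambda>n. limit_ratio r t (S n) x) \<longlonglongrightarrow> limit_ratio r t S' x"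
proof (rule metric_LIMSEQ_I)
  fix e :: real assume "0 < e"
  have "(\<lambda>n. 4 * ratio_error n) \<longlonglongrightarrow> 0" using ratio_error_tendsto by (rule tendsto_mult_right_zero)
  then obtain m where m: "4 * ratio_error m < e"
    using order_tendstoD(2)[OF _ \<open>0 < e\<close>] eventually_happens'[OF sequentially_bot] by blast
  obtain N where N: "\<And>n. N \<le> n \<Longrightarrow> S n \<inter> ball x (real m * r) = S' \<inter> ball x (real m * r)"
    using eq[of "real m * r"] unfolding eventually_sequentially by blast
  show "\<exists>N. \<forall>n\<ge>N. dist (limit_ratio r t (S n) x) (limit_ratio r t S' x) < e"
  proof (intro exI allI impI)
    fix n assume "N \<le> n"
    from limit_ratio_local[OF t S N[OF this]] show "dist (limit_ratio r t (S n) x) (limit_ratio r t S' x) < e"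
      using m by (simp add: dist_real_def)
  qed
qed

text \<open>The key uniqueness statement: no matter which functional it comes from, the vacancy ratio solves the recursion, and
  so it is determined by the region.\<close>

lemma vacancy_ratio_eq_limit:
  assumes "positive_removal_functional r t \<S> q" "t \<le> xm" "S \<in> \<S>"
  shows "positive_removal_functional.vacancy_ratio r q S x = limit_ratio r t S x"
proof -
  interpret positive_removal_functional r t \<S> q by fact
  define s where "s S x = sqrt (vacancy_ratio S x)" for S x
  have sq: "(s S x)\<^sup>2 = vacancy_ratio S x" if "S \<in> \<S>" for S x using vacancy_ratio_bounds[OF that] by (simp add: s_def)
  have cl: "S - ball x \<rho> \<in> \<S>" if "S \<in> \<S>" for S x \<rho> using that by (intro region_diff) auto
  have close: "norm (of_real (s S x) - iterate r n (of_real t) S x) \<le> ratio_error n" for n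
  proof (rule real_solution_close[where \<S>=\<S>])
    fix S x assume S: "S \<in> \<S>"
    show "0 \<le> s S x \<and> s S x \<le> 1" using vacancy_ratio_bounds[OF S] by (simp add: s_def)
    have "(\<lambda>y. sqrt (indicator (ball x r) y * vacancy_ratio (S - ball x (dist x y)) y)) \<in> borel_measurable borel"
      using vacancy_ratio_shell_measurable[OF S] by measurable
    also have "(\<lambda>y. sqrt (indicator (ball x r) y * vacancy_ratio (S - ball x (dist x y)) y)) =
      (\<lambda>y. indicator (ball x r) y * s (S - ball x (dist x y)) y)" by (auto simp: s_def indicator_def)
    finally show "(\<lambda>y. indicator (ball x r) y * s (S - ball x (dist x y)) y) \<in> borel_measurable borel" .
    have "s S x = sqrt (exp (- t * (LINT y:ball x r \<inter> S|lborel. vacancy_ratio (S - ball x (dist x y)) y)))"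
      unfolding s_def vacancy_recursion[OF S, of x] ..
    also have "\<dots> = exp (- (t / 2) * (LINT y:ball x r \<inter> S|lborel. vacancy_ratio (S - ball x (dist x y)) y))"
      by (rule real_sqrt_unique) (auto simp: power2_eq_square exp_add[symmetric])
    also have "(\<lambda>y. vacancy_ratio (S - ball x (dist x y)) y) = (\<lambda>y. (s (S - ball x (dist x y)) y)\<^sup>2)"
      using sq[OF cl[OF S]] by simp
    finally show "s S x = exp (- (t / 2) * (LINT y:ball x r \<inter> S|lborel. (s (S - ball x (dist x y)) y)\<^sup>2))" .
  qed (use assms z_nonneg region_borel cl in auto)
  have "(\<lambda>n. of_real (s S x) - iterate r n (of_real t) S x) \<longlonglongrightarrow> 0"
    by (rule Lim_null_comparison[OF _ ratio_error_tendsto]) (use close in auto)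
  hence "(\<lambda>n. of_real (s S x) - (of_real (s S x) - iterate r n (of_real t) S x)) \<longlonglongrightarrow> of_real (s S x) - 0"
    by (intro tendsto_diff tendsto_const)
  hence "lim (\<lambda>n. iterate r n (of_real t) S x) = of_real (s S x)" by (intro limI) simp
  thus ?thesis unfolding limit_ratio_def using sq[OF assms(3)] by simp
qed

end

lemma square_eq_cbox: "square_of_area n = cbox (\<chi> i. - (sqrt (real n) / 2)) (\<chi> i. sqrt (real n) / 2)"
proof (rule set_eqI)
  fix x :: plane
  have "\<bar>x $ i\<bar> \<le> c \<longleftrightarrow> - c \<le> x $ i \<and> x $ i \<le> c" for i c by arith
  thus "x \<in> square_of_area n \<longleftrightarrow> x \<in> cbox (\<chi> i. - (sqrt (real n) / 2)) (\<chi> i. sqrt (real n) / 2)"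
    by (simp only: square_of_area_def mem_Collect_eq mem_box_cart vec_lambda_beta)
qed

lemma area_cbox_plane:
  assumes "\<And>i. a $ i \<le> b $ i"
  shows "area (cbox a b) = (b $ 1 - a $ 1) * (b $ 2 - a $ 2)"
proof -
  have "cbox a b \<noteq> {}" using assms by (auto simp: interval_ne_empty_cart)
  hence "area (cbox a b) = (\<Prod>i\<in>UNIV. b $ i - a $ i)" by (rule content_cbox_cart)
  thus ?thesis by (simp add: UNIV_2)
qed

lemma area_strip_le:
  assumes D: "D \<in> sets borel" "D \<subseteq> cball 0 \<rho>" and "s \<le> t" "0 \<le> \<rho>"
  shows "area {y \<in> D. s \<le> y $ 1 \<and> y $ 1 < t} \<le> 2 * \<rho> * (t - s)"
proof -
  let ?a = "\<chi> i. if i = 1 then s else - \<rho>" and ?b = "(\<chi> i. if i = 1 then t else \<rho>) :: plane"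
  have "area {y \<in> D. s \<le> y $ 1 \<and> y $ 1 < t} \<le> area (cbox ?a ?b)"
  proof (rule area_mono)
    show "{y \<in> D. s \<le> y $ 1 \<and> y $ 1 < t} \<subseteq> cbox ?a ?b"
    proof
      fix y assume y: "y \<in> {y \<in> D. s \<le> y $ 1 \<and> y $ 1 < t}"
      hence "norm y \<le> \<rho>" using D by auto
      hence "\<bar>y $ i\<bar> \<le> \<rho>" for i using component_le_norm_cart[of y i] by simp
      hence "- \<rho> \<le> y $ i \<and> y $ i \<le> \<rho>" for i by (simp add: abs_le_iff minus_le_iff)
      thus "y \<in> cbox ?a ?b" using y by (auto simp: mem_box_cart)
    qed
    show "{y \<in> D. s \<le> y $ 1 \<and> y $ 1 < t} \<in> sets borel" using D(1) by measurable
  qed auto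
  also have "\<dots> = 2 * \<rho> * (t - s)" using assms by (subst area_cbox_plane) auto
  finally show ?thesis .
qed

context contraction
begin

text \<open>Emptying \<open>A\<close> from left to right. When the point \<open>x\<close> is reached, the points of \<open>A\<close> to the left of \<open>x\<close> are
  gone, and the vacancy ratio at \<open>x\<close> is the known one. The formula shows that \<open>q\<close> is determined by \<open>q S\<close>.\<close>

lemma sweep_formula:
  assumes q: "positive_removal_functional r t \<S> q" and t: "t \<le> xm" and S: "S \<in> \<S>" and A: "A \<in> sets borel" "bounded A"
  shows "q (S - A) = q S * exp (- t * (LINT x:A \<inter> S|lborel. limit_ratio r t (S - {y \<in> A. y $ 1 < x $ 1}) x))"
    and "(\<lambda>x. indicator A x * limit_ratio r t (S - {y \<in> A. y $ 1 < x $ 1}) x) \<in> borel_measurable borel"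
proof -
  interpret positive_removal_functional r t \<S> q by fact
  obtain \<rho> where \<rho>: "0 < \<rho>" "A \<subseteq> cball 0 \<rho>" using A(2) by (auto simp: bounded_pos subset_iff)
  have c: "- \<rho> \<le> x $ 1 \<and> x $ 1 < \<rho> + 1" if "x \<in> A" for x
  proof -
    have "norm x \<le> \<rho>" using that \<rho> by auto
    hence "\<bar>x $ 1\<bar> \<le> \<rho>" using component_le_norm_cart[of x 1] by simp
    thus ?thesis by auto
  qed
  have lev: "(\<lambda>x::plane. x $ 1) \<in> borel_measurable borel" by measurable
  have K: "area {y \<in> A. s \<le> y $ 1 \<and> y $ 1 < u} \<le> 2 * \<rho> * (u - s)" if "s \<le> u" for s u
    using A \<rho> that by (intro area_strip_le) auto
  have mem: "S - {y \<in> A. y $ 1 < u} \<in> \<S>" for u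
  proof (rule region_diff[OF S])
    show "{y \<in> A. y $ 1 < u} \<in> sets borel" using A(1) by measurable
  qed (rule bounded_subset[OF A(2)], auto)
  have eq: "vacancy_ratio (S - {y \<in> A. y $ 1 < u}) x = limit_ratio r t (S - {y \<in> A. y $ 1 < u}) x" for u x
    by (rule vacancy_ratio_eq_limit[OF q t mem])
  have "q (S - {y \<in> A. y $ 1 < \<rho> + 1}) = q (S - {y \<in> A. y $ 1 < - \<rho>}) * exp (- t *
      (LINT x:{y \<in> A. - \<rho> \<le> y $ 1 \<and> y $ 1 < \<rho> + 1} \<inter> S|lborel. vacancy_ratio (S - {y \<in> A. y $ 1 < x $ 1}) x))"
    by (rule q_diff_family[OF S A lev _ K]) (use \<rho> in auto)
  moreover have "{y \<in> A. y $ 1 < \<rho> + 1} = A" "{y \<in> A. y $ 1 < - \<rho>} = {}" "{y \<in> A. - \<rho> \<le> y $ 1 \<and> y $ 1 < \<rho> + 1} = A"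
    using c by (auto simp: not_less)
  ultimately show "q (S - A) = q S * exp (- t * (LINT x:A \<inter> S|lborel. limit_ratio r t (S - {y \<in> A. y $ 1 < x $ 1}) x))"
    unfolding eq by simp
  have [measurable]: "(\<lambda>x. vacancy_ratio (S - {y \<in> A. y $ 1 < max (- \<rho>) (min (\<rho> + 1) (x $ 1))}) x) \<in> borel_measurable borel"
    by (rule vacancy_ratio_family_measurable[OF S A lev _ K]) (use \<rho> in auto)
  note [measurable] = A(1)
  have "(\<lambda>x. indicator A x * vacancy_ratio (S - {y \<in> A. y $ 1 < max (- \<rho>) (min (\<rho> + 1) (x $ 1))}) x) \<in> borel_measurable borel"
    by measurable
  also have "(\<lambda>x. indicator A x * vacancy_ratio (S - {y \<in> A. y $ 1 < max (- \<rho>) (min (\<rho> + 1) (x $ 1))}) x)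
    = (\<lambda>x. indicator A x * limit_ratio r t (S - {y \<in> A. y $ 1 < x $ 1}) x)"
  proof
    fix x
    show "indicator A x * vacancy_ratio (S - {y \<in> A. y $ 1 < max (- \<rho>) (min (\<rho> + 1) (x $ 1))}) x
      = indicator A x * limit_ratio r t (S - {y \<in> A. y $ 1 < x $ 1}) x"
      using c[of x] unfolding eq by (cases "x \<in> A") auto
  qed
  finally show "(\<lambda>x. indicator A x * limit_ratio r t (S - {y \<in> A. y $ 1 < x $ 1}) x) \<in> borel_measurable borel" .
qed

end

section \<open>The pressure\<close>

lemma partition_sum_functional:
  assumes "0 < r" "0 \<le> t"
  shows "positive_removal_functional r t {S. S \<in> sets borel \<and> bounded S} (partition_sum r t)"
proof
  show "(\<And>x y. x \<in> B \<Longrightarrow> y \<in> B \<Longrightarrow> dist x y < r) \<Longrightarrow> partition_sum r t S - partition_sum r t (S - B) =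
        t * (LINT x:B \<inter> S|lborel. partition_sum r t (S - ball x r))"
    if "S \<in> {S. S \<in> sets borel \<and> bounded S}" "B \<in> sets borel" for S B
    using that assms by (intro partition_sum_remove) auto
  show "0 < partition_sum r t S" if "S \<in> {S. S \<in> sets borel \<and> bounded S}" for S
    using partition_sum_ge_1[of S t r] that assms by auto
qed (use assms in \<open>auto intro: partition_sum_measurable_ball bounded_subset simp: partition_sum_def\<close>)

text \<open>What remains in the vicinity of a point deep inside a large square when the sweep from left to right reaches it.\<close>

definition right_half_plane :: "plane set" where
  "right_half_plane = {x. 0 \<le> x $ 1}"

lemma right_half_plane_borel [measurable]: "right_half_plane \<in> sets borel"
  unfolding right_half_plane_def by measurable

context contraction
begin

lemma ln_partition_sum:
  assumes t: "0 \<le> t" "t \<le> xm" and L: "L \<in> sets borel" "bounded L"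
  shows "ln (partition_sum r t L) = t * (LINT x:L|lborel. limit_ratio r t (L - {y \<in> L. y $ 1 < x $ 1}) x)"
proof -
  have "partition_sum r t (L - L) = partition_sum r t L *
      exp (- t * (LINT x:L \<inter> L|lborel. limit_ratio r t (L - {y \<in> L. y $ 1 < x $ 1}) x))"
    by (rule sweep_formula(1)[OF partition_sum_functional]) (use t L r_pos in auto)
  hence "1 = partition_sum r t L * exp (- (t * (LINT x:L|lborel. limit_ratio r t (L - {y \<in> L. y $ 1 < x $ 1}) x)))"
    by (simp add: partition_sum_empty)
  hence "partition_sum r t L = exp (t * (LINT x:L|lborel. limit_ratio r t (L - {y \<in> L. y $ 1 < x $ 1}) x))"
    by (simp add: exp_minus field_simps)
  thus ?thesis by simp
qed

text \<open>At points of the inner square, at distance \<open>m r\<close> or more from the boundary, the swept region looks like a half plane,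
  and \<open>limit_ratio_local\<close> applies; the remaining frame has an area proportional to the perimeter.\<close>

lemma ln_partition_sum_square:
  assumes t: "0 \<le> t" "t \<le> xm" and n: "2 * real m * r \<le> sqrt (real n)"
  shows "\<bar>ln (partition_sum r t (square_of_area n)) - real n * (t * limit_ratio r t right_half_plane 0)\<bar>
     \<le> t * (4 * ratio_error m * real n + 4 * real m * r * sqrt (real n))"
proof -
  define L where "L = square_of_area n"
  \<comment> \<open>The square has half side \<open>c\<close>, and its inner part \<open>I\<close> below stays at distance \<open>d\<close> from the boundary.\<close>
  define c where "c = sqrt (real n) / 2"
  define d where "d = real m * r"
  have d: "0 \<le> d" "d \<le> c" using n r_pos by (auto simp: d_def c_def)
  have L: "L \<in> sets borel" "bounded L" unfolding L_def square_eq_cbox by auto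
  have aL: "area L = real n" unfolding L_def square_eq_cbox by (subst area_cbox_plane) auto
  define I :: "plane set" where "I = cbox (\<chi> i. - (c - d)) (\<chi> i. c - d)"
  have aI: "area I = (2 * (c - d)) * (2 * (c - d))" unfolding I_def using d by (subst area_cbox_plane) auto
  have IL: "ball x d \<subseteq> L" if "x \<in> I" for x
  proof
    fix y assume y: "y \<in> ball x d"
    have 1: "\<bar>y $ i - x $ i\<bar> < d" for i
      using component_le_norm_cart[of "y - x" i] y by (simp add: dist_norm norm_minus_commute)
    have 2: "- (c - d) \<le> x $ i \<and> x $ i \<le> c - d" for i using that by (simp add: I_def mem_box_cart)
    have "\<bar>y $ i\<bar> \<le> c" for i using 1[of i] 2[of i] by linarith
    thus "y \<in> L" by (simp add: L_def square_of_area_def c_def)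
  qed
  have IsubL: "I \<subseteq> L"
  proof
    fix x assume "x \<in> I"
    hence 1: "- (c - d) \<le> x $ i \<and> x $ i \<le> c - d" for i by (simp add: I_def mem_box_cart)
    have "\<bar>x $ i\<bar> \<le> c" for i using 1[of i] d by linarith
    thus "x \<in> L" by (simp add: L_def square_of_area_def c_def)
  qed
  have Ib: "I \<in> sets borel" "bounded I" by (auto simp: I_def)
  define h where "h = limit_ratio r t right_half_plane 0"
  define f where "f x = limit_ratio r t (L - {y \<in> L. y $ 1 < x $ 1}) x" for x
  have Lm: "L - {y \<in> L. y $ 1 < u} \<in> sets borel" for u :: real
  proof -
    have "L - {y \<in> L. y $ 1 < u} = L - {y. y $ 1 < u}" by auto
    moreover have "{y::plane. y $ 1 < u} \<in> sets borel" by measurable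
    ultimately show ?thesis using L by auto
  qed
  have f01: "0 \<le> f x" "f x \<le> 1" for x unfolding f_def using limit_ratio_bounds[OF t Lm] by auto
  have h01: "0 \<le> h" "h \<le> 1" unfolding h_def using limit_ratio_bounds[OF t right_half_plane_borel] by auto
  have fh: "\<bar>f x - h\<bar> \<le> 4 * ratio_error m" if x: "x \<in> I" for x
  proof -
    have "h = limit_ratio r t ((+) x ` right_half_plane) (x + 0)" unfolding h_def limit_ratio_translate ..
    also have "(+) x ` right_half_plane = {y. x $ 1 \<le> y $ 1}"
    proof (rule set_eqI)
      fix y
      have "y = x + (y - x)" by simp
      thus "y \<in> (+) x ` right_half_plane \<longleftrightarrow> y \<in> {y. x $ 1 \<le> y $ 1}"
        unfolding right_half_plane_def by (auto simp: image_iff intro!: exI[of _ "y - x"])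
    qed
    finally have h: "h = limit_ratio r t {y. x $ 1 \<le> y $ 1} x" by simp
    show ?thesis unfolding h f_def
    proof (rule limit_ratio_local[OF t Lm])
      show "{y::plane. x $ 1 \<le> y $ 1} \<in> sets borel" by measurable
      show "(L - {y \<in> L. y $ 1 < x $ 1}) \<inter> ball x (real m * r) = {y. x $ 1 \<le> y $ 1} \<inter> ball x (real m * r)"
        using IL[OF x] unfolding d_def by auto
    qed
  qed
  have fint: "set_integrable lborel B f" if "B \<in> sets borel" "bounded B" "B \<subseteq> L" for B
  proof -
    have "(\<lambda>x. indicator L x * f x) \<in> borel_measurable borel" unfolding f_def
      by (rule sweep_formula(2)[OF partition_sum_functional]) (use t L r_pos in auto)
    hence "set_integrable lborel B (\<lambda>x. indicator L x * f x)"
      using that f01 by (intro set_integrable_bounded[where K=1]) (auto simp: indicator_def)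
    moreover have "(\<lambda>x. indicator B x *\<^sub>R (indicator L x * f x)) = (\<lambda>x. indicator B x *\<^sub>R f x)"
      using that by (auto simp: fun_eq_iff indicator_def subset_iff)
    ultimately show ?thesis by (simp add: set_integrable_def)
  qed
  have cint: "set_integrable lborel B (\<lambda>_. h)" if "B \<in> sets borel" "bounded B" for B :: "plane set"
    using that by (intro set_integrable_bounded[where K="\<bar>h\<bar>"]) auto
  have "(LINT x:L|lborel. f x) - real n * h = (LINT x:L|lborel. f x - h)"
    using fint[OF L] cint[OF L] L by (simp add: set_integral_diff) (simp add: set_lebesgue_integral_def aL)
  also have "\<dots> = (LINT x:I|lborel. f x - h) + (LINT x:L - I|lborel. f x - h)"
  proof -
    have "L = I \<union> (L - I)" using IsubL by auto
    moreover have "bounded (L - I)" "L - I \<in> sets borel" using L Ib by (auto intro: bounded_subset)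
    ultimately show ?thesis using IsubL Ib fint cint
      by (subst \<open>L = I \<union> (L - I)\<close>, subst set_integral_Un) (auto intro!: set_integral_diff(1))
  qed
  also have "\<bar>\<dots>\<bar> \<le> 4 * ratio_error m * area I + 1 * area (L - I)"
  proof -
    have "norm (LINT x:I|lborel. f x - h) \<le> 4 * ratio_error m * area I"
      using Ib fh by (intro set_integral_norm_bound) auto
    moreover have "norm (f x - h) \<le> 1" for x using f01[of x] h01 by auto
    hence "norm (LINT x:L - I|lborel. f x - h) \<le> 1 * area (L - I)"
      using L Ib by (intro set_integral_norm_bound) (auto intro: bounded_subset)
    ultimately show ?thesis by simp
  qed
  also have "area (L - I) = area L - area I"
    using L Ib IsubL finite_area[OF L(2)] by (intro measure_Diff) auto
  also have "4 * ratio_error m * area I + 1 * (area L - area I) \<le> 4 * ratio_error m * real n + 4 * real m * r * sqrt (real n)"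
  proof -
    have "0 \<le> 4 * ratio_error m"
      using order.trans[OF norm_ge_zero iterate_limit(2)[OF self_close t right_half_plane_borel, of m 0]] by simp
    moreover have "area I \<le> real n" using area_mono[OF L(2) IsubL L(1) Ib(1)] aL by simp
    ultimately have "4 * ratio_error m * area I \<le> 4 * ratio_error m * real n" by (rule mult_left_mono[rotated])
    moreover have "area L - area I \<le> 4 * d * (2 * c)"
    proof -
      have "real n = (2 * c) * (2 * c)" by (simp add: c_def)
      thus ?thesis using d unfolding aI aL by (simp add: algebra_simps)
    qed
    moreover have "4 * d * (2 * c) = 4 * real m * r * sqrt (real n)" by (simp add: c_def d_def)
    ultimately show ?thesis by simp
  qed
  finally have "\<bar>(LINT x:L|lborel. f x) - real n * h\<bar> \<le> 4 * ratio_error m * real n + 4 * real m * r * sqrt (real n)" .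
  moreover have "ln (partition_sum r t L) - real n * (t * h) = t * ((LINT x:L|lborel. f x) - real n * h)"
    unfolding ln_partition_sum[OF t L] f_def by (simp add: algebra_simps)
  ultimately show ?thesis unfolding L_def[symmetric] h_def[symmetric] using t
    by (simp add: abs_mult mult_left_mono)
qed

text \<open>Divide \<open>ln_partition_sum_square\<close> by the area; first \<open>m\<close> is chosen large, then \<open>n\<close>.\<close>

lemma pressure_limit:
  assumes t: "0 \<le> t" "t \<le> xm"
  shows "finite_volume_pressure (hard_sphere r) t \<longlonglongrightarrow> t * limit_ratio r t right_half_plane 0"
proof (rule metric_LIMSEQ_I)
  fix e :: real assume e: "0 < e"
  define p where "p = t * limit_ratio r t right_half_plane 0"
  have "(\<lambda>m. t * (4 * ratio_error m)) \<longlonglongrightarrow> t * (4 * 0)" by (intro tendsto_intros ratio_error_tendsto)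
  hence "\<forall>\<^sub>F m in sequentially. t * (4 * ratio_error m) < e / 2" using e by (intro order_tendstoD(2)[of _ 0]) auto
  then obtain m where m: "t * (4 * ratio_error m) < e / 2" using eventually_happens'[OF sequentially_bot] by blast
  have sq: "filterlim (\<lambda>n. sqrt (real n)) at_top sequentially"
    by (rule filterlim_compose[OF sqrt_at_top filterlim_real_sequentially])
  have "(\<lambda>n. t * (4 * real m * r) / sqrt (real n)) \<longlonglongrightarrow> 0"
    by (rule real_tendsto_divide_at_top[OF tendsto_const sq])
  hence "\<forall>\<^sub>F n in sequentially. t * (4 * real m * r) / sqrt (real n) < e / 2" using e by (intro order_tendstoD(2)[of _ 0]) auto
  moreover have "\<forall>\<^sub>F n in sequentially. 2 * real m * r \<le> sqrt (real n)" using sq by (simp add: filterlim_at_top)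
  ultimately have "\<forall>\<^sub>F n in sequentially. dist (finite_volume_pressure (hard_sphere r) t n) p < e"
    using eventually_gt_at_top[of 0]
  proof eventually_elim
    case (elim n)
    have n: "0 < real n" using elim by simp
    have L: "square_of_area n \<in> sets borel" "bounded (square_of_area n)" by (auto simp: square_eq_cbox)
    have "finite_volume_pressure (hard_sphere r) t n = ln (partition_sum r t (square_of_area n)) / real n"
      by (simp add: finite_volume_pressure_def partition_function_eq[OF L t(1)])
    hence "finite_volume_pressure (hard_sphere r) t n - p = (ln (partition_sum r t (square_of_area n)) - real n * p) / real n"
      using n by (simp add: field_simps)
    hence "\<bar>finite_volume_pressure (hard_sphere r) t n - p\<bar> \<le> t * (4 * ratio_error m * real n + 4 * real m * r * sqrt (real n)) / real n"
      using ln_partition_sum_square[OF t elim(2)] n unfolding p_def[symmetric] by (simp add: divide_right_mono abs_divide)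
    also have "\<dots> = t * (4 * ratio_error m) + t * (4 * real m * r) / sqrt (real n)"
      using n by (simp add: field_simps)
    also have "\<dots> < e" using m elim(1) by simp
    finally show ?case by (simp add: dist_real_def)
  qed
  thus "\<exists>N. \<forall>n\<ge>N. dist (finite_volume_pressure (hard_sphere r) t n) (t * limit_ratio r t right_half_plane 0) < e"
    unfolding eventually_sequentially p_def .
qed

definition good_activities :: "complex set" where
  "good_activities = (\<Union>t\<in>{0..xm}. ball (of_real t) \<delta>)"

text \<open>The rate \<open>ratio_error\<close> is uniform in the activity, so the holomorphic iterates converge locally
  uniformly.\<close>

lemma limit_holomorphic:
  assumes "S \<in> sets borel"
  shows "(\<lambda>z. lim (\<lambda>n. iterate r n z S x)) holomorphic_on good_activities"
proof (rule holomorphic_uniform_sequence[where f="\<lambda>n z. iterate r n z S x"])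
  show op: "open good_activities" unfolding good_activities_def by auto
  show "(\<lambda>z. iterate r n z S x) holomorphic_on good_activities" for n
    using iterate_holomorphic[OF assms] by (rule holomorphic_on_subset) auto
  fix z assume "z \<in> good_activities"
  then obtain d where d: "0 < d" "cball z d \<subseteq> good_activities" using op open_contains_cball by blast
  have "uniform_limit (cball z d) (\<lambda>n z. iterate r n z S x) (\<lambda>z. lim (\<lambda>n. iterate r n z S x)) sequentially"
    unfolding uniform_limit_iff
  proof (intro allI impI)
    fix e :: real assume "0 < e"
    hence "\<forall>\<^sub>F n in sequentially. ratio_error n < e" using ratio_error_tendsto by (intro order_tendstoD(2))
    thus "\<forall>\<^sub>F n in sequentially. \<forall>w\<in>cball z d. dist (iterate r n w S x) (lim (\<lambda>n. iterate r n w S x)) < e"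
    proof eventually_elim
      case (elim n)
      show ?case
      proof
        fix w assume "w \<in> cball z d"
        then obtain t where t: "t \<in> {0..xm}" "w \<in> ball (of_real t) \<delta>" using d by (auto simp: good_activities_def)
        hence "norm (w - of_real t) \<le> \<delta>" by (simp add: dist_norm norm_minus_commute)
        from iterate_limit(2)[OF this _ _ assms, of n x] show "dist (iterate r n w S x) (lim (\<lambda>n. iterate r n w S x)) < e"
          using t elim by (simp add: dist_norm)
      qed
    qed
  qed
  thus "\<exists>d>0. cball z d \<subseteq> good_activities \<and> uniform_limit (cball z d) (\<lambda>n z. iterate r n z S x) (\<lambda>z. lim (\<lambda>n. iterate r n z S x)) sequentially"
    using d by blast
qed

end

text \<open>One formula, \<open>z\<close> times the squared limit of the iterates at the half plane, serves for all activities. The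
  neighbourhoods obtained for the compact intervals \<open>[0, t]\<close> with \<open>t < b\<close> can therefore simply be united.\<close>

theorem pressure_analytic:
  assumes "0 < r" and b: "b = exp 1 / (sqrt (1 / 2 + 3 * sqrt 3 / (8 * pi)) * (pi * r\<^sup>2))"
  shows "0 \<le> z \<Longrightarrow> z < b \<Longrightarrow> convergent (finite_volume_pressure (hard_sphere r) z)"
    and "real_analytic_on (pressure (hard_sphere r)) {0..<b}"
proof -
  show "convergent (finite_volume_pressure (hard_sphere r) z)" if z: "0 \<le> z" "z < b" for z
  proof -
    obtain \<delta> \<epsilon> \<kappa> \<theta> M where "contraction r z \<delta> \<epsilon> \<kappa> \<theta> M" using contraction_parameters[OF assms(1) z(1)] z(2) b by blast
    then interpret contraction r z \<delta> \<epsilon> \<kappa> \<theta> M .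
    show ?thesis using pressure_limit[OF z(1)] by (auto simp: convergent_def)
  qed
  define good where "good \<delta> t = (\<Union>s\<in>{0..t}. ball (complex_of_real s) \<delta>)" for \<delta> t :: real
  \<comment> \<open>The sets \<open>good_activities\<close> of all contractions for radius \<open>r\<close>, described outside of the locale.\<close>
  define \<U> where "\<U> = {good \<delta> t |\<delta> t. 0 < \<delta> \<and> 0 \<le> t \<and> (\<exists>\<epsilon> \<kappa> \<theta> M. contraction r t \<delta> \<epsilon> \<kappa> \<theta> M)}"
  define f where "f z = z * (lim (\<lambda>n. iterate r n z right_half_plane 0))\<^sup>2" for z
  have op: "open V" if "V \<in> \<U>" for V using that by (auto simp: \<U>_def good_def)
  have hol: "f holomorphic_on V" if V: "V \<in> \<U>" for V
  proof -
    obtain \<delta> t \<epsilon> \<kappa> \<theta> M where V: "V = good \<delta> t" and c: "contraction r t \<delta> \<epsilon> \<kappa> \<theta> M" using V by (auto simp: \<U>_def)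
    interpret contraction r t \<delta> \<epsilon> \<kappa> \<theta> M by fact
    have "V = good_activities" by (simp add: V good_def good_activities_def)
    thus ?thesis unfolding f_def using limit_holomorphic[OF right_half_plane_borel, of 0]
      by (auto intro!: holomorphic_intros)
  qed
  show "real_analytic_on (pressure (hard_sphere r)) {0..<b}"
    unfolding real_analytic_on_def
  proof (intro exI conjI ballI)
    show "open (\<Union>\<U>)" using op by blast
    show "f holomorphic_on \<Union>\<U>"
      using holomorphic_on_UN_open[of \<U> f "\<lambda>V. V"] hol op by simp
    show "complex_of_real ` {0..<b} \<subseteq> \<Union>\<U>"
    proof
      fix w assume "w \<in> complex_of_real ` {0..<b}"
      then obtain t where t: "w = of_real t" "0 \<le> t" "t < b" by auto
      obtain \<delta> \<epsilon> \<kappa> \<theta> M where c: "0 < \<delta>" "contraction r t \<delta> \<epsilon> \<kappa> \<theta> M"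
        using contraction_parameters[OF assms(1) t(2)] t(3) b by blast
      hence "good \<delta> t \<in> \<U>" using t unfolding \<U>_def by blast
      moreover have "w \<in> good \<delta> t" using t c by (auto simp: good_def intro!: bexI[of _ t])
      ultimately show "w \<in> \<Union>\<U>" by blast
    qed
    fix t assume "t \<in> {0..<b}"
    hence t: "0 \<le> t" "t < b" by auto
    obtain \<delta> \<epsilon> \<kappa> \<theta> M where "contraction r t \<delta> \<epsilon> \<kappa> \<theta> M"
      using contraction_parameters[OF assms(1) t(1)] t(2) b by blast
    then interpret contraction r t \<delta> \<epsilon> \<kappa> \<theta> M .
    have "pressure (hard_sphere r) t = t * limit_ratio r t right_half_plane 0"
      unfolding pressure_def using pressure_limit[OF t(1)] by (intro limI) auto
    moreover have "of_real (limit_ratio r t right_half_plane 0) = (lim (\<lambda>n. iterate r n (of_real t) right_half_plane 0))\<^sup>2"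
      unfolding limit_ratio_def by (subst limit_root(1)[OF t(1) _ right_half_plane_borel, of 0]) auto
    ultimately show "f (complex_of_real t) = complex_of_real (pressure (hard_sphere r) t)" by (simp add: f_def)
  qed
qed

section \<open>Void probabilities in infinite volume\<close>

abbreviation cobounded_borel :: "plane set set" where
  "cobounded_borel \<equiv> {S. S \<in> sets borel \<and> bounded (- S)}"

context contraction
begin

text \<open>The sweep formula for \<open>A = - S\<close> in the full plane, with the normalization \<open>1\<close> at the full plane.
  It is the only candidate for the probability that there is no point outside \<open>S\<close>.\<close>

definition void_prob :: "real \<Rightarrow> plane set \<Rightarrow> real" where
  "void_prob t S = exp (- t * (LINT x:- S|lborel. limit_ratio r t (- {y \<in> - S. y $ 1 < x $ 1}) x))"

text \<open>In finite volume the ratio is given by the sweep formula. Its integrand converges pointwise because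
  vacancy ratios are local, and it is bounded by \<open>1\<close> on the bounded set \<open>- S\<close>.\<close>

lemma void_prob_limit:
  assumes t: "0 \<le> t" "t \<le> xm" and S: "S \<in> cobounded_borel"
  shows "(\<lambda>n. partition_sum r t (ball 0 (real n) \<inter> S) / partition_sum r t (ball 0 (real n))) \<longlonglongrightarrow> void_prob t S"
proof -
  let ?A = "- S" and ?B = "\<lambda>n. ball (0::plane) (real n)"
  have A: "?A \<in> sets borel" "bounded ?A" using S by auto
  note F = partition_sum_functional[OF r_pos t(1)]
  have B: "?B n \<in> {S. S \<in> sets borel \<and> bounded S}" for n by auto
  define g where "g n x = limit_ratio r t (?B n - {y \<in> ?A. y $ 1 < x $ 1}) x" for n x
  define g' where "g' x = limit_ratio r t (- {y \<in> ?A. y $ 1 < x $ 1}) x" for x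
  have Em: "{y \<in> ?A. y $ 1 < u} \<in> sets borel" for u using A(1) by measurable
  have g01: "0 \<le> g n x" "g n x \<le> 1" for n x unfolding g_def using limit_ratio_bounds[OF t] Em by auto
  have gl: "(\<lambda>n. g n x) \<longlonglongrightarrow> g' x" for x unfolding g_def g'_def
  proof (rule limit_ratio_tendsto[OF t])
    fix \<rho> :: real
    obtain N where N: "norm x + \<rho> \<le> real N" using real_arch_simple by blast
    have "ball x \<rho> \<subseteq> ?B n" if "N \<le> n" for n
    proof
      fix y assume "y \<in> ball x \<rho>"
      hence "norm y < norm x + \<rho>" using norm_triangle_sub[of y x] by (simp add: dist_norm norm_minus_commute)
      thus "y \<in> ?B n" using N that by auto
    qed
    thus "\<forall>\<^sub>F n in sequentially. (?B n - {y \<in> ?A. y $ 1 < x $ 1}) \<inter> ball x \<rho> = - {y \<in> ?A. y $ 1 < x $ 1} \<inter> ball x \<rho>"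
      unfolding eventually_sequentially by (intro exI[of _ N]) auto
  qed (use Em in auto)
  have gm: "(\<lambda>x. indicator ?A x * g n x) \<in> borel_measurable borel" for n
    unfolding g_def by (rule sweep_formula(2)[OF F t(2) B A])
  have g'm: "(\<lambda>x. indicator ?A x * g' x) \<in> borel_measurable borel"
    by (rule borel_measurable_LIMSEQ_real[OF tendsto_mult[OF tendsto_const gl] gm])
  have "(\<lambda>n. LINT x|lborel. indicator (?B n) x * (indicator ?A x * g n x)) \<longlonglongrightarrow> (LINT x|lborel. indicator ?A x * g' x)"
  proof (rule integral_dominated_convergence[where w="indicator ?A"])
    show "(\<lambda>x. indicator ?A x * g' x) \<in> borel_measurable lborel" using g'm by simp
    show "(\<lambda>x. indicator (?B n) x * (indicator ?A x * g n x)) \<in> borel_measurable lborel" for n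
      using borel_measurable_times[OF borel_measurable_indicator gm[of n], of "?B n"] by simp
    show "integrable lborel (indicator ?A :: plane \<Rightarrow> real)" using A finite_area[OF A(2)] by simp
    show "AE x in lborel. (\<lambda>n. indicator (?B n) x * (indicator ?A x * g n x)) \<longlonglongrightarrow> indicator ?A x * g' x"
    proof (intro AE_I2)
      fix x :: plane
      obtain N where N: "norm x < real N" using reals_Archimedean2 by blast
      have "(\<lambda>n. indicator ?A x * g n x) \<longlonglongrightarrow> indicator ?A x * g' x" by (intro tendsto_mult tendsto_const gl)
      moreover have "\<forall>\<^sub>F n in sequentially. indicator ?A x * g n x = indicator (?B n) x * (indicator ?A x * g n x)"
        unfolding eventually_sequentially using N by (intro exI[of _ N]) (auto simp: indicator_def)
      ultimately show "(\<lambda>n. indicator (?B n) x * (indicator ?A x * g n x)) \<longlonglongrightarrow> indicator ?A x * g' x"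
        by (rule Lim_transform_eventually)
    qed
    show "AE x in lborel. norm (indicator (?B n) x * (indicator ?A x * g n x)) \<le> indicator ?A x" for n
      using g01 by (auto simp: indicator_def)
  qed
  hence "(\<lambda>n. exp (- t * (LINT x|lborel. indicator (?B n) x * (indicator ?A x * g n x)))) \<longlonglongrightarrow> exp (- t * (LINT x|lborel. indicator ?A x * g' x))"
    by (intro tendsto_intros)
  moreover have "partition_sum r t (?B n \<inter> S) / partition_sum r t (?B n) = exp (- t * (LINT x|lborel. indicator (?B n) x * (indicator ?A x * g n x)))" for n
  proof -
    have e: "?B n \<inter> S = ?B n - ?A" by auto
    have "0 < partition_sum r t (?B n)" using partition_sum_ge_1[of "?B n" t r] t by simp
    moreover have "(LINT x:?A \<inter> ?B n|lborel. g n x) = (LINT x|lborel. indicator (?B n) x * (indicator ?A x * g n x))"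
      unfolding set_lebesgue_integral_def by (intro Bochner_Integration.integral_cong refl) (auto simp: indicator_def)
    ultimately show ?thesis unfolding e
      by (subst sweep_formula(1)[OF F t(2) B A]) (simp add: g_def)
  qed
  moreover have "void_prob t S = exp (- t * (LINT x|lborel. indicator ?A x * g' x))"
    by (simp add: void_prob_def set_lebesgue_integral_def g'_def)
  ultimately show ?thesis by simp
qed

lemma void_prob_UNIV: "void_prob t UNIV = 1"
  by (simp add: void_prob_def set_lebesgue_integral_def)

text \<open>The removal identity is linear in the functional, so it passes from the normalized partition functions to their
  limit by dominated convergence.\<close>

lemma void_prob_functional:
  assumes t: "0 \<le> t" "t \<le> xm"
  shows "positive_removal_functional r t cobounded_borel (void_prob t)"
proof -
  let ?B = "\<lambda>n. ball (0::plane) (real n)"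
  define F where "F n S = partition_sum r t (?B n \<inter> S) / partition_sum r t (?B n)" for n S
  interpret Z: positive_removal_functional r t "{S. S \<in> sets borel \<and> bounded S}" "partition_sum r t"
    by (rule partition_sum_functional[OF r_pos t(1)])
  have B: "?B n \<inter> S \<in> {S. S \<in> sets borel \<and> bounded S}" if "S \<in> sets borel" for S n using that by (auto intro: bounded_subset[OF bounded_ball])
  have Zpos: "0 < partition_sum r t (?B n)" for n using Z.q_pos[of "?B n"] by auto
  have diff: "S - C \<in> cobounded_borel" if "S \<in> cobounded_borel" "C \<in> sets borel" "bounded C" for S C
  proof -
    have "- (S - C) = - S \<union> C" by auto
    thus ?thesis using that by auto
  qed
  have Fl: "(\<lambda>n. F n S) \<longlonglongrightarrow> void_prob t S" if "S \<in> cobounded_borel" for S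
    unfolding F_def by (rule void_prob_limit[OF t that])
  have eq: "?B n \<inter> (S - C) = ?B n \<inter> S - C" for n S C by auto
  have Fm: "(\<lambda>x. F n (S - ball x r)) \<in> borel_measurable borel" if "S \<in> cobounded_borel" for S n
    unfolding F_def eq using Z.q_measurable[OF B, of S n] that by auto
  have F01: "0 \<le> F n S" "F n S \<le> 1" if "S \<in> sets borel" for n S
  proof -
    show "0 \<le> F n S" unfolding F_def using Z.q_nonneg[OF B[OF that]] Zpos[of n] by auto
    have "?B n \<inter> S = ?B n - (?B n - S)" by auto
    hence "partition_sum r t (?B n \<inter> S) \<le> partition_sum r t (?B n)"
      using Z.q_antimono[of "?B n - S" "?B n"] that by (auto intro: bounded_subset[OF bounded_ball])
    thus "F n S \<le> 1" unfolding F_def using Zpos[of n] by simp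
  qed
  have Frem: "F n S - F n (S - D) = t * (LINT x:D \<inter> (?B n \<inter> S)|lborel. F n (S - ball x r))"
    if "S \<in> cobounded_borel" "D \<in> sets borel" "\<And>x y. x \<in> D \<Longrightarrow> y \<in> D \<Longrightarrow> dist x y < r" for S D n
  proof -
    have "F n S - F n (S - D) = (partition_sum r t (?B n \<inter> S) - partition_sum r t (?B n \<inter> S - D)) / partition_sum r t (?B n)"
      unfolding F_def eq by (simp add: diff_divide_distrib)
    also have "\<dots> = t * (LINT x:D \<inter> (?B n \<inter> S)|lborel. partition_sum r t (?B n \<inter> S - ball x r)) / partition_sum r t (?B n)"
      using Z.removal[OF B that(2,3), of S n] that(1) by auto
    also have "\<dots> = t * (LINT x:D \<inter> (?B n \<inter> S)|lborel. F n (S - ball x r))"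
      unfolding F_def eq by simp
    finally show ?thesis .
  qed
  show ?thesis
  proof
    fix S assume S: "S \<in> cobounded_borel"
    show "0 < void_prob t S" "0 \<le> void_prob t S" by (auto simp: void_prob_def)
    show "S \<in> sets borel" using S by auto
    have SB: "S - ball x r \<in> cobounded_borel" for x by (rule diff[OF S]) auto
    show m: "(\<lambda>x. void_prob t (S - ball x r)) \<in> borel_measurable borel"
      by (rule borel_measurable_LIMSEQ_real[OF Fl[OF SB] Fm[OF S]])
    fix D :: "plane set" assume D: "D \<in> sets borel" "\<And>x y. x \<in> D \<Longrightarrow> y \<in> D \<Longrightarrow> dist x y < r"
    have bD: "bounded D" by (rule bounded_if_small) (rule D(2))
    have "(\<lambda>n. LINT x|lborel. indicator (D \<inter> (?B n \<inter> S)) x * F n (S - ball x r)) \<longlonglongrightarrow> (LINT x|lborel. indicator (D \<inter> S) x * void_prob t (S - ball x r))"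
    proof (rule integral_dominated_convergence[where w="indicator D"])
      show "(\<lambda>x. indicator (D \<inter> S) x * void_prob t (S - ball x r)) \<in> borel_measurable lborel"
        using m D(1) S by auto
      show "(\<lambda>x. indicator (D \<inter> (?B n \<inter> S)) x * F n (S - ball x r)) \<in> borel_measurable lborel" for n
        using borel_measurable_times[OF borel_measurable_indicator Fm[OF S, of n], of "D \<inter> (?B n \<inter> S)"] D(1) S by auto
      show "integrable lborel (indicator D :: plane \<Rightarrow> real)" using D finite_area[OF bD] by simp
      show "AE x in lborel. (\<lambda>n. indicator (D \<inter> (?B n \<inter> S)) x * F n (S - ball x r)) \<longlonglongrightarrow> indicator (D \<inter> S) x * void_prob t (S - ball x r)"
      proof (intro AE_I2)
        fix x :: plane
        obtain N where N: "norm x < real N" using reals_Archimedean2 by blast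
        have "(\<lambda>n. indicator (D \<inter> S) x * F n (S - ball x r)) \<longlonglongrightarrow> indicator (D \<inter> S) x * void_prob t (S - ball x r)"
          by (intro tendsto_mult tendsto_const Fl SB)
        moreover have "\<forall>\<^sub>F n in sequentially. indicator (D \<inter> S) x * F n (S - ball x r) = indicator (D \<inter> (?B n \<inter> S)) x * F n (S - ball x r)"
          unfolding eventually_sequentially using N by (intro exI[of _ N]) (auto simp: indicator_def)
        ultimately show "(\<lambda>n. indicator (D \<inter> (?B n \<inter> S)) x * F n (S - ball x r)) \<longlonglongrightarrow> indicator (D \<inter> S) x * void_prob t (S - ball x r)"
          by (rule Lim_transform_eventually)
      qed
      show "AE x in lborel. norm (indicator (D \<inter> (?B n \<inter> S)) x * F n (S - ball x r)) \<le> indicator D x" for n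
        using F01[of "S - ball _ r" n] S by (auto simp: indicator_def)
    qed
    hence "(\<lambda>n. t * (LINT x:D \<inter> (?B n \<inter> S)|lborel. F n (S - ball x r))) \<longlonglongrightarrow> t * (LINT x:D \<inter> S|lborel. void_prob t (S - ball x r))"
      unfolding set_lebesgue_integral_def real_scaleR_def by (intro tendsto_intros)
    moreover have "(\<lambda>n. F n S - F n (S - D)) \<longlonglongrightarrow> void_prob t S - void_prob t (S - D)"
      using S D bD by (intro tendsto_diff Fl diff) auto
    ultimately show "void_prob t S - void_prob t (S - D) = t * (LINT x:D \<inter> S|lborel. void_prob t (S - ball x r))"
      using Frem[OF S D] LIMSEQ_unique by simp
  qed (use r_pos t diff in auto)
qed

lemma functional_eq_void_prob:
  assumes "positive_removal_functional r t cobounded_borel q" "t \<le> xm" "q UNIV = 1" "S \<in> cobounded_borel"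
  shows "q S = void_prob t S"
proof -
  have "q (UNIV - (- S)) = q UNIV * exp (- t * (LINT x:- S \<inter> UNIV|lborel. limit_ratio r t (UNIV - {y \<in> - S. y $ 1 < x $ 1}) x))"
    using assms(4) by (intro sweep_formula(1)[OF assms(1,2)]) auto
  thus ?thesis using assms(3) by (simp add: void_prob_def flip: Compl_eq_Diff_UNIV)
qed

end

section \<open>Void probabilities of Gibbs measures\<close>

definition void :: "plane set \<Rightarrow> plane set set" where
  "void A = {X. loc_finite X \<and> X \<inter> A = {}}"

abbreviation void_events :: "plane set set set" where
  "void_events \<equiv> {void A |A. A \<in> sets borel \<and> bounded A}"

lemma loc_finite_Int: "loc_finite X \<Longrightarrow> bounded B \<Longrightarrow> finite (X \<inter> B)"
  by (simp add: loc_finite_def)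

lemma space_config: "space config_space = {X. loc_finite X}"
  by (simp add: config_space_def space_measure_of_conv)

lemma sets_config:
  "sets config_space = sigma_sets {X. loc_finite X} {{X. loc_finite X \<and> card (X \<inter> B) = k} |B k. bounded B \<and> B \<in> sets borel}"
  unfolding config_space_def by (rule sets_measure_of) auto

lemma count_event: "bounded B \<Longrightarrow> B \<in> sets borel \<Longrightarrow> {X. loc_finite X \<and> card (X \<inter> B) = k} \<in> sets config_space"
  unfolding sets_config by (intro sigma_sets.Basic) blast

lemma void_event: assumes "A \<in> sets borel" "bounded A" shows "void A \<in> sets config_space"
proof -
  have "void A = {X. loc_finite X \<and> card (X \<inter> A) = 0}"
    using loc_finite_Int[OF _ assms(2)] by (auto simp: void_def)
  thus ?thesis using count_event[OF assms(2,1)] by simp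
qed

lemma separated_finite:
  assumes "finite (P :: plane set)"
  shows "\<exists>\<delta>>0. \<forall>p\<in>P. \<forall>q\<in>P. p \<noteq> q \<longrightarrow> \<delta> \<le> dist p q"
  using assms
proof (induction P rule: finite_induct)
  case empty show ?case by (intro exI[of _ 1]) auto
next
  case (insert a P)
  then obtain \<delta> where \<delta>: "0 < \<delta>" "\<And>p q. p \<in> P \<Longrightarrow> q \<in> P \<Longrightarrow> p \<noteq> q \<Longrightarrow> \<delta> \<le> dist p q" by blast
  obtain d where d: "0 < d" "\<And>x. x \<in> P \<Longrightarrow> x \<noteq> a \<Longrightarrow> d \<le> dist a x"
    using finite_set_avoid[OF insert(1), of a] by blast
  show ?case
  proof (intro exI[of _ "min \<delta> d"] conjI ballI impI)
    show "0 < min \<delta> d" using \<delta> d by simp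
    fix p q assume "p \<in> insert a P" "q \<in> insert a P" "p \<noteq> q"
    thus "min \<delta> d \<le> dist p q" using \<delta>(2)[of p q] d(2)[of p] d(2)[of q] by (auto simp: dist_commute min.coboundedI1 min.coboundedI2)
  qed
qed

text \<open>Counts can be recovered from void events: \<open>X \<inter> B\<close> has at least \<open>k\<close> points if and only if there are \<open>k\<close> disjoint
  members of a fixed countable basis each of which meets \<open>X \<inter> B\<close>.\<close>

lemma sets_config_void: "sets config_space = sigma_sets {X. loc_finite X} void_events"
proof
  have sub: "void_events \<subseteq> Pow {X. loc_finite X}" by (auto simp: void_def)
  interpret V: sigma_algebra "{X. loc_finite X}" "sigma_sets {X. loc_finite X} void_events"
    by (rule sigma_algebra_sigma_sets[OF sub])
  show "sigma_sets {X. loc_finite X} void_events \<subseteq> sets config_space"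
    using sets.sigma_sets_subset[of void_events config_space] void_event unfolding space_config by blast
  obtain \<B> :: "plane set set" where \<B>: "countable \<B>" "topological_basis \<B>" using ex_countable_basis by blast
  have B_borel: "U \<in> sets borel" if "U \<in> \<B>" for U using topological_basis_open[OF \<B>(2) that] by simp
  have ge: "{X. loc_finite X \<and> k \<le> card (X \<inter> B)} \<in> sigma_sets {X. loc_finite X} void_events"
    if B: "bounded B" "B \<in> sets borel" for B k
  proof -
    \<comment> \<open>The possible choices of \<open>k\<close> disjoint basic sets.\<close>
    define \<F> where "\<F> = {F. finite F \<and> F \<subseteq> \<B> \<and> card F = k \<and> (\<forall>U\<in>F. \<forall>V\<in>F. U \<noteq> V \<longrightarrow> U \<inter> V = {})}"
    have cF: "countable \<F>"
      by (rule countable_subset[OF _ countable_Collect_finite_subset[OF \<B>(1)]]) (auto simp: \<F>_def)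
    have eq: "{X. loc_finite X \<and> k \<le> card (X \<inter> B)} = (\<Union>F\<in>\<F>. {X. loc_finite X} \<inter> (\<Inter>U\<in>F. {X. loc_finite X} - void (B \<inter> U)))"
    proof (intro equalityI subsetI)
      fix X assume "X \<in> {X. loc_finite X \<and> k \<le> card (X \<inter> B)}"
      hence X: "loc_finite X" "k \<le> card (X \<inter> B)" by auto
      obtain P where P: "P \<subseteq> X \<inter> B" "card P = k" "finite P"
        using obtain_subset_with_card_n[OF X(2)] by (metis finite_subset loc_finite_Int[OF X(1) B(1)])
      obtain \<delta> where \<delta>: "0 < \<delta>" "\<And>p q. p \<in> P \<Longrightarrow> q \<in> P \<Longrightarrow> p \<noteq> q \<Longrightarrow> \<delta> \<le> dist p q"
        using separated_finite[OF P(3)] by blast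
      have "\<exists>U. U \<in> \<B> \<and> p \<in> U \<and> U \<subseteq> ball p (\<delta> / 2)" for p
        using topological_basisE[OF \<B>(2), of "ball p (\<delta> / 2)" p] \<delta>(1) by (metis centre_in_ball half_gt_zero open_ball)
      then obtain U where U: "\<And>p. U p \<in> \<B>" "\<And>p. p \<in> U p" "\<And>p. U p \<subseteq> ball p (\<delta> / 2)" by metis
      have dis: "U p \<inter> U p' = {}" if "p \<in> P" "p' \<in> P" "p \<noteq> p'" for p p'
      proof (rule ccontr)
        assume "U p \<inter> U p' \<noteq> {}"
        then obtain w where "w \<in> U p" "w \<in> U p'" by auto
        hence "dist p w < \<delta> / 2" "dist p' w < \<delta> / 2" using U(3)[of p] U(3)[of p'] by (metis mem_ball subsetD)+
        hence "dist p p' < \<delta>" by (metis dist_triangle_half_r dist_commute)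
        thus False using \<delta>(2)[OF that] by simp
      qed
      have "inj_on U P" using dis U(2) by (intro inj_onI) (metis Int_iff empty_iff)
      hence "card (U ` P) = k" using P by (simp add: card_image)
      moreover have "V \<inter> W = {}" if "V \<in> U ` P" "W \<in> U ` P" "V \<noteq> W" for V W
        using that dis by (elim imageE) blast
      moreover have "U ` P \<subseteq> \<B>" using U(1) by blast
      ultimately have "U ` P \<in> \<F>" using P(3) unfolding \<F>_def by simp
      moreover have "X \<in> {X. loc_finite X} \<inter> (\<Inter>V\<in>U ` P. {X. loc_finite X} - void (B \<inter> V))"
        using X P U(2) by (auto simp: void_def)
      ultimately show "X \<in> (\<Union>F\<in>\<F>. {X. loc_finite X} \<inter> (\<Inter>U\<in>F. {X. loc_finite X} - void (B \<inter> U)))" by blast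
    next
      fix X assume "X \<in> (\<Union>F\<in>\<F>. {X. loc_finite X} \<inter> (\<Inter>U\<in>F. {X. loc_finite X} - void (B \<inter> U)))"
      then obtain F where F1: "F \<in> \<F>" and F2: "X \<in> {X. loc_finite X} \<inter> (\<Inter>U\<in>F. {X. loc_finite X} - void (B \<inter> U))"
        by (rule UN_E)
      have "X \<inter> (B \<inter> U) \<noteq> {}" if "U \<in> F" for U
        using INT_D[OF IntD2[OF F2] that] by (simp add: void_def)
      with F1 IntD1[OF F2] have F: "F \<in> \<F>" "loc_finite X" "\<And>U. U \<in> F \<Longrightarrow> X \<inter> (B \<inter> U) \<noteq> {}"
        by simp_all
      define f where "f U = (SOME x. x \<in> X \<inter> (B \<inter> U))" for U
      have f: "f U \<in> X \<inter> (B \<inter> U)" if "U \<in> F" for U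
        unfolding f_def using F(3)[OF that] by (simp only: some_in_eq simp_thms)
      have "inj_on f F"
      proof (rule inj_onI, rule ccontr)
        fix U V assume "U \<in> F" "V \<in> F" "f U = f V" "U \<noteq> V"
        moreover from this have "U \<inter> V = {}" using F(1) by (auto simp: \<F>_def)
        ultimately show False using f[of U] f[of V] by auto
      qed
      hence "k = card (f ` F)" using F(1) by (simp add: card_image \<F>_def)
      also have "\<dots> \<le> card (X \<inter> B)" using f loc_finite_Int[OF F(2) B(1)] by (intro card_mono) auto
      finally show "X \<in> {X. loc_finite X \<and> k \<le> card (X \<inter> B)}" using F(2) by simp
    qed
    have vU: "void (B \<inter> U) \<in> sigma_sets {X. loc_finite X} void_events" if "U \<in> \<B>" for U
      using B B_borel[OF that] by (intro sigma_sets.Basic) (auto intro!: bounded_subset[OF B(1)])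
    have "{X. loc_finite X} \<inter> (\<Inter>U\<in>F. {X. loc_finite X} - void (B \<inter> U)) \<in> sigma_sets {X. loc_finite X} void_events"
      if "F \<in> \<F>" for F
    proof (cases "F = {}")
      case False
      have "(\<Inter>U\<in>F. {X. loc_finite X} - void (B \<inter> U)) \<in> sigma_sets {X. loc_finite X} void_events"
        using that False vU by (intro V.finite_INT V.compl_sets) (auto simp: \<F>_def)
      thus ?thesis by (intro V.Int V.top)
    qed (use V.top in simp)
    thus ?thesis unfolding eq using cF by (intro V.countable_UN'') auto
  qed
  show "sets config_space \<subseteq> sigma_sets {X. loc_finite X} void_events"
    unfolding sets_config
  proof (rule V.sigma_sets_subset, clarify)
    fix B :: "plane set" and k assume B: "bounded B" "B \<in> sets borel"
    have "{X. loc_finite X \<and> card (X \<inter> B) = k} = {X. loc_finite X \<and> k \<le> card (X \<inter> B)} - {X. loc_finite X \<and> Suc k \<le> card (X \<inter> B)}"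
      by auto
    thus "{X. loc_finite X \<and> card (X \<inter> B) = k} \<in> sigma_sets {X. loc_finite X} void_events"
      using V.Diff[OF ge[OF B] ge[OF B]] by simp
  qed
qed

lemma void_Un: "void A \<inter> void B = void (A \<union> B)"
  by (auto simp: void_def)

lemma void_empty: "void {} = {X. loc_finite X}"
  by (simp add: void_def)

lemma Int_stable_void: "Int_stable void_events"
proof (rule Int_stableI, clarify)
  fix A B :: "plane set" assume "A \<in> sets borel" "bounded A" "B \<in> sets borel" "bounded B"
  thus "\<exists>C. void A \<inter> void B = void C \<and> C \<in> sets borel \<and> bounded C" by (intro exI[of _ "A \<union> B"]) (auto simp: void_Un)
qed

lemma measurable_config:
  assumes "\<And>x. x \<in> space M \<Longrightarrow> loc_finite (f x)"
    and "\<And>A. A \<in> sets borel \<Longrightarrow> bounded A \<Longrightarrow> {x \<in> space M. f x \<inter> A = {}} \<in> sets M"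
  shows "f \<in> measurable M config_space"
proof (rule measurable_sigma_sets[OF sets_config_void])
  fix V assume "V \<in> void_events"
  then obtain A where A: "V = void A" "A \<in> sets borel" "bounded A" by auto
  have "f -` V \<inter> space M = {x \<in> space M. f x \<inter> A = {}}" using assms(1) by (auto simp: A void_def)
  thus "f -` V \<inter> space M \<in> sets M" using assms(2)[OF A(2,3)] by simp
qed (use assms in \<open>auto simp: void_def\<close>)

text \<open>Void events are stable under intersection, as \<open>void A \<inter> void B = void (A \<union> B)\<close>, and they generate.\<close>

lemma config_measure_eqI:
  assumes "prob_space M" "prob_space N" "sets M = sets config_space" "sets N = sets config_space"
    and "\<And>A. A \<in> sets borel \<Longrightarrow> bounded A \<Longrightarrow> measure M (void A) = measure N (void A)"
  shows "M = N"
proof (rule measure_eqI_generator_eq[OF Int_stable_void, where \<Omega>="{X. loc_finite X}" and A="\<lambda>_. void {}"])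
  interpret M: prob_space M by fact
  interpret N: prob_space N by fact
  show "emeasure M X = emeasure N X" if "X \<in> void_events" for X
    using that assms(5) by (auto simp: M.emeasure_eq_measure N.emeasure_eq_measure)
  show "emeasure M (void {}) \<noteq> \<infinity>" by simp
qed (use assms sets_config_void in \<open>auto simp: void_def intro: exI[of _ "{}"]\<close>)

lemma count_measurable: "bounded B \<Longrightarrow> B \<in> sets borel \<Longrightarrow> (\<lambda>X. card (X \<inter> B)) \<in> measurable config_space (count_space UNIV)"
  by (rule measurable_count_space_eq2_countable[THEN iffD2])
     (use count_event[of B] in \<open>auto simp: space_config vimage_def Collect_conj_eq[symmetric] conj_commute\<close>)

lemma void_pred: "A \<in> sets borel \<Longrightarrow> bounded A \<Longrightarrow> Measurable.pred config_space (\<lambda>X. X \<inter> A = {})"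
  unfolding pred_def using void_event[of A] by (simp add: void_def space_config)

lemma add_point_measurable: "(\<lambda>(x::plane, X). X \<union> {x}) \<in> measurable (borel \<Otimes>\<^sub>M config_space) config_space"
proof (rule measurable_config)
  fix p :: "plane \<times> plane set" assume "p \<in> space (borel \<Otimes>\<^sub>M config_space)"
  thus "loc_finite (case p of (x, X) \<Rightarrow> X \<union> {x})"
    by (auto simp: space_pair_measure space_config loc_finite_def Int_insert_left)
next
  fix A :: "plane set" assume A[measurable]: "A \<in> sets borel" and "bounded A"
  note [measurable] = void_pred[OF A \<open>bounded A\<close>]
  have "{p \<in> space (borel \<Otimes>\<^sub>M config_space). (case p of (x, X) \<Rightarrow> X \<union> {x}) \<inter> A = {}}
     = {p \<in> space (borel \<Otimes>\<^sub>M config_space). fst p \<notin> A \<and> snd p \<inter> A = {}}" by auto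
  also have "\<dots> \<in> sets (borel \<Otimes>\<^sub>M config_space)" by measurable
  finally show "{p \<in> space (borel \<Otimes>\<^sub>M config_space). (case p of (x, X) \<Rightarrow> X \<union> {x}) \<inter> A = {}} \<in> sets (borel \<Otimes>\<^sub>M config_space)" .
qed

text \<open>A point of \<open>X\<close> in the disk lies in one of countably many smaller balls that are contained in the disk.\<close>

lemma ball_void_pred: "Measurable.pred (borel \<Otimes>\<^sub>M config_space) (\<lambda>(x, X). X \<inter> ball x r = {})"
proof -
  obtain D :: "plane set" where D: "countable D" "\<And>U. open U \<Longrightarrow> U \<noteq> {} \<Longrightarrow> \<exists>d\<in>D. d \<in> U"
    using countable_dense_exists by blast
  \<comment> \<open>Centres range over a countable dense set and radii over the rationals.\<close>
  have eq: "(case p of (x, X) \<Rightarrow> X \<inter> ball x r = {}) \<longleftrightarrow>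
    \<not> (\<exists>c\<in>D. \<exists>e\<in>\<rat>. dist (fst p) c + e \<le> r \<and> \<not> snd p \<inter> ball c e = {})" for p
  proof -
    obtain x X where p: "p = (x, X)" by (cases p)
    have "\<exists>c\<in>D. \<exists>e\<in>\<rat>. dist x c + e \<le> r \<and> y \<in> ball c e" if "y \<in> ball x r" for y
    proof -
      define \<eta> where "\<eta> = (r - dist x y) / 3"
      have \<eta>: "0 < \<eta>" using that by (simp add: \<eta>_def)
      obtain c where c: "c \<in> D" "dist y c < \<eta>" using D(2)[of "ball y \<eta>"] \<eta> by auto
      obtain e where e: "e \<in> \<rat>" "\<eta> < e" "e < 2 * \<eta>" using Rats_dense_in_real[of \<eta> "2 * \<eta>"] \<eta> by auto
      have "dist x c + e \<le> r" using dist_triangle[of x c y] c e unfolding \<eta>_def by (simp add: field_simps)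
      thus ?thesis using c e by (intro bexI[of _ c] bexI[of _ e]) (auto simp: dist_commute)
    qed
    moreover have "y \<in> ball x r" if "dist x c + e \<le> r" "y \<in> ball c e" for y c e
      using that dist_triangle[of x y c] by auto
    ultimately show ?thesis unfolding p by fastforce
  qed
  have [measurable]: "Measurable.pred config_space (\<lambda>X. X \<inter> ball c e = {})" for c :: plane and e by (rule void_pred) auto
  have cQ: "countable (\<rat> :: real set)" by (rule countable_rat)
  have "Measurable.pred (borel \<Otimes>\<^sub>M config_space) (\<lambda>p. \<not> (\<exists>c\<in>D. \<exists>e\<in>\<rat>. dist (fst p) c + e \<le> r \<and> \<not> snd p \<inter> ball c e = {}))"
    using D(1) cQ by measurable
  thus ?thesis unfolding eq .
qed

lemma exp_neg_energy:
  "exp_neg (energy (hard_sphere r) x X) = (if X \<inter> ball x r = {} then 1 else 0)"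
proof (cases "X \<inter> ball x r = {}")
  case True
  hence "energy (hard_sphere r) x X = (\<integral>\<^sup>+ y. 0 \<partial>count_space X)"
    unfolding energy_def by (intro nn_integral_cong) (auto simp: hard_sphere_def dist_norm[symmetric])
  thus ?thesis using True by (simp add: exp_neg_def)
next
  case False
  then obtain y where y: "y \<in> X" "dist x y < r" by auto
  have "\<top> = hard_sphere r x y" using y by (simp add: hard_sphere_def dist_norm)
  also have "\<dots> \<le> energy (hard_sphere r) x X" unfolding energy_def by (rule nn_integral_ge_point[OF y(1)])
  finally have "energy (hard_sphere r) x X = \<top>" by (simp add: top_unique)
  thus ?thesis using False by (simp add: exp_neg_def)
qed

definition void_functional :: "plane set measure \<Rightarrow> plane set \<Rightarrow> real" where
  "void_functional \<nu> S = measure \<nu> (void (- S))"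

lemma void_functional_measurable:
  assumes "prob_space \<nu>" and sets: "sets \<nu> = sets config_space" and S: "S \<in> cobounded_borel"
  shows "(\<lambda>x. void_functional \<nu> (S - ball x r)) \<in> borel_measurable borel"
proof -
  interpret prob_space \<nu> by fact
  note [measurable_cong] = sets
  have [measurable]: "Measurable.pred \<nu> (\<lambda>X. X \<inter> - S = {})"
    using void_pred[OF borel_comp, of S] S by (simp add: measurable_cong_sets[OF sets refl])
  have [measurable]: "Measurable.pred (borel \<Otimes>\<^sub>M \<nu>) (\<lambda>(x, X). X \<inter> ball x r = {})"
    using ball_void_pred[of r] by (simp add: measurable_cong_sets[OF sets_pair_measure_cong[OF refl sets] refl])
  have "(\<lambda>x. \<integral>\<^sup>+ X. (if (case (x, X) of (x, X) \<Rightarrow> X \<inter> ball x r = {}) \<and> X \<inter> - S = {} then 1 else 0) \<partial>\<nu>) \<in> borel_measurable borel"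
    by measurable
  also have "(\<lambda>x. \<integral>\<^sup>+ X. (if (case (x, X) of (x, X) \<Rightarrow> X \<inter> ball x r = {}) \<and> X \<inter> - S = {} then 1 else 0) \<partial>\<nu>)
     = (\<lambda>x. emeasure \<nu> (void (- (S - ball x r))))"
  proof
    fix x
    have v: "void (- (S - ball x r)) \<in> sets \<nu>"
      unfolding sets
    proof (rule void_event)
      have "- (S - ball x r) = - S \<union> ball x r" by auto
      thus "- (S - ball x r) \<in> sets borel" "bounded (- (S - ball x r))" using S by auto
    qed
    have "(\<integral>\<^sup>+ X. (if (case (x, X) of (x, X) \<Rightarrow> X \<inter> ball x r = {}) \<and> X \<inter> - S = {} then 1 else 0) \<partial>\<nu>)
      = (\<integral>\<^sup>+ X. indicator (void (- (S - ball x r))) X \<partial>\<nu>)"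
      by (intro nn_integral_cong) (auto simp: indicator_def void_def sets_eq_imp_space_eq[OF sets] space_config)
    also have "\<dots> = emeasure \<nu> (void (- (S - ball x r)))" by (rule nn_integral_indicator[OF v])
    finally show "(\<integral>\<^sup>+ X. (if (case (x, X) of (x, X) \<Rightarrow> X \<inter> ball x r = {}) \<and> X \<inter> - S = {} then 1 else 0) \<partial>\<nu>)
      = emeasure \<nu> (void (- (S - ball x r)))" .
  qed
  finally show ?thesis unfolding void_functional_def measure_def by measurable
qed

text \<open>The defining equation, with the hard sphere weight written as the event that the disk around \<open>x\<close> is
  vacant.\<close>

lemma gibbs_GNZ:
  assumes G: "gibbs_measure (hard_sphere r) z \<nu>" and F: "F \<in> borel_measurable (borel \<Otimes>\<^sub>M config_space)"
  shows "(\<integral>\<^sup>+ X. (\<integral>\<^sup>+ x. F (x, X) \<partial>count_space X) \<partial>\<nu>) =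
        ennreal z * (\<integral>\<^sup>+ x. (\<integral>\<^sup>+ X. F (x, X \<union> {x}) * indicator (void (ball x r)) X \<partial>\<nu>) \<partial>lborel)"
proof -
  have sets: "sets \<nu> = sets config_space" using G by (simp add: gibbs_measure_def)
  have "ennreal (exp_neg (energy (hard_sphere r) x X)) = indicator (void (ball x r)) X" if "X \<in> space \<nu>" for x X
    using that unfolding exp_neg_energy by (auto simp: void_def sets_eq_imp_space_eq[OF sets] space_config indicator_def)
  hence "(\<integral>\<^sup>+ X. F (x, X \<union> {x}) * ennreal (exp_neg (energy (hard_sphere r) x X)) \<partial>\<nu>)
     = (\<integral>\<^sup>+ X. F (x, X \<union> {x}) * indicator (void (ball x r)) X \<partial>\<nu>)" for x
    by (intro nn_integral_cong) simp
  thus ?thesis using G F by (simp add: gibbs_measure_def)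
qed

lemma nn_integral_count_space_indicator_card:
  assumes "finite (X \<inter> K)"
  shows "(\<integral>\<^sup>+ x. indicator K x * c \<partial>count_space X) = of_nat (card (X \<inter> K)) * c"
proof -
  have "(\<integral>\<^sup>+ x. indicator K x * c \<partial>count_space X) = (\<integral>\<^sup>+ x. c * indicator (X \<inter> K) x \<partial>count_space X)"
    by (intro nn_integral_cong) (auto simp: indicator_def)
  also have "\<dots> = c * emeasure (count_space X) (X \<inter> K)" by (rule nn_integral_cmult_indicator) simp
  also have "emeasure (count_space X) (X \<inter> K) = of_nat (card (X \<inter> K))" using assms by (intro emeasure_count_space_finite) auto
  finally show ?thesis by (simp add: mult.commute)
qed

text \<open>Test the defining equation with the indicator that \<open>x\<close> lies in \<open>K\<close> and \<open>K\<close> contains at least two points. On the right-hand side the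
  disk around \<open>x\<close>, which covers \<open>K\<close>, is vacant before \<open>x\<close> is added, so the integrand is \<open>0\<close>.\<close>

lemma gibbs_at_most_one:
  assumes G: "gibbs_measure (hard_sphere r) z \<nu>"
    and K: "K \<in> sets borel" "bounded K" "\<And>x y. x \<in> K \<Longrightarrow> y \<in> K \<Longrightarrow> dist x y < r"
  shows "AE X in \<nu>. card (X \<inter> K) \<le> 1"
proof -
  have sets: "sets \<nu> = sets config_space" using G by (simp add: gibbs_measure_def)
  have sp: "space \<nu> = {X. loc_finite X}" using sets_eq_imp_space_eq[OF sets] by (simp add: space_config)
  note [measurable] = count_measurable[OF K(2,1)] K(1)
  define F :: "plane \<times> plane set \<Rightarrow> ennreal" where "F p = indicator K (fst p) * (if 2 \<le> card (snd p \<inter> K) then 1 else 0)" for p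
  have Fm: "F \<in> borel_measurable (borel \<Otimes>\<^sub>M config_space)" unfolding F_def by measurable
  have "(\<integral>\<^sup>+ X. (\<integral>\<^sup>+ x. F (x, X) \<partial>count_space X) \<partial>\<nu>) = 0"
  proof -
    have 0: "F (x, X \<union> {x}) * indicator (void (ball x r)) X = 0" for x X
    proof (cases "x \<in> K \<and> X \<inter> ball x r = {}")
      case True
      hence "(X \<union> {x}) \<inter> K = {x}" using small_subset_ball[of x K r] K(3) by blast
      thus ?thesis by (simp add: F_def)
    qed (auto simp: F_def void_def indicator_def)
    show ?thesis unfolding gibbs_GNZ[OF G Fm] 0 by simp
  qed
  also have "(\<integral>\<^sup>+ X. (\<integral>\<^sup>+ x. F (x, X) \<partial>count_space X) \<partial>\<nu>) = (\<integral>\<^sup>+ X. of_nat (card (X \<inter> K)) * (if 2 \<le> card (X \<inter> K) then 1 else 0) \<partial>\<nu>)"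
    unfolding F_def fst_conv snd_conv
    by (intro nn_integral_cong nn_integral_count_space_indicator_card) (simp add: sp loc_finite_Int[OF _ K(2)])
  finally have "(\<integral>\<^sup>+ X. of_nat (card (X \<inter> K)) * (if 2 \<le> card (X \<inter> K) then 1 else 0) \<partial>\<nu>) = 0" .
  moreover have "(\<lambda>X. of_nat (card (X \<inter> K)) * (if 2 \<le> card (X \<inter> K) then 1 else 0) :: ennreal) \<in> borel_measurable \<nu>"
    unfolding measurable_cong_sets[OF sets refl] by measurable
  ultimately have "AE X in \<nu>. of_nat (card (X \<inter> K)) * (if 2 \<le> card (X \<inter> K) then 1 else 0) = (0::ennreal)"
    by (simp add: nn_integral_0_iff_AE)
  thus ?thesis by (rule AE_mp) (auto intro!: AE_I2 split: if_splits)
qed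

text \<open>Test the defining equation with the indicator that \<open>x\<close> lies in \<open>K\<close> and no point lies outside \<open>S\<close>. As \<open>K\<close> contains at
  most one point, the left-hand side is the probability that \<open>S\<close> contains all points and \<open>K\<close>
  is not vacant.\<close>

lemma gibbs_removal:
  assumes G: "gibbs_measure (hard_sphere r) z \<nu>" and r: "0 < r"
    and S: "S \<in> cobounded_borel"
    and K: "K \<in> sets borel" "\<And>x y. x \<in> K \<Longrightarrow> y \<in> K \<Longrightarrow> dist x y < r"
  shows "void_functional \<nu> S - void_functional \<nu> (S - K) = z * (LINT x:K \<inter> S|lborel. void_functional \<nu> (S - ball x r))"
proof -
  have sets: "sets \<nu> = sets config_space" and z: "0 \<le> z" and P: "prob_space \<nu>" using G by (auto simp: gibbs_measure_def)
  interpret prob_space \<nu> by fact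
  have sp: "space \<nu> = {X. loc_finite X}" using sets_eq_imp_space_eq[OF sets] by (simp add: space_config)
  have bK: "bounded K" by (rule bounded_if_small) (rule K(2))
  define A where "A = - S"
  have A: "A \<in> sets borel" "bounded A" using S by (auto simp: A_def)
  have vA: "void (A \<union> B) \<in> sets \<nu>" if "B \<in> sets borel" "bounded B" for B
    unfolding sets using A that by (intro void_event) auto
  note [measurable] = void_pred[OF A] K(1) A(1)
  define F :: "plane \<times> plane set \<Rightarrow> ennreal" where "F p = indicator K (fst p) * (if snd p \<inter> A = {} then 1 else 0)" for p
  have Fm: "F \<in> borel_measurable (borel \<Otimes>\<^sub>M config_space)" unfolding F_def by measurable
  have L: "(\<integral>\<^sup>+ X. (\<integral>\<^sup>+ x. F (x, X) \<partial>count_space X) \<partial>\<nu>) = ennreal (measure \<nu> (void A) - measure \<nu> (void (A \<union> K)))"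
  proof -
    have "(\<integral>\<^sup>+ X. (\<integral>\<^sup>+ x. F (x, X) \<partial>count_space X) \<partial>\<nu>) = (\<integral>\<^sup>+ X. of_nat (card (X \<inter> K)) * (if X \<inter> A = {} then 1 else 0) \<partial>\<nu>)"
      unfolding F_def fst_conv snd_conv
      by (intro nn_integral_cong nn_integral_count_space_indicator_card) (simp add: sp loc_finite_Int[OF _ bK])
    also have "\<dots> = (\<integral>\<^sup>+ X. indicator (void A - void (A \<union> K)) X \<partial>\<nu>)"
    proof (rule nn_integral_cong_AE, rule AE_mp[OF gibbs_at_most_one[OF G K(1) bK K(2)]], assumption, assumption, intro AE_I2 impI)
      fix X assume X: "X \<in> space \<nu>" "card (X \<inter> K) \<le> 1"
      have "finite (X \<inter> K)" using X loc_finite_Int[OF _ bK] sp by auto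
      hence "card (X \<inter> K) = (if X \<inter> K = {} then 0 else 1)" using X(2)
        by (metis card_eq_0_iff le_less_Suc_eq One_nat_def le_zero_eq not_less_eq_eq le_antisym)
      thus "of_nat (card (X \<inter> K)) * (if X \<inter> A = {} then 1 else 0) = (indicator (void A - void (A \<union> K)) X :: ennreal)"
        using X sp by (auto simp: indicator_def void_def)
    qed
    also have "\<dots> = emeasure \<nu> (void A - void (A \<union> K))"
      using vA[of "{}"] vA[OF K(1) bK] by (intro nn_integral_indicator) auto
    also have "\<dots> = ennreal (measure \<nu> (void A - void (A \<union> K)))" by (rule emeasure_eq_measure)
    also have "measure \<nu> (void A - void (A \<union> K)) = measure \<nu> (void A) - measure \<nu> (void (A \<union> K))"
      using vA[of "{}"] vA[OF K(1) bK] by (intro finite_measure_Diff) (auto simp: void_def)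
    finally show ?thesis .
  qed
  have R: "(\<integral>\<^sup>+ X. F (x, X \<union> {x}) * indicator (void (ball x r)) X \<partial>\<nu>) = ennreal (indicator (K \<inter> S) x * void_functional \<nu> (S - ball x r))" for x
  proof -
    have e: "- (S - ball x r) = A \<union> ball x r" by (auto simp: A_def)
    have "(\<integral>\<^sup>+ X. F (x, X \<union> {x}) * indicator (void (ball x r)) X \<partial>\<nu>) = (\<integral>\<^sup>+ X. indicator (K \<inter> S) x * indicator (void (A \<union> ball x r)) X \<partial>\<nu>)"
      by (intro nn_integral_cong) (auto simp: F_def indicator_def void_def A_def)
    also have "\<dots> = indicator (K \<inter> S) x * emeasure \<nu> (void (A \<union> ball x r))"
      by (rule nn_integral_cmult_indicator) (rule vA, auto)
    also have "\<dots> = ennreal (indicator (K \<inter> S) x * void_functional \<nu> (S - ball x r))"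
      unfolding void_functional_def e by (auto simp: indicator_def emeasure_eq_measure)
    finally show ?thesis .
  qed
  have vm: "(\<lambda>x. void_functional \<nu> (S - ball x r)) \<in> borel_measurable borel" by (rule void_functional_measurable[OF P sets S])
  have v01: "0 \<le> void_functional \<nu> T" "void_functional \<nu> T \<le> 1" for T by (auto simp: void_functional_def)
  have int: "set_integrable lborel (K \<inter> S) (\<lambda>x. void_functional \<nu> (S - ball x r))"
    using K(1) S v01 vm bounded_subset[OF bK, of "K \<inter> S"] by (intro set_integrable_bounded[where K=1]) auto
  have "ennreal (measure \<nu> (void A) - measure \<nu> (void (A \<union> K))) = ennreal z * (\<integral>\<^sup>+ x. ennreal (indicator (K \<inter> S) x * void_functional \<nu> (S - ball x r)) \<partial>lborel)"
    unfolding L[symmetric] gibbs_GNZ[OF G Fm] R ..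
  also have "(\<integral>\<^sup>+ x. ennreal (indicator (K \<inter> S) x * void_functional \<nu> (S - ball x r)) \<partial>lborel) = ennreal (LINT x:K \<inter> S|lborel. void_functional \<nu> (S - ball x r))"
    using int v01 unfolding set_integrable_def set_lebesgue_integral_def real_scaleR_def
    by (intro nn_integral_eq_integral) auto
  also have "ennreal z * \<dots> = ennreal (z * (LINT x:K \<inter> S|lborel. void_functional \<nu> (S - ball x r)))"
    using z by (simp add: ennreal_mult')
  finally have "measure \<nu> (void A) - measure \<nu> (void (A \<union> K)) = z * (LINT x:K \<inter> S|lborel. void_functional \<nu> (S - ball x r))"
  proof (subst (asm) ennreal_inj)
    show "0 \<le> measure \<nu> (void A) - measure \<nu> (void (A \<union> K))"
      using finite_measure_mono[of "void (A \<union> K)" "void A"] vA[of "{}"] by (auto simp: void_def)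
    show "0 \<le> z * (LINT x:K \<inter> S|lborel. void_functional \<nu> (S - ball x r))"
      unfolding set_lebesgue_integral_def using z v01 by (intro mult_nonneg_nonneg Bochner_Integration.integral_nonneg) auto
  qed
  moreover have "- (S - K) = A \<union> K" by (auto simp: A_def)
  ultimately show ?thesis unfolding void_functional_def by (simp add: A_def)
qed

text \<open>Positivity is not part of the definition of a Gibbs measure; it follows from the normalization by
  \<open>q_positive\<close>.\<close>

theorem gibbs_void_functional:
  assumes G: "gibbs_measure (hard_sphere r) z \<nu>" and r: "0 < r"
  shows "positive_removal_functional r z cobounded_borel (void_functional \<nu>)" "void_functional \<nu> UNIV = 1"
proof -
  have sets: "sets \<nu> = sets config_space" and z: "0 \<le> z" and P: "prob_space \<nu>" using G by (auto simp: gibbs_measure_def)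
  interpret prob_space \<nu> by fact
  show U: "void_functional \<nu> UNIV = 1"
    using prob_space sets_eq_imp_space_eq[OF sets] by (simp add: void_functional_def void_empty space_config)
  interpret R: removal_functional r z cobounded_borel "void_functional \<nu>"
  proof
    fix S C :: "plane set" assume "S \<in> cobounded_borel" "C \<in> sets borel" "bounded C"
    moreover have "- (S - C) = - S \<union> C" by auto
    ultimately show "S - C \<in> cobounded_borel" by auto
  qed (use r z gibbs_removal[OF G r] void_functional_measurable[OF P sets] in \<open>auto simp: void_functional_def\<close>)
  show "positive_removal_functional r z cobounded_borel (void_functional \<nu>)"
  proof
    fix S assume S: "S \<in> cobounded_borel"
    have "0 < void_functional \<nu> (UNIV - (- S))" using S U by (intro R.q_positive) auto
    moreover have "UNIV - (- S) = S" by auto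
    ultimately show "0 < void_functional \<nu> S" by simp
  qed
qed

section \<open>Point processes whose void probabilities satisfy the removal identity\<close>

text \<open>The squares of a grid of mesh \<open>r/2\<close>, enumerated by the natural numbers; a number that encodes no
  square yields the empty cell. The mesh makes the diameter less than \<open>r\<close>.\<close>

definition cell :: "real \<Rightarrow> nat \<Rightarrow> plane set" where
  "cell r k = {x. to_nat (\<lfloor>x $ 1 / (r / 2)\<rfloor>, \<lfloor>x $ 2 / (r / 2)\<rfloor>) = k}"

lemma cell_borel [measurable]: "cell r k \<in> sets borel"
proof -
  have eq: "cell r k = (\<Union>p\<in>{p::int \<times> int. to_nat p = k}. {x. \<lfloor>x $ 1 / (r / 2)\<rfloor> = fst p \<and> \<lfloor>x $ 2 / (r / 2)\<rfloor> = snd p})"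
    by (auto simp: cell_def)
  have "{x::plane. \<lfloor>x $ 1 / (r / 2)\<rfloor> = i \<and> \<lfloor>x $ 2 / (r / 2)\<rfloor> = j} \<in> sets borel" for i j
  proof -
    have "{x::plane. \<lfloor>x $ 1 / (r / 2)\<rfloor> = i \<and> \<lfloor>x $ 2 / (r / 2)\<rfloor> = j} =
      {x. of_int i \<le> x $ 1 / (r / 2) \<and> x $ 1 / (r / 2) < of_int i + 1 \<and> of_int j \<le> x $ 2 / (r / 2) \<and> x $ 2 / (r / 2) < of_int j + 1}"
      by (simp add: floor_eq_iff conj_assoc)
    also have "\<dots> \<in> sets borel" by measurable
    finally show ?thesis .
  qed
  thus ?thesis unfolding eq by (intro sets.countable_UN'') auto
qed

lemma cell_cover: "\<exists>!k. x \<in> cell r k"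
  by (simp add: cell_def)

lemma cell_disjoint: "x \<in> cell r k \<Longrightarrow> x \<in> cell r j \<Longrightarrow> k = j"
  by (simp add: cell_def)

lemma cell_small:
  assumes "0 < r" "x \<in> cell r k" "y \<in> cell r k" shows "dist x y < r"
proof -
  have "(\<lfloor>x $ 1 / (r / 2)\<rfloor>, \<lfloor>x $ 2 / (r / 2)\<rfloor>) = (\<lfloor>y $ 1 / (r / 2)\<rfloor>, \<lfloor>y $ 2 / (r / 2)\<rfloor>)"
  proof -
    have "to_nat (\<lfloor>x $ 1 / (r / 2)\<rfloor>, \<lfloor>x $ 2 / (r / 2)\<rfloor>) = k" "to_nat (\<lfloor>y $ 1 / (r / 2)\<rfloor>, \<lfloor>y $ 2 / (r / 2)\<rfloor>) = k"
      using assms(2,3) unfolding cell_def by blast+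
    hence "to_nat (\<lfloor>x $ 1 / (r / 2)\<rfloor>, \<lfloor>x $ 2 / (r / 2)\<rfloor>) = to_nat (\<lfloor>y $ 1 / (r / 2)\<rfloor>, \<lfloor>y $ 2 / (r / 2)\<rfloor>)"
      by (rule trans[OF _ sym])
    thus ?thesis by (simp only: to_nat_split)
  qed
  hence "\<lfloor>x $ 1 / (r / 2)\<rfloor> = \<lfloor>y $ 1 / (r / 2)\<rfloor>" "\<lfloor>x $ 2 / (r / 2)\<rfloor> = \<lfloor>y $ 2 / (r / 2)\<rfloor>" by auto
  hence "\<bar>x $ 1 / (r / 2) - y $ 1 / (r / 2)\<bar> < 1" "\<bar>x $ 2 / (r / 2) - y $ 2 / (r / 2)\<bar> < 1" by linarith+
  moreover have "\<bar>a - b\<bar> < r / 2" if "\<bar>a / (r / 2) - b / (r / 2)\<bar> < 1" for a b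
  proof -
    have r2: "0 < r / 2" using assms(1) by simp
    have "\<bar>a / (r / 2) - b / (r / 2)\<bar> = \<bar>a - b\<bar> / (r / 2)"
      using r2 by (simp only: diff_divide_distrib[symmetric] abs_divide abs_of_pos)
    thus ?thesis using that r2 by (simp only: divide_less_eq_1_pos)
  qed
  ultimately have 1: "\<bar>x $ 1 - y $ 1\<bar> < r / 2" "\<bar>x $ 2 - y $ 2\<bar> < r / 2" by blast+
  have "dist x y \<le> (\<Sum>i\<in>UNIV. \<bar>(x - y) $ i\<bar>)" unfolding dist_norm by (rule norm_le_l1_cart)
  also have "\<dots> < r" using 1 by (simp add: UNIV_2)
  finally show ?thesis .
qed

lemma cell_bounded: assumes "0 < r" shows "bounded (cell r k)"
  by (rule bounded_if_small) (rule cell_small[OF assms])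

lemma cells_meet_bounded:
  assumes "0 < r" "bounded B" shows "\<exists>m. B \<subseteq> (\<Union>k<m. cell r k)"
proof -
  obtain \<rho> where \<rho>: "\<And>x. x \<in> B \<Longrightarrow> norm x \<le> \<rho>" using assms(2) by (auto simp: bounded_iff)
  define J where "J = {- \<lceil>\<rho> / (r / 2)\<rceil> - 1 .. \<lceil>\<rho> / (r / 2)\<rceil>}"
  have J: "\<lfloor>x $ i / (r / 2)\<rfloor> \<in> J" if "x \<in> B" for x i
  proof -
    have "\<bar>x $ i\<bar> \<le> \<rho>" using component_le_norm_cart[of x i] \<rho>[OF that] by simp
    hence "\<bar>x $ i / (r / 2)\<bar> \<le> \<rho> / (r / 2)" using assms(1) by (simp add: abs_divide divide_right_mono)
    thus ?thesis unfolding J_def atLeastAtMost_iff by linarith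
  qed
  have "finite (to_nat ` (J \<times> J))" by (simp add: J_def)
  then obtain m where m: "\<And>k. k \<in> to_nat ` (J \<times> J) \<Longrightarrow> k < m" by (meson finite_nat_set_iff_bounded)
  have "B \<subseteq> (\<Union>k<m. cell r k)"
  proof
    fix x assume x: "x \<in> B"
    let ?k = "to_nat (\<lfloor>x $ 1 / (r / 2)\<rfloor>, \<lfloor>x $ 2 / (r / 2)\<rfloor>)"
    have "?k < m" using J[OF x] by (intro m) auto
    moreover have "x \<in> cell r ?k" by (simp add: cell_def)
    ultimately show "x \<in> (\<Union>k<m. cell r k)" by blast
  qed
  thus ?thesis ..
qed

text \<open>A point process about which nothing is known except that its void probabilities satisfy the removal identity.\<close>

locale void_process = prob_space \<nu> for \<nu> :: "plane set measure" +
  fixes r z :: real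
  assumes sets_nu: "sets \<nu> = sets config_space"
    and functional: "positive_removal_functional r z cobounded_borel (void_functional \<nu>)"
begin

sublocale R: positive_removal_functional r z cobounded_borel "void_functional \<nu>" by (rule functional)

lemma space_nu: "space \<nu> = {X. loc_finite X}"
  using sets_eq_imp_space_eq[OF sets_nu] by (simp add: space_config)

lemma void_in: "A \<in> sets borel \<Longrightarrow> bounded A \<Longrightarrow> void A \<in> sets \<nu>"
  unfolding sets_nu by (rule void_event)

lemma prob_void: "prob (void A) = void_functional \<nu> (- A)"
  by (simp add: void_functional_def)

lemma prob_void_UNIV: "void_functional \<nu> UNIV = 1"
  using prob_space by (simp add: void_functional_def void_empty space_nu)

text \<open>On sets of diameter less than \<open>r\<close>, the identity makes the probability \<open>1 - q\<close> of being hit additive. So the events that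
  \<open>U\<close> and \<open>V\<close> are hit intersect in a null set, by inclusion and exclusion.\<close>

lemma pair_never_hit:
  assumes U: "U \<in> sets borel" "V \<in> sets borel" "U \<inter> V = {}" "\<And>x y. x \<in> U \<union> V \<Longrightarrow> y \<in> U \<union> V \<Longrightarrow> dist x y < r"
  shows "AE X in \<nu>. X \<inter> U = {} \<or> X \<inter> V = {}"
proof -
  have bd: "bounded (U \<union> V)" by (rule bounded_if_small) (rule U(4))
  hence b: "bounded U" "bounded V" by auto
  have rem: "1 - prob (void K) = z * (LINT x:K|lborel. void_functional \<nu> (UNIV - ball x r))"
    if "K \<in> sets borel" "K \<subseteq> U \<union> V" for K
    using R.removal[of UNIV K] that U(4) prob_void_UNIV by (auto simp: prob_void Compl_eq_Diff_UNIV)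
  have "(LINT x:U \<union> V|lborel. void_functional \<nu> (UNIV - ball x r)) =
     (LINT x:U|lborel. void_functional \<nu> (UNIV - ball x r)) + (LINT x:V|lborel. void_functional \<nu> (UNIV - ball x r))"
    using U b by (intro set_integral_Un R.q_ball_integrable) auto
  hence "1 - prob (void (U \<union> V)) = (1 - prob (void U)) + (1 - prob (void V))"
    using rem[of U] rem[of V] rem[of "U \<union> V"] U by (simp add: algebra_simps)
  moreover have "prob (void U \<union> void V) = prob (void U) + prob (void V) - prob (void U \<inter> void V)"
    using void_in U b by (intro measure_Un3) (auto simp: fmeasurable_eq_sets)
  ultimately have "prob (void U \<union> void V) = 1" by (simp add: void_Un)
  hence "AE X in \<nu>. X \<in> void U \<union> void V"
    using void_in U b by (subst (asm) prob_eq_1) auto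
  thus ?thesis by (rule AE_mp) (auto simp: void_def)
qed

text \<open>Two points that are too close are separated by two disjoint members of a countable basis, so countably many
  null sets of \<open>pair_never_hit\<close> cover all violations.\<close>

lemma hard_core: "AE X in \<nu>. \<forall>x\<in>X. \<forall>y\<in>X. x \<noteq> y \<longrightarrow> r \<le> dist x y"
proof -
  obtain \<B> :: "plane set set" where \<B>: "countable \<B>" "topological_basis \<B>" using ex_countable_basis by blast
  have B_borel: "U \<in> sets borel" if "U \<in> \<B>" for U using topological_basis_open[OF \<B>(2) that] by simp
  define \<P> where "\<P> = {p \<in> \<B> \<times> \<B>. fst p \<inter> snd p = {} \<and> (\<forall>x\<in>fst p \<union> snd p. \<forall>y\<in>fst p \<union> snd p. dist x y < r)}"
  have "countable \<P>" by (rule countable_subset[OF _ countable_SIGMA[OF \<B>(1) \<B>(1)]]) (auto simp: \<P>_def)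
  hence "AE X in \<nu>. \<forall>p\<in>\<P>. X \<inter> fst p = {} \<or> X \<inter> snd p = {}"
  proof (subst AE_ball_countable, assumption, intro ballI)
    fix p assume "p \<in> \<P>"
    thus "AE X in \<nu>. X \<inter> fst p = {} \<or> X \<inter> snd p = {}" using B_borel by (intro pair_never_hit) (auto simp: \<P>_def)
  qed
  thus ?thesis
  proof (rule AE_mp, intro AE_I2 impI ballI)
    fix X x y assume X: "\<forall>p\<in>\<P>. X \<inter> fst p = {} \<or> X \<inter> snd p = {}" "x \<in> X" "y \<in> X" "x \<noteq> y"
    show "r \<le> dist x y"
    proof (rule ccontr)
      assume "\<not> r \<le> dist x y"
      \<comment> \<open>Balls of radius \<open>\<eta>\<close> around \<open>x\<close> and \<open>y\<close> are disjoint, and their union has diameter less than \<open>r\<close>.\<close>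
      define \<eta> where "\<eta> = min (dist x y / 2) ((r - dist x y) / 4)"
      have "\<eta> \<le> dist x y / 2" "\<eta> \<le> (r - dist x y) / 4" unfolding \<eta>_def by (rule min.cobounded1, rule min.cobounded2)
      moreover have "0 < \<eta>" using X \<open>\<not> r \<le> dist x y\<close> by (simp add: \<eta>_def)
      ultimately have \<eta>: "0 < \<eta>" "2 * \<eta> \<le> dist x y" "4 * \<eta> \<le> r - dist x y"
        by (auto simp: field_simps)
      obtain U where U: "U \<in> \<B>" "x \<in> U" "U \<subseteq> ball x \<eta>"
        using topological_basisE[OF \<B>(2), of "ball x \<eta>" x] \<eta>(1) by (metis centre_in_ball open_ball)
      obtain V where V: "V \<in> \<B>" "y \<in> V" "V \<subseteq> ball y \<eta>"
        using topological_basisE[OF \<B>(2), of "ball y \<eta>" y] \<eta>(1) by (metis centre_in_ball open_ball)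
      have "U \<inter> V = {}"
      proof (rule ccontr)
        assume "U \<inter> V \<noteq> {}"
        then obtain w where "w \<in> ball x \<eta>" "w \<in> ball y \<eta>" using U V by blast
        thus False using \<eta>(2) dist_triangle2[of x y w] by (simp add: dist_commute)
      qed
      moreover have "dist v w < r" if "v \<in> U \<union> V" "w \<in> U \<union> V" for v w
      proof -
        have d: "dist v x < \<eta> \<or> dist v y < \<eta>" "dist w x < \<eta> \<or> dist w y < \<eta>" using that U V by (auto simp: dist_commute)
        have "dist v w \<le> dist v x + dist x w" "dist v w \<le> dist v y + dist y w"
          "dist v x \<le> dist v y + dist x y" "dist w x \<le> dist w y + dist x y" "dist v y \<le> dist v x + dist x y" "dist w y \<le> dist w x + dist x y"
          by (metis dist_triangle dist_commute)+
        moreover have "dist x w = dist w x" "dist y w = dist w y" by (simp_all add: dist_commute)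
        ultimately show ?thesis using d \<eta> by linarith
      qed
      ultimately have "(U, V) \<in> \<P>" using U V by (auto simp: \<P>_def)
      from bspec[OF X(1) this] show False using U(2) V(2) X(2,3) by auto
    qed
  qed
qed

lemma at_most_one:
  assumes "\<And>x y. x \<in> K \<Longrightarrow> y \<in> K \<Longrightarrow> dist x y < r"
  shows "AE X in \<nu>. \<forall>x\<in>X \<inter> K. X \<inter> K = {x}"
  by (rule AE_mp[OF hard_core], intro AE_I2 impI) (use assms in \<open>force simp: not_le\<close>)

text \<open>A measurable choice of the point in a cell. The value \<open>0\<close> for cells without a unique point is irrelevant, as it only
  occurs where the density of the Campbell measure is \<open>0\<close>.\<close>

definition the_point :: "nat \<Rightarrow> plane set \<Rightarrow> plane" where
  "the_point i X = (if card (X \<inter> cell r i) = 1 then the_elem (X \<inter> cell r i) else 0)"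

lemma cell_count_measurable [measurable]: "B \<in> sets borel \<Longrightarrow> (\<lambda>X. card (X \<inter> (cell r i \<inter> B))) \<in> measurable config_space (count_space UNIV)"
  using cell_bounded[OF R.r_pos] by (intro count_measurable) (auto intro: bounded_subset)

lemma the_point_measurable [measurable]: "the_point i \<in> measurable config_space borel"
proof (rule measurableI)
  fix B :: "plane set" assume B[measurable]: "B \<in> sets borel"
  have m1: "Measurable.pred config_space (\<lambda>X. card (X \<inter> (cell r i \<inter> UNIV)) = 1)" by measurable
  have m2: "Measurable.pred config_space (\<lambda>X. card (X \<inter> (cell r i \<inter> B)) = 1)" by measurable
  have *: "the_point i X \<in> B \<longleftrightarrow> (if card (X \<inter> (cell r i \<inter> UNIV)) = 1 then card (X \<inter> (cell r i \<inter> B)) = 1 else 0 \<in> B)" for X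
  proof (cases "card (X \<inter> cell r i) = 1")
    case True
    then obtain x where x: "X \<inter> cell r i = {x}" by (auto simp: card_1_singleton_iff)
    hence "X \<inter> (cell r i \<inter> B) = (if x \<in> B then {x} else {})" by auto
    thus ?thesis using x by (simp add: the_point_def)
  qed (simp add: the_point_def)
  have "Measurable.pred config_space (\<lambda>X. the_point i X \<in> B)" unfolding * using m1 m2 by measurable
  thus "the_point i -` B \<inter> space config_space \<in> sets config_space" by (simp add: pred_def vimage_def Collect_conj_eq Int_commute)
qed simp

text \<open>The Campbell measure of the points in one cell: the law of the pair formed by the point in the
  cell, if there is one, and the configuration.\<close>

definition campbell :: "nat \<Rightarrow> (plane \<times> plane set) measure" where
  "campbell i = distr (density \<nu> (\<lambda>X. if card (X \<inter> cell r i) = 1 then 1 else 0)) (borel \<Otimes>\<^sub>M config_space) (\<lambda>X. (the_point i X, X))"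

text \<open>The right-hand side of the defining equation of a Gibbs measure, restricted to points in one cell and read as a
  measure on pairs.\<close>

definition reduced_campbell :: "nat \<Rightarrow> (plane \<times> plane set) measure" where
  "reduced_campbell i = distr (density (lborel \<Otimes>\<^sub>M \<nu>) (\<lambda>(x, X). ennreal z * indicator (cell r i) x * (if X \<inter> ball x r = {} then 1 else 0)))
     (borel \<Otimes>\<^sub>M config_space) (\<lambda>(x, X). (x, X \<union> {x}))"

lemma card_cell_pred [measurable]: "Measurable.pred config_space (\<lambda>X. card (X \<inter> cell r i) = 1)"
proof -
  have "Measurable.pred config_space (\<lambda>X. card (X \<inter> (cell r i \<inter> UNIV)) = 1)" by measurable
  thus ?thesis by simp
qed

lemma ball_void_pred' [measurable]: "Measurable.pred (borel \<Otimes>\<^sub>M config_space) (\<lambda>p. snd p \<inter> ball (fst p) r = {})"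
  using ball_void_pred[of r] by (simp add: case_prod_beta)

lemma nn_integral_campbell:
  assumes F: "F \<in> borel_measurable (borel \<Otimes>\<^sub>M config_space)"
  shows "(\<integral>\<^sup>+ p. F p \<partial>campbell i) = (\<integral>\<^sup>+ X. (if card (X \<inter> cell r i) = 1 then 1 else 0) * F (the_point i X, X) \<partial>\<nu>)"
proof -
  note [measurable_cong] = sets_nu and [measurable] = F
  have m: "(\<lambda>X. (the_point i X, X)) \<in> measurable \<nu> (borel \<Otimes>\<^sub>M config_space)"
    unfolding measurable_cong_sets[OF sets_nu refl] by measurable
  have c: "(\<lambda>X. if card (X \<inter> cell r i) = 1 then 1 else 0 :: ennreal) \<in> borel_measurable \<nu>"
    unfolding measurable_cong_sets[OF sets_nu refl] by measurable
  show ?thesis unfolding campbell_def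
    using m c by (subst nn_integral_distr) (auto intro!: nn_integral_density measurable_compose[OF m F])
qed

lemma nn_integral_reduced_campbell:
  assumes F: "F \<in> borel_measurable (borel \<Otimes>\<^sub>M config_space)"
  shows "(\<integral>\<^sup>+ p. F p \<partial>reduced_campbell i) =
    (\<integral>\<^sup>+ x. (\<integral>\<^sup>+ X. ennreal z * indicator (cell r i) x * (if X \<inter> ball x r = {} then 1 else 0) * F (x, X \<union> {x}) \<partial>\<nu>) \<partial>lborel)"
proof -
  have se: "sets (lborel \<Otimes>\<^sub>M \<nu>) = sets (borel \<Otimes>\<^sub>M config_space)"
    by (rule sets_pair_measure_cong) (auto simp: sets_nu)
  note [measurable] = F add_point_measurable
  have m: "(\<lambda>(x, X). (x, X \<union> {x})) \<in> measurable (lborel \<Otimes>\<^sub>M \<nu>) (borel \<Otimes>\<^sub>M config_space)"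
  proof -
    have "(\<lambda>p. (fst p, (\<lambda>(x::plane, X). X \<union> {x}) p)) \<in> measurable (borel \<Otimes>\<^sub>M config_space) (borel \<Otimes>\<^sub>M config_space)"
      by measurable
    thus ?thesis unfolding measurable_cong_sets[OF se refl] by (simp add: case_prod_beta)
  qed
  have c: "(\<lambda>(x, X). ennreal z * indicator (cell r i) x * (if X \<inter> ball x r = {} then 1 else 0)) \<in> borel_measurable (lborel \<Otimes>\<^sub>M \<nu>)"
    unfolding measurable_cong_sets[OF se refl] case_prod_beta by measurable
  have Fm: "(\<lambda>(x, X). F (x, X \<union> {x})) \<in> borel_measurable (lborel \<Otimes>\<^sub>M \<nu>)"
    using measurable_compose[OF m F] by (simp add: case_prod_beta)
  let ?c = "\<lambda>(x, X). ennreal z * indicator (cell r i) x * (if X \<inter> ball x r = {} then 1 else 0)"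
    and ?T = "\<lambda>(x::plane, X). (x, X \<union> {x})"
  have "(\<integral>\<^sup>+ p. F p \<partial>reduced_campbell i) = (\<integral>\<^sup>+ p. F (?T p) \<partial>density (lborel \<Otimes>\<^sub>M \<nu>) ?c)"
    unfolding reduced_campbell_def by (rule nn_integral_distr) (use m F in simp_all)
  also have "\<dots> = (\<integral>\<^sup>+ p. ?c p * F (?T p) \<partial>(lborel \<Otimes>\<^sub>M \<nu>))"
    by (rule nn_integral_density[OF c measurable_compose[OF m F]])
  also have "\<dots> = (\<integral>\<^sup>+ p. (case p of (x, X) \<Rightarrow> ennreal z * indicator (cell r i) x * (if X \<inter> ball x r = {} then 1 else 0)) * (case p of (x, X) \<Rightarrow> F (x, X \<union> {x})) \<partial>(lborel \<Otimes>\<^sub>M \<nu>))"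
    by (intro nn_integral_cong) (simp add: case_prod_beta)
  also have "\<dots> = (\<integral>\<^sup>+ x. (\<integral>\<^sup>+ X. (case (x, X) of (x, X) \<Rightarrow> ennreal z * indicator (cell r i) x * (if X \<inter> ball x r = {} then 1 else 0)) * (case (x, X) of (x, X) \<Rightarrow> F (x, X \<union> {x})) \<partial>\<nu>) \<partial>lborel)"
    by (rule nn_integral_fst[symmetric]) (rule borel_measurable_times_ennreal[OF c Fm])
  finally show ?thesis by simp
qed

text \<open>On a product of a Borel set \<open>B\<close> and a void event \<open>void A\<close>, the left-hand side is the probability that \<open>A\<close> is vacant but the part
  of the cell in \<open>B\<close> is not, and the right-hand side is the integral in the removal identity. These
  products are stable under intersection and generate.\<close>

lemma campbell_eq: "campbell i = reduced_campbell i"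
proof -
  let ?E = "{B \<times> V |B V. B \<in> sets borel \<and> V \<in> void_events} :: (plane \<times> plane set) set set"
  have r: "0 < r" by (rule R.r_pos)
  have sE: "sets (borel \<Otimes>\<^sub>M config_space) = sigma_sets (UNIV \<times> {X. loc_finite X}) ?E"
  proof -
    have "sets (borel \<Otimes>\<^sub>M config_space) = sets (sigma (space borel \<times> space config_space) ?E)"
    proof (rule sets_pair_eq[where Ca="{UNIV}" and Cb="{void {}}"])
      show "sets borel = sigma_sets (space borel) (sets borel)" by (rule sets.sigma_sets_eq[symmetric])
      show "sets config_space = sigma_sets (space config_space) void_events" unfolding space_config by (rule sets_config_void)
    qed (auto simp: space_config void_def intro!: exI[of _ "{}"])
    also have "\<dots> = sigma_sets (UNIV \<times> {X. loc_finite X}) ?E"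
      unfolding space_config space_borel by (rule sets_measure_of) (auto simp: void_def)
    finally show ?thesis .
  qed
  have Em: "W \<in> sets (borel \<Otimes>\<^sub>M config_space)" if "W \<in> ?E" for W using that by (auto intro!: pair_measureI void_event)
  have val: "emeasure (campbell i) (B \<times> void A) = ennreal (void_functional \<nu> (- A) - void_functional \<nu> (- A - (cell r i \<inter> B)))"
    "emeasure (reduced_campbell i) (B \<times> void A) = ennreal (void_functional \<nu> (- A) - void_functional \<nu> (- A - (cell r i \<inter> B)))"
    if B: "B \<in> sets borel" and A: "A \<in> sets borel" "bounded A" for A B
  proof -
    let ?K = "cell r i \<inter> B"
    have K: "?K \<in> sets borel" "bounded ?K" "\<And>x y. x \<in> ?K \<Longrightarrow> y \<in> ?K \<Longrightarrow> dist x y < r"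
      using B cell_bounded[OF r] cell_small[OF r] by (auto intro: bounded_subset)
    have W: "B \<times> void A \<in> sets (borel \<Otimes>\<^sub>M config_space)" using A B by (auto intro!: pair_measureI void_event)
    have S: "- A \<in> cobounded_borel" using A by auto
    have "emeasure (campbell i) (B \<times> void A) = (\<integral>\<^sup>+ p. indicator (B \<times> void A) p \<partial>campbell i)"
      using W by (intro nn_integral_indicator[symmetric]) (simp add: campbell_def)
    also have "\<dots> = (\<integral>\<^sup>+ X. (if card (X \<inter> cell r i) = 1 then 1 else 0) * indicator (B \<times> void A) (the_point i X, X) \<partial>\<nu>)"
      by (rule nn_integral_campbell) (use W in auto)
    also have "\<dots> = (\<integral>\<^sup>+ X. indicator (void A - void (A \<union> ?K)) X \<partial>\<nu>)"
    proof (rule nn_integral_cong_AE, rule AE_mp[OF at_most_one[OF cell_small[OF r]]], assumption, assumption, intro AE_I2 impI)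
      fix X assume X: "X \<in> space \<nu>" "\<forall>x\<in>X \<inter> cell r i. X \<inter> cell r i = {x}"
      show "(if card (X \<inter> cell r i) = 1 then 1 else 0) * indicator (B \<times> void A) (the_point i X, X) = (indicator (void A - void (A \<union> ?K)) X :: ennreal)"
      proof (cases "X \<inter> cell r i = {}")
        case True thus ?thesis using X by (auto simp: indicator_def void_def)
      next
        case False
        then obtain x where x: "X \<inter> cell r i = {x}" using X(2) by blast
        hence "the_point i X = x" by (simp add: the_point_def)
        moreover have "x \<in> B \<longleftrightarrow> X \<inter> (cell r i \<inter> B) \<noteq> {}" using x by auto
        ultimately show ?thesis using X(1) x by (auto simp: indicator_def void_def space_nu)
      qed
    qed
    also have "\<dots> = emeasure \<nu> (void A - void (A \<union> ?K))"
      using void_in[OF A] void_in[of "A \<union> ?K"] A K by (intro nn_integral_indicator) auto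
    also have "\<dots> = ennreal (prob (void A) - prob (void (A \<union> ?K)))"
      unfolding emeasure_eq_measure using void_in[OF A] void_in[of "A \<union> ?K"] A K
      by (subst finite_measure_Diff) (auto simp: void_def)
    also have "prob (void A) - prob (void (A \<union> ?K)) = void_functional \<nu> (- A) - void_functional \<nu> (- A - ?K)"
    proof -
      have "- (A \<union> ?K) = - A - ?K" by auto
      thus ?thesis unfolding prob_void by simp
    qed
    finally show "emeasure (campbell i) (B \<times> void A) = ennreal (void_functional \<nu> (- A) - void_functional \<nu> (- A - ?K))" .
    have "emeasure (reduced_campbell i) (B \<times> void A) = (\<integral>\<^sup>+ p. indicator (B \<times> void A) p \<partial>reduced_campbell i)"
      using W by (intro nn_integral_indicator[symmetric]) (simp add: reduced_campbell_def)
    also have "\<dots> = (\<integral>\<^sup>+ x. (\<integral>\<^sup>+ X. ennreal z * indicator (cell r i) x * (if X \<inter> ball x r = {} then 1 else 0) * indicator (B \<times> void A) (x, X \<union> {x}) \<partial>\<nu>) \<partial>lborel)"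
      by (rule nn_integral_reduced_campbell) (use W in auto)
    also have "\<dots> = (\<integral>\<^sup>+ x. ennreal z * ennreal (indicator (?K \<inter> - A) x * void_functional \<nu> (- A - ball x r)) \<partial>lborel)"
    proof (intro nn_integral_cong, goal_cases)
      case (1 x)
      have "(\<integral>\<^sup>+ X. ennreal z * indicator (cell r i) x * (if X \<inter> ball x r = {} then 1 else 0) * indicator (B \<times> void A) (x, X \<union> {x}) \<partial>\<nu>)
        = (\<integral>\<^sup>+ X. (ennreal z * indicator (?K \<inter> - A) x) * indicator (void (A \<union> ball x r)) X \<partial>\<nu>)"
        by (intro nn_integral_cong) (auto simp: indicator_def void_def space_nu loc_finite_def Int_insert_left)
      also have "\<dots> = ennreal z * indicator (?K \<inter> - A) x * emeasure \<nu> (void (A \<union> ball x r))"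
        using A by (intro nn_integral_cmult_indicator void_in) auto
      also have "- A - ball x r = - (A \<union> ball x r)" by auto
      hence "emeasure \<nu> (void (A \<union> ball x r)) = ennreal (void_functional \<nu> (- A - ball x r))"
        by (simp add: emeasure_eq_measure prob_void)
      finally show ?case by (simp add: indicator_def)
    qed
    also have "\<dots> = ennreal z * (\<integral>\<^sup>+ x. ennreal (indicator (?K \<inter> - A) x * void_functional \<nu> (- A - ball x r)) \<partial>lborel)"
      by (rule nn_integral_cmult) (use R.q_measurable[OF S] K A in auto)
    also have "(\<integral>\<^sup>+ x. ennreal (indicator (?K \<inter> - A) x * void_functional \<nu> (- A - ball x r)) \<partial>lborel) = ennreal (LINT x:?K \<inter> - A|lborel. void_functional \<nu> (- A - ball x r))"
      using R.q_ball_integrable[OF _ _ S, of "?K \<inter> - A"] K A bounded_subset[OF K(2), of "?K \<inter> - A"] R.q_ball_nonneg[OF S]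
      unfolding set_integrable_def set_lebesgue_integral_def real_scaleR_def
      by (intro nn_integral_eq_integral) auto
    also have "ennreal z * \<dots> = ennreal (z * (LINT x:?K \<inter> - A|lborel. void_functional \<nu> (- A - ball x r)))"
      using R.z_nonneg by (simp add: ennreal_mult')
    also have "z * (LINT x:?K \<inter> - A|lborel. void_functional \<nu> (- A - ball x r)) = void_functional \<nu> (- A) - void_functional \<nu> (- A - ?K)"
      by (rule R.removal[OF S K(1,3), symmetric])
    finally show "emeasure (reduced_campbell i) (B \<times> void A) = ennreal (void_functional \<nu> (- A) - void_functional \<nu> (- A - ?K))" .
  qed
  show ?thesis
  proof (rule measure_eqI_generator_eq[where E="?E" and \<Omega>="UNIV \<times> {X. loc_finite X}" and A="\<lambda>_. UNIV \<times> void {}"])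
    show "Int_stable ?E"
    proof (rule Int_stableI)
      fix a b assume "a \<in> ?E" "b \<in> ?E"
      then obtain A B A' B' where ab: "a = B \<times> void A" "b = B' \<times> void A'" "B \<in> sets borel" "B' \<in> sets borel"
        "A \<in> sets borel" "bounded A" "A' \<in> sets borel" "bounded A'" by auto
      have "a \<inter> b = (B \<inter> B') \<times> void (A \<union> A')" using ab(1,2) void_Un[of A A'] by auto
      moreover have "B \<inter> B' \<in> sets borel" "A \<union> A' \<in> sets borel" "bounded (A \<union> A')" using ab by auto
      ultimately show "a \<inter> b \<in> ?E" by blast
    qed
    show "emeasure (campbell i) X = emeasure (reduced_campbell i) X" if "X \<in> ?E" for X
      using that val by auto
    show "emeasure (campbell i) (UNIV \<times> void {}) \<noteq> \<infinity>" using val(1)[of UNIV "{}"] by simp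
    show "sets (campbell i) = sigma_sets (UNIV \<times> {X. loc_finite X}) ?E" "sets (reduced_campbell i) = sigma_sets (UNIV \<times> {X. loc_finite X}) ?E"
      by (simp_all only: campbell_def reduced_campbell_def sets_distr sE)
    show "range (\<lambda>_. UNIV \<times> void {}) \<subseteq> ?E"
      by (intro image_subsetI CollectI exI[of _ UNIV] exI[of _ "void {}"]) (auto intro!: exI[of _ "{}"])
  qed (auto simp: void_def)
qed

text \<open>Almost surely every cell contains at most one point, so the sum over all points is the sum of the
  Campbell integrals of the cells.\<close>

theorem is_gibbs: "gibbs_measure (hard_sphere r) z \<nu>"
  unfolding gibbs_measure_def
proof (intro conjI allI impI)
  show "0 \<le> z" by (rule R.z_nonneg)
  show "prob_space \<nu>" by (rule prob_space_axioms)
  show "sets \<nu> = sets config_space" by (rule sets_nu)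
  fix F :: "plane \<times> plane set \<Rightarrow> ennreal" assume F: "F \<in> borel_measurable (borel \<Otimes>\<^sub>M config_space)"
  have r: "0 < r" by (rule R.r_pos)
  define h where "h p = (if snd p \<inter> ball (fst p) r = {} then 1 else 0) * F (fst p, snd p \<union> {fst p})" for p
  define G where "G x = (\<integral>\<^sup>+ X. h (x, X) \<partial>\<nu>)" for x
  have hm: "h \<in> borel_measurable (borel \<Otimes>\<^sub>M \<nu>)"
  proof -
    note [measurable] = F add_point_measurable
    have "(\<lambda>p. F (fst p, (\<lambda>(x::plane, X). X \<union> {x}) p)) \<in> borel_measurable (borel \<Otimes>\<^sub>M config_space)" by measurable
    hence [measurable]: "(\<lambda>p. F (fst p, snd p \<union> {fst p})) \<in> borel_measurable (borel \<Otimes>\<^sub>M config_space)"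
      by (simp add: case_prod_beta)
    show ?thesis unfolding h_def measurable_cong_sets[OF sets_pair_measure_cong[OF refl sets_nu] refl] by measurable
  qed
  have hx: "(\<lambda>X. h (x, X)) \<in> borel_measurable \<nu>" for x by (rule measurable_Pair2[OF hm]) simp
  have Gm: "G \<in> borel_measurable borel" unfolding G_def by (rule borel_measurable_nn_integral_fst[OF hm])
  have one: "(\<Sum>i. indicator (cell r i) x * c) = c" for x and c :: ennreal
  proof -
    obtain k where k: "x \<in> cell r k" using cell_cover by blast
    have "x \<notin> cell r i" if "i \<notin> {k}" for i using that cell_disjoint[OF k, of i] by auto
    hence "(\<Sum>i. indicator (cell r i) x * c) = (\<Sum>i\<in>{k}. indicator (cell r i) x * c)"
      by (intro suminf_finite) (auto simp: indicator_def)
    thus ?thesis using k by simp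
  qed
  have "(\<integral>\<^sup>+ X. (\<integral>\<^sup>+ x. F (x, X) \<partial>count_space X) \<partial>\<nu>) = (\<integral>\<^sup>+ X. (\<Sum>i. (\<integral>\<^sup>+ x. indicator (cell r i) x * F (x, X) \<partial>count_space X)) \<partial>\<nu>)"
    by (intro nn_integral_cong, subst nn_integral_suminf[symmetric]) (simp, simp only: one)
  also have "\<dots> = (\<integral>\<^sup>+ X. (\<Sum>i. (if card (X \<inter> cell r i) = 1 then 1 else 0) * F (the_point i X, X)) \<partial>\<nu>)"
  proof (rule nn_integral_cong_AE)
    have "AE X in \<nu>. \<forall>i. \<forall>x\<in>X \<inter> cell r i. X \<inter> cell r i = {x}"
      unfolding AE_all_countable by (intro allI at_most_one) (rule cell_small[OF r])
    thus "AE X in \<nu>. (\<Sum>i. (\<integral>\<^sup>+ x. indicator (cell r i) x * F (x, X) \<partial>count_space X)) = (\<Sum>i. (if card (X \<inter> cell r i) = 1 then 1 else 0) * F (the_point i X, X))"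
    proof (rule AE_mp, intro AE_I2 impI suminf_cong)
      fix X i assume X: "\<forall>i. \<forall>x\<in>X \<inter> cell r i. X \<inter> cell r i = {x}"
      show "(\<integral>\<^sup>+ x. indicator (cell r i) x * F (x, X) \<partial>count_space X) = (if card (X \<inter> cell r i) = 1 then 1 else 0) * F (the_point i X, X)"
      proof (cases "X \<inter> cell r i = {}")
        case True
        hence "(\<integral>\<^sup>+ x. indicator (cell r i) x * F (x, X) \<partial>count_space X) = (\<integral>\<^sup>+ x. 0 \<partial>count_space X)"
          by (intro nn_integral_cong) (auto simp: indicator_def)
        thus ?thesis using True by simp
      next
        case False
        then obtain x where x: "X \<inter> cell r i = {x}" using X by blast
        hence "(\<integral>\<^sup>+ y. indicator (cell r i) y * F (y, X) \<partial>count_space X) = (\<integral>\<^sup>+ y. indicator (cell r i) y * F (x, X) \<partial>count_space X)"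
          by (intro nn_integral_cong) (auto simp: indicator_def)
        also have "\<dots> = F (x, X)" using x by (subst nn_integral_count_space_indicator_card) auto
        finally show ?thesis using x by (simp add: the_point_def)
      qed
    qed
  qed
  also have "\<dots> = (\<Sum>i. (\<integral>\<^sup>+ X. (if card (X \<inter> cell r i) = 1 then 1 else 0) * F (the_point i X, X) \<partial>\<nu>))"
  proof (rule nn_integral_suminf)
    fix i
    note [measurable] = F
    show "(\<lambda>X. (if card (X \<inter> cell r i) = 1 then 1 else 0) * F (the_point i X, X)) \<in> borel_measurable \<nu>"
      unfolding measurable_cong_sets[OF sets_nu refl] by measurable
  qed
  also have "\<dots> = (\<Sum>i. (\<integral>\<^sup>+ x. (\<integral>\<^sup>+ X. ennreal z * indicator (cell r i) x * (if X \<inter> ball x r = {} then 1 else 0) * F (x, X \<union> {x}) \<partial>\<nu>) \<partial>lborel))"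
    unfolding nn_integral_campbell[OF F, symmetric] nn_integral_reduced_campbell[OF F, symmetric] campbell_eq ..
  also have "\<dots> = (\<Sum>i. (\<integral>\<^sup>+ x. indicator (cell r i) x * (ennreal z * G x) \<partial>lborel))"
  proof (intro suminf_cong nn_integral_cong)
    fix i x
    have "(\<integral>\<^sup>+ X. ennreal z * indicator (cell r i) x * (if X \<inter> ball x r = {} then 1 else 0) * F (x, X \<union> {x}) \<partial>\<nu>)
      = (\<integral>\<^sup>+ X. (ennreal z * indicator (cell r i) x) * h (x, X) \<partial>\<nu>)"
      by (simp add: h_def mult.assoc)
    also have "\<dots> = (ennreal z * indicator (cell r i) x) * G x"
      unfolding G_def by (rule nn_integral_cmult) (rule hx)
    finally show "(\<integral>\<^sup>+ X. ennreal z * indicator (cell r i) x * (if X \<inter> ball x r = {} then 1 else 0) * F (x, X \<union> {x}) \<partial>\<nu>)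
      = indicator (cell r i) x * (ennreal z * G x)" by (simp add: mult_ac)
  qed
  also have "\<dots> = (\<integral>\<^sup>+ x. (\<Sum>i. indicator (cell r i) x * (ennreal z * G x)) \<partial>lborel)"
    by (rule nn_integral_suminf[symmetric]) (use Gm in measurable)
  also have "\<dots> = (\<integral>\<^sup>+ x. ennreal z * G x \<partial>lborel)" by (simp only: one)
  also have "\<dots> = ennreal z * (\<integral>\<^sup>+ x. G x \<partial>lborel)" by (rule nn_integral_cmult) (use Gm in simp)
  also have "(\<integral>\<^sup>+ x. G x \<partial>lborel) = (\<integral>\<^sup>+ x. (\<integral>\<^sup>+ X. F (x, X \<union> {x}) * ennreal (exp_neg (energy (hard_sphere r) x X)) \<partial>\<nu>) \<partial>lborel)"
    unfolding G_def h_def exp_neg_energy by (intro nn_integral_cong) auto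
  finally show "(\<integral>\<^sup>+ X. (\<integral>\<^sup>+ x. F (x, X) \<partial>count_space X) \<partial>\<nu>) = ennreal z * (\<integral>\<^sup>+ x. (\<integral>\<^sup>+ X. F (x, X \<union> {x}) * ennreal (exp_neg (energy (hard_sphere r) x X)) \<partial>\<nu>) \<partial>lborel)" .
qed

end

section \<open>Revealing the cells of a grid\<close>

abbreviation seqs :: "nat \<Rightarrow> (nat \<Rightarrow> plane) measure" where
  "seqs k \<equiv> \<Pi>\<^sub>M i\<in>{0..<k}. (borel :: plane measure)"

text \<open>A functional \<open>q\<close> that is to be realized as void probabilities. The function \<open>R\<close> is its vacancy ratio, given by
  an expression that is defined and jointly measurable for all regions.\<close>

locale void_construction = positive_removal_functional r z cobounded_borel q for r z q +
  fixes R :: "plane set \<Rightarrow> plane \<Rightarrow> real"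
  assumes q_UNIV: "q UNIV = 1"
    and ratio_eq: "S \<in> cobounded_borel \<Longrightarrow> vacancy_ratio S x = R S x"
    and R_measurable: "T \<in> sets borel \<Longrightarrow> (\<lambda>(\<omega>, x). R (minus_balls T \<omega>) x) \<in> borel_measurable (ball_seqs \<Otimes>\<^sub>M borel)"
begin

text \<open>A sequence \<open>\<omega>\<close> proposes one point for each cell; \<open>\<omega> i\<close> counts only if it lies in cell \<open>i\<close>, and otherwise cell \<open>i\<close> is
  vacant. The region is where further points are possible once the first \<open>k\<close> cells are known.\<close>

definition region :: "nat \<Rightarrow> (nat \<Rightarrow> plane) \<Rightarrow> plane set" where
  "region k \<omega> = {w. \<forall>i<k. w \<notin> cell r i \<and> (\<omega> i \<in> cell r i \<longrightarrow> r \<le> dist (\<omega> i) w)}"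

definition free_cells :: "nat \<Rightarrow> plane set" where
  "free_cells k = {w. \<forall>i<k. w \<notin> cell r i}"

text \<open>The disks around the points found so far, in the encoding of \<open>minus_balls\<close>; vacant and unexplored cells
  contribute the empty ball of radius \<open>0\<close>.\<close>

definition balls_of :: "nat \<Rightarrow> (nat \<Rightarrow> plane) \<Rightarrow> nat \<Rightarrow> plane \<times> real" where
  "balls_of k \<omega> i = (if i < k then (\<omega> i, if \<omega> i \<in> cell r i then r else 0) else (0, 0))"

lemma region_eq: "region k \<omega> = minus_balls (free_cells k) (balls_of k \<omega>)"
proof (rule set_eqI)
  fix w
  have "(\<forall>i. snd (balls_of k \<omega> i) \<le> dist (fst (balls_of k \<omega> i)) w) \<longleftrightarrow> (\<forall>i<k. \<omega> i \<in> cell r i \<longrightarrow> r \<le> dist (\<omega> i) w)"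
    by (auto simp: balls_of_def)
  thus "w \<in> region k \<omega> \<longleftrightarrow> w \<in> minus_balls (free_cells k) (balls_of k \<omega>)"
    by (auto simp: region_def minus_balls_def free_cells_def)
qed

lemma free_cells_borel [measurable]: "free_cells k \<in> sets borel"
  unfolding free_cells_def by measurable

lemma region_borel [measurable]: "region k \<omega> \<in> sets borel"
  unfolding region_eq by (rule minus_balls_borel) simp

lemma region_in: "region k \<omega> \<in> cobounded_borel"
proof -
  have "- region k \<omega> \<subseteq> (\<Union>i<k. cell r i) \<union> (\<Union>i<k. ball (\<omega> i) r)" by (auto simp: region_def not_le)
  moreover have "bounded ((\<Union>i<k. cell r i) \<union> (\<Union>i<k. ball (\<omega> i) r))" using cell_bounded[OF r_pos] by auto
  ultimately have "bounded (- region k \<omega>)" by (rule bounded_subset[rotated])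
  thus ?thesis by simp
qed

lemma balls_of_measurable [measurable]: "balls_of k \<in> measurable (seqs k) ball_seqs"
  unfolding balls_of_def
proof (rule measurable_abs_UNIV)
  fix i
  show "(\<lambda>\<omega>. if i < k then (\<omega> i, if \<omega> i \<in> cell r i then r else 0) else (0, 0)) \<in> measurable (seqs k) (borel \<Otimes>\<^sub>M borel)"
  proof (cases "i < k")
    case True
    hence [measurable]: "(\<lambda>\<omega>. \<omega> i) \<in> measurable (seqs k) borel" by (intro measurable_component_singleton) simp
    show ?thesis using True by simp
  qed simp
qed

lemma region_pred [measurable]: "Measurable.pred (seqs k \<Otimes>\<^sub>M borel) (\<lambda>p. snd p \<in> region k (fst p))"
  unfolding region_eq by measurable

lemma R_region_measurable [measurable]: "(\<lambda>p. R (region k (fst p)) (snd p)) \<in> borel_measurable (seqs k \<Otimes>\<^sub>M borel)"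
proof -
  have "(\<lambda>p. (\<lambda>(\<omega>, x). R (minus_balls (free_cells k) \<omega>) x) (balls_of k (fst p), snd p)) \<in> borel_measurable (seqs k \<Otimes>\<^sub>M borel)"
    by (rule measurable_compose[OF _ R_measurable]) measurable
  thus ?thesis by (simp add: region_eq)
qed

lemma dummy_exists: "\<exists>E::plane set. E \<in> sets borel \<and> E \<inter> cell r k = {} \<and> emeasure lborel E = 1"
proof -
  obtain \<rho> where \<rho>: "\<And>x. x \<in> cell r k \<Longrightarrow> norm x \<le> \<rho>" using cell_bounded[OF r_pos, of k] by (auto simp: bounded_iff)
  define a :: plane where "a = (\<chi> i. \<rho> + 1)"
  define b :: plane where "b = (\<chi> i. \<rho> + 2)"
  have "cbox a b \<inter> cell r k = {}"
  proof (rule ccontr)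
    assume "cbox a b \<inter> cell r k \<noteq> {}"
    then obtain x where x: "x \<in> cbox a b" "x \<in> cell r k" by auto
    have "\<rho> + 1 \<le> x $ 1" using x(1) by (simp add: mem_box_cart a_def)
    moreover have "\<bar>x $ 1\<bar> \<le> \<rho>" using \<rho>[OF x(2)] component_le_norm_cart[of x 1] by simp
    ultimately show False by simp
  qed
  moreover have "area (cbox a b) = 1" by (subst area_cbox_plane) (auto simp: a_def b_def)
  hence "emeasure lborel (cbox a b) = 1" using emeasure_area[of "cbox a b"] by simp
  ultimately show ?thesis by (intro exI[of _ "cbox a b"]) auto
qed

text \<open>To report that a cell is vacant, the proposed point is drawn uniformly from a set of area \<open>1\<close> outside the cell. Thus
  every step of the construction has a density with respect to Lebesgue measure.\<close>

definition dummy :: "nat \<Rightarrow> plane set" where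
  "dummy k = (SOME E. E \<in> sets borel \<and> E \<inter> cell r k = {} \<and> emeasure lborel E = 1)"

lemma dummy: "dummy k \<in> sets borel" "dummy k \<inter> cell r k = {}" "emeasure lborel (dummy k) = 1"
  using someI_ex[OF dummy_exists[of k]] unfolding dummy_def by auto

declare dummy(1) [measurable]

text \<open>The conditional probability that cell \<open>k\<close> is vacant, see \<open>no_point_eq\<close>.\<close>

definition no_point :: "nat \<Rightarrow> (nat \<Rightarrow> plane) \<Rightarrow> real" where
  "no_point k \<omega> = 1 - z * (LINT x:cell r k \<inter> region k \<omega>|lborel. R (region k \<omega>) x)"

text \<open>The conditional density of the point in cell \<open>k\<close> is the activity times the vacancy ratio. The second summand
  reports a vacancy.\<close>

definition dens :: "nat \<Rightarrow> (nat \<Rightarrow> plane) \<Rightarrow> plane \<Rightarrow> real" where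
  "dens k \<omega> x = indicator (cell r k \<inter> region k \<omega>) x * (z * R (region k \<omega>) x) + indicator (dummy k) x * no_point k \<omega>"

definition kernel :: "nat \<Rightarrow> (nat \<Rightarrow> plane) \<Rightarrow> plane measure" where
  "kernel k \<omega> = density lborel (\<lambda>x. ennreal (dens k \<omega> x))"

lemma R_eq: "S \<in> cobounded_borel \<Longrightarrow> R S x = q (S - ball x r) / q S"
  using ratio_eq[of S x] by (simp add: vacancy_ratio_def)

lemma region_minus_cell: "region k \<omega> - cell r k \<in> cobounded_borel"
  using region_diff[OF region_in cell_borel cell_bounded[OF r_pos]] .

lemma no_point_eq: "no_point k \<omega> = q (region k \<omega> - cell r k) / q (region k \<omega>)"
proof -
  let ?S = "region k \<omega>"
  have "q ?S - q (?S - cell r k) = z * (LINT x:cell r k \<inter> ?S|lborel. q (?S - ball x r))"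
    by (rule removal[OF region_in]) (use cell_small[OF r_pos] in auto)
  moreover have "(LINT x:cell r k \<inter> ?S|lborel. R ?S x) = (LINT x:cell r k \<inter> ?S|lborel. q (?S - ball x r)) / q ?S"
    by (simp add: R_eq[OF region_in])
  ultimately show ?thesis using q_pos[OF region_in, of k \<omega>] by (simp add: no_point_def field_simps)
qed

lemma no_point_nonneg: "0 \<le> no_point k \<omega>"
  unfolding no_point_eq using q_nonneg[OF region_in] q_nonneg[OF region_minus_cell] by simp

lemma no_point_measurable [measurable]: "no_point k \<in> borel_measurable (seqs k)"
proof -
  have "(\<lambda>p. if snd p \<in> cell r k \<and> snd p \<in> region k (fst p) then R (region k (fst p)) (snd p) else 0) \<in> borel_measurable (seqs k \<Otimes>\<^sub>M borel)"
    by measurable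
  also have "(\<lambda>p. if snd p \<in> cell r k \<and> snd p \<in> region k (fst p) then R (region k (fst p)) (snd p) else 0)
    = (\<lambda>(\<omega>, x). indicator (cell r k \<inter> region k \<omega>) x *\<^sub>R R (region k \<omega>) x)"
    by (auto simp: fun_eq_iff indicator_def)
  finally have "(\<lambda>(\<omega>, x). indicator (cell r k \<inter> region k \<omega>) x *\<^sub>R R (region k \<omega>) x) \<in> borel_measurable (seqs k \<Otimes>\<^sub>M lborel)" by simp
  from lborel.borel_measurable_lebesgue_integral[OF this] show ?thesis
    unfolding no_point_def set_lebesgue_integral_def by measurable
qed

lemma dens_measurable [measurable]: "(\<lambda>p. dens k (fst p) (snd p)) \<in> borel_measurable (seqs k \<Otimes>\<^sub>M borel)"
proof -
  have "(\<lambda>p. (if snd p \<in> cell r k \<and> snd p \<in> region k (fst p) then z * R (region k (fst p)) (snd p) else 0)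
     + indicator (dummy k) (snd p) * no_point k (fst p)) \<in> borel_measurable (seqs k \<Otimes>\<^sub>M borel)"
    by measurable
  also have "(\<lambda>p. (if snd p \<in> cell r k \<and> snd p \<in> region k (fst p) then z * R (region k (fst p)) (snd p) else 0)
     + indicator (dummy k) (snd p) * no_point k (fst p)) = (\<lambda>p. dens k (fst p) (snd p))"
    by (auto simp: fun_eq_iff dens_def indicator_def)
  finally show ?thesis .
qed

lemma dens_measurable': "\<omega> \<in> space (seqs k) \<Longrightarrow> dens k \<omega> \<in> borel_measurable borel"
  using measurable_Pair2[OF dens_measurable, of \<omega> k] by simp

text \<open>The conditional probability that the configuration avoids \<open>A\<close>, given what was found in the first \<open>k\<close> cells.\<close>

definition avoid :: "plane set \<Rightarrow> nat \<Rightarrow> (nat \<Rightarrow> plane) \<Rightarrow> real" where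
  "avoid A k \<omega> = (if \<forall>i<k. \<omega> i \<notin> cell r i \<inter> A then q (region k \<omega> - A) / q (region k \<omega>) else 0)"

text \<open>The conditional probabilities form a martingale. If cell \<open>k\<close> is vacant, the region loses the cell; if it
  contains the point \<open>x\<close>, the region loses the disk around \<open>x\<close>, which covers the cell. Weighting these outcomes
  with their densities gives the removal identity of \<open>S - A\<close> and the cell, where \<open>S\<close> is the
  current region.\<close>

lemma avoid_step:
  assumes \<omega>: "\<omega> \<in> space (seqs k)" and A: "A \<in> sets borel" "bounded A"
  shows "(\<integral>\<^sup>+ x. ennreal (avoid A (Suc k) (fun_upd \<omega> k x)) \<partial>kernel k \<omega>) = ennreal (avoid A k \<omega>)"
proof (cases "\<forall>i<k. \<omega> i \<notin> cell r i \<inter> A")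
  case False
  hence 1: "avoid A (Suc k) (fun_upd \<omega> k x) = 0" for x by (auto simp: avoid_def less_Suc_eq)
  have 2: "avoid A k \<omega> = 0" unfolding avoid_def using False by (rule if_not_P)
  show ?thesis unfolding 1 2 by simp
next
  case True
  define S where "S = region k \<omega>"
  define K where "K = cell r k"
  have S: "S \<in> cobounded_borel" unfolding S_def by (rule region_in)
  have K: "K \<in> sets borel" "bounded K" "\<And>x y. x \<in> K \<Longrightarrow> y \<in> K \<Longrightarrow> dist x y < r"
    unfolding K_def using cell_bounded[OF r_pos] cell_small[OF r_pos] by auto
  have SA: "S - A \<in> cobounded_borel" using S A by (rule region_diff)
  have SK: "S - K \<in> cobounded_borel" using S K(1,2) by (rule region_diff)
  have reg: "region (Suc k) (fun_upd \<omega> k x) = (if x \<in> K then S - ball x r else S - K)" for x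
  proof -
    have "region (Suc k) (fun_upd \<omega> k x) = (S - K) - (if x \<in> K then ball x r else {})"
      unfolding region_def S_def K_def by (auto simp: less_Suc_eq)
    moreover have "K \<subseteq> ball x r" if "x \<in> K" using K(3)[OF that] by auto
    ultimately show ?thesis by auto
  qed
  have av: "avoid A (Suc k) (fun_upd \<omega> k x) = (if x \<in> K then (if x \<in> A then 0 else q (S - ball x r - A) / q (S - ball x r)) else q (S - K - A) / q (S - K))" for x
    unfolding avoid_def reg using True by (auto simp: less_Suc_eq K_def)
  have qpos: "0 < q S" "0 < q (S - K)" "0 < q (S - ball x r)" for x
    using q_pos[OF S] q_pos[OF SK] q_pos[OF region_diff[OF S, of "ball x r"]] by auto
  define a where "a x = indicator (K \<inter> (S - A)) x * (z * q (S - A - ball x r) / q S)" for x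
  define c where "c = q (S - A - K) / q S"
  have c0: "0 \<le> c" unfolding c_def using q_nonneg[OF S] q_nonneg[OF region_diff[OF SA K(1,2)]] by simp
  have a0: "0 \<le> a x" for x unfolding a_def using z_nonneg q_ball_nonneg[OF SA] qpos(1) by simp
  have [measurable]: "a \<in> borel_measurable borel"
    unfolding a_def using q_measurable[OF SA] K(1) SA by (auto intro!: borel_measurable_times borel_measurable_indicator borel_measurable_divide)
  have d0: "0 \<le> dens k \<omega> x" for x
    unfolding dens_def using no_point_nonneg z_nonneg vacancy_ratio_bounds(1)[OF region_in, of k \<omega> x] by (simp add: ratio_eq[OF region_in])
  \<comment> \<open>The two terms are the outcomes with a point in the cell and without; the denominators of \<open>avoid\<close> cancel
    against the numerators of the density.\<close>
  have prod: "dens k \<omega> x * avoid A (Suc k) (fun_upd \<omega> k x) = a x + indicator (dummy k) x * c" for x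
  proof (cases "x \<in> K")
    case True
    hence "x \<notin> dummy k" using dummy(2)[of k] by (auto simp: K_def)
    hence dx: "dens k \<omega> x = indicator S x * (z * q (S - ball x r) / q S)"
      using True unfolding dens_def S_def[symmetric] K_def[symmetric] R_eq[OF S] by (simp add: indicator_def)
    have comm: "S - ball x r - A = S - A - ball x r" by auto
    show ?thesis unfolding dx av comm a_def using True \<open>x \<notin> dummy k\<close> qpos(3)[of x]
      by (auto simp: indicator_def)
  next
    case False
    have comm: "S - K - A = S - A - K" by auto
    have "dens k \<omega> x = indicator (dummy k) x * (q (S - K) / q S)"
      using False unfolding dens_def no_point_eq S_def[symmetric] K_def[symmetric] by (simp add: indicator_def)
    thus ?thesis unfolding av comm a_def c_def using False qpos(2) by (auto simp: indicator_def)
  qed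
  have avm: "(\<lambda>x. avoid A (Suc k) (fun_upd \<omega> k x)) \<in> borel_measurable borel"
  proof -
    have "S - ball x r - A = S - A - ball x r" for x by auto
    hence [measurable]: "(\<lambda>x. q (S - ball x r - A)) \<in> borel_measurable borel" using q_measurable[OF SA] by simp
    note [measurable] = q_measurable[OF S] K(1) A(1)
    show ?thesis unfolding av by measurable
  qed
  have "(\<integral>\<^sup>+ x. ennreal (avoid A (Suc k) (fun_upd \<omega> k x)) \<partial>kernel k \<omega>) = (\<integral>\<^sup>+ x. ennreal (dens k \<omega> x) * ennreal (avoid A (Suc k) (fun_upd \<omega> k x)) \<partial>lborel)"
    unfolding kernel_def using dens_measurable'[OF \<omega>] avm by (intro nn_integral_density) auto
  also have "\<dots> = (\<integral>\<^sup>+ x. ennreal (a x) + ennreal c * indicator (dummy k) x \<partial>lborel)"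
  proof (intro nn_integral_cong)
    fix x
    have "ennreal (dens k \<omega> x) * ennreal (avoid A (Suc k) (fun_upd \<omega> k x)) = ennreal (a x + indicator (dummy k) x * c)"
      using d0 by (simp only: ennreal_mult'[symmetric] prod)
    also have "\<dots> = ennreal (a x) + ennreal c * indicator (dummy k) x"
      using a0[of x] c0 by (subst ennreal_plus) (auto simp: indicator_def)
    finally show "ennreal (dens k \<omega> x) * ennreal (avoid A (Suc k) (fun_upd \<omega> k x)) = ennreal (a x) + ennreal c * indicator (dummy k) x" .
  qed
  also have "\<dots> = (\<integral>\<^sup>+ x. ennreal (a x) \<partial>lborel) + ennreal c"
    by (subst nn_integral_add) (auto simp: nn_integral_cmult_indicator dummy)
  also have "(\<integral>\<^sup>+ x. ennreal (a x) \<partial>lborel) = ennreal (LINT x|lborel. a x)"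
  proof (rule nn_integral_eq_integral)
    have "set_integrable lborel (K \<inter> (S - A)) (\<lambda>x. q (S - A - ball x r))"
      using K(1) SA bounded_subset[OF K(2), of "K \<inter> (S - A)"] by (intro q_ball_integrable[OF _ _ SA]) auto
    hence "integrable lborel (\<lambda>x. (z / q S) * (indicator (K \<inter> (S - A)) x *\<^sub>R q (S - A - ball x r)))"
      unfolding set_integrable_def by (rule integrable_mult_right)
    thus "integrable lborel a" unfolding a_def by (simp add: mult_ac)
  qed (use a0 in auto)
  also have "(LINT x|lborel. a x) = z * (LINT x:K \<inter> (S - A)|lborel. q (S - A - ball x r)) / q S"
  proof -
    have "(LINT x|lborel. a x) = (LINT x|lborel. (z / q S) * (indicator (K \<inter> (S - A)) x *\<^sub>R q (S - A - ball x r)))"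
      unfolding a_def by (intro Bochner_Integration.integral_cong) (auto simp: mult_ac)
    also have "\<dots> = (z / q S) * (LINT x:K \<inter> (S - A)|lborel. q (S - A - ball x r))"
      unfolding set_lebesgue_integral_def by (rule integral_mult_right_zero)
    finally show ?thesis by simp
  qed
  also have "z * (LINT x:K \<inter> (S - A)|lborel. q (S - A - ball x r)) = q (S - A) - q (S - A - K)"
    by (rule removal[OF SA K(1,3), symmetric])
  also have "ennreal ((q (S - A) - q (S - A - K)) / q S) + ennreal c = ennreal (q (S - A) / q S)"
  proof -
    have "0 \<le> (q (S - A) - q (S - A - K)) / q S" using q_antimono[OF K(1,2) SA] qpos(1) by simp
    hence "ennreal ((q (S - A) - q (S - A - K)) / q S) + ennreal c = ennreal ((q (S - A) - q (S - A - K)) / q S + c)"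
      using c0 by (simp add: ennreal_plus)
    thus ?thesis by (simp add: c_def diff_divide_distrib)
  qed
  also have "q (S - A) / q S = avoid A k \<omega>" using True by (simp add: avoid_def S_def)
  finally show ?thesis .
qed

text \<open>The case \<open>A = {}\<close> of \<open>avoid_step\<close>.\<close>

lemma kernel_prob:
  assumes "\<omega> \<in> space (seqs k)" shows "prob_space (kernel k \<omega>)"
proof
  have a1: "avoid {} j \<omega>' = 1" for j \<omega>' using q_pos[OF region_in, of j \<omega>'] by (simp add: avoid_def)
  have "emeasure (kernel k \<omega>) (space (kernel k \<omega>)) = (\<integral>\<^sup>+ x. 1 \<partial>kernel k \<omega>)" by simp
  also have "\<dots> = 1" using avoid_step[OF assms, of "{}"] by (simp add: a1)
  finally show "emeasure (kernel k \<omega>) (space (kernel k \<omega>)) = 1" .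
qed

lemma kernel_measurable: "kernel k \<in> measurable (seqs k) (subprob_algebra borel)"
proof (rule measurable_subprob_algebra)
  show "subprob_space (kernel k \<omega>)" if "\<omega> \<in> space (seqs k)" for \<omega>
    using kernel_prob[OF that] by (rule prob_space_imp_subprob_space)
  show "sets (kernel k \<omega>) = sets borel" for \<omega> by (simp add: kernel_def)
  fix B :: "plane set" assume [measurable]: "B \<in> sets borel"
  have m: "(\<lambda>(\<omega>, x). ennreal (dens k \<omega> x) * indicator B x) \<in> borel_measurable (seqs k \<Otimes>\<^sub>M lborel)"
    using dens_measurable[of k] unfolding case_prod_beta by measurable
  have "(\<lambda>\<omega>. \<integral>\<^sup>+ x. ennreal (dens k \<omega> x) * indicator B x \<partial>lborel) \<in> borel_measurable (seqs k)"
    by (rule lborel.borel_measurable_nn_integral[OF m])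
  moreover have "emeasure (kernel k \<omega>) B = (\<integral>\<^sup>+ x. ennreal (dens k \<omega> x) * indicator B x \<partial>lborel)"
    if "\<omega> \<in> space (seqs k)" for \<omega>
    unfolding kernel_def by (rule emeasure_density) (use dens_measurable'[OF that] in auto)
  ultimately show "(\<lambda>\<omega>. emeasure (kernel k \<omega>) B) \<in> borel_measurable (seqs k)"
    by (subst measurable_cong)
qed

sublocale IT: Ionescu_Tulcea kernel "\<lambda>_. borel"
  by (rule Ionescu_Tulcea.intro) (rule kernel_measurable, rule kernel_prob)

definition avoiding :: "plane set \<Rightarrow> nat \<Rightarrow> (nat \<Rightarrow> plane) set" where
  "avoiding A m = {\<omega> \<in> space (seqs m). \<forall>i<m. \<omega> i \<notin> cell r i \<inter> A}"

lemma avoiding_measurable: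
  assumes A: "A \<in> sets borel" shows "avoiding A m \<in> sets (seqs m)"
proof -
  have c: "(\<lambda>\<omega>. \<omega> i) \<in> measurable (seqs m) borel" if "i < m" for i by (rule measurable_component_singleton) (use that in simp)
  have "Measurable.pred (seqs m) (\<lambda>\<omega>. \<omega> i \<notin> cell r i \<inter> A)" if "i < m" for i
    using c[OF that] A by measurable
  hence "Measurable.pred (seqs m) (\<lambda>\<omega>. \<forall>i\<in>{..<m}. \<omega> i \<notin> cell r i \<inter> A)" by (intro pred_intros_finite) auto
  moreover have "avoiding A m = {\<omega> \<in> space (seqs m). \<forall>i\<in>{..<m}. \<omega> i \<notin> cell r i \<inter> A}"
    unfolding avoiding_def by blast
  ultimately show ?thesis by (simp only: pred_def)
qed

text \<open>Backward induction along the martingale \<open>avoid A\<close>. Once all cells that meet \<open>A\<close> are known, it is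
  the indicator of the event.\<close>

lemma avoiding_prob:
  assumes A: "A \<in> sets borel" "bounded A" and m: "A \<subseteq> (\<Union>i<m. cell r i)"
    and "\<omega> \<in> space (seqs k)" "k + l = m"
  shows "emeasure (IT.C k l \<omega>) (avoiding A m) = ennreal (avoid A k \<omega>)"
  using assms(4,5)
proof (induction l arbitrary: k \<omega>)
  case 0
  have eq: "region k \<omega> - A = region k \<omega>" using m 0(2) by (auto simp: region_def)
  have av: "avoid A k \<omega> = (if \<forall>i<k. \<omega> i \<notin> cell r i \<inter> A then 1 else 0)"
    unfolding avoid_def eq using less_imp_neq[OF q_pos[OF region_in, of k \<omega>]] by (simp only: divide_self_if) simp
  have km: "k = m" using 0(2) by simp
  have "emeasure (return (seqs m) \<omega>) (avoiding A m) = indicator (avoiding A m) \<omega>"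
    by (rule emeasure_return[OF avoiding_measurable[OF A(1)]])
  also have "\<dots> = ennreal (avoid A k \<omega>)"
    using 0(1) unfolding av unfolding km avoiding_def by (simp add: indicator_def)
  finally show ?case by (simp add: km)
next
  case (Suc l)
  have km: "Suc k + l = m" using Suc.prems by simp
  have split: "IT.C k (1 + l) \<omega> = IT.C k 1 \<omega> \<bind> IT.C (k + 1) l" using IT.split_C[OF Suc.prems(1), of 1 l] by simp
  have C1: "IT.C k 1 \<omega> = IT.eP k \<omega>"
    using Suc.prems(1) by (simp add: bind_return[OF IT.measurable_eP])
  have Cm: "IT.C (Suc k) l \<in> measurable (seqs (Suc k)) (subprob_algebra (seqs m))" using IT.measurable_C[of "Suc k" l] km by simp
  have ne: "space (IT.eP k \<omega>) \<noteq> {}" using prob_space.not_empty[OF IT.prob_space_eP[OF Suc.prems(1)]] .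
  have Cm': "IT.C (Suc k) l \<in> measurable (IT.eP k \<omega>) (subprob_algebra (seqs m))"
    using Cm by (simp add: measurable_cong_sets[OF IT.sets_eP[OF Suc.prems(1)] refl])
  have "emeasure (IT.C k (Suc l) \<omega>) (avoiding A m) = emeasure (IT.eP k \<omega> \<bind> IT.C (Suc k) l) (avoiding A m)"
    using split C1 by simp
  also have "\<dots> = (\<integral>\<^sup>+ \<omega>'. emeasure (IT.C (Suc k) l \<omega>') (avoiding A m) \<partial>IT.eP k \<omega>)"
    by (rule emeasure_bind[OF ne Cm' avoiding_measurable[OF A(1)]])
  also have "\<dots> = (\<integral>\<^sup>+ x. emeasure (IT.C (Suc k) l (fun_upd \<omega> k x)) (avoiding A m) \<partial>kernel k \<omega>)"
    using Cm by (intro IT.nn_integral_eP[OF Suc.prems(1)] measurable_emeasure_kernel[OF _ avoiding_measurable[OF A(1)]])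
  also have "\<dots> = (\<integral>\<^sup>+ x. ennreal (avoid A (Suc k) (fun_upd \<omega> k x)) \<partial>kernel k \<omega>)"
  proof (intro nn_integral_cong Suc.IH km)
    fix x
    show "fun_upd \<omega> k x \<in> space (seqs (Suc k))"
      using Suc.prems(1) by (auto simp: space_PiM PiE_iff extensional_def)
  qed
  also have "\<dots> = ennreal (avoid A k \<omega>)" by (rule avoid_step[OF Suc.prems(1) A])
  finally show ?case .
qed

definition config_of :: "(nat \<Rightarrow> plane) \<Rightarrow> plane set" where
  "config_of \<omega> = {\<omega> i |i. \<omega> i \<in> cell r i}"

lemma config_of_avoids: "config_of \<omega> \<inter> A = {} \<longleftrightarrow> (\<forall>i. \<omega> i \<notin> cell r i \<inter> A)"
  by (auto simp: config_of_def)

lemma config_of_measurable: "config_of \<in> measurable (\<Pi>\<^sub>M i\<in>UNIV. borel) config_space"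
proof (rule measurable_config)
  fix \<omega>
  show "loc_finite (config_of \<omega>)" unfolding loc_finite_def
  proof (intro allI impI)
    fix B :: "plane set" assume "bounded B"
    then obtain m where m: "B \<subseteq> (\<Union>k<m. cell r k)" using cells_meet_bounded[OF r_pos] by blast
    have "config_of \<omega> \<inter> B \<subseteq> \<omega> ` {..<m}"
    proof
      fix x assume "x \<in> config_of \<omega> \<inter> B"
      then obtain i where i: "x = \<omega> i" "\<omega> i \<in> cell r i" "\<omega> i \<in> B" by (auto simp: config_of_def)
      then obtain k where "k < m" "\<omega> i \<in> cell r k" using m by auto
      hence "i < m" using cell_disjoint[OF i(2)] by blast
      thus "x \<in> \<omega> ` {..<m}" using i(1) by simp
    qed
    thus "finite (config_of \<omega> \<inter> B)" by (rule finite_subset) simp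
  qed
next
  fix A :: "plane set" assume A[measurable]: "A \<in> sets borel"
  show "{\<omega> \<in> space (\<Pi>\<^sub>M i\<in>UNIV. borel). config_of \<omega> \<inter> A = {}} \<in> sets (\<Pi>\<^sub>M i\<in>UNIV. (borel :: plane measure))"
    unfolding config_of_avoids by measurable
qed

definition gibbs_law :: "plane set measure" where
  "gibbs_law = distr IT.PF.lim config_space config_of"

text \<open>The event only concerns the finitely many cells that meet \<open>A\<close>, and at the start nothing is known, so
  \<open>avoid A\<close> is \<open>q (- A)\<close>.\<close>

lemma gibbs_law_void:
  assumes A: "A \<in> sets borel" "bounded A"
  shows "emeasure gibbs_law (void A) = ennreal (q (- A))"
proof -
  obtain m where m: "A \<subseteq> (\<Union>k<m. cell r k)" using cells_meet_bounded[OF r_pos A(2)] by blast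
  have cm: "config_of \<in> measurable IT.PF.lim config_space"
    using config_of_measurable by (simp add: measurable_cong_sets[OF IT.PF.sets_lim refl])
  have "emeasure gibbs_law (void A) = emeasure IT.PF.lim (config_of -` void A \<inter> space IT.PF.lim)"
    unfolding gibbs_law_def by (rule emeasure_distr[OF cm void_event[OF A]])
  also have "config_of -` void A \<inter> space IT.PF.lim = IT.PF.emb UNIV {0..<m} (avoiding A m)"
  proof (rule set_eqI)
    fix \<omega> :: "nat \<Rightarrow> plane"
    have "loc_finite (config_of \<omega>)"
      using measurable_space[OF config_of_measurable, of \<omega>] by (simp add: space_PiM space_config)
    hence "\<omega> \<in> config_of -` void A \<inter> space IT.PF.lim \<longleftrightarrow> (\<forall>i. \<omega> i \<notin> cell r i \<inter> A)"
      by (simp add: void_def config_of_avoids space_PiM)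
    also have "\<dots> \<longleftrightarrow> (\<forall>i<m. \<omega> i \<notin> cell r i \<inter> A)"
    proof (intro iffI allI impI)
      fix i assume *: "\<forall>i<m. \<omega> i \<notin> cell r i \<inter> A"
      show "\<omega> i \<notin> cell r i \<inter> A"
      proof
        assume i: "\<omega> i \<in> cell r i \<inter> A"
        then obtain k where "k < m" "\<omega> i \<in> cell r k" using m by auto
        hence "i < m" using cell_disjoint[of "\<omega> i" r i k] i by auto
        thus False using * i by auto
      qed
    qed auto
    also have "\<dots> \<longleftrightarrow> \<omega> \<in> IT.PF.emb UNIV {0..<m} (avoiding A m)"
      by (auto simp: prod_emb_def avoiding_def space_PiM restrict_def)
    finally show "\<omega> \<in> config_of -` void A \<inter> space IT.PF.lim \<longleftrightarrow> \<omega> \<in> IT.PF.emb UNIV {0..<m} (avoiding A m)" .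
  qed
  also have "emeasure IT.PF.lim \<dots> = emeasure (IT.CI {0..<m}) (avoiding A m)"
    by (rule IT.lim) (auto intro: avoiding_measurable A)
  also have "\<dots> = emeasure (IT.C 0 m (\<lambda>_. undefined)) (IT.PF.emb {0..<m} {0..<m} (avoiding A m))"
    by (rule IT.emeasure_CI) (auto intro: avoiding_measurable A)
  also have "IT.PF.emb {0..<m} {0..<m} (avoiding A m) = avoiding A m"
    using sets.sets_into_space[OF avoiding_measurable[OF A(1), of m]] by (intro prod_emb_id) (simp add: space_PiM)
  also have "emeasure (IT.C 0 m (\<lambda>_. undefined)) (avoiding A m) = ennreal (avoid A 0 (\<lambda>_. undefined))"
    by (rule avoiding_prob[OF A m]) (auto simp: space_PiM)
  also have "avoid A 0 (\<lambda>_. undefined) = q (- A)"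
    by (simp add: avoid_def region_def q_UNIV Compl_eq_Diff_UNIV)
  finally show ?thesis .
qed

theorem gibbs_law_gibbs: "gibbs_measure (hard_sphere r) z gibbs_law"
proof -
  have sp: "space gibbs_law = void {}" by (simp add: gibbs_law_def space_config void_empty)
  interpret P: prob_space gibbs_law
    by standard (use gibbs_law_void[of "{}"] q_UNIV in \<open>simp add: sp\<close>)
  have vf: "void_functional gibbs_law S = q S" if "S \<in> cobounded_borel" for S
  proof -
    have "emeasure gibbs_law (void (- S)) = ennreal (q S)" using gibbs_law_void[of "- S"] that by auto
    thus ?thesis unfolding void_functional_def measure_def using q_nonneg[OF that] by simp
  qed
  have D: "S - C \<in> cobounded_borel" if "S \<in> cobounded_borel" "C \<in> sets borel" "bounded C" for S C using that by (rule region_diff)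
  have F: "positive_removal_functional r z cobounded_borel (void_functional gibbs_law)"
  proof
    fix S assume S: "S \<in> cobounded_borel"
    have eq: "void_functional gibbs_law (S - ball x r) = q (S - ball x r)" for x by (intro vf D[OF S]) auto
    show "(\<lambda>x. void_functional gibbs_law (S - ball x r)) \<in> borel_measurable borel"
      unfolding eq by (rule q_measurable[OF S])
    show "0 < void_functional gibbs_law S" "0 \<le> void_functional gibbs_law S" using vf[OF S] q_pos[OF S] by auto
    show "S \<in> sets borel" using S by simp
    show "S - C \<in> cobounded_borel" if "C \<in> sets borel" "bounded C" for C by (rule D[OF S that])
    fix B :: "plane set" assume B: "B \<in> sets borel" "\<And>x y. x \<in> B \<Longrightarrow> y \<in> B \<Longrightarrow> dist x y < r"
    have "bounded B" by (rule bounded_if_small) (rule B(2))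
    thus "void_functional gibbs_law S - void_functional gibbs_law (S - B) = z * (LINT x:B \<inter> S|lborel. void_functional gibbs_law (S - ball x r))"
      unfolding eq using removal[OF S B] vf[OF S] vf[OF D[OF S B(1)]] by simp
  qed (use r_pos z_nonneg in auto)
  interpret void_process gibbs_law r z
    by (rule void_process.intro[OF P.prob_space_axioms void_process_axioms.intro[OF _ F]]) (simp add: gibbs_law_def)
  show ?thesis by (rule is_gibbs)
qed

end

section \<open>Existence, uniqueness and analyticity\<close>

text \<open>Existence is the construction applied to \<open>void_prob\<close>. Conversely the void functional of any Gibbs measure is
  \<open>void_prob\<close>, since both solve the removal identity with the same normalization.\<close>

theorem unique_gibbs_measure:
  assumes "0 < r" "0 \<le> z" "z < exp 1 / (sqrt (1 / 2 + 3 * sqrt 3 / (8 * pi)) * (pi * r\<^sup>2))"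
  shows "\<exists>!\<nu>. gibbs_measure (hard_sphere r) z \<nu>"
proof -
  obtain \<delta> \<epsilon> \<kappa> \<theta> M where "contraction r z \<delta> \<epsilon> \<kappa> \<theta> M" using contraction_parameters[OF assms] by blast
  then interpret C: contraction r z \<delta> \<epsilon> \<kappa> \<theta> M .
  have V: "positive_removal_functional r z cobounded_borel (C.void_prob z)"
    by (rule C.void_prob_functional[OF assms(2) order.refl])
  interpret V: void_construction r z "C.void_prob z" "limit_ratio r z"
    by (intro void_construction.intro V void_construction_axioms.intro C.void_prob_UNIV
        C.vacancy_ratio_eq_limit[OF V order.refl] limit_ratio_measurable)
  show ?thesis
  proof (rule ex1I)
    show "gibbs_measure (hard_sphere r) z V.gibbs_law" by (rule V.gibbs_law_gibbs)
    have void: "measure \<nu> (void A) = C.void_prob z (- A)"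
      if "gibbs_measure (hard_sphere r) z \<nu>" "A \<in> sets borel" "bounded A" for \<nu> A
      using C.functional_eq_void_prob[OF gibbs_void_functional(1)[OF that(1) assms(1)] order.refl gibbs_void_functional(2)[OF that(1) assms(1)], of "- A"] that
      by (auto simp: void_functional_def)
    fix \<nu> assume \<nu>: "gibbs_measure (hard_sphere r) z \<nu>"
    show "\<nu> = V.gibbs_law"
      using \<nu> V.gibbs_law_gibbs void[OF \<nu>] void[OF V.gibbs_law_gibbs]
      by (intro config_measure_eqI) (auto simp: gibbs_measure_def)
  qed
qed

theorem corollary6:
  fixes r b :: real
  assumes "r > 0"
    and "b = exp 1 / (sqrt (1 / 2 + 3 * sqrt 3 / (8 * pi)) * (pi * r\<^sup>2))"
  shows "(\<forall>z. 0 \<le> z \<and> z < b \<longrightarrow>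
             (\<exists>!\<nu>. gibbs_measure (hard_sphere r) z \<nu>) \<and>
             convergent (finite_volume_pressure (hard_sphere r) z)) \<and>
         real_analytic_on (pressure (hard_sphere r)) {0..<b}"
  using unique_gibbs_measure[OF assms(1)] pressure_analytic[OF assms] assms(2) by blast

end
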